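(* Let $n\ge 1$ and $1<p<\infty$. There is a constant $C_3$ depending only on $n$ and $p$ with the following property. Let $U\subset\mathbb{R}^n$ be an open, bounded, connected set with Lipschitz boundary, and let $u\in W^{1,\infty}(U,\mathbb{R}^n)$ be essentially injective with $\operatorname{diam}(u(U))\le d$ and $0<\lambda\le \det Du(x)\le\Lambda$ for a.e. $x\in U$. Then there exists $S\in W^{1,\infty}(U,\mathbb{R}^n)$ essentially injective and measure preserving such that $$\int_U |u-S|^p\,dx\le C\int_U |1-\det Du|^p\,dx,\qquad C=C_3\left(\frac{d}{\lambda^{1/n}}\right)^p\left(1+\frac{1}{\lambda^p}\left(\frac{\Lambda}{\lambda}\right)^{2p-2}\right).$$
   Context: Functions in $W^{1,\infty}(U,\mathbb{R}^n)$ are identified with their continuous representatives. A map $u:U\to\mathbb{R}^n$ is essentially injective if the multiplicity function $y\mapsto \mathcal{H}^0(U\cap u^{-1}\{y\})\in[0,\infty]$ has $L^\infty(\mathbb{R}^n)$-norm equal to $1$. For $A\subset\mathbb{R}^n$ measurable, a map $s\in L^\infty(A,\mathbb{R}^n)$ is measure preserving if there exists a measurable set $B\subset\mathbb{R}^n$ such that the push-forward satisfies $s_\#(\mathcal{H}^n\llcorner A)=\mathcal{H}^n\llcorner B$, where $\mathcal{H}^n\llcorner A$ is $n$-dimensional Hausdorff (Lebesgue) measure restricted to $A$. *)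

theory Defs
  imports "HOL-Probability.Essential_Supremum"
begin

text \<open>Maps on a set \<open>U\<close> are total functions; no notion below depends on values outside \<open>U\<close>.\<close>

text \<open>Locally, up to a rigid motion, \<open>U\<close> is the region strictly above the graph of a Lipschitz
  function. The unit vector \<open>e\<close> is the local vertical direction and the graph lives over the
  hyperplane orthogonal to \<open>e\<close> (a single point in dimension 1).\<close>

definition lipschitz_boundary :: "'a::euclidean_space set \<Rightarrow> bool" where
  "lipschitz_boundary U \<longleftrightarrow>
     (\<forall>x\<in>frontier U. \<exists>V e \<gamma> L. open V \<and> x \<in> V \<and> norm e = 1 \<and>
        L-lipschitz_on {z. z \<bullet> e = 0} \<gamma> \<and>
        U \<inter> V = {y \<in> V. \<gamma> (y - (y \<bullet> e) *\<^sub>R e) < y \<bullet> e})"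

primrec continuously_differentiable :: "nat \<Rightarrow> ('a::euclidean_space \<Rightarrow> real) \<Rightarrow> bool" where
  "continuously_differentiable 0 f \<longleftrightarrow> continuous_on UNIV f"
| "continuously_differentiable (Suc k) f \<longleftrightarrow>
     (\<forall>x. f differentiable (at x)) \<and>
     (\<forall>b\<in>Basis. continuously_differentiable k (\<lambda>x. frechet_derivative f (at x) b))"

definition test_function :: "'a::euclidean_space set \<Rightarrow> ('a \<Rightarrow> real) \<Rightarrow> bool" where
  "test_function U \<phi> \<longleftrightarrow>
     (\<forall>k. continuously_differentiable k \<phi>) \<and>
     compact (closure {x. \<phi> x \<noteq> 0}) \<and> closure {x. \<phi> x \<noteq> 0} \<subseteq> U"

definition locally_integrable ::
  "'a::euclidean_space set \<Rightarrow> ('a \<Rightarrow> 'b::euclidean_space) \<Rightarrow> bool" where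
  "locally_integrable U f \<longleftrightarrow> (\<forall>K. compact K \<and> K \<subseteq> U \<longrightarrow> set_integrable lebesgue K f)"

text \<open>\<open>D x $ i $ j\<close> is the weak partial derivative in direction \<open>j\<close> of the \<open>i\<close>-th component
  of \<open>u\<close>. It is determined by \<open>u\<close> only up to null sets, hence a relation.\<close>

definition has_weak_jacobian ::
  "(real^'n) set \<Rightarrow> (real^'n \<Rightarrow> real^'m) \<Rightarrow> (real^'n \<Rightarrow> real^'n^'m) \<Rightarrow> bool" where
  "has_weak_jacobian U u D \<longleftrightarrow>
     locally_integrable U u \<and> locally_integrable U D \<and>
     (\<forall>\<phi> i j. test_function U \<phi> \<longrightarrow>
        (LINT x:U|lebesgue. u x $ i * frechet_derivative \<phi> (at x) (axis j 1)) =
        - (LINT x:U|lebesgue. D x $ i $ j * \<phi> x))"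

definition L_infinity ::
  "'a::euclidean_space set \<Rightarrow> ('a \<Rightarrow> 'b::euclidean_space) set" where
  "L_infinity A = {f. f \<in> borel_measurable (lebesgue_on A) \<and>
     esssup (lebesgue_on A) (\<lambda>x. ereal (norm (f x))) < \<infinity>}"

text \<open>Continuity on \<open>U\<close> encodes the identification of a Sobolev function with its continuous
  representative.\<close>

definition W_1_infinity :: "(real^'n) set \<Rightarrow> (real^'n \<Rightarrow> real^'m) set" where
  "W_1_infinity U = {u. continuous_on U u \<and> u \<in> L_infinity U \<and>
     (\<exists>D. has_weak_jacobian U u D \<and> D \<in> L_infinity U)}"

text \<open>The counting measure plays the role of 0-dimensional Hausdorff measure; the multiplicity
  function is nonnegative, so its essential supremum is its \<open>L\<close>-infinity norm.\<close>

definition multiplicity_function :: "'a set \<Rightarrow> ('a \<Rightarrow> 'b) \<Rightarrow> 'b \<Rightarrow> ennreal" where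
  "multiplicity_function U u y = emeasure (count_space UNIV) (U \<inter> u -` {y})"

definition essentially_injective ::
  "'a::euclidean_space set \<Rightarrow> ('a \<Rightarrow> 'a) \<Rightarrow> bool" where
  "essentially_injective U u \<longleftrightarrow> esssup lebesgue (multiplicity_function U u) = 1"

text \<open>Push-forward and restricted Lebesgue measure are compared as Borel measures on the whole
  space. The identity on the right only moves the restriction of Lebesgue measure to \<open>B\<close>, whose
  underlying space is \<open>B\<close>, to the whole space.\<close>

definition measure_preserving_map ::
  "'a::euclidean_space set \<Rightarrow> ('a \<Rightarrow> 'a) \<Rightarrow> bool" where
  "measure_preserving_map A s \<longleftrightarrow>
     A \<in> sets lebesgue \<and> s \<in> L_infinity A \<and>
     (\<exists>B\<in>sets lebesgue. distr (lebesgue_on A) borel s = distr (lebesgue_on B) borel (\<lambda>y. y))"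

end

theory Submission
  imports Defs
begin

text \<open>
  Writing \<open>J = det Du\<close>, let \<open>m\<close> and \<open>g\<close> be the densities of the images under \<open>u\<close> of Lebesgue measure on \<open>U\<close>
  and of \<open>J\<close> times it. By the area formula \<open>g\<close> is the indicator of \<open>u(U)\<close> and \<open>m \<le> g/l\<close>, and testing
  \<open>w = m - g\<close> against its dual function bounds the \<open>L\<^sup>p\<close> norm of \<open>w\<close> by that of \<open>1 - J\<close>. Shifting every
  point \<open>y\<close> in a fixed direction \<open>e\<close> by the integral of \<open>w\<close> over the half-line behind \<open>y\<close> pushes the density
  \<open>1 + w \<ge> m\<close> to Lebesgue measure; composed with \<open>u\<close> it gives a map \<open>s\<close> whose image measure is at most
  Lebesgue measure and for which \<open>\<integral>\<bar>u - s\<bar>\<^sup>p\<close> is controlled. In dimension at least two such an \<open>s\<close> is an \<open>L\<^sup>p\<close> limit of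
  smooth volume preserving diffeomorphisms: on a fine grid it is nearly an injective map of cells, row shifts
  generate enough permutations of the grid (the commutator of two crossing shifts is a 3-cycle), and a row shift is a
  limit of smooth shears. If \<open>1 - J\<close> does not vanish there is room for this approximation, otherwise \<open>u\<close>
  itself is measure preserving. In dimension one a translation suffices.
\<close>

section \<open>Smooth bump functions\<close>

text \<open>The obstacle is that \<open>s\<close> is merely measurable: it need not be injective,
  continuous or of Sobolev class. What survives is that its image measure does not exceed Lebesgue
  measure, and this bounds the volume that has to fit into each cell of a grid. The bound rests on
  \<open>1 + w = m + (1 - g)\<close> and \<open>g \<le> 1\<close>. The powers of \<open>l\<close>
  have two sources: duality gives \<open>l powr (1 - p)\<close>, and the shift costs a further
  \<open>1 / l\<close> because \<open>m \<le> 1 / l\<close>. A line meets a ball of radius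
  \<open>d\<close> in length at most \<open>2 * d\<close>, whence \<open>(2 * d) powr p\<close>. The
  smooth map is taken as close to \<open>s\<close> as \<open>s\<close> is known to be to
  \<open>u\<close>, so both errors have the same bound and the triangle inequality leads to the
  constant \<open>2 * 4 powr p\<close>. All this presupposes that the weak Jacobian is a classical
  derivative almost everywhere; that is obtained by averaging \<open>u\<close> with kernels whose
  width is proportional to the increment.\<close>

definition bump :: "nat \<Rightarrow> real \<Rightarrow> real" where
  "bump k t = (if t \<le> 0 then 0 else exp (- 1 / t) / t ^ k)"

lemma bump_nonneg: "0 \<le> bump k t"
  by (simp add: bump_def)

lemma bump_0_le_1: "bump 0 t \<le> 1"
  by (simp add: bump_def)

lemma bump_pos_iff: "0 < bump k t \<longleftrightarrow> 0 < t"
  by (simp add: bump_def)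

text \<open>A single term of the exponential series at \<open>1 / t\<close>, the one of order
  \<open>Suc k\<close>, bounds \<open>exp (1 / t)\<close> from below. Linear decay at the origin for
  every \<open>k\<close> is what makes the whole family differentiable there.\<close>

lemma bump_le_linear: "bump k t \<le> fact (Suc k) * \<bar>t\<bar>"
proof (cases "t \<le> 0")
  case False
  then have t: "0 < t" by simp
  have "(1/t) ^ Suc k /\<^sub>R fact (Suc k) \<le> exp (1/t)"
  proof -
    have s: "summable (\<lambda>n. (1/t) ^ n /\<^sub>R fact n)"
      by (rule summable_exp_generic)
    have "(\<Sum>n\<in>{Suc k}. (1/t) ^ n /\<^sub>R fact n) \<le> (\<Sum>n. (1/t) ^ n /\<^sub>R fact n)"
      by (rule sum_le_suminf[OF s]) (use t in auto)
    then show ?thesis by (simp add: exp_def)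
  qed
  then have "(1/t) ^ Suc k \<le> fact (Suc k) * exp (1/t)"
    using mult_left_mono[of _ _ "fact (Suc k) :: real"] by (simp add: field_simps pos_divide_le_eq mult_ac power_one_over t del: fact_Suc power_Suc)
  then have "1 \<le> fact (Suc k) * exp (1/t) * t ^ Suc k"
    using t by (simp add: power_one_over field_simps del: fact_Suc)
  then have "exp (- (1/t)) / t ^ k \<le> fact (Suc k) * t"
    using t by (simp add: exp_minus field_simps del: fact_Suc)
  then show ?thesis using t by (simp add: bump_def del: fact_Suc)
next
  case True
  have "0 \<le> fact (Suc k) * \<bar>t\<bar>" by (intro mult_nonneg_nonneg) auto
  with True show ?thesis by (simp add: bump_def del: fact_Suc)
qed

text \<open>Powers of \<open>t\<close> in the denominator belong to the family so that
  differentiation stays inside it and no formula for higher derivatives is needed. At the origin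
  both terms on the right vanish.\<close>

lemma DERIV_bump:
  "(bump k has_real_derivative bump (k + 2) t - k * bump (k + 1) t) (at t)"
proof -
  consider "t < 0" | "t = 0" | "0 < t" by linarith
  then show ?thesis
  proof cases
    case 1
    have "((\<lambda>_. 0) has_real_derivative bump (k + 2) t - k * bump (k + 1) t) (at t)"
      using 1 by (simp add: bump_def)
    then show ?thesis
      by (rule has_field_derivative_transform_within_open[of _ _ _ "{..<0}"])
        (use 1 in \<open>auto simp: bump_def\<close>)
  next
    case 2
    have "((\<lambda>h. bump k h / h) \<longlongrightarrow> 0) (at 0)"
    proof (rule Lim_null_comparison)
      show "((\<lambda>h. fact (Suc (Suc k)) * \<bar>h\<bar>) \<longlongrightarrow> (0::real)) (at 0)"
        by (rule tendsto_eq_intros refl | simp)+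
      \<comment> \<open>Dividing by \<open>h\<close> turns \<open>bump k\<close> into
        \<open>bump (Suc k)\<close>, so the linear bound is used one index higher.\<close>
      have "norm (bump k h / h) \<le> fact (Suc (Suc k)) * \<bar>h\<bar>" for h :: real
        using bump_le_linear[of "Suc k" h] by (auto simp: bump_def field_simps)
      then show "\<forall>\<^sub>F h in at 0. norm (bump k h / h) \<le> fact (Suc (Suc k)) * \<bar>h\<bar>"
        by simp
    qed
    then show ?thesis using 2 by (simp add: DERIV_def bump_def)
  next
    case 3
    have "((\<lambda>s. exp (- 1 / s) / s ^ k) has_real_derivative bump (k + 2) t - k * bump (k + 1) t) (at t)"
    proof -
      have "t ^ (k - Suc 0) * t * real k = t ^ k * real k"
        by (cases k) auto
      then show ?thesis
        using 3
        by (auto intro!: derivative_eq_intros simp: bump_def field_simps power2_eq_square)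
    qed
    then show ?thesis
      by (rule has_field_derivative_transform_within_open[of _ _ _ "{0<..}"])
        (use 3 in \<open>auto simp: bump_def\<close>)
  qed
qed

text \<open>The recursion in \<open>continuously_differentiable\<close> asks at each level for
  regularity of the partial derivatives. A class that is closed under them settles all orders by one
  induction.\<close>

inductive bump_algebra :: "('a::euclidean_space \<Rightarrow> real) \<Rightarrow> bool" where
  const: "bump_algebra (\<lambda>x. c)"
| bump: "bump_algebra (\<lambda>x. bump k (c + s * (x \<bullet> b)))"
| add: "bump_algebra f \<Longrightarrow> bump_algebra g \<Longrightarrow> bump_algebra (\<lambda>x. f x + g x)"
| mult: "bump_algebra f \<Longrightarrow> bump_algebra g \<Longrightarrow> bump_algebra (\<lambda>x. f x * g x)"

lemma bump_algebra_derivative: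
  "bump_algebra f \<Longrightarrow>
    \<exists>f'. (\<forall>x. (f has_derivative f' x) (at x)) \<and> (\<forall>h. bump_algebra (\<lambda>x. f' x h))"
proof (induction rule: bump_algebra.induct)
  case (const c)
  show ?case
    by (rule exI[of _ "\<lambda>_ _. 0"]) (auto intro: bump_algebra.const)
next
  case (bump k c s b)
  define f' where "f' = (\<lambda>x h. (bump (k + 2) (c + s * (x \<bullet> b)) + (- real k) * bump (k + 1) (c + s * (x \<bullet> b))) * (s * (h \<bullet> b)))"
  have "((\<lambda>x. bump k (c + s * (x \<bullet> b))) has_derivative f' x) (at x)" for x :: 'a
  proof -
    have 1: "((\<lambda>x. c + s * (x \<bullet> b)) has_derivative (\<lambda>h. s * (h \<bullet> b))) (at x)"
      by (auto intro!: derivative_eq_intros)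
    show ?thesis
      using has_derivative_compose[OF 1 DERIV_bump[of k, unfolded has_field_derivative_def]]
      by (simp add: f'_def)
  qed
  moreover have "bump_algebra (\<lambda>x. f' x h)" for h
    unfolding f'_def by (intro bump_algebra.intros)
  ultimately show ?case by blast
next
  case (add f g)
  then obtain f' g' where *: "\<And>x. (f has_derivative f' x) (at x)" "\<And>h. bump_algebra (\<lambda>x. f' x h)"
    "\<And>x. (g has_derivative g' x) (at x)" "\<And>h. bump_algebra (\<lambda>x. g' x h)" by blast
  show ?case
    by (rule exI[of _ "\<lambda>x h. f' x h + g' x h"])
      (auto intro!: bump_algebra.intros * has_derivative_add)
next
  case (mult f g)
  then obtain f' g' where *: "\<And>x. (f has_derivative f' x) (at x)" "\<And>h. bump_algebra (\<lambda>x. f' x h)"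
    "\<And>x. (g has_derivative g' x) (at x)" "\<And>h. bump_algebra (\<lambda>x. g' x h)" by blast
  show ?case
    by (rule exI[of _ "\<lambda>x h. f x * g' x h + f' x h * g x"])
      (auto intro!: bump_algebra.intros * has_derivative_mult mult)
qed

lemma bump_algebra_continuously_differentiable:
  "bump_algebra f \<Longrightarrow> continuously_differentiable k f"
proof (induction k arbitrary: f)
  case 0
  then show ?case
    using bump_algebra_derivative[OF 0] has_derivative_continuous
    by (fastforce intro!: continuous_at_imp_continuous_on)
next
  case (Suc k)
  obtain f' where *: "\<And>x. (f has_derivative f' x) (at x)" "\<And>h. bump_algebra (\<lambda>x. f' x h)"
    using bump_algebra_derivative[OF Suc.prems] by blast
  have "frechet_derivative f (at x) = f' x" for x
    using frechet_derivative_at[OF *(1)] by simp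
  with * Suc.IH show ?case by (auto intro: differentiableI)
qed

text \<open>Positive exactly on the open cube with centre \<open>a\<close> and half side
  \<open>r\<close>. It serves both as a cut-off and as an averaging kernel.\<close>

definition box_bump :: "'a::euclidean_space \<Rightarrow> real \<Rightarrow> 'a \<Rightarrow> real" where
  "box_bump a r x =
    (\<Prod>b\<in>Basis. bump 0 (1 - (x - a) \<bullet> b / r) * bump 0 (1 + (x - a) \<bullet> b / r))"

lemma bump_algebra_box_bump: "bump_algebra (box_bump a r)"
proof -
  have "bump_algebra (\<lambda>x. \<Prod>b\<in>B. bump 0 (1 - (x - a) \<bullet> b / r) * bump 0 (1 + (x - a) \<bullet> b / r))"
    if "finite B" for B
    using that
  proof (induction B)
    case empty
    show ?case using bump_algebra.const[of 1] by simp
  next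
    case (insert b B)
    have 1: "(\<lambda>x. bump 0 (1 - (x - a) \<bullet> b / r)) = (\<lambda>x. bump 0 ((1 + a \<bullet> b / r) + (- 1 / r) * (x \<bullet> b)))"
      by (auto simp: inner_diff_left diff_divide_distrib algebra_simps)
    have 2: "(\<lambda>x. bump 0 (1 + (x - a) \<bullet> b / r)) = (\<lambda>x. bump 0 ((1 - a \<bullet> b / r) + (1 / r) * (x \<bullet> b)))"
      by (auto simp: inner_diff_left diff_divide_distrib algebra_simps)
    have "bump_algebra (\<lambda>x. bump 0 (1 - (x - a) \<bullet> b / r))" "bump_algebra (\<lambda>x. bump 0 (1 + (x - a) \<bullet> b / r))"
      unfolding 1 2 by (rule bump_algebra.bump)+
    with insert show ?case
      by (simp add: bump_algebra.mult)
  qed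
  then show ?thesis by (simp add: box_bump_def[abs_def])
qed

lemma box_bump_nonneg: "0 \<le> box_bump a r x"
  by (auto simp: box_bump_def intro!: prod_nonneg mult_nonneg_nonneg bump_nonneg)

lemma box_bump_le_1: "box_bump a r x \<le> 1"
  unfolding box_bump_def
  by (intro prod_le_1) (auto intro!: mult_nonneg_nonneg mult_le_one bump_nonneg bump_0_le_1)

lemma box_bump_pos_iff:
  assumes "0 < r"
  shows "0 < box_bump a r x \<longleftrightarrow> x \<in> box (a - r *\<^sub>R One) (a + r *\<^sub>R One)"
proof -
  have pos: "0 < box_bump a r x \<longleftrightarrow> (\<forall>b\<in>Basis. 0 < bump 0 (1 - (x - a) \<bullet> b / r) * bump 0 (1 + (x - a) \<bullet> b / r))"
    unfolding box_bump_def
    by (metis (no_types, lifting) bump_nonneg finite_Basis less_irrefl mult_nonneg_nonneg order_le_less prod_pos prod_zero)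
  have "0 < bump 0 (1 - (x - a) \<bullet> b / r) * bump 0 (1 + (x - a) \<bullet> b / r) \<longleftrightarrow> a \<bullet> b - r < x \<bullet> b \<and> x \<bullet> b < a \<bullet> b + r" for b
  proof -
    have "0 < bump 0 (1 - (x - a) \<bullet> b / r) * bump 0 (1 + (x - a) \<bullet> b / r) \<longleftrightarrow>
       0 < bump 0 (1 - (x - a) \<bullet> b / r) \<and> 0 < bump 0 (1 + (x - a) \<bullet> b / r)"
      using bump_nonneg[of 0 "1 - (x - a) \<bullet> b / r"] bump_nonneg[of 0 "1 + (x - a) \<bullet> b / r"]
      by (auto simp: zero_less_mult_iff)
    then show ?thesis
      using assms by (auto simp: bump_pos_iff field_simps inner_diff_left)
  qed
  with pos show ?thesis
    by (simp add: mem_box inner_diff_left inner_add_left)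
qed

lemma box_bump_eq_0:
  assumes "0 < r" "x \<notin> box (a - r *\<^sub>R One) (a + r *\<^sub>R One)"
  shows "box_bump a r x = 0"
  using assms box_bump_pos_iff[of r a x] box_bump_nonneg[of a r x] by force

lemma support_box_bump:
  assumes "0 < r"
  shows "{x. box_bump a r x \<noteq> 0} = box (a - r *\<^sub>R One) (a + r *\<^sub>R One)"
proof (intro set_eqI iffI)
  fix x show "x \<in> {x. box_bump a r x \<noteq> 0}" if "x \<in> box (a - r *\<^sub>R One) (a + r *\<^sub>R One)"
    using that box_bump_pos_iff[OF assms, of a x] by simp
qed (use box_bump_eq_0[OF assms] in blast)

lemma test_function_box_bump:
  assumes "0 < r" "cbox (a - r *\<^sub>R One) (a + r *\<^sub>R One) \<subseteq> U"
  shows "test_function U (box_bump a r)"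
proof -
  have "box (a - r *\<^sub>R One) (a + r *\<^sub>R One) \<noteq> {}"
    using assms by (auto simp: box_ne_empty inner_diff_left inner_add_left)
  then show ?thesis
    using assms
    by (simp add: test_function_def support_box_bump bump_algebra_continuously_differentiable
      bump_algebra_box_bump compact_cbox)
qed

text \<open>All kernels are dilates and translates of one function, so moving the centre of a kernel
  amounts to moving the argument of a single C1 function.\<close>

lemma box_bump_rescale: "box_bump a r x = box_bump 0 1 ((x - a) /\<^sub>R r)"
  by (simp add: box_bump_def divide_inverse mult.commute)

lemma box_bump_derivative:
  obtains G :: "'a::euclidean_space \<Rightarrow> 'a \<Rightarrow> real"
  where "\<And>x. (box_bump 0 1 has_derivative G x) (at x)" "\<And>h. continuous_on UNIV (\<lambda>x. G x h)"
proof -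
  obtain G where G: "\<And>x. ((box_bump 0 1 :: 'a \<Rightarrow> real) has_derivative G x) (at x)" "\<And>h. bump_algebra (\<lambda>x. G x h)"
    using bump_algebra_derivative[OF bump_algebra_box_bump] by blast
  show ?thesis
    using that[OF G(1)] bump_algebra_continuously_differentiable[OF G(2), of 0] by simp
qed

lemma continuous_box_bump: "continuous_on S (box_bump a r)"
  using bump_algebra_continuously_differentiable[OF bump_algebra_box_bump, of 0]
  by (auto intro: continuous_on_subset)

lemma test_function_continuous: "test_function U \<phi> \<Longrightarrow> continuous_on S \<phi>"
  unfolding test_function_def by (metis continuously_differentiable.simps(1) continuous_on_subset subset_UNIV)

lemma test_function_derivative:
  assumes "test_function U \<phi>"
  shows "(\<phi> has_derivative frechet_derivative \<phi> (at x)) (at x)"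
    "b \<in> Basis \<Longrightarrow> continuous_on S (\<lambda>x. frechet_derivative \<phi> (at x) b)"
proof -
  have "continuously_differentiable (Suc 0) \<phi>"
    using assms by (simp only: test_function_def)
  then show "(\<phi> has_derivative frechet_derivative \<phi> (at x)) (at x)"
    "b \<in> Basis \<Longrightarrow> continuous_on S (\<lambda>x. frechet_derivative \<phi> (at x) b)"
    by (auto simp: frechet_derivative_works[symmetric] intro: continuous_on_subset)
qed

section \<open>Weak Jacobians\<close>

lemma set_integrable_lebesgue_compact:
  fixes f :: "'a::euclidean_space \<Rightarrow> 'b::euclidean_space"
  assumes "compact K" "continuous_on K f"
  shows "set_integrable lebesgue K f"
proof -
  have "integrable lborel (\<lambda>x. indicator K x *\<^sub>R f x)"
    by (rule borel_integrable_compact[OF assms])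
  then show ?thesis
    unfolding set_integrable_def by (subst integrable_completion) (auto intro: borel_measurable_integrable)
qed

lemma continuous_imp_locally_integrable:
  "continuous_on U f \<Longrightarrow> locally_integrable U f"
  unfolding locally_integrable_def
proof (intro allI impI)
  fix K assume "continuous_on U f" "compact K \<and> K \<subseteq> U"
  then show "set_integrable lebesgue K f"
    by (metis set_integrable_lebesgue_compact continuous_on_subset)
qed

lemma has_derivative_0_outside:
  assumes "closed K" "\<And>x. x \<notin> K \<Longrightarrow> g x = 0" "(g has_derivative g') (at x)" "x \<notin> K"
  shows "g' = (\<lambda>h. 0)"
proof -
  have "((\<lambda>x. 0) has_derivative (\<lambda>h. 0)) (at x)" by simp
  then have "(g has_derivative (\<lambda>h. 0)) (at x)"
    by (rule has_derivative_transform_within_open[of _ _ _ _ "- K"]) (use assms in auto)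
  with assms(3) show ?thesis by (rule has_derivative_unique)
qed

lemma continuous_compact_support_bounded:
  fixes f :: "'a::euclidean_space \<Rightarrow> real"
  assumes "compact K" "continuous_on UNIV f" "\<And>x. x \<notin> K \<Longrightarrow> f x = 0"
  obtains C where "0 \<le> C" "\<And>x. \<bar>f x\<bar> \<le> C"
proof -
  have "bounded (f ` K)"
    using assms by (intro compact_imp_bounded compact_continuous_image continuous_on_subset[OF assms(2)]) auto
  then obtain C where C: "\<And>x. x \<in> K \<Longrightarrow> \<bar>f x\<bar> \<le> C" by (auto simp: bounded_iff)
  have "\<bar>f x\<bar> \<le> max C 0" for x
    using C[of x] assms(3)[of x] by (cases "x \<in> K") auto
  then show ?thesis using that[of "max C 0"] by simp
qed

lemma continuous_compact_support_integrable:
  fixes f :: "'a::euclidean_space \<Rightarrow> real"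
  assumes "compact K" "continuous_on UNIV f" "\<And>x. x \<notin> K \<Longrightarrow> f x = 0"
  shows "integrable lborel f"
proof -
  have "integrable lborel (\<lambda>x. indicator K x *\<^sub>R f x)"
    using assms by (intro borel_integrable_compact continuous_on_subset[OF assms(2)]) auto
  moreover have "(\<lambda>x. indicator K x *\<^sub>R f x) = f"
    using assms(3) by (auto simp: indicator_def fun_eq_iff)
  ultimately show ?thesis by simp
qed

lemma DERIV_along_line:
  fixes g :: "'a::real_normed_vector \<Rightarrow> real"
  assumes "(g has_derivative g') (at (x + u *\<^sub>R e))"
  shows "((\<lambda>t. g (x + t *\<^sub>R e)) has_real_derivative g' e) (at u)"
proof -
  have 1: "((\<lambda>t. x + t *\<^sub>R e) has_derivative (\<lambda>t. t *\<^sub>R e)) (at u)"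
    by (auto intro!: derivative_eq_intros)
  have "(\<lambda>t. g' (t *\<^sub>R e)) = (*) (g' e)"
    using has_derivative_linear[OF assms] by (auto simp: linear_cmul mult.commute)
  then show ?thesis
    using has_derivative_compose[OF 1 assms] by (simp add: has_field_derivative_def)
qed

text \<open>The difference quotients of \<open>g\<close> have integral zero by translation invariance.\<close>

lemma integral_derivative_compact_support:
  fixes g :: "'a::euclidean_space \<Rightarrow> real"
  assumes K: "compact K" "\<And>x. x \<notin> K \<Longrightarrow> g x = 0"
    and g': "\<And>x. (g has_derivative g' x) (at x)" "continuous_on UNIV (\<lambda>x. g' x e)"
  shows "integral\<^sup>L lborel (\<lambda>x. g' x e) = 0"
proof -
  have contg: "continuous_on UNIV g"
    using g'(1) has_derivative_continuous by (intro continuous_at_imp_continuous_on) blast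
  have out: "g' x e = 0" if "x \<notin> K" for x
    using has_derivative_0_outside[OF compact_imp_closed[OF K(1)] K(2) g'(1) that] by simp
  obtain C where C: "0 \<le> C" "\<And>x. \<bar>g' x e\<bar> \<le> C"
    using continuous_compact_support_bounded[OF K(1) g'(2) out] by blast
  \<comment> \<open>All \<open>x\<close> for which some point \<open>x + s *\<^sub>R e\<close> with
    \<open>0 \<le> s \<le> 1\<close> lies in \<open>K\<close>. This compact set carries every
    quotient \<open>q n\<close>.\<close>
  define K' where "K' = {x - y |x y. x \<in> K \<and> y \<in> (\<lambda>t. t *\<^sub>R e) ` {0..1}}"
  have K': "compact K'"
    unfolding K'_def
    by (intro compact_differences K compact_continuous_image continuous_intros) auto
  define q where "q n x = real (Suc n) * (g (x + (1 / real (Suc n)) *\<^sub>R e) - g x)" for n x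
  have contq: "continuous_on UNIV (q n)" for n
    unfolding q_def by (intro continuous_intros continuous_on_compose2[OF contg]) auto
  have lim: "(\<lambda>n. q n x) \<longlonglongrightarrow> g' x e" for x
  proof -
    have "((\<lambda>t. g (x + t *\<^sub>R e)) has_real_derivative g' x e) (at 0)"
      using DERIV_along_line[of g "g' x" x 0 e] g'(1) by simp
    then have "((\<lambda>h. (g (x + h *\<^sub>R e) - g x) / h) \<longlongrightarrow> g' x e) (at 0)"
      by (simp add: DERIV_def)
    moreover have "filterlim (\<lambda>n. 1 / real (Suc n)) (at 0) sequentially"
      using LIMSEQ_inverse_real_of_nat by (auto simp: filterlim_at inverse_eq_divide)
    ultimately have "((\<lambda>n. (g (x + (1 / real (Suc n)) *\<^sub>R e) - g x) / (1 / real (Suc n))) \<longlonglongrightarrow> g' x e)"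
      by (rule filterlim_compose)
    then show ?thesis by (simp add: q_def mult.commute)
  qed
  have bnd: "norm (q n x) \<le> C * indicator K' x" for n x
  proof -
    define t where "t = 1 / real (Suc n)"
    have t: "0 < t" "t \<le> 1" by (auto simp: t_def)
    \<comment> \<open>The mean value theorem writes the quotient as a value of the derivative, which
      yields the dominating bound and the common support at once.\<close>
    have "\<exists>z>0. z < t \<and> g (x + t *\<^sub>R e) - g (x + 0 *\<^sub>R e) = (t - 0) * g' (x + z *\<^sub>R e) e"
      by (rule MVT2[OF t(1)]) (intro DERIV_along_line g'(1))
    then obtain s where s: "0 < s" "s < t" "g (x + t *\<^sub>R e) - g x = t * g' (x + s *\<^sub>R e) e"
      by auto
    have q: "q n x = g' (x + s *\<^sub>R e) e"
      using s(3) by (simp add: q_def t_def field_simps)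
    show ?thesis
    proof (cases "x \<in> K'")
      case True then show ?thesis using q C by simp
    next
      case False
      have "x + s *\<^sub>R e \<notin> K"
      proof
        assume "x + s *\<^sub>R e \<in> K"
        moreover have "x = (x + s *\<^sub>R e) - s *\<^sub>R e" by simp
        moreover have "s *\<^sub>R e \<in> (\<lambda>t. t *\<^sub>R e) ` {0..1}" using s t by auto
        ultimately have "x \<in> K'" unfolding K'_def by blast
        with False show False by simp
      qed
      with out q False show ?thesis by simp
    qed
  qed
  have "(\<lambda>n. integral\<^sup>L lborel (q n)) \<longlonglongrightarrow> integral\<^sup>L lborel (\<lambda>x. g' x e)"
  proof (rule integral_dominated_convergence[where w = "\<lambda>x. C * indicator K' x"])
    show "integrable lborel (\<lambda>x. C * indicator K' x)"
      by (intro integrable_mult_right integrable_real_indicator borel_compact[OF K', THEN sets_lborel[THEN equalityD2, THEN subsetD]]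
         emeasure_compact_finite[OF K'])
    show "q n \<in> borel_measurable lborel" for n
      using borel_measurable_continuous_onI[OF contq] by simp
    show "(\<lambda>x. g' x e) \<in> borel_measurable lborel"
      using borel_measurable_continuous_onI[OF g'(2)] by simp
    show "AE x in lborel. (\<lambda>n. q n x) \<longlonglongrightarrow> g' x e" using lim by blast
    show "AE x in lborel. norm (q n x) \<le> C * indicator K' x" for n using bnd by blast
  qed
  moreover have "integral\<^sup>L lborel (q n) = 0" for n
  proof -
    have i: "integrable lborel g" by (rule continuous_compact_support_integrable[OF K(1) contg K(2)])
    define v where "v = (1 / real (Suc n)) *\<^sub>R e"
    have m: "(\<lambda>x. x + v) \<in> lborel \<rightarrow>\<^sub>M borel" by simp
    have d: "distr lborel borel (\<lambda>x. x + v) = lborel"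
    proof -
      have "(\<lambda>x. x + v) = (+) v" by (auto simp: add.commute)
      then show ?thesis by (simp add: lborel_distr_plus)
    qed
    have "integrable (distr lborel borel (\<lambda>x. x + v)) g" using d i by simp
    then have 1: "integrable lborel (\<lambda>x. g (x + v))"
      by (subst (asm) integrable_distr_eq) (use borel_measurable_continuous_onI[OF contg] in auto)
    have "integral\<^sup>L (distr lborel borel (\<lambda>x. x + v)) g = integral\<^sup>L lborel (\<lambda>x. g (x + v))"
      by (rule integral_distr) (use borel_measurable_continuous_onI[OF contg] in auto)
    with d have "integral\<^sup>L lborel (\<lambda>x. g (x + v)) = integral\<^sup>L lborel g" by simp
    then have "integral\<^sup>L lborel (\<lambda>x. real (Suc n) * (g (x + v) - g x)) = 0"
      unfolding integral_mult_right_zero using Bochner_Integration.integral_diff[OF 1 i] by simp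
    then show ?thesis by (simp add: q_def[abs_def] v_def)
  qed
  ultimately show ?thesis by (simp add: LIMSEQ_const_iff)
qed

lemma matrix_vector_mult_axis: "((A :: real^'n^'m) *v axis j 1) $ i = A $ i $ j"
  by (subst matrix_vector_mult_basis) (simp only: column_def vec_lambda_beta)

lemma test_function_0_outside: "test_function U \<phi> \<Longrightarrow> x \<notin> closure {x. \<phi> x \<noteq> 0} \<Longrightarrow> \<phi> x = 0"
  by (metis (mono_tags, lifting) closure_subset mem_Collect_eq subsetD)

text \<open>The product \<open>f x $ i * \<phi> x\<close> has compact support, so its partial
  derivative integrates to zero, and the product rule splits that integral into the two sides of the
  weak formulation. This puts smooth diffeomorphisms into the Sobolev class.\<close>

lemma has_weak_jacobian_C1:
  fixes f :: "real^'n \<Rightarrow> real^'m" and D :: "real^'n \<Rightarrow> real^'n^'m"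
  assumes f: "\<And>x. (f has_derivative (*v) (D x)) (at x)" and D: "continuous_on UNIV D"
  shows "has_weak_jacobian U f D"
  unfolding has_weak_jacobian_def
proof (intro conjI allI impI)
  have contf: "continuous_on UNIV f"
    using f has_derivative_continuous by (intro continuous_at_imp_continuous_on) blast
  show "locally_integrable U f" "locally_integrable U D"
    using contf D by (auto intro!: continuous_imp_locally_integrable intro: continuous_on_subset)
  fix \<phi> :: "real^'n \<Rightarrow> real" and i :: 'm and j :: 'n
  assume \<phi>: "test_function U \<phi>"
  define K where "K = closure {x. \<phi> x \<noteq> 0}"
  have K: "compact K" "K \<subseteq> U" using \<phi> by (auto simp: test_function_def K_def)
  have \<phi>0: "\<phi> x = 0" if "x \<notin> K" for x
    by (rule test_function_0_outside[OF \<phi> that[unfolded K_def]])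
  define e :: "real^'n" where "e = axis j 1"
  let ?d = "\<lambda>x. frechet_derivative \<phi> (at x)"
  have e: "e \<in> Basis" by (simp add: e_def)
  have d\<phi>: "(\<phi> has_derivative ?d x) (at x)" for x by (rule test_function_derivative(1)[OF \<phi>])
  have d0: "?d x e = 0" if "x \<notin> K" for x
    using has_derivative_0_outside[OF compact_imp_closed[OF K(1)] \<phi>0 d\<phi> that] by simp
  have cont: "continuous_on UNIV (\<lambda>x. f x $ i * ?d x e)" "continuous_on UNIV (\<lambda>x. D x $ i $ j * \<phi> x)"
    by (intro continuous_intros contf D test_function_derivative(2)[OF \<phi> e] test_function_continuous[OF \<phi>])+
  have int: "integrable lborel (\<lambda>x. f x $ i * ?d x e)" "integrable lborel (\<lambda>x. D x $ i $ j * \<phi> x)"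
    by (rule continuous_compact_support_integrable[OF K(1) cont(1)], simp add: d0,
        rule continuous_compact_support_integrable[OF K(1) cont(2)], simp add: \<phi>0)
  have "integral\<^sup>L lborel (\<lambda>x. f x $ i * ?d x e + (D x *v e) $ i * \<phi> x) = 0"
  proof (rule integral_derivative_compact_support[OF K(1)])
    show "((\<lambda>x. f x $ i * \<phi> x) has_derivative (\<lambda>h. f x $ i * ?d x h + (D x *v h) $ i * \<phi> x)) (at x)" for x
      by (intro has_derivative_mult d\<phi> bounded_linear.has_derivative[OF bounded_linear_vec_nth] f)
    show "continuous_on UNIV (\<lambda>x. f x $ i * ?d x e + (D x *v e) $ i * \<phi> x)"
      using continuous_on_add[OF cont] by (simp add: e_def matrix_vector_mult_axis)
  qed (simp add: \<phi>0)
  then have *: "integral\<^sup>L lborel (\<lambda>x. f x $ i * ?d x e) = - integral\<^sup>L lborel (\<lambda>x. D x $ i $ j * \<phi> x)"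
    using int by (simp add: e_def matrix_vector_mult_axis)
  have 1: "(\<lambda>x. indicator U x *\<^sub>R (f x $ i * ?d x e)) = (\<lambda>x. f x $ i * ?d x e)"
    using d0 K by (fastforce simp: indicator_def)
  have 2: "(\<lambda>x. indicator U x *\<^sub>R (D x $ i $ j * \<phi> x)) = (\<lambda>x. D x $ i $ j * \<phi> x)"
    using \<phi>0 K by (fastforce simp: indicator_def)
  show "(LINT x:U|lebesgue. f x $ i * ?d x (axis j 1)) = - (LINT x:U|lebesgue. D x $ i $ j * \<phi> x)"
    using * int unfolding set_lebesgue_integral_def e_def[symmetric] 1 2
    by (simp add: integral_completion borel_measurable_integrable)
qed

section \<open>Lebesgue points\<close>

text \<open>A bad point is the centre of arbitrarily small balls whose part outside \<open>E\<close>
  exceeds the fraction \<alpha>. Vitali's theorem selects disjoint ones inside an open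
  \<open>G\<close> that is hardly larger than \<open>E\<close>. They cover the bad set up to a null
  set, and their total volume is at most \<open>1 / \<alpha>\<close> times that of
  \<open>G - E\<close>.\<close>

lemma negligible_density_defect:
  fixes E :: "'a::euclidean_space set"
  assumes E: "E \<in> sets lebesgue" and \<alpha>: "0 < \<alpha>"
  shows "negligible {x\<in>E. \<not> (\<exists>\<rho>>0. \<forall>r. 0 < r \<and> r < \<rho> \<longrightarrow>
    measure lebesgue (ball x r - E) \<le> \<alpha> * measure lebesgue (ball x r))}" (is "negligible ?B")
  unfolding negligible_outer_le
proof (intro allI impI)
  fix e :: real assume e: "0 < e"
  define b where "b x r \<longleftrightarrow> \<alpha> * measure lebesgue (ball x r) < measure lebesgue (ball x r - E)" for x r
  \<comment> \<open>The factor \<alpha> in the tolerance pays for the division by \<alpha> when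
    balls are compared with their parts outside \<open>E\<close>.\<close>
  obtain G where G: "open G" "E \<subseteq> G" "emeasure lebesgue (G - E) < ennreal (\<alpha> * e)"
    using sets_lebesgue_outer_open[OF E, of "\<alpha> * e"] \<alpha> e by (metis mult_pos_pos)
  define K where "K = {(x, r). x \<in> ?B \<and> 0 < r \<and> ball x r \<subseteq> G \<and> b x r}"
  have cov: "\<exists>i. i \<in> K \<and> x \<in> ball (fst i) (snd i) \<and> snd i < d" if x: "x \<in> ?B" and d: "0 < d" for x d
  proof -
    have "x \<in> G" using x G(2) by blast
    then obtain \<epsilon> where \<epsilon>: "0 < \<epsilon>" "ball x \<epsilon> \<subseteq> G" using G(1) openE by blast
    have "\<not> (\<forall>r. 0 < r \<and> r < min d \<epsilon> \<longrightarrow> measure lebesgue (ball x r - E) \<le> \<alpha> * measure lebesgue (ball x r))"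
      (is "\<not> ?Q")
    proof
      assume ?Q
      moreover have "0 < min d \<epsilon>" using d \<epsilon>(1) by simp
      ultimately have "\<exists>\<rho>>0. \<forall>r. 0 < r \<and> r < \<rho> \<longrightarrow> measure lebesgue (ball x r - E) \<le> \<alpha> * measure lebesgue (ball x r)"
        by blast
      with x show False by blast
    qed
    then obtain r where r: "0 < r" "r < d" "r < \<epsilon>" "b x r" by (auto simp: b_def not_le)
    have "ball x r \<subseteq> G" using \<epsilon>(2) r(3) by (meson less_imp_le order_trans subset_ball)
    then have "(x, r) \<in> K" using x r by (simp add: K_def)
    then show ?thesis using r by (intro exI[of _ "(x, r)"]) simp
  qed
  obtain C where C: "countable C" "C \<subseteq> K"
     "pairwise (\<lambda>i j. disjnt (ball (fst i) (snd i)) (ball (fst j) (snd j))) C"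
     and N: "negligible (?B - (\<Union>i \<in> C. ball (fst i) (snd i)))"
    by (rule Vitali_covering_theorem_balls[of ?B K fst snd, OF cov])
  define W where "W i = ball (fst i) (snd i)" for i :: "'a \<times> real"
  define N' where "N' = ?B - (\<Union>i \<in> C. ball (fst i) (snd i))"
  have disj: "disjoint_family_on W C"
    using C(3) by (auto simp: disjoint_family_on_def pairwise_def W_def disjnt_def)
  then have disj2: "disjoint_family_on (\<lambda>i. W i - E) C"
    unfolding disjoint_family_on_def by blast
  have meas: "W i \<in> sets lebesgue" "W i - E \<in> sets lebesgue" for i
    using E by (auto simp: W_def)
  have fin: "emeasure lebesgue (W i) = measure lebesgue (W i)" "emeasure lebesgue (W i - E) = measure lebesgue (W i - E)" for i
  proof -
    have l: "W i \<in> lmeasurable" by (simp add: W_def lmeasurable_ball)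
    then show "emeasure lebesgue (W i) = measure lebesgue (W i)" by (rule emeasure_eq_measure2)
    have "W i - E \<in> lmeasurable" using l E by (rule fmeasurable_Diff)
    then show "emeasure lebesgue (W i - E) = measure lebesgue (W i - E)" by (rule emeasure_eq_measure2)
  qed
  have "emeasure lebesgue (\<Union>i\<in>C. W i) = (\<integral>\<^sup>+i. emeasure lebesgue (W i) \<partial>count_space C)"
    using meas C(1) disj by (intro emeasure_UN_countable) auto
  also have "\<dots> \<le> (\<integral>\<^sup>+i. ennreal (1 / \<alpha>) * emeasure lebesgue (W i - E) \<partial>count_space C)"
  proof (intro nn_integral_mono)
    fix i assume "i \<in> space (count_space C)"
    then have "b (fst i) (snd i)" using C(2) by (auto simp: K_def)
    then have "\<alpha> * measure lebesgue (W i) < measure lebesgue (W i - E)" by (simp add: b_def W_def)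
    then have "measure lebesgue (W i) \<le> 1 / \<alpha> * measure lebesgue (W i - E)"
      using \<alpha> by (simp add: field_simps)
    then show "emeasure lebesgue (W i) \<le> ennreal (1 / \<alpha>) * emeasure lebesgue (W i - E)"
      unfolding fin using \<alpha> by (simp add: ennreal_mult[symmetric])
  qed
  also have "\<dots> = ennreal (1 / \<alpha>) * (\<integral>\<^sup>+i. emeasure lebesgue (W i - E) \<partial>count_space C)"
    by (rule nn_integral_cmult) simp
  also have "(\<integral>\<^sup>+i. emeasure lebesgue (W i - E) \<partial>count_space C) = emeasure lebesgue (\<Union>i\<in>C. W i - E)"
    using meas C(1) disj2 by (intro emeasure_UN_countable[symmetric]) auto
  also have "\<dots> \<le> emeasure lebesgue (G - E)"
  proof (rule emeasure_mono)
    have "W i \<subseteq> G" if "i \<in> C" for i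
    proof -
      have "i \<in> K" using that C(2) by blast
      then show ?thesis unfolding K_def W_def by (simp add: split_beta)
    qed
    then show "(\<Union>i\<in>C. W i - E) \<subseteq> G - E" by blast
    have "G \<in> sets lebesgue" using borel_open[OF G(1)] by simp
    then show "G - E \<in> sets lebesgue" using E by (rule sets.Diff)
  qed
  also have "\<dots> \<le> ennreal (\<alpha> * e)" using G(3) by simp
  finally have "emeasure lebesgue (\<Union>i\<in>C. W i) \<le> ennreal (1 / \<alpha>) * ennreal (\<alpha> * e)"
    by (simp add: mult_left_mono order_trans)
  also have "\<dots> = ennreal e" using \<alpha> e by (simp add: ennreal_mult[symmetric])
  finally have le: "emeasure lebesgue (\<Union>i\<in>C. W i) \<le> ennreal e" .
  have mU: "(\<Union>i\<in>C. W i) \<in> sets lebesgue" using meas C(1) by (intro sets.countable_UN') auto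
  have N'0: "N' \<in> null_sets lebesgue" using N by (simp add: N'_def negligible_iff_null_sets)
  have "emeasure lebesgue ((\<Union>i\<in>C. W i) \<union> N') = emeasure lebesgue (\<Union>i\<in>C. W i)"
    using mU N'0 by (rule emeasure_Un_null_set)
  with le have le': "emeasure lebesgue ((\<Union>i\<in>C. W i) \<union> N') \<le> ennreal e" by simp
  show "\<exists>T. ?B \<subseteq> T \<and> T \<in> lmeasurable \<and> measure lebesgue T \<le> e"
  proof (intro exI conjI)
    show "?B \<subseteq> (\<Union>i\<in>C. W i) \<union> N'" unfolding N'_def W_def by blast
    show l: "(\<Union>i\<in>C. W i) \<union> N' \<in> lmeasurable"
      using le' mU N'0 by (intro fmeasurableI) (auto intro: le_less_trans)
    show "measure lebesgue ((\<Union>i\<in>C. W i) \<union> N') \<le> e"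
      using le' e unfolding emeasure_eq_measure2[OF l] by simp
  qed
qed

text \<open>Almost every point is a density point of the small-oscillation level set containing it.\<close>

lemma AE_Lebesgue_point:
  fixes f :: "'a::euclidean_space \<Rightarrow> 'b::euclidean_space"
  assumes f: "f \<in> borel_measurable lebesgue" and M: "\<And>x. norm (f x) \<le> M"
  shows "AE x in lebesgue. \<forall>\<epsilon>>0. \<exists>\<rho>>0. \<forall>r. 0 < r \<and> r < \<rho> \<longrightarrow>
    (LINT y:ball x r|lebesgue. norm (f y - f x)) \<le> \<epsilon> * measure lebesgue (ball x r)"
proof -
  have M0: "0 \<le> M" using M[of 0] norm_ge_zero order_trans by blast
  let ?P = "\<lambda>\<epsilon> x. \<exists>\<rho>>0. \<forall>r. 0 < r \<and> r < \<rho> \<longrightarrow>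
    (LINT y:ball x r|lebesgue. norm (f y - f x)) \<le> \<epsilon> * measure lebesgue (ball x r)"
  have one: "AE x in lebesgue. ?P \<epsilon> x" if \<epsilon>: "0 < \<epsilon>" for \<epsilon> :: real
  proof -
    obtain Q :: "'b set" where Q: "countable Q" "\<And>X. open X \<Longrightarrow> X \<noteq> {} \<Longrightarrow> \<exists>d\<in>Q. d \<in> X"
      using countable_dense_exists by metis
    \<comment> \<open>Outside the level set only the bound \<open>2 * M\<close> on the oscillation
      is available. With this density defect that part contributes at most
      \<open>\<epsilon> / 2\<close>; the level set contributes the other half.\<close>
    define \<alpha> where "\<alpha> = \<epsilon> / (4 * M + 4)"
    have \<alpha>: "0 < \<alpha>" "4 * M * \<alpha> \<le> \<epsilon>" using \<epsilon> M0 by (auto simp: \<alpha>_def field_simps)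
    \<comment> \<open>The centres run through a countable dense set, so countably many level sets
      exhaust the space, and on each of them \<open>f\<close> oscillates by at most
      \<open>\<epsilon> / 2\<close>.\<close>
    define E where "E = (\<lambda>c. f -` ball c (\<epsilon> / 4))"
    have Em: "E c \<in> sets lebesgue" for c
      unfolding E_def using measurable_sets[OF f, of "ball c (\<epsilon> / 4)"] by simp
    have "AE x in lebesgue. x \<in> E c \<longrightarrow> (\<exists>\<rho>>0. \<forall>r. 0 < r \<and> r < \<rho> \<longrightarrow>
      measure lebesgue (ball x r - E c) \<le> \<alpha> * measure lebesgue (ball x r))" for c
      using negligible_density_defect[OF Em \<alpha>(1), of c] unfolding negligible_iff_null_sets
      by (rule AE_I') auto
    then have "AE x in lebesgue. \<forall>c\<in>Q. x \<in> E c \<longrightarrow> (\<exists>\<rho>>0. \<forall>r. 0 < r \<and> r < \<rho> \<longrightarrow>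
      measure lebesgue (ball x r - E c) \<le> \<alpha> * measure lebesgue (ball x r))"
      using Q(1) by (simp add: AE_ball_countable)
    then show ?thesis
    proof (rule AE_mp, intro AE_I2 impI)
      fix x assume *: "\<forall>c\<in>Q. x \<in> E c \<longrightarrow> (\<exists>\<rho>>0. \<forall>r. 0 < r \<and> r < \<rho> \<longrightarrow>
        measure lebesgue (ball x r - E c) \<le> \<alpha> * measure lebesgue (ball x r))"
      obtain c where c: "c \<in> Q" "c \<in> ball (f x) (\<epsilon> / 4)"
        using Q(2)[of "ball (f x) (\<epsilon> / 4)"] \<epsilon> by auto
      then have xE: "x \<in> E c" by (simp add: E_def dist_commute)
      then obtain \<rho> where \<rho>: "0 < \<rho>" "\<And>r. 0 < r \<Longrightarrow> r < \<rho> \<Longrightarrow>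
        measure lebesgue (ball x r - E c) \<le> \<alpha> * measure lebesgue (ball x r)"
        using * c(1) by blast
      have "(LINT y:ball x r|lebesgue. norm (f y - f x)) \<le> \<epsilon> * measure lebesgue (ball x r)"
        if r: "0 < r" "r < \<rho>" for r
      proof -
        have l: "ball x r \<in> lmeasurable" by (simp add: lmeasurable_ball)
        then have l2: "ball x r - E c \<in> lmeasurable" using Em by (rule fmeasurable_Diff)
        have int: "integrable lebesgue (\<lambda>y. (\<epsilon> / 2) * indicator (ball x r) y + (2 * M) * indicator (ball x r - E c) y)"
          using l l2 by (intro Bochner_Integration.integrable_add integrable_mult_right) (auto simp: fmeasurable_def)
        have pw: "indicator (ball x r) y *\<^sub>R norm (f y - f x) \<le>
          (\<epsilon> / 2) * indicator (ball x r) y + (2 * M) * indicator (ball x r - E c) y" for y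
        proof (cases "y \<in> E c")
          case True
          have "dist (f y) (f x) \<le> dist c (f y) + dist c (f x)" by (rule dist_triangle3)
          also have "\<dots> \<le> \<epsilon> / 2" using True xE by (simp add: E_def)
          finally show ?thesis using True by (simp add: indicator_def dist_norm)
        next
          case False
          have "norm (f y - f x) \<le> 2 * M"
            using norm_triangle_ineq4[of "f y" "f x"] M[of x] M[of y] by simp
          with False \<epsilon> show ?thesis by (simp add: indicator_def)
        qed
        have "(LINT y:ball x r|lebesgue. norm (f y - f x)) \<le>
          integral\<^sup>L lebesgue (\<lambda>y. (\<epsilon> / 2) * indicator (ball x r) y + (2 * M) * indicator (ball x r - E c) y)"
          unfolding set_lebesgue_integral_def
          by (rule integral_mono_AE'[OF int AE_I2[OF pw]]) (use \<epsilon> M0 in simp)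
        also have "\<dots> = (\<epsilon> / 2) * measure lebesgue (ball x r) + (2 * M) * measure lebesgue (ball x r - E c)"
          using l l2 by (subst Bochner_Integration.integral_add) (auto simp: fmeasurable_def)
        also have "\<dots> \<le> (\<epsilon> / 2) * measure lebesgue (ball x r) + (2 * M) * (\<alpha> * measure lebesgue (ball x r))"
          using \<rho>(2)[OF r] M0 by (intro add_left_mono mult_left_mono) auto
        also have "\<dots> = (\<epsilon> / 2 + 2 * M * \<alpha>) * measure lebesgue (ball x r)" by (simp add: algebra_simps)
        also have "\<dots> \<le> \<epsilon> * measure lebesgue (ball x r)"
          using \<alpha> by (intro mult_right_mono) auto
        finally show ?thesis .
      qed
      with \<rho>(1) show "?P \<epsilon> x" by blast
    qed
  qed
  then have "AE x in lebesgue. \<forall>n. ?P (1 / real (Suc n)) x"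
    by (subst AE_all_countable) (intro allI one, simp)
  then show ?thesis
  proof (rule AE_mp, intro AE_I2 impI)
    fix x assume *: "\<forall>n. ?P (1 / real (Suc n)) x"
    have "?P \<epsilon> x" if "0 < \<epsilon>" for \<epsilon> :: real
    proof -
      from that obtain n where n: "1 / real (Suc n) < \<epsilon>" using nat_approx_posE by auto
      from * obtain \<rho> where "0 < \<rho>" "\<And>r. 0 < r \<Longrightarrow> r < \<rho> \<Longrightarrow>
       (LINT y:ball x r|lebesgue. norm (f y - f x)) \<le> 1 / real (Suc n) * measure lebesgue (ball x r)" by blast
    moreover have "1 / real (Suc n) * measure lebesgue (ball x r) \<le> \<epsilon> * measure lebesgue (ball x r)" for r
      using n by (intro mult_right_mono) auto
    ultimately show ?thesis by (meson order_trans)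
    qed
    then show "\<forall>\<epsilon>>0. ?P \<epsilon> x" by blast
  qed
qed

section \<open>Uniqueness and pointwise meaning of the weak Jacobian\<close>

lemma set_integrable_mult_compact_support:
  fixes f :: "'a::euclidean_space \<Rightarrow> real"
  assumes f: "locally_integrable U f" and K: "compact K" "K \<subseteq> U"
    and \<psi>: "continuous_on UNIV \<psi>" "\<And>x. x \<notin> K \<Longrightarrow> \<psi> x = 0"
  shows "set_integrable lebesgue U (\<lambda>x. f x * \<psi> x)"
proof -
  obtain C where C: "0 \<le> C" "\<And>x. \<bar>\<psi> x\<bar> \<le> C"
    using continuous_compact_support_bounded[OF K(1) \<psi>] by metis
  have i: "integrable lebesgue (\<lambda>x. indicator K x *\<^sub>R f x)"
    using f K by (simp add: locally_integrable_def set_integrable_def)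
  have m: "\<psi> \<in> borel_measurable lebesgue"
    using borel_measurable_continuous_onI[OF \<psi>(1)] by (intro measurable_completion) simp
  have "integrable lebesgue (\<lambda>x. (indicator K x *\<^sub>R f x) * \<psi> x)"
  proof (rule Bochner_Integration.integrable_bound)
    show "integrable lebesgue (\<lambda>x. C * (indicator K x *\<^sub>R f x))" using i by (rule integrable_mult_right)
    show "(\<lambda>x. (indicator K x *\<^sub>R f x) * \<psi> x) \<in> borel_measurable lebesgue"
      using borel_measurable_integrable[OF i] m by (rule borel_measurable_times)
    have "norm ((indicator K x *\<^sub>R f x) * \<psi> x) \<le> norm (C * (indicator K x *\<^sub>R f x))" for x
    proof -
      have "norm ((indicator K x *\<^sub>R f x) * \<psi> x) = \<bar>indicator K x *\<^sub>R f x\<bar> * \<bar>\<psi> x\<bar>" by (simp add: abs_mult)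
      also have "\<dots> \<le> \<bar>indicator K x *\<^sub>R f x\<bar> * C" using C by (intro mult_left_mono) auto
      finally show ?thesis using C(1) by (simp add: abs_mult mult.commute)
    qed
    then show "AE x in lebesgue. norm ((indicator K x *\<^sub>R f x) * \<psi> x) \<le> norm (C * (indicator K x *\<^sub>R f x))"
      by (rule AE_I2)
  qed
  moreover have "(\<lambda>x. (indicator K x *\<^sub>R f x) * \<psi> x) = (\<lambda>x. indicator U x *\<^sub>R (f x * \<psi> x))"
  proof
    fix x show "(indicator K x *\<^sub>R f x) * \<psi> x = indicator U x *\<^sub>R (f x * \<psi> x)"
      using \<psi>(2)[of x] K(2) by (cases "x \<in> K") (auto simp: indicator_def)
  qed
  ultimately show ?thesis by (simp add: set_integrable_def)
qed

lemma locally_integrable_bounded_linear: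
  fixes L :: "'b::euclidean_space \<Rightarrow> 'c::euclidean_space"
  assumes "locally_integrable U f" "bounded_linear L"
  shows "locally_integrable U (\<lambda>x. L (f x))"
  unfolding locally_integrable_def
proof (intro allI impI)
  fix K assume "compact K \<and> K \<subseteq> U"
  then have "integrable lebesgue (\<lambda>x. indicator K x *\<^sub>R f x)"
    using assms(1) by (simp add: locally_integrable_def set_integrable_def)
  then have "integrable lebesgue (\<lambda>x. L (indicator K x *\<^sub>R f x))"
    by (rule integrable_bounded_linear[OF assms(2)])
  then show "set_integrable lebesgue K (\<lambda>x. L (f x))"
    by (simp add: set_integrable_def linear_cmul[OF bounded_linear.linear[OF assms(2)]])
qed

lemma weak_jacobian_entry_integrable:
  assumes "locally_integrable U D" "test_function U \<phi>"
  shows "set_integrable lebesgue U (\<lambda>x. D x $ i $ j * \<phi> x)"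
proof (rule set_integrable_mult_compact_support)
  show "locally_integrable U (\<lambda>x. D x $ i $ j)"
    using assms(1) by (rule locally_integrable_bounded_linear)
      (intro bounded_linear_compose[OF bounded_linear_vec_nth bounded_linear_vec_nth])
  show "compact (closure {x. \<phi> x \<noteq> 0})" "closure {x. \<phi> x \<noteq> 0} \<subseteq> U"
    using assms(2) by (simp_all add: test_function_def)
  show "continuous_on UNIV \<phi>" by (rule test_function_continuous[OF assms(2)])
  show "\<phi> x = 0" if "x \<notin> closure {x. \<phi> x \<noteq> 0}" for x
    by (rule test_function_0_outside[OF assms(2) that])
qed

text \<open>The definition tests coordinate directions only; expanding \<open>h\<close> in the basis
  gives every direction, as needed for increments of \<open>u\<close> along a segment.\<close>

lemma weak_jacobian_directional:
  fixes u :: "real^'n \<Rightarrow> real^'m"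
  assumes w: "has_weak_jacobian U u D" and \<phi>: "test_function U \<phi>"
  shows "(LINT x:U|lebesgue. u x $ i * frechet_derivative \<phi> (at x) h) =
    - (LINT x:U|lebesgue. (D x *v h) $ i * \<phi> x)"
    "set_integrable lebesgue U (\<lambda>x. (D x *v h) $ i * \<phi> x)"
proof -
  let ?d = "\<lambda>j x. frechet_derivative \<phi> (at x) (axis j 1)"
  have li: "locally_integrable U u" "locally_integrable U D" using w by (auto simp: has_weak_jacobian_def)
  have K: "compact (closure {x. \<phi> x \<noteq> 0})" "closure {x. \<phi> x \<noteq> 0} \<subseteq> U"
    using \<phi> by (simp_all add: test_function_def)
  have i1: "set_integrable lebesgue U (\<lambda>x. u x $ i * ?d j x)" for j
  proof (rule set_integrable_mult_compact_support[OF _ K])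
    show "locally_integrable U (\<lambda>x. u x $ i)"
      using li(1) by (rule locally_integrable_bounded_linear) (rule bounded_linear_vec_nth)
    show "continuous_on UNIV (?d j)" by (rule test_function_derivative(2)[OF \<phi>]) simp
    show "?d j x = 0" if "x \<notin> closure {x. \<phi> x \<noteq> 0}" for x
      using has_derivative_0_outside[OF compact_imp_closed[OF K(1)] test_function_0_outside[OF \<phi>]
        test_function_derivative(1)[OF \<phi>] that] by simp
  qed
  have i2: "set_integrable lebesgue U (\<lambda>x. D x $ i $ j * \<phi> x)" for j
    by (rule weak_jacobian_entry_integrable[OF li(2) \<phi>])
  have eq1: "u x $ i * frechet_derivative \<phi> (at x) h = (\<Sum>j\<in>UNIV. h $ j * (u x $ i * ?d j x))" for x
  proof -
    have lin: "linear (frechet_derivative \<phi> (at x))"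
      using test_function_derivative(1)[OF \<phi>] by (rule has_derivative_linear)
    have "h = (\<Sum>j\<in>UNIV. h $ j *\<^sub>R axis j 1)"
      by (simp add: basis_expansion[symmetric] scalar_mult_eq_scaleR[symmetric])
    then have "frechet_derivative \<phi> (at x) h = frechet_derivative \<phi> (at x) (\<Sum>j\<in>UNIV. h $ j *\<^sub>R axis j 1)"
      by simp
    also have "\<dots> = (\<Sum>j\<in>UNIV. h $ j * ?d j x)"
      by (simp add: linear_sum[OF lin] linear_cmul[OF lin])
    finally show ?thesis by (simp add: sum_distrib_left mult_ac)
  qed
  have eq2: "(D x *v h) $ i * \<phi> x = (\<Sum>j\<in>UNIV. h $ j * (D x $ i $ j * \<phi> x))" for x
    by (simp add: matrix_vector_mult_def sum_distrib_left sum_distrib_right mult_ac)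
  have s1: "set_integrable lebesgue U (\<lambda>x. h $ j * (u x $ i * ?d j x))"
    "set_integrable lebesgue U (\<lambda>x. h $ j * (D x $ i $ j * \<phi> x))" for j
    using i1 i2 by (auto intro!: set_integrable_mult_right)
  have fs: "(LINT x:U|lebesgue. (\<Sum>j\<in>UNIV. g j x)) = (\<Sum>j\<in>UNIV. LINT x:U|lebesgue. g j x)"
    if "\<And>j. set_integrable lebesgue U (g j)" for g :: "'n \<Rightarrow> real^'n \<Rightarrow> real"
    using that unfolding set_lebesgue_integral_def scaleR_sum_right set_integrable_def
    by (rule Bochner_Integration.integral_sum)
  have "(LINT x:U|lebesgue. u x $ i * frechet_derivative \<phi> (at x) h) =
    (\<Sum>j\<in>UNIV. LINT x:U|lebesgue. h $ j * (u x $ i * ?d j x))"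
    unfolding eq1 by (rule fs[OF s1(1)])
  also have "\<dots> = (\<Sum>j\<in>UNIV. h $ j * (LINT x:U|lebesgue. u x $ i * ?d j x))"
    by (intro sum.cong refl set_integral_mult_right)
  also have "\<dots> = (\<Sum>j\<in>UNIV. h $ j * - (LINT x:U|lebesgue. D x $ i $ j * \<phi> x))"
    using w \<phi> unfolding has_weak_jacobian_def by simp
  also have "\<dots> = - (\<Sum>j\<in>UNIV. h $ j * (LINT x:U|lebesgue. D x $ i $ j * \<phi> x))"
    by (simp add: sum_negf)
  also have "(\<Sum>j\<in>UNIV. h $ j * (LINT x:U|lebesgue. D x $ i $ j * \<phi> x)) =
    (\<Sum>j\<in>UNIV. LINT x:U|lebesgue. h $ j * (D x $ i $ j * \<phi> x))"
    by (intro sum.cong refl set_integral_mult_right[symmetric])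
  also have "\<dots> = (LINT x:U|lebesgue. (D x *v h) $ i * \<phi> x)"
    unfolding eq2 by (rule fs[OF s1(2), symmetric])
  finally show "(LINT x:U|lebesgue. u x $ i * frechet_derivative \<phi> (at x) h) =
    - (LINT x:U|lebesgue. (D x *v h) $ i * \<phi> x)" .
  show "set_integrable lebesgue U (\<lambda>x. (D x *v h) $ i * \<phi> x)"
    unfolding eq2 set_integrable_def scaleR_sum_right
    using s1(2) by (intro Bochner_Integration.integrable_sum) (simp add: set_integrable_def)
qed

lemma bump_algebra_power: "bump_algebra f \<Longrightarrow> bump_algebra (\<lambda>x. f x ^ n)"
proof (induction n)
  case 0
  show ?case using bump_algebra.const[of 1] by simp
next
  case (Suc n)
  then show ?case using bump_algebra.mult by fastforce
qed

text \<open>The test functions \<open>1 - (1 - \<beta>)^n\<close>, with \<open>\<beta>\<close> a box bump, increase to the indicator of the box.\<close>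

lemma integral_cube_eq_0:
  fixes f :: "'a::euclidean_space \<Rightarrow> real"
  assumes f: "locally_integrable U f"
    and 0: "\<And>\<phi>. test_function U \<phi> \<Longrightarrow> (LINT x:U|lebesgue. f x * \<phi> x) = 0"
    and r: "0 < r" "cbox (a - r *\<^sub>R One) (a + r *\<^sub>R One) \<subseteq> U"
  shows "integral (cbox (a - r *\<^sub>R One) (a + r *\<^sub>R One)) f = 0"
proof -
  let ?K = "cbox (a - r *\<^sub>R One) (a + r *\<^sub>R One)" and ?B = "box (a - r *\<^sub>R One) (a + r *\<^sub>R One)"
  define \<phi> where "\<phi> n x = 1 - (1 - box_bump a r x) ^ Suc n" for n x
  have out: "\<phi> n x = 0" if "x \<notin> ?B" for n x
    using box_bump_eq_0[OF r(1) that] by (simp add: \<phi>_def)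
  have ran: "0 \<le> \<phi> n x" "\<phi> n x \<le> 1" for n x
    using box_bump_nonneg[of a r x] box_bump_le_1[of a r x]
    by (auto simp: \<phi>_def intro!: power_le_one mult_le_one mult_nonneg_nonneg)
  have lim: "(\<lambda>n. \<phi> n x) \<longlonglongrightarrow> indicator ?B x" for x
  proof (cases "x \<in> ?B")
    case True
    then have "0 < box_bump a r x" using box_bump_pos_iff[OF r(1), of a x] by simp
    then have "(\<lambda>n. (1 - box_bump a r x) ^ Suc n) \<longlonglongrightarrow> 0"
      using box_bump_le_1[of a r x] by (intro LIMSEQ_Suc LIMSEQ_power_zero) auto
    then have "(\<lambda>n. \<phi> n x) \<longlonglongrightarrow> 1 - 0" unfolding \<phi>_def by (intro tendsto_diff tendsto_const)
    with True show ?thesis by simp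
  qed (simp add: out)
  have test: "test_function U (\<phi> n)" for n
  proof -
    have "bump_algebra (\<lambda>x. 1 + (-1) * (1 + (-1) * box_bump a r x) ^ Suc n)"
      by (intro bump_algebra.intros bump_algebra_power bump_algebra_box_bump)
    moreover have "(\<lambda>x. 1 + (-1) * (1 + (-1) * box_bump a r x) ^ Suc n) = \<phi> n"
      by (auto simp: \<phi>_def)
    ultimately have alg: "bump_algebra (\<phi> n)" by simp
    have "{x. \<phi> n x \<noteq> 0} \<subseteq> ?K" using out box_subset_cbox by blast
    then have cl: "closure {x. \<phi> n x \<noteq> 0} \<subseteq> ?K" by (rule closure_minimal[OF _ closed_cbox])
    then have "bounded (closure {x. \<phi> n x \<noteq> 0})" using bounded_cbox bounded_subset by blast
    then have "compact (closure {x. \<phi> n x \<noteq> 0})" by (simp add: compact_eq_bounded_closed)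
    with alg cl r(2) show ?thesis
      unfolding test_function_def using bump_algebra_continuously_differentiable by blast
  qed
  have fi: "integrable lebesgue (\<lambda>x. indicator ?K x *\<^sub>R f x)"
    using f r(2) unfolding locally_integrable_def set_integrable_def by (meson compact_cbox)
  have \<phi>m: "\<phi> n \<in> borel_measurable lebesgue" for n
    using borel_measurable_continuous_onI[OF test_function_continuous[OF test]]
    by (intro measurable_completion) simp
  have "(\<lambda>n. integral\<^sup>L lebesgue (\<lambda>x. (indicator ?K x *\<^sub>R f x) * \<phi> n x)) \<longlonglongrightarrow>
    integral\<^sup>L lebesgue (\<lambda>x. (indicator ?K x *\<^sub>R f x) * indicator ?B x)"
  proof (rule integral_dominated_convergence[where w = "\<lambda>x. \<bar>indicator ?K x *\<^sub>R f x\<bar>"])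
    show "(\<lambda>x. (indicator ?K x *\<^sub>R f x) * indicator ?B x) \<in> borel_measurable lebesgue"
      by (intro borel_measurable_times borel_measurable_integrable[OF fi] borel_measurable_indicator) simp
    show "(\<lambda>x. (indicator ?K x *\<^sub>R f x) * \<phi> n x) \<in> borel_measurable lebesgue" for n
      by (intro borel_measurable_times borel_measurable_integrable[OF fi] \<phi>m)
    show "integrable lebesgue (\<lambda>x. \<bar>indicator ?K x *\<^sub>R f x\<bar>)" using fi by (rule integrable_abs)
    show "AE x in lebesgue. (\<lambda>n. (indicator ?K x *\<^sub>R f x) * \<phi> n x) \<longlonglongrightarrow> (indicator ?K x *\<^sub>R f x) * indicator ?B x"
      by (intro AE_I2 tendsto_mult tendsto_const lim)
    show "AE x in lebesgue. norm ((indicator ?K x *\<^sub>R f x) * \<phi> n x) \<le> \<bar>indicator ?K x *\<^sub>R f x\<bar>" for n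
    proof (rule AE_I2)
      fix x
      have "\<bar>indicator ?K x *\<^sub>R f x\<bar> * \<bar>\<phi> n x\<bar> \<le> \<bar>indicator ?K x *\<^sub>R f x\<bar> * 1"
        using ran[of n x] by (intro mult_left_mono) auto
      then show "norm ((indicator ?K x *\<^sub>R f x) * \<phi> n x) \<le> \<bar>indicator ?K x *\<^sub>R f x\<bar>"
        by (simp add: abs_mult)
    qed
  qed
  moreover have "integral\<^sup>L lebesgue (\<lambda>x. (indicator ?K x *\<^sub>R f x) * \<phi> n x) = 0" for n
  proof -
    have "(\<lambda>x. (indicator ?K x *\<^sub>R f x) * \<phi> n x) = (\<lambda>x. indicator U x *\<^sub>R (f x * \<phi> n x))"
    proof
      fix x show "(indicator ?K x *\<^sub>R f x) * \<phi> n x = indicator U x *\<^sub>R (f x * \<phi> n x)"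
      proof (cases "x \<in> ?B")
        case True
        then have "x \<in> ?K" "x \<in> U" using r(2) box_subset_cbox by blast+
        then show ?thesis by simp
      qed (simp add: out)
    qed
    then show ?thesis using 0[OF test[of n]] by (simp add: set_lebesgue_integral_def)
  qed
  ultimately have "integral\<^sup>L lebesgue (\<lambda>x. (indicator ?K x *\<^sub>R f x) * indicator ?B x) = 0"
    by (simp add: LIMSEQ_const_iff)
  moreover have "(\<lambda>x. (indicator ?K x *\<^sub>R f x) * indicator ?B x) = (\<lambda>x. indicator ?B x *\<^sub>R f x)"
    using box_subset_cbox by (fastforce simp: indicator_def)
  ultimately have "(LINT x:?B|lebesgue. f x) = 0" by (simp add: set_lebesgue_integral_def)
  moreover have "set_integrable lebesgue ?B f"
  proof (rule set_integrable_subset)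
    show "set_integrable lebesgue ?K f" using fi by (simp add: set_integrable_def)
  qed (use box_subset_cbox in auto)
  ultimately have "integral ?B f = 0" by (simp add: set_lebesgue_integral_eq_integral(2))
  then show ?thesis by (simp add: integral_open_interval)
qed

text \<open>Integrals over all cubes inside \<open>U\<close> vanish, while for almost every
  \<open>x\<close> the means over shrinking cubes with a corner at \<open>x\<close> converge to the
  value at \<open>x\<close>. Countably many boxes exhaust \<open>U\<close>.\<close>

lemma AE_0_of_test_functions:
  fixes f :: "'a::euclidean_space \<Rightarrow> real"
  assumes U: "open U" and f: "locally_integrable U f"
    and 0: "\<And>\<phi>. test_function U \<phi> \<Longrightarrow> (LINT x:U|lebesgue. f x * \<phi> x) = 0"
  shows "AE x in lebesgue. x \<in> U \<longrightarrow> f x = 0"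
proof -
  obtain \<D> where \<D>: "countable \<D>" "\<D> \<subseteq> Pow U" "\<And>X. X \<in> \<D> \<Longrightarrow> \<exists>a b. X = cbox a b" "\<Union>\<D> = U"
    using open_countable_Union_open_cbox[OF U] by metis
  have "AE x in lebesgue. x \<in> X \<longrightarrow> f x = 0" if X: "X \<in> \<D>" for X
  proof -
    obtain a b where Xab: "X = cbox a b" using \<D>(3)[OF X] by blast
    have XU: "cbox a b \<subseteq> U" using X \<D>(2) Xab by blast
    have fX: "set_integrable lebesgue X f"
      using f XU unfolding locally_integrable_def Xab by (meson compact_cbox)
    \<comment> \<open>The differentiation theorem asks for integrability over all boxes, so
      \<open>f\<close> is cut off outside the piece \<open>X\<close>.\<close>
    define g where "g x = indicator X x *\<^sub>R f x" for x
    have gi: "integrable lebesgue g" using fX by (simp add: g_def[abs_def] set_integrable_def)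
    have gint: "g integrable_on cbox c d" for c d
    proof -
      have "set_integrable lebesgue UNIV g" using gi by (simp add: set_integrable_def)
      then have "set_integrable lebesgue (cbox c d) g" by (rule set_integrable_subset) auto
      then show ?thesis by (rule set_lebesgue_integral_eq_integral(1))
    qed
    obtain N where N: "negligible N" "\<And>x e. \<lbrakk>x \<notin> N; 0 < e\<rbrakk> \<Longrightarrow>
      \<exists>d>0. \<forall>h. 0 < h \<and> h < d \<longrightarrow> norm (integral (cbox x (x + h *\<^sub>R One)) g /\<^sub>R h ^ DIM('a) - g x) < e"
      using integrable_ccontinuous_explicit[of g, OF gint] by blast
    have "f x = 0" if x: "x \<in> box a b" "x \<notin> N" for x
    proof -
      have xX: "x \<in> X" using x(1) box_subset_cbox[of a b] Xab by blast
      have "\<bar>g x\<bar> \<le> e" if e: "0 < e" for e :: real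
      proof -
        obtain \<delta> where \<delta>: "0 < \<delta>" "ball x \<delta> \<subseteq> box a b" using openE[OF open_box x(1)] by blast
        obtain d where d: "0 < d" "\<And>h. 0 < h \<Longrightarrow> h < d \<Longrightarrow> norm (integral (cbox x (x + h *\<^sub>R One)) g /\<^sub>R h ^ DIM('a) - g x) < e"
          using N(2)[OF x(2) e] by blast
        \<comment> \<open>A cube of side \<open>h\<close> with a corner at \<open>x\<close> has
          diameter at most \<open>h * DIM('a)\<close>, hence stays within distance \<delta> of
          \<open>x\<close>.\<close>
        define h where "h = min (d / 2) (\<delta> / (2 * real DIM('a)))"
        have h: "0 < h" "h < d" "h * real DIM('a) < \<delta>"
          using d(1) \<delta>(1) by (auto simp: h_def min_less_iff_disj field_simps min_def)
        have sub: "cbox x (x + h *\<^sub>R One) \<subseteq> X"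
        proof
          fix y assume y: "y \<in> cbox x (x + h *\<^sub>R One)"
          have "norm (y - x) \<le> (\<Sum>i\<in>Basis. \<bar>(y - x) \<bullet> i\<bar>)" by (rule norm_le_l1)
          also have "\<dots> \<le> (\<Sum>i\<in>(Basis :: 'a set). h)"
            using y by (intro sum_mono) (auto simp: mem_box inner_diff_left inner_add_left)
          also have "\<dots> < \<delta>" using h(3) by (simp add: mult.commute)
          finally have "y \<in> ball x \<delta>" by (simp add: dist_norm norm_minus_commute)
          then show "y \<in> X" using \<delta>(2) box_subset_cbox[of a b] Xab by blast
        qed
        \<comment> \<open>The cube with corner \<open>x\<close> and side \<open>h\<close>, rewritten
          in terms of its centre and half side.\<close>
        have eq: "x + (h / 2) *\<^sub>R One - (h / 2) *\<^sub>R One = x" "x + (h / 2) *\<^sub>R One + (h / 2) *\<^sub>R One = x + h *\<^sub>R (One :: 'a)"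
          by (simp_all add: add.assoc scaleR_add_left[symmetric])
        have "integral (cbox x (x + h *\<^sub>R One)) g = integral (cbox x (x + h *\<^sub>R One)) f"
          using sub by (intro Henstock_Kurzweil_Integration.integral_cong) (auto simp: g_def)
        also have "\<dots> = 0"
          using integral_cube_eq_0[OF f 0, of "h / 2" "x + (h / 2) *\<^sub>R One"] h(1) sub XU unfolding eq Xab by simp
        finally show ?thesis using d(2)[OF h(1,2)] by simp
      qed
      then have "\<bar>g x\<bar> \<le> 0" by (rule field_le_epsilon[of _ 0, simplified])
      then show ?thesis using xX by (simp add: g_def)
    qed
    then have "{x. \<not> (x \<in> X \<longrightarrow> f x = 0)} \<subseteq> N \<union> (cbox a b - box a b)" using Xab by blast
    moreover have "negligible (N \<union> (cbox a b - box a b))"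
      using N(1) negligible_frontier_interval by (rule negligible_Un)
    ultimately show ?thesis unfolding negligible_iff_null_sets by (intro AE_I') auto
  qed
  then have "AE x in lebesgue. \<forall>X\<in>\<D>. x \<in> X \<longrightarrow> f x = 0"
    by (intro AE_ball_countable[OF \<D>(1), THEN iffD2] ballI)
  then show ?thesis
  proof (rule AE_mp, intro AE_I2 impI)
    fix x assume "\<forall>X\<in>\<D>. x \<in> X \<longrightarrow> f x = 0" "x \<in> U"
    then show "f x = 0" using \<D>(4) by blast
  qed
qed

text \<open>The theorem speaks of an arbitrary version \<open>Du\<close>, whereas the
  differentiability argument needs a bounded measurable one. Each entry of the difference
  annihilates all test functions, so the two agree almost everywhere.\<close>

lemma weak_jacobian_unique:
  fixes u :: "real^'n \<Rightarrow> real^'m"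
  assumes U: "open U" and D: "has_weak_jacobian U u D" and E: "has_weak_jacobian U u E"
  shows "AE x in lebesgue. x \<in> U \<longrightarrow> D x = E x"
proof -
  have li: "locally_integrable U D" "locally_integrable U E" using D E by (auto simp: has_weak_jacobian_def)
  have bl: "bounded_linear (\<lambda>A::real^'n^'m. A $ i $ j)" for i j
    by (rule bounded_linear_compose[OF bounded_linear_vec_nth bounded_linear_vec_nth])
  have "AE x in lebesgue. x \<in> U \<longrightarrow> D x $ i $ j - E x $ i $ j = 0" for i j
  proof (rule AE_0_of_test_functions[OF U])
    show "locally_integrable U (\<lambda>x. D x $ i $ j - E x $ i $ j)"
      unfolding locally_integrable_def
    proof (intro allI impI)
      fix K assume K: "compact K \<and> K \<subseteq> U"
      have "set_integrable lebesgue K (\<lambda>x. D x $ i $ j)" "set_integrable lebesgue K (\<lambda>x. E x $ i $ j)"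
        using locally_integrable_bounded_linear[OF li(1) bl, of i j] locally_integrable_bounded_linear[OF li(2) bl, of i j] K
        unfolding locally_integrable_def by blast+
      then show "set_integrable lebesgue K (\<lambda>x. D x $ i $ j - E x $ i $ j)" by (rule set_integral_diff(1))
    qed
    fix \<phi> :: "real^'n \<Rightarrow> real" assume \<phi>: "test_function U \<phi>"
    have "- (LINT x:U|lebesgue. D x $ i $ j * \<phi> x) = - (LINT x:U|lebesgue. E x $ i $ j * \<phi> x)"
    proof -
      have "(LINT x:U|lebesgue. u x $ i * frechet_derivative \<phi> (at x) (axis j 1)) = - (LINT x:U|lebesgue. D x $ i $ j * \<phi> x)"
        "(LINT x:U|lebesgue. u x $ i * frechet_derivative \<phi> (at x) (axis j 1)) = - (LINT x:U|lebesgue. E x $ i $ j * \<phi> x)"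
        using D E \<phi> unfolding has_weak_jacobian_def by blast+
      then show ?thesis by simp
    qed
    then show "(LINT x:U|lebesgue. (D x $ i $ j - E x $ i $ j) * \<phi> x) = 0"
      using set_integral_diff(2)[OF weak_jacobian_entry_integrable[OF li(1) \<phi>, of i j] weak_jacobian_entry_integrable[OF li(2) \<phi>, of i j]]
      by (simp add: left_diff_distrib)
  qed
  then have "AE x in lebesgue. \<forall>i j. x \<in> U \<longrightarrow> D x $ i $ j - E x $ i $ j = 0"
    unfolding AE_all_countable by blast
  then show ?thesis
  proof (rule AE_mp, intro AE_I2 impI)
    fix x assume "\<forall>i j. x \<in> U \<longrightarrow> D x $ i $ j - E x $ i $ j = 0" "x \<in> U"
    then show "D x = E x" by (simp add: vec_eq_iff)
  qed
qed

section \<open>Averages of a Sobolev map against moving kernels\<close>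

lemma lborel_integral_shift:
  fixes f :: "'a::euclidean_space \<Rightarrow> 'b::{banach, second_countable_topology}"
  assumes "f \<in> borel_measurable borel"
  shows "integral\<^sup>L lborel (\<lambda>x. f (v + x)) = integral\<^sup>L lborel f"
proof -
  have "integral\<^sup>L (distr lborel borel ((+) v)) f = integral\<^sup>L lborel (\<lambda>x. f (v + x))"
    by (rule integral_distr) (use assms in auto)
  then show ?thesis unfolding lborel_distr_plus by (rule sym)
qed

text \<open>Kernels are left unnormalised, so their total mass stays as a factor on both sides of
  the estimates. It depends on the type only through the dimension.\<close>

definition bump_mass :: "'a::euclidean_space itself \<Rightarrow> real \<Rightarrow> real" where
  "bump_mass _ r = integral\<^sup>L lborel (box_bump (0::'a) r)"

lemma box_bump_measurable [measurable]: "box_bump a r \<in> borel_measurable borel"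
  by (rule borel_measurable_continuous_onI[OF continuous_box_bump])

lemma box_bump_integrable:
  fixes a :: "'a::euclidean_space"
  assumes "0 < r" shows "integrable lborel (box_bump a r)"
proof (rule continuous_compact_support_integrable[OF compact_cbox continuous_box_bump])
  fix x assume "x \<notin> cbox (a - r *\<^sub>R One) (a + r *\<^sub>R One)"
  then show "box_bump a r x = 0"
    using box_subset_cbox[of "a - r *\<^sub>R One" "a + r *\<^sub>R One"] by (intro box_bump_eq_0 assms) auto
qed

lemma box_bump_set_integral:
  fixes a :: "'a::euclidean_space"
  assumes r: "0 < r" and sub: "cbox (a - r *\<^sub>R One) (a + r *\<^sub>R One) \<subseteq> cbox c d"
  shows "set_integrable lebesgue (cbox c d) (box_bump a r)"
    and "(LINT w:cbox c d|lebesgue. box_bump a r w) = bump_mass TYPE('a) r"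
proof -
  have eq: "(\<lambda>w. indicator (cbox c d) w *\<^sub>R box_bump a r w) = box_bump a r"
  proof
    fix w show "indicator (cbox c d) w *\<^sub>R box_bump a r w = box_bump a r w"
      using box_bump_eq_0[OF r, of w a] sub box_subset_cbox[of "a - r *\<^sub>R One" "a + r *\<^sub>R One"]
      by (cases "w \<in> cbox c d") auto
  qed
  have "integrable lebesgue (box_bump a r)"
    using box_bump_integrable[OF r] by (subst integrable_completion) auto
  then show "set_integrable lebesgue (cbox c d) (box_bump a r)" by (simp only: set_integrable_def eq)
  have "(LINT w:cbox c d|lebesgue. box_bump a r w) = integral\<^sup>L lborel (box_bump a r)"
    unfolding set_lebesgue_integral_def eq by (rule integral_completion) simp
  also have "\<dots> = integral\<^sup>L lborel (\<lambda>w. box_bump a r (a + w))" by (rule lborel_integral_shift[symmetric]) simp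
  also have "(\<lambda>w. box_bump a r (a + w)) = box_bump 0 r" by (simp add: box_bump_def[abs_def])
  finally show "(LINT w:cbox c d|lebesgue. box_bump a r w) = bump_mass TYPE('a) r"
    by (simp add: bump_mass_def)
qed

text \<open>On the concentric cube of half the size each factor of the kernel is at least
  \<open>bump 0 (1/2)\<close>, and that cube has volume \<open>r ^ DIM('a)\<close>. The bound allows
  errors of the order of \<open>r ^ DIM('a)\<close> to be absorbed into the mass.\<close>

lemma bump_mass_lower:
  obtains \<kappa> where "0 < \<kappa>" "\<And>r. 0 < r \<Longrightarrow> \<kappa> * r ^ DIM('a) \<le> bump_mass TYPE('a::euclidean_space) r"
proof -
  define \<kappa> where "\<kappa> = (bump 0 (1/2) * bump 0 (1/2)) ^ DIM('a)"
  have \<kappa>: "0 < \<kappa>" by (simp add: \<kappa>_def bump_def)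
  have mono: "bump 0 (1/2) \<le> bump 0 t" if "1/2 \<le> t" for t
    using that by (simp add: bump_def field_simps)
  show thesis
  proof (rule that[OF \<kappa>])
    fix r :: real assume r: "0 < r"
    let ?Q = "cbox (- (r/2) *\<^sub>R One) ((r/2) *\<^sub>R One) :: 'a set"
    have "\<kappa> * indicator ?Q x \<le> box_bump 0 r x" for x :: 'a
    proof (cases "x \<in> ?Q")
      case True
      have "\<kappa> = (\<Prod>b\<in>(Basis::'a set). bump 0 (1/2) * bump 0 (1/2))" by (simp add: \<kappa>_def)
      also have "\<dots> \<le> box_bump 0 r x"
        unfolding box_bump_def
      proof (rule prod_mono)
        fix b :: 'a assume b: "b \<in> Basis"
        have "- (r/2) \<le> x \<bullet> b" "x \<bullet> b \<le> r/2" using True b by (auto simp: mem_box)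
        then have "1/2 \<le> 1 - (x - 0) \<bullet> b / r" "1/2 \<le> 1 + (x - 0) \<bullet> b / r" using r by (auto simp: field_simps)
        then show "0 \<le> bump 0 (1/2) * bump 0 (1/2) \<and> bump 0 (1/2) * bump 0 (1/2) \<le>
          bump 0 (1 - (x - 0) \<bullet> b / r) * bump 0 (1 + (x - 0) \<bullet> b / r)"
          by (intro conjI mult_mono mult_nonneg_nonneg mono bump_nonneg)
      qed
      finally show ?thesis using True by simp
    qed (simp add: box_bump_nonneg)
    then have "integral\<^sup>L lborel (\<lambda>x. \<kappa> * indicator ?Q x) \<le> bump_mass TYPE('a) r"
      unfolding bump_mass_def using box_bump_integrable[OF r, of 0]
      by (intro integral_mono integrable_mult_right integrable_real_indicator emeasure_lborel_cbox_finite) auto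
    moreover have "measure lborel ?Q = r ^ DIM('a)"
      using r by (subst content_cbox) (auto simp: inner_simps)
    ultimately show "\<kappa> * r ^ DIM('a) \<le> bump_mass TYPE('a) r"
      by simp
  qed
qed

text \<open>As the centre travels from \<open>x\<close> to \<open>x + h\<close>, the average of
  \<open>u\<close> is a differentiable function of the parameter: the derivative falls on the
  kernel, and the weak Jacobian moves it back to \<open>u\<close>. The mean value theorem then picks
  one \<open>t\<close>. A fixed compact box as domain of integration justifies differentiating under
  the integral.\<close>

lemma mollified_increment:
  fixes u :: "real^'n \<Rightarrow> real^'m"
  assumes u: "continuous_on U u" and D: "has_weak_jacobian U u D" and ab: "cbox a b \<subseteq> U" and r: "0 < r"
    and sub: "\<And>t. 0 \<le> t \<Longrightarrow> t \<le> 1 \<Longrightarrow> cbox (x + t *\<^sub>R h - r *\<^sub>R One) (x + t *\<^sub>R h + r *\<^sub>R One) \<subseteq> cbox a b"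
  obtains t where "0 \<le> t" "t \<le> 1"
    "(LINT w:cbox a b|lebesgue. u w $ i * box_bump (x + h) r w) - (LINT w:cbox a b|lebesgue. u w $ i * box_bump x r w)
      = (LINT w:cbox a b|lebesgue. (D w *v h) $ i * box_bump (x + t *\<^sub>R h) r w)"
    "set_integrable lebesgue (cbox a b) (\<lambda>w. (D w *v h) $ i * box_bump (x + t *\<^sub>R h) r w)"
proof -
  obtain G :: "real^'n \<Rightarrow> real^'n \<Rightarrow> real" where G: "\<And>x. (box_bump 0 1 has_derivative G x) (at x)" "\<And>h. continuous_on UNIV (\<lambda>x. G x h)"
    using box_bump_derivative by metis
  define z where "z t w = (w - x - t *\<^sub>R h) /\<^sub>R r" for t w
  have bz: "box_bump (x + t *\<^sub>R h) r w = box_bump 0 1 (z t w)" for t w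
    by (subst box_bump_rescale) (simp add: z_def diff_diff_eq)
  \<comment> \<open>The argument \<open>z t w\<close> has velocity \<open>- h / r\<close>. This
    minus sign cancels the one in the definition of the weak Jacobian.\<close>
  define f where "f t w = u w $ i * box_bump 0 1 (z t w)" for t w
  define f' where "f' t w = u w $ i * G (z t w) (- (h /\<^sub>R r))" for t w
  have uc: "continuous_on (cbox a b) u" using u ab by (rule continuous_on_subset)

  have der: "((\<lambda>t. f t w) has_field_derivative f' t w) (at t within UNIV)" for t w
  proof -
    have "(z t w) = (w - x) /\<^sub>R r + t *\<^sub>R (- (h /\<^sub>R r))" for t w
      by (simp add: z_def algebra_simps)
    then have "((\<lambda>t. box_bump 0 1 (z t w)) has_real_derivative G (z t w) (- (h /\<^sub>R r))) (at t)"
      using DERIV_along_line[of "box_bump 0 1" "G (z t w)" "(w - x) /\<^sub>R r" t "- (h /\<^sub>R r)"] G(1) by simp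
    then show ?thesis unfolding f_def f'_def by (intro DERIV_cmult) simp
  qed
  have fc: "continuous_on (cbox a b) (f t)" for t
    unfolding f_def z_def
    by (intro continuous_intros uc continuous_on_compose2[OF continuous_box_bump[of UNIV]]) auto
  have f'c: "continuous_on (UNIV \<times> cbox a b) (\<lambda>(t, w). f' t w)"
    unfolding f'_def z_def split_beta
    by (intro continuous_intros continuous_on_compose2[OF uc] continuous_on_compose2[OF G(2)]) auto
  have "((\<lambda>t. integral (cbox a b) (f t)) has_field_derivative integral (cbox a b) (f' t)) (at t within UNIV)" for t
    by (rule leibniz_rule_field_derivative[OF der _ f'c])
      (auto intro: integrable_continuous fc)
  then have "\<exists>t>0. t < 1 \<and> integral (cbox a b) (f 1) - integral (cbox a b) (f 0) = (1 - 0) * integral (cbox a b) (f' t)"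
    by (intro MVT2) auto
  then obtain t where t: "0 < t" "t < 1" and inc: "integral (cbox a b) (f 1) - integral (cbox a b) (f 0) = integral (cbox a b) (f' t)"
    by auto
  have int_eq: "integral (cbox a b) g = (LINT w:cbox a b|lebesgue. g w)" if "continuous_on (cbox a b) g" for g :: "real^'n \<Rightarrow> real"
    by (rule set_lebesgue_integral_eq_integral(2)[symmetric], rule set_integrable_lebesgue_compact[OF compact_cbox that])
  let ?\<phi> = "box_bump (x + t *\<^sub>R h) r"
  have test: "test_function U ?\<phi>"
    using sub[of t] t ab by (intro test_function_box_bump r) auto
  have fd: "frechet_derivative ?\<phi> (at w) = (\<lambda>v. G (z t w) (v /\<^sub>R r))" for w
  proof -
    have "(z t has_derivative (\<lambda>v. v /\<^sub>R r)) (at w)"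
      unfolding z_def by (auto intro!: derivative_eq_intros)
    then have "((\<lambda>w. box_bump 0 1 (z t w)) has_derivative (\<lambda>v. G (z t w) (v /\<^sub>R r))) (at w)"
      using has_derivative_compose G(1) by blast
    then have "(?\<phi> has_derivative (\<lambda>v. G (z t w) (v /\<^sub>R r))) (at w)" unfolding bz[symmetric] .
    then show ?thesis by (rule frechet_derivative_at[symmetric])
  qed
  have f'eq: "f' t w = - (u w $ i * frechet_derivative ?\<phi> (at w) h)" for w
    using linear_neg[OF has_derivative_linear[OF G(1)]] by (simp add: f'_def fd)
  have out: "?\<phi> w = 0" "frechet_derivative ?\<phi> (at w) h = 0" if "w \<notin> cbox a b" for w
  proof -
    have z: "?\<phi> w = 0" if "w \<notin> cbox a b" for w
      using that sub[of t] t box_subset_cbox[of "x + t *\<^sub>R h - r *\<^sub>R One" "x + t *\<^sub>R h + r *\<^sub>R One"]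
      by (intro box_bump_eq_0 r) auto
    then show "?\<phi> w = 0" using that .
    show "frechet_derivative ?\<phi> (at w) h = 0"
      using has_derivative_0_outside[OF closed_cbox z test_function_derivative(1)[OF test] that] by simp
  qed
  have res: "(LINT w:cbox a b|lebesgue. g w) = (LINT w:U|lebesgue. g w)"
    "set_integrable lebesgue (cbox a b) g = set_integrable lebesgue U g"
    if "\<And>w. w \<notin> cbox a b \<Longrightarrow> g w = 0" for g :: "real^'n \<Rightarrow> real"
  proof -
    have "(\<lambda>w. indicator (cbox a b) w *\<^sub>R g w) = (\<lambda>w. indicator U w *\<^sub>R g w)"
    proof
      fix w show "indicator (cbox a b) w *\<^sub>R g w = indicator U w *\<^sub>R g w"
        using that[of w] ab by (cases "w \<in> cbox a b") auto
    qed
    then show "(LINT w:cbox a b|lebesgue. g w) = (LINT w:U|lebesgue. g w)"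
      "set_integrable lebesgue (cbox a b) g = set_integrable lebesgue U g"
      by (simp_all add: set_lebesgue_integral_def set_integrable_def)
  qed
  have f'ct: "continuous_on (cbox a b) (f' t)"
  proof -
    have "continuous_on (cbox a b) (\<lambda>w. case (t, w) of (t, w) \<Rightarrow> f' t w)"
      by (rule continuous_on_compose2[OF f'c]) (auto intro!: continuous_intros)
    then show ?thesis by simp
  qed
  have "integral (cbox a b) (f' t) = (LINT w:cbox a b|lebesgue. f' t w)" by (rule int_eq[OF f'ct])
  also have "\<dots> = - (LINT w:cbox a b|lebesgue. u w $ i * frechet_derivative ?\<phi> (at w) h)"
    unfolding f'eq by (simp add: set_lebesgue_integral_def)
  also have "\<dots> = - (LINT w:U|lebesgue. u w $ i * frechet_derivative ?\<phi> (at w) h)"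
    using res(1)[of "\<lambda>w. u w $ i * frechet_derivative ?\<phi> (at w) h"] out(2) by simp
  also have "\<dots> = (LINT w:U|lebesgue. (D w *v h) $ i * ?\<phi> w)"
    using weak_jacobian_directional(1)[OF D test, where i = i and h = h] by simp
  also have "\<dots> = (LINT w:cbox a b|lebesgue. (D w *v h) $ i * ?\<phi> w)"
    using res(1)[of "\<lambda>w. (D w *v h) $ i * ?\<phi> w"] out(1) by simp
  finally have rhs: "integral (cbox a b) (f' t) = (LINT w:cbox a b|lebesgue. (D w *v h) $ i * ?\<phi> w)" .
  have f1: "f 1 = (\<lambda>w. u w $ i * box_bump (x + h) r w)" and f0: "f 0 = (\<lambda>w. u w $ i * box_bump x r w)"
    using bz[of 1] bz[of 0] by (auto simp: f_def)
  show thesis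
  proof (rule that[of t])
    show "(LINT w:cbox a b|lebesgue. u w $ i * box_bump (x + h) r w) - (LINT w:cbox a b|lebesgue. u w $ i * box_bump x r w)
      = (LINT w:cbox a b|lebesgue. (D w *v h) $ i * ?\<phi> w)"
      using inc rhs int_eq[OF fc[of 1]] int_eq[OF fc[of 0]] by (simp add: f1 f0)
    show "set_integrable lebesgue (cbox a b) (\<lambda>w. (D w *v h) $ i * ?\<phi> w)"
      using weak_jacobian_directional(2)[OF D test, where i = i and h = h] res(2)[of "\<lambda>w. (D w *v h) $ i * ?\<phi> w"] out(1) by simp
  qed (use t in auto)
qed

lemma component_mult_le: "\<bar>((A :: real^'n^'m) *v h) $ i\<bar> \<le> norm A * norm h"
proof -
  have "\<bar>(A *v h) $ i\<bar> = \<bar>A $ i \<bullet> h\<bar>" by (simp add: matrix_vector_mul_component)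
  also have "\<dots> \<le> norm (A $ i) * norm h" by (rule Cauchy_Schwarz_ineq2)
  also have "\<dots> \<le> norm A * norm h" by (intro mult_right_mono Finite_Cartesian_Product.norm_nth_le) simp
  finally show ?thesis .
qed

text \<open>At both ends the average differs from the point value by at most \<omega> times the
  mass, and in between the average of \<open>D\<close> is compared with the constant matrix
  \<open>A\<close>. Taking \<open>A = 0\<close> gives a Lipschitz bound; taking
  \<open>A = D x\<close> gives differentiability at a Lebesgue point.\<close>

lemma increment_estimate:
  fixes u :: "real^'n \<Rightarrow> real^'m"
  assumes u: "continuous_on U u" and D: "has_weak_jacobian U u D" and ab: "cbox a b \<subseteq> U" and r: "0 < r"
    and sub: "\<And>t. 0 \<le> t \<Longrightarrow> t \<le> 1 \<Longrightarrow> cbox (x + t *\<^sub>R h - r *\<^sub>R One) (x + t *\<^sub>R h + r *\<^sub>R One) \<subseteq> cbox a b"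
    and osc: "\<And>w. w \<in> cbox (x - r *\<^sub>R One) (x + r *\<^sub>R One) \<Longrightarrow> \<bar>u w $ i - u x $ i\<bar> \<le> \<omega>"
      "\<And>w. w \<in> cbox (x + h - r *\<^sub>R One) (x + h + r *\<^sub>R One) \<Longrightarrow> \<bar>u w $ i - u (x + h) $ i\<bar> \<le> \<omega>"
    and B: "\<And>t. 0 \<le> t \<Longrightarrow> t \<le> 1 \<Longrightarrow> (LINT w:cbox a b|lebesgue. norm (D w - A) * box_bump (x + t *\<^sub>R h) r w) \<le> B"
  shows "bump_mass TYPE(real^'n) r * \<bar>u (x + h) $ i - u x $ i - (A *v h) $ i\<bar> \<le>
    2 * \<omega> * bump_mass TYPE(real^'n) r + norm h * B"
proof -
  let ?m = "bump_mass TYPE(real^'n) r"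
  let ?I = "\<lambda>f. LINT w:cbox a b|lebesgue. f w"
  obtain t where t: "0 \<le> t" "t \<le> 1"
    "?I (\<lambda>w. u w $ i * box_bump (x + h) r w) - ?I (\<lambda>w. u w $ i * box_bump x r w)
      = ?I (\<lambda>w. (D w *v h) $ i * box_bump (x + t *\<^sub>R h) r w)"
    "set_integrable lebesgue (cbox a b) (\<lambda>w. (D w *v h) $ i * box_bump (x + t *\<^sub>R h) r w)"
    by (rule mollified_increment[OF u D ab r sub])
  have uc: "continuous_on (cbox a b) u" using u ab by (rule continuous_on_subset)
  have end_est: "\<bar>?I (\<lambda>w. u w $ i * box_bump y r w) - u y $ i * ?m\<bar> \<le> \<omega> * ?m"
    if y: "cbox (y - r *\<^sub>R One) (y + r *\<^sub>R One) \<subseteq> cbox a b"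
      and o: "\<And>w. w \<in> cbox (y - r *\<^sub>R One) (y + r *\<^sub>R One) \<Longrightarrow> \<bar>u w $ i - u y $ i\<bar> \<le> \<omega>" for y
  proof -
    note bb = box_bump_set_integral[OF r y]
    have i1: "set_integrable lebesgue (cbox a b) (\<lambda>w. u w $ i * box_bump y r w)"
      by (intro set_integrable_lebesgue_compact compact_cbox continuous_intros uc continuous_box_bump)
    have i2: "set_integrable lebesgue (cbox a b) (\<lambda>w. u y $ i * box_bump y r w)"
      using bb(1) by (rule set_integrable_mult_right)
    have i3: "set_integrable lebesgue (cbox a b) (\<lambda>w. \<omega> * box_bump y r w)"
      using bb(1) by (rule set_integrable_mult_right)
    have "?I (\<lambda>w. u w $ i * box_bump y r w) - u y $ i * ?m = ?I (\<lambda>w. u w $ i * box_bump y r w - u y $ i * box_bump y r w)"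
      unfolding set_integral_diff(2)[OF i1 i2] set_integral_mult_right bb(2) ..
    also have "\<bar>\<dots>\<bar> \<le> ?I (\<lambda>w. \<omega> * box_bump y r w)"
      unfolding set_lebesgue_integral_def
    proof (rule Bochner_Integration.integral_abs_bound_integral)
      show "integrable lebesgue (\<lambda>w. indicator (cbox a b) w *\<^sub>R (u w $ i * box_bump y r w - u y $ i * box_bump y r w))"
        using set_integral_diff(1)[OF i1 i2] by (simp add: set_integrable_def)
      show "integrable lebesgue (\<lambda>w. indicator (cbox a b) w *\<^sub>R (\<omega> * box_bump y r w))"
        using i3 by (simp add: set_integrable_def)
      fix w
      have "\<bar>u w $ i - u y $ i\<bar> * box_bump y r w \<le> \<omega> * box_bump y r w"
      proof (cases "w \<in> cbox (y - r *\<^sub>R One) (y + r *\<^sub>R One)")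
        case True then show ?thesis by (intro mult_right_mono o box_bump_nonneg)
      next
        case False
        then have "box_bump y r w = 0"
          using box_subset_cbox[of "y - r *\<^sub>R One" "y + r *\<^sub>R One"] by (intro box_bump_eq_0 r) auto
        then show ?thesis by simp
      qed
      then have "\<bar>u w $ i * box_bump y r w - u y $ i * box_bump y r w\<bar> \<le> \<omega> * box_bump y r w"
        using box_bump_nonneg[of y r w] by (simp add: abs_mult left_diff_distrib[symmetric])
      then show "\<bar>indicator (cbox a b) w *\<^sub>R (u w $ i * box_bump y r w - u y $ i * box_bump y r w)\<bar>
        \<le> indicator (cbox a b) w *\<^sub>R (\<omega> * box_bump y r w)"
        by (simp add: indicator_def)
    qed
    also have "\<dots> = \<omega> * ?m" unfolding set_integral_mult_right bb(2) ..
    finally show ?thesis .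
  qed
  note e0 = end_est[OF _ osc(1)] and e1 = end_est[OF _ osc(2)]
  have s0: "cbox (x - r *\<^sub>R One) (x + r *\<^sub>R One) \<subseteq> cbox a b" and s1: "cbox (x + h - r *\<^sub>R One) (x + h + r *\<^sub>R One) \<subseteq> cbox a b"
    using sub[of 0] sub[of 1] by simp_all
  let ?\<phi> = "box_bump (x + t *\<^sub>R h) r"
  note bt = box_bump_set_integral[OF r sub[OF t(1,2)]]
  have j1: "set_integrable lebesgue (cbox a b) (\<lambda>w. (A *v h) $ i * ?\<phi> w)"
    using bt(1) by (rule set_integrable_mult_right)
  have DA: "set_integrable lebesgue (cbox a b) (\<lambda>w. norm (D w - A) * ?\<phi> w)"
  proof (rule set_integrable_subset)
    have "locally_integrable U (\<lambda>w. norm (D w - A))"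
      unfolding locally_integrable_def
    proof (intro allI impI)
      fix K assume K: "compact K \<and> K \<subseteq> U"
      then have "set_integrable lebesgue K D" using D by (simp add: has_weak_jacobian_def locally_integrable_def)
      then have "set_integrable lebesgue K (\<lambda>w. D w - A)"
        using K by (intro set_integral_diff(1)) (auto intro: set_integrable_lebesgue_compact)
      then have "integrable lebesgue (\<lambda>w. norm (indicator K w *\<^sub>R (D w - A)))"
        unfolding set_integrable_def by (rule integrable_norm)
      then show "set_integrable lebesgue K (\<lambda>w. norm (D w - A))" by (simp add: set_integrable_def)
    qed
    then show "set_integrable lebesgue U (\<lambda>w. norm (D w - A) * ?\<phi> w)"
    proof (rule set_integrable_mult_compact_support[OF _ compact_cbox ab continuous_box_bump])
      fix w assume "w \<notin> cbox a b"
      then show "?\<phi> w = 0"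
        using sub[OF t(1,2)] box_subset_cbox[of "x + t *\<^sub>R h - r *\<^sub>R One" "x + t *\<^sub>R h + r *\<^sub>R One"]
        by (intro box_bump_eq_0 r) auto
    qed
  qed (use ab in auto)
  have "?I (\<lambda>w. (D w *v h) $ i * ?\<phi> w) - (A *v h) $ i * ?m = ?I (\<lambda>w. (D w *v h) $ i * ?\<phi> w - (A *v h) $ i * ?\<phi> w)"
    unfolding set_integral_diff(2)[OF t(4) j1] set_integral_mult_right bt(2) ..
  also have "\<bar>\<dots>\<bar> \<le> ?I (\<lambda>w. norm h * (norm (D w - A) * ?\<phi> w))"
    unfolding set_lebesgue_integral_def
  proof (rule Bochner_Integration.integral_abs_bound_integral)
    show "integrable lebesgue (\<lambda>w. indicator (cbox a b) w *\<^sub>R ((D w *v h) $ i * ?\<phi> w - (A *v h) $ i * ?\<phi> w))"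
      using set_integral_diff(1)[OF t(4) j1] by (simp add: set_integrable_def)
    show "integrable lebesgue (\<lambda>w. indicator (cbox a b) w *\<^sub>R (norm h * (norm (D w - A) * ?\<phi> w)))"
      using set_integrable_mult_right[OF DA, of "norm h"] by (simp add: set_integrable_def)
    fix w
    have "\<bar>(D w *v h) $ i - (A *v h) $ i\<bar> \<le> norm (D w - A) * norm h"
      using component_mult_le[of "D w - A" h i] by (simp add: matrix_vector_mult_diff_rdistrib)
    then have "\<bar>(D w *v h) $ i - (A *v h) $ i\<bar> * ?\<phi> w \<le> norm (D w - A) * norm h * ?\<phi> w"
      by (rule mult_right_mono) (rule box_bump_nonneg)
    then have "\<bar>(D w *v h) $ i * ?\<phi> w - (A *v h) $ i * ?\<phi> w\<bar> \<le> norm h * (norm (D w - A) * ?\<phi> w)"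
      using box_bump_nonneg[of "x + t *\<^sub>R h" r w] by (simp add: abs_mult left_diff_distrib[symmetric] mult_ac)
    then show "\<bar>indicator (cbox a b) w *\<^sub>R ((D w *v h) $ i * ?\<phi> w - (A *v h) $ i * ?\<phi> w)\<bar>
        \<le> indicator (cbox a b) w *\<^sub>R (norm h * (norm (D w - A) * ?\<phi> w))"
      by (simp add: indicator_def)
  qed
  also have "\<dots> = norm h * ?I (\<lambda>w. norm (D w - A) * ?\<phi> w)" by (rule set_integral_mult_right)
  also have "\<dots> \<le> norm h * B" using B[OF t(1,2)] by (rule mult_left_mono) simp
  finally have mid: "\<bar>?I (\<lambda>w. (D w *v h) $ i * ?\<phi> w) - (A *v h) $ i * ?m\<bar> \<le> norm h * B" .
  have m0: "0 \<le> ?m" unfolding bump_mass_def by (simp add: box_bump_nonneg)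
  have "?m * \<bar>u (x + h) $ i - u x $ i - (A *v h) $ i\<bar> = \<bar>u (x + h) $ i * ?m - u x $ i * ?m - (A *v h) $ i * ?m\<bar>"
    using m0 by (simp add: abs_mult left_diff_distrib[symmetric])
  also have "\<dots> \<le> \<omega> * ?m + \<omega> * ?m + norm h * B"
    using e0[OF s0] e1[OF s1] mid t(3) by linarith
  finally show ?thesis by simp
qed

lemma cube_segment_subset:
  fixes x :: "'a::euclidean_space"
  assumes "cbox (x - r *\<^sub>R One) (x + r *\<^sub>R One) \<subseteq> cbox a b" "cbox (x + h - r *\<^sub>R One) (x + h + r *\<^sub>R One) \<subseteq> cbox a b"
    "0 < r" "0 \<le> t" "t \<le> 1"
  shows "cbox (x + t *\<^sub>R h - r *\<^sub>R One) (x + t *\<^sub>R h + r *\<^sub>R One) \<subseteq> cbox a b"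
proof (rule subset_box_imp(1), intro ballI)
  fix i :: 'a assume i: "i \<in> Basis"
  have "x - r *\<^sub>R One \<in> cbox a b" "x + r *\<^sub>R One \<in> cbox a b" "x + h - r *\<^sub>R One \<in> cbox a b" "x + h + r *\<^sub>R One \<in> cbox a b"
    by (intro subsetD[OF assms(1)] subsetD[OF assms(2)]; use assms(3) in \<open>simp add: mem_box inner_simps\<close>)+
  then have *: "a \<bullet> i \<le> x \<bullet> i - r" "x \<bullet> i + r \<le> b \<bullet> i" "a \<bullet> i \<le> x \<bullet> i + h \<bullet> i - r" "x \<bullet> i + h \<bullet> i + r \<le> b \<bullet> i"
    using i by (auto simp: mem_box inner_simps)
  have "(1 - t) * (a \<bullet> i) \<le> (1 - t) * (x \<bullet> i - r)" "t * (a \<bullet> i) \<le> t * (x \<bullet> i + h \<bullet> i - r)"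
    "(1 - t) * (x \<bullet> i + r) \<le> (1 - t) * (b \<bullet> i)" "t * (x \<bullet> i + h \<bullet> i + r) \<le> t * (b \<bullet> i)"
    using * assms by (auto intro!: mult_left_mono)
  then show "a \<bullet> i \<le> (x + t *\<^sub>R h - r *\<^sub>R One) \<bullet> i \<and> (x + t *\<^sub>R h + r *\<^sub>R One) \<bullet> i \<le> b \<bullet> i"
    using i by (simp add: inner_simps algebra_simps)
qed

lemma norm_le_cube:
  fixes w x :: "'a::euclidean_space"
  assumes "w \<in> cbox (x - r *\<^sub>R One) (x + r *\<^sub>R One)"
  shows "norm (w - x) \<le> real DIM('a) * r"
proof -
  have "norm (w - x) \<le> (\<Sum>i\<in>Basis. \<bar>(w - x) \<bullet> i\<bar>)" by (rule norm_le_l1)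
  also have "\<dots> \<le> (\<Sum>i\<in>(Basis :: 'a set). r)"
    using assms by (intro sum_mono) (auto simp: mem_box inner_simps abs_le_iff)
  finally show ?thesis by simp
qed

lemma bump_mass_pos: "0 < r \<Longrightarrow> 0 < bump_mass TYPE('a::euclidean_space) r"
  using bump_mass_lower[where 'a='a] by (metis mult_pos_pos order_less_le_trans zero_less_power)

text \<open>The increment estimate with \<open>A = 0\<close>: the kernel average of the norm of
  \<open>D\<close> is at most \<open>M\<close> times the mass, and the oscillation at the two ends
  is made small by continuity when the kernel shrinks.\<close>

lemma weak_jacobian_bounded_Lipschitz:
  fixes u :: "real^'n \<Rightarrow> real^'m"
  assumes u: "continuous_on U u" and D: "has_weak_jacobian U u D" and ab: "cbox a b \<subseteq> U"
    and M: "\<And>w. norm (D w) \<le> M" and x: "x \<in> box a b" and y: "y \<in> box a b"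
  shows "\<bar>u y $ i - u x $ i\<bar> \<le> M * norm (y - x)"
proof (rule field_le_epsilon)
  fix e :: real assume e: "0 < e"
  have near: "\<exists>r>0. \<forall>s. 0 < s \<and> s \<le> r \<longrightarrow> cbox (z - s *\<^sub>R One) (z + s *\<^sub>R One) \<subseteq> cbox a b \<and>
    (\<forall>w\<in>cbox (z - s *\<^sub>R One) (z + s *\<^sub>R One). \<bar>u w $ i - u z $ i\<bar> \<le> e / 2)" if z: "z \<in> box a b" for z
  proof -
    have zU: "z \<in> cbox a b" using z box_subset_cbox[of a b] by blast
    have "continuous_on (cbox a b) (\<lambda>w. u w $ i)"
      by (intro continuous_intros continuous_on_subset[OF u ab])
    then obtain d where d: "0 < d" "\<And>w. w \<in> cbox a b \<Longrightarrow> dist w z < d \<Longrightarrow> dist (u w $ i) (u z $ i) < e / 2"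
      using zU e unfolding continuous_on_iff by (metis half_gt_zero)
    obtain \<delta> where \<delta>: "0 < \<delta>" "ball z \<delta> \<subseteq> box a b" using openE[OF open_box z] by blast
    define r where "r = min d \<delta> / (2 * real DIM(real^'n))"
    have r: "0 < r" using d(1) \<delta>(1) by (simp add: r_def)
    have cl: "norm (w - z) < min d \<delta>" if "w \<in> cbox (z - s *\<^sub>R One) (z + s *\<^sub>R One)" "0 < s" "s \<le> r" for w s
    proof -
      have "norm (w - z) \<le> real DIM(real^'n) * s" by (rule norm_le_cube[OF that(1)])
      also have "\<dots> \<le> real DIM(real^'n) * r" using that by (intro mult_left_mono) auto
      also have "\<dots> = min d \<delta> / 2" by (simp add: r_def)
      also have "\<dots> < min d \<delta>"
      proof -
        have "0 < min d \<delta>" using d(1) \<delta>(1) by simp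
        then show ?thesis by linarith
      qed
      finally show ?thesis .
    qed
    show ?thesis
    proof (intro exI[of _ r] conjI allI impI r ballI)
      fix s assume s: "0 < s \<and> s \<le> r"
      show sub: "cbox (z - s *\<^sub>R One) (z + s *\<^sub>R One) \<subseteq> cbox a b"
      proof
        fix w assume "w \<in> cbox (z - s *\<^sub>R One) (z + s *\<^sub>R One)"
        then have "norm (w - z) < \<delta>" using cl s by fastforce
        then have "w \<in> ball z \<delta>" by (simp add: dist_norm norm_minus_commute)
        then show "w \<in> cbox a b" using \<delta>(2) box_subset_cbox[of a b] by blast
      qed
      fix w assume w: "w \<in> cbox (z - s *\<^sub>R One) (z + s *\<^sub>R One)"
      then have "norm (w - z) < d" using cl s by fastforce
      then have "dist (u w $ i) (u z $ i) < e / 2" using d(2) sub w by (auto simp: dist_norm)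
      then show "\<bar>u w $ i - u z $ i\<bar> \<le> e / 2" by (simp add: dist_real_def)
    qed
  qed
  obtain r1 where r1: "0 < r1" "\<And>s. 0 < s \<Longrightarrow> s \<le> r1 \<Longrightarrow> cbox (x - s *\<^sub>R One) (x + s *\<^sub>R One) \<subseteq> cbox a b"
    "\<And>s w. 0 < s \<Longrightarrow> s \<le> r1 \<Longrightarrow> w\<in>cbox (x - s *\<^sub>R One) (x + s *\<^sub>R One) \<Longrightarrow> \<bar>u w $ i - u x $ i\<bar> \<le> e / 2"
    using near[OF x] by blast
  obtain r2 where r2: "0 < r2" "\<And>s. 0 < s \<Longrightarrow> s \<le> r2 \<Longrightarrow> cbox (y - s *\<^sub>R One) (y + s *\<^sub>R One) \<subseteq> cbox a b"
    "\<And>s w. 0 < s \<Longrightarrow> s \<le> r2 \<Longrightarrow> w\<in>cbox (y - s *\<^sub>R One) (y + s *\<^sub>R One) \<Longrightarrow> \<bar>u w $ i - u y $ i\<bar> \<le> e / 2"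
    using near[OF y] by blast
  define r where "r = min r1 r2"
  have r: "0 < r" "r \<le> r1" "r \<le> r2" using r1(1) r2(1) by (auto simp: r_def)
  let ?m = "bump_mass TYPE(real^'n) r"
  have yx: "x + (y - x) = y" by simp
  have sub: "cbox (x + t *\<^sub>R (y - x) - r *\<^sub>R One) (x + t *\<^sub>R (y - x) + r *\<^sub>R One) \<subseteq> cbox a b" if "0 \<le> t" "t \<le> 1" for t
    using r1(2)[OF r(1,2)] r2(2)[OF r(1,3)] r(1) that by (intro cube_segment_subset) simp_all
  have "?m * \<bar>u (x + (y - x)) $ i - u x $ i - (0 *v (y - x)) $ i\<bar> \<le> 2 * (e / 2) * ?m + norm (y - x) * (M * ?m)"
  proof (rule increment_estimate[OF u D ab r(1) sub r1(3)[OF r(1,2)]])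
    show "\<bar>u w $ i - u (x + (y - x)) $ i\<bar> \<le> e / 2" if "w \<in> cbox (x + (y - x) - r *\<^sub>R One) (x + (y - x) + r *\<^sub>R One)" for w
      using r2(3)[OF r(1,3)] that unfolding yx .
    fix t :: real assume t: "0 \<le> t" "t \<le> 1"
    note bt = box_bump_set_integral[OF r(1) sub[OF t]]
    have "(LINT w:cbox a b|lebesgue. norm (D w - 0) * box_bump (x + t *\<^sub>R (y - x)) r w) \<le>
      (LINT w:cbox a b|lebesgue. M * box_bump (x + t *\<^sub>R (y - x)) r w)"
      unfolding set_lebesgue_integral_def
    proof (rule integral_mono_AE')
      show "integrable lebesgue (\<lambda>w. indicator (cbox a b) w *\<^sub>R (M * box_bump (x + t *\<^sub>R (y - x)) r w))"
        using set_integrable_mult_right[OF bt(1), of M] by (simp add: set_integrable_def)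
      have M0: "0 \<le> M" using M[of 0] norm_ge_zero order_trans by blast
      show "AE w in lebesgue. indicator (cbox a b) w *\<^sub>R (norm (D w - 0) * box_bump (x + t *\<^sub>R (y - x)) r w) \<le>
        indicator (cbox a b) w *\<^sub>R (M * box_bump (x + t *\<^sub>R (y - x)) r w)"
        using M by (intro AE_I2 scaleR_left_mono mult_right_mono box_bump_nonneg) auto
      show "AE w in lebesgue. 0 \<le> indicator (cbox a b) w *\<^sub>R (M * box_bump (x + t *\<^sub>R (y - x)) r w)"
        using M0 by (intro AE_I2 scaleR_nonneg_nonneg mult_nonneg_nonneg box_bump_nonneg) auto
    qed
    then show "(LINT w:cbox a b|lebesgue. norm (D w - 0) * box_bump (x + t *\<^sub>R (y - x)) r w) \<le> M * ?m"
      unfolding set_integral_mult_right bt(2) .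
  qed
  then have "?m * \<bar>u y $ i - u x $ i\<bar> \<le> ?m * (M * norm (y - x) + e)" by (simp add: algebra_simps)
  then show "\<bar>u y $ i - u x $ i\<bar> \<le> M * norm (y - x) + e"
    using bump_mass_pos[OF r(1), where 'a="real^'n"] by (rule mult_left_le_imp_le)
qed

text \<open>The kernel has width proportional to the norm of \<open>h\<close>. The Lipschitz bound
  then makes the oscillation at the ends a small multiple of that norm, and all kernels along the
  segment lie in a ball of comparable size about \<open>x\<close>, where the Lebesgue point property
  controls the mean of \<open>D - D x\<close>.\<close>

lemma weak_jacobian_Lebesgue_point:
  fixes u :: "real^'n \<Rightarrow> real^'m"
  assumes U: "open U" and u: "continuous_on U u" and D: "has_weak_jacobian U u D"
    and Dm: "D \<in> borel_measurable lebesgue" and M: "\<And>w. norm (D w) \<le> M" and x: "x \<in> U"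
    and leb: "\<And>\<epsilon>. 0 < \<epsilon> \<Longrightarrow> \<exists>\<rho>>0. \<forall>r. 0 < r \<and> r < \<rho> \<longrightarrow>
      (LINT y:ball x r|lebesgue. norm (D y - D x)) \<le> \<epsilon> * measure lebesgue (ball x r)"
  shows "(u has_derivative (*v) (D x)) (at x)"
proof -
  define n where "n = real DIM(real^'n)"
  have n: "1 \<le> n" unfolding n_def by (simp add: Suc_leI)
  have M0: "0 \<le> M" using M[of 0] norm_ge_zero order_trans by blast
  obtain \<kappa> where \<kappa>: "0 < \<kappa>" "\<And>r. 0 < r \<Longrightarrow> \<kappa> * r ^ DIM(real^'n) \<le> bump_mass TYPE(real^'n) r"
    using bump_mass_lower[where 'a="real^'n"] by metis
  obtain R where R: "0 < R" "cbox (x - R *\<^sub>R One) (x + R *\<^sub>R One) \<subseteq> U"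
  proof -
    obtain \<delta> where \<delta>: "0 < \<delta>" "ball x \<delta> \<subseteq> U" using openE[OF U x] by blast
    have "cbox (x - (\<delta> / (2 * n)) *\<^sub>R One) (x + (\<delta> / (2 * n)) *\<^sub>R One) \<subseteq> U"
    proof
      fix w assume "w \<in> cbox (x - (\<delta> / (2 * n)) *\<^sub>R One) (x + (\<delta> / (2 * n)) *\<^sub>R One)"
      then have "norm (w - x) \<le> n * (\<delta> / (2 * n))" unfolding n_def by (rule norm_le_cube)
      also have "\<dots> < \<delta>" using n \<delta>(1) by simp
      finally have "w \<in> ball x \<delta>" by (simp add: dist_norm norm_minus_commute)
      then show "w \<in> U" using \<delta>(2) by blast
    qed
    moreover have "0 < \<delta> / (2 * n)" using \<delta>(1) n by simp
    ultimately show thesis using that by blast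
  qed
  define a where "a = x - R *\<^sub>R One"
  define b where "b = x + R *\<^sub>R One"
  have ab: "cbox a b \<subseteq> U" using R(2) by (simp add: a_def b_def)
  have inbox: "w \<in> box a b" if "\<And>i. i \<in> Basis \<Longrightarrow> \<bar>(w - x) \<bullet> i\<bar> < R" for w
  proof -
    have "a \<bullet> i < w \<bullet> i \<and> w \<bullet> i < b \<bullet> i" if i: "i \<in> Basis" for i
      using \<open>\<And>i. i \<in> Basis \<Longrightarrow> \<bar>(w - x) \<bullet> i\<bar> < R\<close>[OF i] i by (simp add: a_def b_def inner_simps abs_less_iff)
    then show ?thesis by (simp add: mem_box)
  qed
  have key: "\<exists>d>0. \<forall>h. norm h < d \<longrightarrow> (\<forall>i. \<bar>u (x + h) $ i - u x $ i - (D x *v h) $ i\<bar> \<le> e * norm h)"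
    if e: "0 < e" for e :: real
  proof -
    \<comment> \<open>The ratio of kernel width to increment. It is small enough for the two end
      oscillations together to cost at most \<open>e / 2\<close> per unit of increment.\<close>
    define \<delta> where "\<delta> = e / (4 * (M + 1) * n)"
    have \<delta>: "0 < \<delta>" using e M0 n by (simp add: \<delta>_def)
    have \<delta>': "2 * (M * (n * \<delta>)) \<le> e / 2"
    proof -
      have "2 * (M * (n * \<delta>)) = e / 2 * (M / (M + 1))"
      proof -
        define c where "c = M + 1"
        have "0 < c" using M0 by (simp add: c_def)
        then show ?thesis using n unfolding \<delta>_def c_def[symmetric] by (simp add: field_simps)
      qed
      also have "\<dots> \<le> e / 2 * 1" using e M0 by (intro mult_left_mono) auto
      finally show ?thesis by simp
    qed
    \<comment> \<open>A kernel centred on the segment reaches at most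
      \<open>1 + n * \<delta>\<close> increments away from \<open>x\<close> in norm, and
      \<open>1 + \<delta>\<close> in each coordinate; \<open>k\<close> exceeds both.\<close>
    define k where "k = 2 + n * \<delta>"
    have k: "1 + \<delta> < k" "1 + n * \<delta> < k" "0 < k"
    proof -
      have "\<delta> \<le> n * \<delta>" using n \<delta> by simp
      with \<delta> show "1 + \<delta> < k" "1 + n * \<delta> < k" "0 < k" unfolding k_def by linarith+
    qed
    define V where "V = unit_ball_vol n"
    have V: "0 < V" using n by (simp add: V_def)
    \<comment> \<open>Chosen so that \<open>\<epsilon>\<close> times the volume of the ball of
      radius \<open>k * H\<close> equals \<open>e / 2 * \<kappa> * r ^ DIM(real^'n)\<close>, which
      is at most \<open>e / 2\<close> times the kernel mass.\<close>
    define \<epsilon> where "\<epsilon> = e / 2 * \<kappa> * \<delta> ^ DIM(real^'n) / (V * k ^ DIM(real^'n))"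
    have \<epsilon>: "0 < \<epsilon>" using e \<kappa>(1) \<delta> V k(3) by (simp add: \<epsilon>_def)
    obtain \<rho> where \<rho>: "0 < \<rho>" "\<And>r. 0 < r \<Longrightarrow> r < \<rho> \<Longrightarrow>
      (LINT y:ball x r|lebesgue. norm (D y - D x)) \<le> \<epsilon> * measure lebesgue (ball x r)"
      using leb[OF \<epsilon>] by blast
    have vol: "measure lebesgue (ball x s) = V * s ^ DIM(real^'n)" if "0 \<le> s" for s
      using content_ball[OF that, of x] by (simp add: V_def n_def)
    define d where "d = min (\<rho> / k) (R / k)"
    have d: "0 < d" using \<rho>(1) R(1) k by (simp add: d_def)
    have "\<bar>u (x + h) $ i - u x $ i - (D x *v h) $ i\<bar> \<le> e * norm h" if h: "norm h < d" for h i
    proof (cases "h = 0")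
      case True then show ?thesis by simp
    next
      case False
      define H where "H = norm h"
      have H: "0 < H" "k * H < \<rho>" "k * H < R"
        using False h k(3) by (auto simp: H_def d_def field_simps)
      define r where "r = \<delta> * H"
      have r: "0 < r" using \<delta> H by (simp add: r_def)
      have HR: "H + r < R"
      proof -
        have "H + r = (1 + \<delta>) * H" by (simp add: r_def algebra_simps)
        also have "\<dots> \<le> k * H" using k(1) H(1) by (intro mult_right_mono) auto
        finally show ?thesis using H(3) by simp
      qed
      let ?m = "bump_mass TYPE(real^'n) r"
      have cube: "cbox (x + t *\<^sub>R h - r *\<^sub>R One) (x + t *\<^sub>R h + r *\<^sub>R One) \<subseteq> box a b" if t: "0 \<le> t" "t \<le> 1" for t
      proof
        fix w assume w: "w \<in> cbox (x + t *\<^sub>R h - r *\<^sub>R One) (x + t *\<^sub>R h + r *\<^sub>R One)"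
        show "w \<in> box a b"
        proof (rule inbox)
          fix i :: "real^'n" assume i: "i \<in> Basis"
          have 1: "x \<bullet> i + t * (h \<bullet> i) - r \<le> w \<bullet> i" "w \<bullet> i \<le> x \<bullet> i + t * (h \<bullet> i) + r"
            using w i by (auto simp: mem_box inner_simps)
          have "\<bar>t * (h \<bullet> i)\<bar> \<le> 1 * \<bar>h \<bullet> i\<bar>" using t unfolding abs_mult by (intro mult_right_mono) auto
          also have "\<dots> \<le> H" using Basis_le_norm[OF i, of h] by (simp add: H_def)
          finally show "\<bar>(w - x) \<bullet> i\<bar> < R" using 1 HR by (simp add: inner_simps abs_le_iff abs_less_iff)
        qed
      qed
      have sub: "cbox (x + t *\<^sub>R h - r *\<^sub>R One) (x + t *\<^sub>R h + r *\<^sub>R One) \<subseteq> cbox a b" if t: "0 \<le> t" "t \<le> 1" for t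
        using cube[OF t] box_subset_cbox[of a b] by blast
      have osc: "\<bar>u w $ i - u y $ i\<bar> \<le> M * (n * r)"
        if w: "w \<in> cbox (y - r *\<^sub>R One) (y + r *\<^sub>R One)" and y: "cbox (y - r *\<^sub>R One) (y + r *\<^sub>R One) \<subseteq> box a b" for w y
      proof -
        have yb: "y \<in> box a b" using r by (intro subsetD[OF y]) (simp add: mem_box inner_simps)
        have wb: "w \<in> box a b" using w y by blast
        have "\<bar>u w $ i - u y $ i\<bar> \<le> M * norm (w - y)"
          by (rule weak_jacobian_bounded_Lipschitz[OF u D ab M yb wb])
        also have "\<dots> \<le> M * (n * r)" using norm_le_cube[OF w] M0 by (intro mult_left_mono) (auto simp: n_def)
        finally show ?thesis .
      qed
      define B where "B = \<epsilon> * (V * (k * H) ^ DIM(real^'n))"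
      have "?m * \<bar>u (x + h) $ i - u x $ i - (D x *v h) $ i\<bar> \<le> 2 * (M * (n * r)) * ?m + norm h * B"
      proof (rule increment_estimate[OF u D ab r sub])
        show "\<bar>u w $ i - u x $ i\<bar> \<le> M * (n * r)" if "w \<in> cbox (x - r *\<^sub>R One) (x + r *\<^sub>R One)" for w
          using osc[OF that] cube[of 0] by simp
        show "\<bar>u w $ i - u (x + h) $ i\<bar> \<le> M * (n * r)" if "w \<in> cbox (x + h - r *\<^sub>R One) (x + h + r *\<^sub>R One)" for w
          using osc[OF that] cube[of 1] by simp
        fix t :: real assume t: "0 \<le> t" "t \<le> 1"
        let ?\<phi> = "box_bump (x + t *\<^sub>R h) r"
        have kH: "0 < k * H" using k H by simp
        have "(LINT w:cbox a b|lebesgue. norm (D w - D x) * ?\<phi> w) \<le> (LINT w:ball x (k * H)|lebesgue. norm (D w - D x))"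
          unfolding set_lebesgue_integral_def
        proof (rule integral_mono_AE')
          show "integrable lebesgue (\<lambda>w. indicator (ball x (k * H)) w *\<^sub>R norm (D w - D x))"
          proof (rule Bochner_Integration.integrable_bound)
            show "integrable lebesgue (\<lambda>w. (2 * M) * indicator (ball x (k * H)) w)"
              using lmeasurable_ball[of x "k * H"] by (intro integrable_mult_right) (auto simp: fmeasurable_def)
            show "(\<lambda>w. indicator (ball x (k * H)) w *\<^sub>R norm (D w - D x)) \<in> borel_measurable lebesgue"
            proof -
              have "(\<lambda>w. norm (D w - D x)) \<in> borel_measurable lebesgue" using Dm by measurable
              then show ?thesis by (intro borel_measurable_scaleR borel_measurable_indicator) auto
            qed
            show "AE w in lebesgue. norm (indicator (ball x (k * H)) w *\<^sub>R norm (D w - D x)) \<le> norm ((2 * M) * indicator (ball x (k * H)) w)"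
            proof (rule AE_I2)
              fix w
              have "norm (D w - D x) \<le> 2 * M"
                using norm_triangle_ineq4[of "D w" "D x"] M[of x] M[of w] by simp
              then show "norm (indicator (ball x (k * H)) w *\<^sub>R norm (D w - D x)) \<le> norm ((2 * M) * indicator (ball x (k * H)) w)"
                using M0 by (simp add: indicator_def)
            qed
          qed
          show "AE w in lebesgue. 0 \<le> indicator (ball x (k * H)) w *\<^sub>R norm (D w - D x)" by simp
          show "AE w in lebesgue. indicator (cbox a b) w *\<^sub>R (norm (D w - D x) * ?\<phi> w) \<le> indicator (ball x (k * H)) w *\<^sub>R norm (D w - D x)"
          proof (rule AE_I2)
            fix w
            show "indicator (cbox a b) w *\<^sub>R (norm (D w - D x) * ?\<phi> w) \<le> indicator (ball x (k * H)) w *\<^sub>R norm (D w - D x)"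
            proof (cases "w \<in> cbox (x + t *\<^sub>R h - r *\<^sub>R One) (x + t *\<^sub>R h + r *\<^sub>R One)")
              case True
              have "norm (w - x) \<le> norm (w - (x + t *\<^sub>R h)) + norm (t *\<^sub>R h)"
                using norm_triangle_ineq[of "w - (x + t *\<^sub>R h)" "t *\<^sub>R h"] by simp
              also have "\<dots> \<le> n * r + H"
                using norm_le_cube[OF True] t mult_right_mono[of t 1 "norm h"] by (intro add_mono) (auto simp: n_def H_def)
              also have "\<dots> = (1 + n * \<delta>) * H" by (simp add: r_def algebra_simps)
              also have "\<dots> < k * H" using k(2) H(1) by simp
              finally have "w \<in> ball x (k * H)" by (simp add: dist_norm norm_minus_commute)
              moreover have "norm (D w - D x) * ?\<phi> w \<le> norm (D w - D x) * 1"
                by (intro mult_left_mono box_bump_le_1) simp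
              ultimately show ?thesis by (simp add: indicator_def)
            next
              case False
              then have "?\<phi> w = 0"
                using box_subset_cbox[of "x + t *\<^sub>R h - r *\<^sub>R One" "x + t *\<^sub>R h + r *\<^sub>R One"]
                by (intro box_bump_eq_0 r) auto
              then show ?thesis by simp
            qed
          qed
        qed
        also have "\<dots> \<le> \<epsilon> * measure lebesgue (ball x (k * H))" by (rule \<rho>(2)[OF kH H(2)])
        also have "\<dots> = B" using vol[of "k * H"] kH by (simp add: B_def)
        finally show "(LINT w:cbox a b|lebesgue. norm (D w - D x) * ?\<phi> w) \<le> B" .
      qed
      also have "norm h * B = H * (e / 2 * (\<kappa> * r ^ DIM(real^'n)))"
        using V k(3) by (simp add: B_def \<epsilon>_def H_def[symmetric] r_def power_mult_distrib)
      also have "2 * (M * (n * r)) * ?m + H * (e / 2 * (\<kappa> * r ^ DIM(real^'n))) \<le> (e / 2 * H) * ?m + H * (e / 2 * ?m)"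
      proof (intro add_mono mult_right_mono mult_left_mono \<kappa>(2) r)
        have "2 * (M * (n * r)) = 2 * (M * (n * \<delta>)) * H" by (simp add: r_def)
        also have "\<dots> \<le> e / 2 * H" using \<delta>' H by (intro mult_right_mono) auto
        finally show "2 * (M * (n * r)) \<le> e / 2 * H" .
      qed (use e H bump_mass_pos[OF r, where 'a="real^'n"] in auto)
      finally have "?m * \<bar>u (x + h) $ i - u x $ i - (D x *v h) $ i\<bar> \<le> ?m * (e * H)" by (simp add: algebra_simps)
      then show ?thesis using bump_mass_pos[OF r, where 'a="real^'n"] unfolding H_def by (rule mult_left_le_imp_le)
    qed
    with d show ?thesis by blast
  qed
  show ?thesis
    unfolding has_derivative_at_alt
  proof (intro conjI allI impI matrix_vector_mul_bounded_linear)
    fix e :: real assume e: "0 < e"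
    define m where "m = real CARD('m)"
    have m: "0 < m" by (simp add: m_def)
    obtain d where d: "0 < d" "\<And>h i. norm h < d \<Longrightarrow> \<bar>u (x + h) $ i - u x $ i - (D x *v h) $ i\<bar> \<le> e / m * norm h"
      using key[of "e / m"] e m by (metis divide_pos_pos)
    have "norm (u y - u x - D x *v (y - x)) \<le> e * norm (y - x)" if y: "norm (y - x) < d" for y
    proof -
      have "norm (u y - u x - D x *v (y - x)) \<le> (\<Sum>i\<in>UNIV. \<bar>(u y - u x - D x *v (y - x)) $ i\<bar>)"
        by (rule norm_le_l1_cart)
      also have "\<dots> \<le> (\<Sum>i\<in>(UNIV::'m set). e / m * norm (y - x))"
        using d(2)[OF y] by (intro sum_mono) simp
      also have "\<dots> = e * norm (y - x)" by (simp add: m_def)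
      finally show ?thesis .
    qed
    with d(1) show "\<exists>d>0. \<forall>y. norm (y - x) < d \<longrightarrow> norm (u y - u x - D x *v (y - x)) \<le> e * norm (y - x)" by blast
  qed
qed

section \<open>The area formula\<close>

definition vec_reindex :: "('i \<Rightarrow> 'j) \<Rightarrow> real^'j::finite \<Rightarrow> real^'i::finite" where
  "vec_reindex p x = (\<chi> i. x $ p i)"

lemma vec_reindex_nth [simp]: "vec_reindex p x $ i = x $ p i"
  by (simp add: vec_reindex_def)

lemma linear_vec_reindex: "linear (vec_reindex p)"
  by (rule linearI) (simp_all add: vec_eq_iff)

locale index_bijection =
  fixes p :: "'i::finite \<Rightarrow> 'j::finite" and q :: "'j \<Rightarrow> 'i"
  assumes pq [simp]: "\<And>j. p (q j) = j" and qp [simp]: "\<And>i. q (p i) = i"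
begin

lemma reindex_inverse [simp]: "vec_reindex q (vec_reindex p x) = x" "vec_reindex p (vec_reindex q y) = y"
  by (simp_all add: vec_eq_iff)

lemma image_reindex: "vec_reindex p ` S = {y. vec_reindex q y \<in> S}"
proof (intro set_eqI iffI)
  fix y assume "y \<in> {y. vec_reindex q y \<in> S}"
  then have "vec_reindex p (vec_reindex q y) \<in> vec_reindex p ` S" by blast
  then show "y \<in> vec_reindex p ` S" by simp
qed auto

lemma image_cbox_reindex: "vec_reindex p ` cbox u v = cbox (vec_reindex p u) (vec_reindex p v)"
  unfolding image_reindex by (auto simp: mem_box_cart) (metis qp pq)+

lemma content_reindex: "measure lborel (vec_reindex p ` cbox u v) = measure lborel (cbox u v)"
proof (cases "cbox u v = {}")
  case False
  then have ne: "cbox (vec_reindex p u) (vec_reindex p v) \<noteq> {}" using image_cbox_reindex[of u v] by auto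
  have "(\<Prod>i\<in>UNIV. v $ p i - u $ p i) = (\<Prod>j\<in>UNIV. v $ j - u $ j)"
    by (rule prod.reindex_bij_witness[of _ q p]) auto
  then show ?thesis unfolding image_cbox_reindex content_cbox_cart[OF False] content_cbox_cart[OF ne] by simp
qed simp

end

lemma index_bijection_sym: "index_bijection p q \<Longrightarrow> index_bijection q p"
  by (simp add: index_bijection_def)

context index_bijection
begin

text \<open>Relabelling coordinates carries boxes to boxes of the same content, which is all that a
  gauge integral can notice.\<close>

lemma has_integral_reindex:
  fixes f :: "real^'j \<Rightarrow> real"
  assumes S: "bounded S" and f: "(f has_integral m) S"
  shows "((\<lambda>y. f (vec_reindex q y)) has_integral m) (vec_reindex p ` S)"
proof -
  interpret inv: index_bijection q p by (rule index_bijection_sym) unfold_locales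
  obtain a b where ab: "S \<subseteq> cbox a b" using bounded_subset_cbox_symmetric[OF S] by blast
  have "((\<lambda>x. if x \<in> S then f x else 0) has_integral m) (cbox a b)"
    using f ab by (simp add: has_integral_restrict)
  then have "((\<lambda>y. (\<lambda>x. if x \<in> S then f x else 0) (vec_reindex q y)) has_integral (1 / 1) *\<^sub>R m) (vec_reindex p ` cbox a b)"
  proof (rule has_integral_twiddle[rotated -1])
    show "continuous (at x) (vec_reindex q)" for x
      using linear_continuous_at[of "vec_reindex q"] linear_vec_reindex[of q] by (simp add: linear_conv_bounded_linear)
    show "\<exists>w z. vec_reindex q ` cbox u v = cbox w z" for u v using inv.image_cbox_reindex by blast
    show "\<exists>w z. vec_reindex p ` cbox u v = cbox w z" for u v using image_cbox_reindex by blast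
    show "measure lborel (vec_reindex q ` cbox u v) = 1 * measure lborel (cbox u v)" for u v
      using inv.content_reindex by simp
  qed auto
  then have "((\<lambda>y. if y \<in> vec_reindex p ` S then f (vec_reindex q y) else 0) has_integral m) (vec_reindex p ` cbox a b)"
    by (simp add: image_reindex)
  moreover have "vec_reindex p ` S \<subseteq> vec_reindex p ` cbox a b" using ab by blast
  ultimately show ?thesis by (simp add: has_integral_restrict)
qed

text \<open>Rows and columns are relabelled alike: conjugation by \<open>p\<close> is a bijection
  between the permutations of the two index types that preserves signs.\<close>

lemma det_reindex:
  fixes A :: "real^'j^'j"
  shows "det (\<chi> i k. A $ p i $ p k) = det A"
proof -
  interpret inv: index_bijection q p by (rule index_bijection_sym) unfold_locales
  have bij: "bij p" by (rule o_bij[of q]) (auto simp: fun_eq_iff)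
  have inv_p: "inv_into UNIV p = q" using bij by (intro inv_equality) auto
  have mp: "map_permutation UNIV p \<pi> = p \<circ> \<pi> \<circ> q" for \<pi>
    using bij_is_surj[OF bij] by (simp add: map_permutation_def restrict_id_def fun_eq_iff inv_p)
  have "det A = (\<Sum>\<pi> | \<pi> permutes (UNIV::'i set). of_int (sign \<pi>) * (\<Prod>i\<in>UNIV. A $ p i $ p (\<pi> i)))"
    unfolding det_def
  proof (rule sum.reindex_bij_witness[of _ "\<lambda>\<pi>. p \<circ> \<pi> \<circ> q" "\<lambda>\<sigma>. q \<circ> \<sigma> \<circ> p"])
    fix \<sigma> assume s: "\<sigma> \<in> {\<sigma>. \<sigma> permutes (UNIV::'j set)}"
    have bs: "bij \<sigma>" using s by (simp add: permutes_bij)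
    have perm: "q \<circ> \<sigma> \<circ> p permutes UNIV"
      using bs bij inv.index_bijection_axioms o_bij[of p q] by (intro bij_imp_permutes) (auto intro!: bij_comp simp: fun_eq_iff)
    then show "q \<circ> \<sigma> \<circ> p \<in> {\<pi>. \<pi> permutes UNIV}" by simp
    have eq: "map_permutation UNIV p (q \<circ> \<sigma> \<circ> p) = \<sigma>" by (simp add: mp fun_eq_iff)
    have "sign \<sigma> = sign (q \<circ> \<sigma> \<circ> p)"
      using sign_map_permutation[of p UNIV "q \<circ> \<sigma> \<circ> p"] perm bij_is_inj[OF bij] by (simp add: eq)
    moreover have "(\<Prod>i\<in>UNIV. A $ p i $ p ((q \<circ> \<sigma> \<circ> p) i)) = (\<Prod>j\<in>UNIV. A $ j $ \<sigma> j)"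
      by (rule prod.reindex_bij_witness[of _ q p]) auto
    ultimately show "of_int (sign (q \<circ> \<sigma> \<circ> p)) * (\<Prod>i\<in>UNIV. A $ p i $ p ((q \<circ> \<sigma> \<circ> p) i)) = of_int (sign \<sigma>) * (\<Prod>j\<in>UNIV. A $ j $ \<sigma> j)"
      by simp
  next
    fix \<pi> assume "\<pi> \<in> {\<pi>. \<pi> permutes (UNIV::'i set)}"
    then have "bij \<pi>" by (simp add: permutes_bij)
    moreover have "bij q" using o_bij[of p q] by (auto simp: fun_eq_iff)
    ultimately show "p \<circ> \<pi> \<circ> q \<in> {\<sigma>. \<sigma> permutes UNIV}"
      using bij by (auto intro!: bij_imp_permutes bij_comp)
  qed (auto simp: fun_eq_iff)
  then show ?thesis by (simp add: det_def)
qed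

end

typedef ('n::finite) ordered_index = "{..<CARD('n)}"
  by (rule exI[of _ 0]) simp

instance ordered_index :: (finite) finite
proof
  show "finite (UNIV :: 'a ordered_index set)"
    unfolding type_definition.Abs_image[OF type_definition_ordered_index, symmetric]
    by (rule finite_imageI) simp
qed

lemma card_ordered_index: "CARD('n ordered_index) = CARD('n::finite)"
  using type_definition.card[OF type_definition_ordered_index] by simp

instantiation ordered_index :: (finite) wellorder
begin
definition less_eq_ordered_index :: "'a ordered_index \<Rightarrow> 'a ordered_index \<Rightarrow> bool" where
  "less_eq_ordered_index x y \<longleftrightarrow> Rep_ordered_index x \<le> Rep_ordered_index y"
definition less_ordered_index :: "'a ordered_index \<Rightarrow> 'a ordered_index \<Rightarrow> bool" where
  "less_ordered_index x y \<longleftrightarrow> Rep_ordered_index x < Rep_ordered_index y"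
instance
proof
  fix P :: "'a ordered_index \<Rightarrow> bool" and a :: "'a ordered_index"
  assume step: "\<And>x. (\<And>y. y < x \<Longrightarrow> P y) \<Longrightarrow> P x"
  show "P a"
    by (induction "Rep_ordered_index a" arbitrary: a rule: less_induct)
      (rule step, auto simp: less_ordered_index_def)
qed (auto simp: less_eq_ordered_index_def less_ordered_index_def Rep_ordered_index_inject)
end

text \<open>The library's change of variables needs a wellordered index type; any finite index type is in
  bijection with one.\<close>

lemma measure_differentiable_image_finite:
  fixes f :: "real^'n \<Rightarrow> real^'n"
  assumes S: "S \<in> sets lebesgue" "bounded S"
    and f: "\<And>x. x \<in> S \<Longrightarrow> (f has_derivative (*v) (D x)) (at x within S)"
    and bf: "bounded (f ` S)"
    and m: "((\<lambda>x. \<bar>det (D x)\<bar>) has_integral m) S"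
  shows "f ` S \<in> lmeasurable" "measure lebesgue (f ` S) \<le> m"
    "inj_on f S \<Longrightarrow> measure lebesgue (f ` S) = m"
proof -
  obtain p :: "'n ordered_index \<Rightarrow> 'n" where "bij p"
    using finite_same_card_bij[of "UNIV :: 'n ordered_index set" "UNIV :: 'n set"] card_ordered_index by auto
  then interpret index_bijection p "inv p"
    by unfold_locales (simp_all add: bij_is_surj surj_f_inv_f bij_is_inj)
  interpret inv: index_bijection "inv p" p by (rule index_bijection_sym) unfold_locales
  let ?R = "vec_reindex p" and ?Q = "vec_reindex (inv p)"
  have bl: "bounded_linear ?R" "bounded_linear ?Q"
    using linear_vec_reindex by (simp_all add: linear_conv_bounded_linear)
  have "S \<in> lmeasurable" using S bounded_set_imp_lmeasurable by blast
  then have "((\<lambda>_. 1) has_integral measure lebesgue S) S" by (simp add: has_integral_measure_lborel lmeasure_integral lmeasurable_iff_integrable_on has_integral_iff)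
  then have "((\<lambda>_. 1::real) has_integral measure lebesgue S) (?R ` S)" by (rule has_integral_reindex[OF S(2)])
  then have RS: "?R ` S \<in> sets lebesgue" using lmeasurable_iff_integrable_on[of "?R ` S"] by (auto simp: integrable_on_def)
  define g where "g y = ?R (f (?Q y))" for y
  define E where "E y = (\<chi> i k. D (?Q y) $ p i $ p k)" for y
  have gR: "g ` ?R ` S = ?R ` f ` S" by (simp add: g_def image_image)
  have der: "(g has_derivative (*v) (E y)) (at y within ?R ` S)" if y: "y \<in> ?R ` S" for y
  proof -
    have "(?Q has_derivative ?Q) (at y within ?R ` S)" using bl(2) by (rule bounded_linear_imp_has_derivative)
    moreover have "(f has_derivative (*v) (D (?Q y))) (at (?Q y) within ?Q ` ?R ` S)"
      using f[of "?Q y"] y by (auto simp: image_image)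
    ultimately have "((\<lambda>y. f (?Q y)) has_derivative (\<lambda>h. D (?Q y) *v ?Q h)) (at y within ?R ` S)"
      by (rule has_derivative_in_compose)
    then have "(g has_derivative (\<lambda>h. ?R (D (?Q y) *v ?Q h))) (at y within ?R ` S)"
      unfolding g_def by (rule bounded_linear.has_derivative[OF bl(1)])
    moreover have "?R (D (?Q y) *v ?Q h) = E y *v h" for h
    proof -
      have "(\<Sum>j\<in>UNIV. D (?Q y) $ p i $ j * h $ inv p j) = (\<Sum>k\<in>UNIV. D (?Q y) $ p i $ p k * h $ k)" for i
        by (rule sum.reindex_bij_witness[of _ p "inv p"]) auto
      then show ?thesis by (simp add: vec_eq_iff matrix_vector_mult_def E_def)
    qed
    ultimately show ?thesis by simp
  qed
  have "\<bar>det (matrix ((*v) (E y)))\<bar> = \<bar>det (D (?Q y))\<bar>" for y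
    by (simp add: matrix_of_matrix_vector_mul E_def det_reindex)
  then have jac: "((\<lambda>y. \<bar>det (matrix ((*v) (E y)))\<bar>) has_integral m) (?R ` S)"
    using has_integral_reindex[OF S(2) m] by simp
  then have jac1: "(\<lambda>y. \<bar>det (matrix ((*v) (E y)))\<bar> * 1) integrable_on (?R ` S)" by auto
  \<comment> \<open>Without injectivity the image is controlled only from above. This half is needed
    for the displacement \<open>u - id\<close> in dimension one, which need not be
    injective.\<close>
  have ub: "(\<lambda>_. 1::real) integrable_on (g ` ?R ` S) \<and> integral (g ` ?R ` S) (\<lambda>_. 1::real) \<le> integral (?R ` S) (\<lambda>y. \<bar>det (matrix ((*v) (E y)))\<bar> * 1)"
    by (rule integral_on_image_ubound_nonneg[OF _ der jac1]) simp_all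
  define m' where "m' = integral (g ` ?R ` S) (\<lambda>_. 1::real)"
  have m'1: "((\<lambda>_. 1::real) has_integral m') (?R ` f ` S)" and m'le: "m' \<le> m"
    using ub jac by (auto simp: m'_def gR has_integral_iff)
  have "bounded (?R ` f ` S)" using bf bl(1) by (rule bounded_linear_image)
  then have "((\<lambda>_. 1::real) has_integral m') (?Q ` ?R ` f ` S)" using m'1 inv.has_integral_reindex by blast
  then have "((\<lambda>_. 1::real) has_integral m') (f ` S)" by (simp add: image_image)
  then have *: "f ` S \<in> lmeasurable" "measure lebesgue (f ` S) = m'"
    by (metis has_integral_iff lmeasurable_iff_integrable_on lmeasure_integral)+
  then show "f ` S \<in> lmeasurable" "measure lebesgue (f ` S) \<le> m" using m'le by simp_all
  show "measure lebesgue (f ` S) = m" if inj: "inj_on f S"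
  proof -
    have "inj_on g (?R ` S)"
    proof (rule inj_onI)
      fix y z assume "y \<in> ?R ` S" "z \<in> ?R ` S" and gyz: "g y = g z"
      then obtain a b where ab: "y = ?R a" "a \<in> S" "z = ?R b" "b \<in> S" by blast
      have "?Q (g y) = ?Q (g z)" using gyz by simp
      then have "f a = f b" by (simp add: g_def ab)
      then have "a = b" by (rule inj_onD[OF inj _ ab(2,4)])
      then show "y = z" by (simp add: ab)
    qed
    then have "measure lebesgue (g ` ?R ` S) = m"
      using has_measure_differentiable_image[OF RS der] jac by blast
    moreover have "measure lebesgue (g ` ?R ` S) = m'"
      using m'1 unfolding gR by (metis has_integral_iff lmeasurable_iff_integrable_on lmeasure_integral)
    ultimately show ?thesis using *(2) by simp
  qed
qed

section \<open>From essential bounds to pointwise statements about Sobolev maps\<close>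

lemma esssup_less_top_AE:
  assumes "esssup M (\<lambda>x. ereal (f x)) < \<infinity>"
  obtains c where "0 \<le> c" "AE x in M. f x \<le> c"
proof -
  obtain n :: nat where n: "esssup M (\<lambda>x. ereal (f x)) < ereal (real n)"
    using assms less_PInf_Ex_of_nat[of "esssup M (\<lambda>x. ereal (f x))"] by auto
  have m: "(\<lambda>x. ereal (f x)) \<in> borel_measurable M"
    using assms esssup_non_measurable[of "\<lambda>x. ereal (f x)" M] by (auto simp: top_ereal_def)
  have "AE x in M. f x \<le> real n"
    using esssup_AE[of "\<lambda>x. ereal (f x)" M]
  proof (rule AE_mp, intro AE_I2 impI)
    fix x assume "ereal (f x) \<le> esssup M (\<lambda>x. ereal (f x))"
    then have "ereal (f x) \<le> ereal (real n)" using n by (meson less_imp_le order_trans)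
    then show "f x \<le> real n" by simp
  qed
  then show thesis using that[of "real n"] by simp
qed

lemma AE_lebesgue_on_iff:
  "S \<in> sets lebesgue \<Longrightarrow> (AE x in lebesgue_on S. P x) \<longleftrightarrow> (AE x in lebesgue. x \<in> S \<longrightarrow> P x)"
  by (subst AE_restrict_space_iff) auto

lemma AE_imp_negligible:
  assumes "AE x in lebesgue. x \<in> S \<longrightarrow> P x"
  shows "negligible {x\<in>S. \<not> P x}"
proof -
  obtain N where N: "{x \<in> space lebesgue. \<not> (x \<in> S \<longrightarrow> P x)} \<subseteq> N" "emeasure lebesgue N = 0" "N \<in> sets lebesgue"
    using assms by (rule AE_E)
  then have "negligible N" by (simp add: negligible_iff_null_sets null_sets_def)
  then show ?thesis by (rule negligible_subset) (use N(1) in auto)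
qed

text \<open>The set where the continuous function \<open>norm (u x)\<close> exceeds its essential
  bound is open and null, hence empty.\<close>

lemma W_1_infinity_bounded:
  assumes U: "open U" and u: "u \<in> W_1_infinity U"
  shows "bounded (u ` U)"
proof -
  have Um: "U \<in> sets lebesgue" using borel_open[OF U] by simp
  obtain c where c: "0 \<le> c" "AE x in lebesgue_on U. norm (u x) \<le> c"
    using u esssup_less_top_AE[of "lebesgue_on U" "\<lambda>x. norm (u x)"] unfolding W_1_infinity_def L_infinity_def by auto
  have "norm (u x) \<le> c" if x: "x \<in> U" for x
  proof (rule ccontr)
    assume "\<not> norm (u x) \<le> c"
    then have xc: "c < norm (u x)" by simp
    have "continuous_on U (\<lambda>x. norm (u x))" using u unfolding W_1_infinity_def by (auto intro: continuous_on_norm)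
    then have "open {x\<in>U. c < norm (u x)}"
      using continuous_open_preimage[of U "\<lambda>x. norm (u x)" "{c<..}"] U by (simp add: vimage_def Int_def)
    moreover have "x \<in> {x\<in>U. c < norm (u x)}" using x xc by simp
    moreover have "negligible {x\<in>U. c < norm (u x)}"
    proof -
      have "AE x in lebesgue. x \<in> U \<longrightarrow> norm (u x) \<le> c" using c(2) by (simp add: AE_lebesgue_on_iff[OF Um])
      then have "negligible {x\<in>U. \<not> norm (u x) \<le> c}" by (rule AE_imp_negligible)
      then show ?thesis by (simp add: not_le)
    qed
    ultimately show False using open_not_negligible by blast
  qed
  then show ?thesis unfolding bounded_iff by blast
qed

text \<open>Truncating at the essential bound and extending by zero alters a weak Jacobian on
  \<open>U\<close> only on a null set. The result is measurable and bounded on the whole space, as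
  required for Lebesgue points.\<close>

lemma weak_jacobian_bounded_version:
  assumes U: "open U" and u: "u \<in> W_1_infinity U"
  obtains D M where "has_weak_jacobian U u D" "D \<in> borel_measurable lebesgue" "\<And>x. norm (D x) \<le> M"
proof -
  have Um: "U \<in> sets lebesgue" using borel_open[OF U] by simp
  obtain E where E: "has_weak_jacobian U u E" "E \<in> borel_measurable (lebesgue_on U)"
    "esssup (lebesgue_on U) (\<lambda>x. ereal (norm (E x))) < \<infinity>"
    using u unfolding W_1_infinity_def L_infinity_def by blast
  obtain M where M: "0 \<le> M" "AE x in lebesgue_on U. norm (E x) \<le> M" using esssup_less_top_AE[OF E(3)] by blast
  define D where "D x = (if x \<in> U then (if norm (E x) \<le> M then E x else 0) else 0)" for x
  have Dm: "D \<in> borel_measurable lebesgue"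
  proof -
    have "(\<lambda>x. if norm (E x) \<le> M then E x else 0) \<in> borel_measurable (lebesgue_on U)"
      using E(2) by measurable
    then show ?thesis unfolding D_def by (rule borel_measurable_if[OF Um, THEN iffD2])
  qed
  have DM: "norm (D x) \<le> M" for x using M(1) by (simp add: D_def)
  have eq: "AE x in lebesgue. x \<in> U \<longrightarrow> D x = E x"
    using M(2) unfolding AE_lebesgue_on_iff[OF Um] by (rule AE_mp) (auto intro!: AE_I2 simp: D_def)
  have "has_weak_jacobian U u D"
    unfolding has_weak_jacobian_def
  proof (intro conjI allI impI)
    show "locally_integrable U u" using E(1) by (simp add: has_weak_jacobian_def)
    show "locally_integrable U D"
      unfolding locally_integrable_def set_integrable_def
    proof (intro allI impI)
      fix K assume K: "compact K \<and> K \<subseteq> U"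
      then have Km: "K \<in> sets lebesgue" by (simp add: borel_compact)
      have "integrable lebesgue (\<lambda>x. indicator K x *\<^sub>R E x)"
        using E(1) K unfolding has_weak_jacobian_def locally_integrable_def set_integrable_def by blast
      moreover have "AE x in lebesgue. indicator K x *\<^sub>R D x = indicator K x *\<^sub>R E x"
        using eq by (rule AE_mp) (use K in \<open>auto intro!: AE_I2 simp: indicator_def\<close>)
      ultimately show "integrable lebesgue (\<lambda>x. indicator K x *\<^sub>R D x)"
        using Dm Km by (subst integrable_cong_AE[of _ _ "\<lambda>x. indicator K x *\<^sub>R E x"]) (auto dest: borel_measurable_integrable)
    qed
    fix \<phi> i j assume \<phi>: "test_function U \<phi>"
    have "(LINT x:U|lebesgue. D x $ i $ j * \<phi> x) = (LINT x:U|lebesgue. E x $ i $ j * \<phi> x)"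
      unfolding set_lebesgue_integral_def
    proof (rule integral_cong_AE)
      have lD: "locally_integrable U E" using E(1) by (simp add: has_weak_jacobian_def)
      show "(\<lambda>x. indicator U x *\<^sub>R (E x $ i $ j * \<phi> x)) \<in> borel_measurable lebesgue"
        using weak_jacobian_entry_integrable[OF lD \<phi>, of i j] unfolding set_integrable_def by (rule borel_measurable_integrable)
      have "\<phi> \<in> borel_measurable lebesgue"
        using borel_measurable_continuous_onI[OF test_function_continuous[OF \<phi>]] by (intro measurable_completion) simp
      moreover have "(\<lambda>x. D x $ i $ j) \<in> borel_measurable lebesgue"
        using Dm by (intro borel_measurable_continuous_on[where f = "\<lambda>A. A $ i $ j"] continuous_intros) auto
      ultimately show "(\<lambda>x. indicator U x *\<^sub>R (D x $ i $ j * \<phi> x)) \<in> borel_measurable lebesgue"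
        using Um by (intro borel_measurable_scaleR borel_measurable_times borel_measurable_indicator)
      show "AE x in lebesgue. indicator U x *\<^sub>R (D x $ i $ j * \<phi> x) = indicator U x *\<^sub>R (E x $ i $ j * \<phi> x)"
        using eq by (rule AE_mp) (auto intro!: AE_I2 simp: indicator_def)
    qed
    then show "(LINT x:U|lebesgue. u x $ i * frechet_derivative \<phi> (at x) (axis j 1)) = - (LINT x:U|lebesgue. D x $ i $ j * \<phi> x)"
      using E(1) \<phi> unfolding has_weak_jacobian_def by simp
  qed
  then show thesis using that Dm DM by blast
qed

text \<open>The estimate lives on boxes inside \<open>U\<close>, so it is local; that is enough for
  null sets to have null images.\<close>

lemma W_1_infinity_locally_Lipschitz:
  fixes u :: "real^'n \<Rightarrow> real^'m"
  assumes U: "open U" and u: "u \<in> W_1_infinity U" and x: "x \<in> U"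
  obtains T B where "open T" "x \<in> T" "T \<subseteq> U" "\<And>y. y \<in> T \<Longrightarrow> norm (u y - u x) \<le> B * norm (y - x)"
proof -
  obtain D M where D: "has_weak_jacobian U u D" "\<And>x. norm (D x) \<le> M"
    using weak_jacobian_bounded_version[OF U u] by metis
  have uc: "continuous_on U u" using u by (simp add: W_1_infinity_def)
  obtain a b where ab: "x \<in> box a b" "cbox a b \<subseteq> U" using open_contains_cbox[OF U x] by metis
  have "norm (u y - u x) \<le> (real CARD('m) * M) * norm (y - x)" if y: "y \<in> box a b" for y
  proof -
    have "norm (u y - u x) \<le> (\<Sum>i\<in>UNIV. \<bar>(u y - u x) $ i\<bar>)" by (rule norm_le_l1_cart)
    also have "\<dots> \<le> (\<Sum>i\<in>(UNIV :: 'm set). M * norm (y - x))"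
      using weak_jacobian_bounded_Lipschitz[OF uc D(1) ab(2) D(2) ab(1) y] by (intro sum_mono) simp
    finally show ?thesis by simp
  qed
  then show thesis using that[of "box a b"] ab box_subset_cbox[of a b] open_box by blast
qed

text \<open>A Rademacher theorem in which the derivative is identified with the prescribed weak
  Jacobian: it holds at the Lebesgue points of the bounded version, and the two versions agree
  almost everywhere.\<close>

theorem W_1_infinity_AE_derivative:
  fixes u :: "real^'n \<Rightarrow> real^'m"
  assumes U: "open U" and u: "u \<in> W_1_infinity U" and Du: "has_weak_jacobian U u Du"
  shows "AE x in lebesgue. x \<in> U \<longrightarrow> (u has_derivative (*v) (Du x)) (at x)"
proof -
  obtain D M where D: "has_weak_jacobian U u D" "D \<in> borel_measurable lebesgue" "\<And>x. norm (D x) \<le> M"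
    using weak_jacobian_bounded_version[OF U u] by metis
  have uc: "continuous_on U u" using u by (simp add: W_1_infinity_def)
  show ?thesis
    using weak_jacobian_unique[OF U D(1) Du] AE_Lebesgue_point[OF D(2,3)]
  proof eventually_elim
    fix x
    assume eq: "x \<in> U \<longrightarrow> D x = Du x" and leb: "\<forall>\<epsilon>>0. \<exists>\<rho>>0. \<forall>r. 0 < r \<and> r < \<rho> \<longrightarrow>
      (LINT y:ball x r|lebesgue. norm (D y - D x)) \<le> \<epsilon> * measure lebesgue (ball x r)"
    show "x \<in> U \<longrightarrow> (u has_derivative (*v) (Du x)) (at x)"
    proof
      assume x: "x \<in> U"
      have "(u has_derivative (*v) (D x)) (at x)"
        by (rule weak_jacobian_Lebesgue_point[OF U uc D(1,2,3) x]) (use leb in blast)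
      then show "(u has_derivative (*v) (Du x)) (at x)" using eq x by simp
    qed
  qed
qed

lemma essentially_injective_AE:
  assumes "essentially_injective U u"
  shows "AE y in lebesgue. \<forall>x\<in>U. \<forall>x'\<in>U. u x = y \<longrightarrow> u x' = y \<longrightarrow> x = x'"
proof -
  have 1: "esssup lebesgue (multiplicity_function U u) = 1"
    using assms by (simp add: essentially_injective_def)
  have "AE y in lebesgue. multiplicity_function U u y \<le> 1"
    using esssup_AE[of "multiplicity_function U u" lebesgue] unfolding 1 .
  then show ?thesis
  proof (rule AE_mp, intro AE_I2 impI ballI)
    fix y x x' assume m: "multiplicity_function U u y \<le> 1" and x: "x \<in> U" "x' \<in> U" "u x = y" "u x' = y"
    show "x = x'"
    proof (rule ccontr)
      assume ne: "x \<noteq> x'"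
      have "emeasure (count_space UNIV) {x, x'} \<le> multiplicity_function U u y"
        unfolding multiplicity_function_def using x by (intro emeasure_mono) auto
      moreover have "emeasure (count_space UNIV) {x, x'} = 2"
        using ne by (subst emeasure_count_space_finite) auto
      ultimately have "2 \<le> multiplicity_function U u y" by simp
      then have "(2::ennreal) \<le> 1" using m by (rule order_trans)
      then show False by simp
    qed
  qed
qed

text \<open>Near a point with invertible derivative, \<open>u\<close> expands distances by a factor \<open>1/k\<close>; on small pieces
  of the set where this holds with fixed \<open>k\<close>, the map has a Lipschitz inverse.\<close>

lemma negligible_preimage:
  fixes u :: "real^'n \<Rightarrow> real^'n"
  assumes d: "\<And>x. x \<in> G \<Longrightarrow> (u has_derivative (*v) (D x)) (at x)" and det: "\<And>x. x \<in> G \<Longrightarrow> det (D x) \<noteq> 0"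
    and N: "negligible N"
  shows "negligible (G \<inter> u -` N)"
proof -
  define E where "E k = {x\<in>G. \<forall>y. norm (y - x) < 1 / real (Suc k) \<longrightarrow> norm (y - x) \<le> real (Suc k) * norm (u y - u x)}" for k
  have cover: "\<exists>k. x \<in> E k" if x: "x \<in> G" for x
  proof -
    have "inj ((*v) (D x))" using det[OF x] by (simp add: invertible_det_nz[symmetric] invertible_left_inverse matrix_left_invertible_injective)
    then obtain B where B: "0 < B" "\<And>h. B * norm h \<le> norm (D x *v h)"
      using linear_inj_bounded_below_pos[of "(*v) (D x)"] matrix_vector_mul_linear[of "D x"] by metis
    have "\<exists>d>0. \<forall>y. norm (y - x) < d \<longrightarrow> norm (u y - u x - D x *v (y - x)) \<le> B / 2 * norm (y - x)"
      using d[OF x] B(1) unfolding has_derivative_at_alt by (metis half_gt_zero)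
    then obtain \<delta> where \<delta>: "0 < \<delta>" "\<And>y. norm (y - x) < \<delta> \<Longrightarrow> norm (u y - u x - D x *v (y - x)) \<le> B / 2 * norm (y - x)"
      by blast
    \<comment> \<open>Large enough that \<open>1 / real (Suc k)\<close> is a radius on which the
      linearisation error is at most half of the lower bound \<open>B\<close>, and that it is itself
      smaller than the remaining \<open>B / 2\<close>.\<close>
    obtain k where k: "1 / real (Suc k) < min \<delta> (B / 2)" using nat_approx_posE[of "min \<delta> (B / 2)"] \<delta>(1) B(1) by auto
    have "norm (y - x) \<le> real (Suc k) * norm (u y - u x)" if y: "norm (y - x) < 1 / real (Suc k)" for y
    proof -
      have "norm (D x *v (y - x)) \<le> norm (u y - u x) + norm (u y - u x - D x *v (y - x))"
        using norm_triangle_ineq4[of "u y - u x" "u y - u x - D x *v (y - x)"] by simp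
      also have "\<dots> \<le> norm (u y - u x) + B / 2 * norm (y - x)" using \<delta>(2)[of y] y k by simp
      finally have "B / 2 * norm (y - x) \<le> norm (u y - u x)" using B(2)[of "y - x"] by simp
      moreover have "1 / real (Suc k) * norm (y - x) \<le> B / 2 * norm (y - x)" using k by (intro mult_right_mono) auto
      ultimately have "1 / real (Suc k) * norm (y - x) \<le> norm (u y - u x)" by linarith
      then show ?thesis by (simp add: field_simps)
    qed
    then show ?thesis using x unfolding E_def by blast
  qed
  have "negligible (E k \<inter> u -` N)" for k
  proof (subst locally_negligible_alt, intro ballI)
    fix z assume z: "z \<in> E k \<inter> u -` N"
    \<comment> \<open>Half the radius, so that any two points of the piece are close enough to each
      other for the expansion estimate.\<close>
    define A where "A = (E k \<inter> u -` N) \<inter> ball z (1 / (2 * real (Suc k)))"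
    have low: "norm (y - x) \<le> real (Suc k) * norm (u y - u x)" if "x \<in> A" "y \<in> A" for x y
    proof -
      have "dist y x \<le> dist z y + dist z x" by (rule dist_triangle3)
      also have "\<dots> < 1 / (2 * real (Suc k)) + 1 / (2 * real (Suc k))" using that unfolding A_def by (intro add_strict_mono) auto
      also have "\<dots> = 1 / real (Suc k)" by (simp add: field_simps)
      finally have "norm (y - x) < 1 / real (Suc k)" by (simp add: dist_norm)
      then show ?thesis using that(1) unfolding A_def E_def by blast
    qed
    have inj: "inj_on u A"
    proof (rule inj_onI)
      fix x y assume "x \<in> A" "y \<in> A" "u x = u y"
      then show "x = y" using low[of x y] by simp
    qed
    have "negligible (inv_into A u ` (u ` A))"
    proof (rule negligible_locally_Lipschitz_image)
      show "negligible (u ` A)" by (rule negligible_subset[OF N]) (auto simp: A_def)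
      fix p assume p: "p \<in> u ` A"
      have "norm (inv_into A u q - inv_into A u p) \<le> real (Suc k) * norm (q - p)" if q: "q \<in> u ` A" for q
        using low[OF inv_into_into[OF p] inv_into_into[OF q]] by (simp add: f_inv_into_f[OF p] f_inv_into_f[OF q])
      then show "\<exists>T B. open T \<and> p \<in> T \<and> (\<forall>q\<in>u ` A \<inter> T. norm (inv_into A u q - inv_into A u p) \<le> B * norm (q - p))"
        by (intro exI[of _ UNIV] exI[of _ "real (Suc k)"]) simp
    qed simp
    moreover have "inv_into A u ` (u ` A) = A" using inj by simp
    ultimately have "negligible A" by simp
    moreover have "openin (top_of_set (E k \<inter> u -` N)) A" unfolding A_def by (rule openin_open_Int) simp
    moreover have "z \<in> A" using z by (simp add: A_def)
    ultimately show "\<exists>U. openin (top_of_set (E k \<inter> u -` N)) U \<and> z \<in> U \<and> negligible U" by blast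
  qed
  then have "negligible (\<Union>k. E k \<inter> u -` N)" by (rule negligible_Union_nat)
  then show ?thesis by (rule negligible_subset) (use cover in blast)
qed

section \<open>The area formula for essentially injective maps\<close>

lemma continuous_on_det: "continuous_on S (det :: real^'n^'n \<Rightarrow> real)"
  unfolding det_def[abs_def] by (intro continuous_intros)

text \<open>Two null sets are discarded from \<open>U\<close>: the points without the expected
  classical derivative, and the points whose value is attained more than once. What remains is
  \<open>X\<close>, on which \<open>u\<close> is injective and differentiable, so the injective
  change of variables applies to each of its measurable subsets.\<close>

theorem area_formula:
  fixes u :: "real^'n \<Rightarrow> real^'n"
  assumes U: "open U" "bounded U" and u: "u \<in> W_1_infinity U" and Du: "has_weak_jacobian U u Du"
    and inj: "essentially_injective U u" and l: "0 < l"
    and J: "AE x in lebesgue_on U. l \<le> det (Du x) \<and> det (Du x) \<le> \<Lambda>"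
  obtains X V where "X \<in> sets lebesgue" "X \<subseteq> U" "negligible (U - X)" "V = u ` X" "V \<in> sets lebesgue"
    "\<And>B. B \<in> sets borel \<Longrightarrow> emeasure lebesgue (V \<inter> B) =
      (\<integral>\<^sup>+x. ennreal (det (Du x)) * indicator (U \<inter> u -` B) x \<partial>lebesgue)"
    "(\<lambda>x. indicator U x * det (Du x)) \<in> borel_measurable lebesgue"
    "\<And>x. x \<in> X \<Longrightarrow> (u has_derivative (*v) (Du x)) (at x)"
proof -
  have Um: "U \<in> sets lebesgue" using borel_open[OF U(1)] by simp
  have uc: "continuous_on U u" using u by (simp add: W_1_infinity_def)
  obtain D M where D: "has_weak_jacobian U u D" "D \<in> borel_measurable lebesgue" "\<And>x. norm (D x) \<le> M"
    using weak_jacobian_bounded_version[OF U(1) u] by metis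
  \<comment> \<open>Agreement with the bounded version \<open>D\<close> is included so that
    \<open>det (Du x)\<close> can be replaced by a function that is measurable everywhere.\<close>
  define good where "good x \<longleftrightarrow> (u has_derivative (*v) (Du x)) (at x) \<and> D x = Du x \<and> l \<le> det (Du x) \<and> det (Du x) \<le> \<Lambda>" for x
  define G where "G = {x\<in>U. good x}"
  have AEg: "AE x in lebesgue. x \<in> U \<longrightarrow> good x"
    using W_1_infinity_AE_derivative[OF U(1) u Du] weak_jacobian_unique[OF U(1) D(1) Du] J[unfolded AE_lebesgue_on_iff[OF Um]]
    by eventually_elim (simp add: good_def)
  define N where "N = {y. \<not> (\<forall>x\<in>U. \<forall>x'\<in>U. u x = y \<longrightarrow> u x' = y \<longrightarrow> x = x')}"
  have N: "negligible N"
    using AE_imp_negligible[of UNIV "\<lambda>y. \<forall>x\<in>U. \<forall>x'\<in>U. u x = y \<longrightarrow> u x' = y \<longrightarrow> x = x'"] essentially_injective_AE[OF inj]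
    by (simp add: N_def)
  \<comment> \<open>Multiple values form a null set in the target. Its preimage is null as well,
    because the determinant is at least \<open>l > 0\<close> at good points.\<close>
  define X where "X = G - u -` N"
  have XU: "X \<subseteq> U" by (auto simp: X_def G_def)
  have Xg: "good x" if "x \<in> X" for x using that by (simp add: X_def G_def)
  have "negligible (G \<inter> u -` N)"
  proof (rule negligible_preimage[OF _ _ N])
    fix x assume "x \<in> G"
    then have "good x" by (simp add: G_def)
    then show "(u has_derivative (*v) (Du x)) (at x)" "det (Du x) \<noteq> 0" using l by (auto simp: good_def)
  qed
  moreover have "negligible {x\<in>U. \<not> good x}" by (rule AE_imp_negligible[OF AEg])
  ultimately have "negligible ({x\<in>U. \<not> good x} \<union> (G \<inter> u -` N))" by (intro negligible_Un)
  moreover have "U - X = {x\<in>U. \<not> good x} \<union> (G \<inter> u -` N)" by (auto simp: X_def G_def)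
  ultimately have UX: "negligible (U - X)" by simp
  have Xm: "X \<in> sets lebesgue"
  proof -
    have "U - X \<in> sets lebesgue" using UX by (simp add: negligible_imp_sets)
    then have "U - (U - X) \<in> sets lebesgue" using Um by (rule sets.Diff[rotated])
    moreover have "U - (U - X) = X" using XU by blast
    ultimately show ?thesis by simp
  qed
  have injX: "inj_on u X"
    unfolding inj_on_def X_def N_def G_def by blast
  have detm: "(\<lambda>x. det (D x)) \<in> borel_measurable lebesgue"
    by (rule borel_measurable_continuous_on[OF continuous_on_det D(2)])
  have image: "u ` S \<in> sets lebesgue \<and> emeasure lebesgue (u ` S) = (\<integral>\<^sup>+x. ennreal (det (Du x)) * indicator S x \<partial>lebesgue)"
    if S: "S \<in> sets lebesgue" "S \<subseteq> X" for S
  proof -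
    define f where "f x = indicator S x * det (D x)" for x
    have f0: "0 \<le> f x" "f x \<le> max 0 \<Lambda> * indicator S x" for x
      using Xg[of x] S(2) l by (auto simp: f_def indicator_def good_def)
    have fm: "f \<in> borel_measurable lebesgue" unfolding f_def using S(1) detm by (intro borel_measurable_times) auto
    have Sb: "bounded S" using S(2) XU U(2) by (meson bounded_subset order_trans)
    then have "S \<in> lmeasurable" using S(1) bounded_set_imp_lmeasurable by blast
    then have "emeasure lebesgue S < \<infinity>"
      by (simp only: emeasure_eq_measure2 ennreal_less_top infinity_ennreal_def)
    have "(\<integral>\<^sup>+x. ennreal (f x) \<partial>lebesgue) \<le> (\<integral>\<^sup>+x. ennreal (max 0 \<Lambda>) * indicator S x \<partial>lebesgue)"
    proof (rule nn_integral_mono)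
      fix x show "ennreal (f x) \<le> ennreal (max 0 \<Lambda>) * indicator S x"
        using f0(2)[of x] by (cases "x \<in> S") (auto simp: f_def intro: ennreal_leI)
    qed
    also have "\<dots> = ennreal (max 0 \<Lambda>) * emeasure lebesgue S" using S(1) by (rule nn_integral_cmult_indicator)
    also have "\<dots> < \<infinity>" using \<open>emeasure lebesgue S < \<infinity>\<close> by (simp add: ennreal_mult_less_top)
    finally obtain m where m: "(\<integral>\<^sup>+x. ennreal (f x) \<partial>lebesgue) = ennreal m" "0 \<le> m" by (metis ennreal_cases infinity_ennreal_def less_irrefl)
    have "(f has_integral m) UNIV"
      using has_integral_iff_nn_integral_lebesgue[of f m] f0(1) fm m by auto
    moreover have "f = (\<lambda>x. if x \<in> S then \<bar>det (D x)\<bar> else 0)"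
    proof
      fix x show "f x = (if x \<in> S then \<bar>det (D x)\<bar> else 0)"
        using f0(1)[of x] by (cases "x \<in> S") (simp_all add: f_def)
    qed
    ultimately have hi: "((\<lambda>x. \<bar>det (D x)\<bar>) has_integral m) S" by (simp add: has_integral_restrict_UNIV)
    have "(u has_derivative (*v) (D x)) (at x within S)" if "x \<in> S" for x

    proof -
      have "good x" using that S(2) by (intro Xg) blast
      then have "(u has_derivative (*v) (D x)) (at x)" by (simp add: good_def)
      then show ?thesis by (rule has_derivative_at_withinI)
    qed
    moreover have "bounded (u ` S)" using W_1_infinity_bounded[OF U(1) u] by (rule bounded_subset) (use S(2) XU in blast)
    moreover have "inj_on u S" using injX S(2) by (rule inj_on_subset)
    ultimately have *: "u ` S \<in> lmeasurable" "measure lebesgue (u ` S) = m"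
      using measure_differentiable_image_finite[OF S(1) Sb _ _ hi] by blast+
    then have "emeasure lebesgue (u ` S) = ennreal m" by (simp add: emeasure_eq_measure2)
    also have "\<dots> = (\<integral>\<^sup>+x. ennreal (det (Du x)) * indicator S x \<partial>lebesgue)"
      unfolding m(1)[symmetric]
    proof (rule nn_integral_cong)
      fix x show "ennreal (f x) = ennreal (det (Du x)) * indicator S x"
        using Xg[of x] S(2) by (cases "x \<in> S") (auto simp: f_def good_def)
    qed
    finally show ?thesis using *(1) by (auto simp: fmeasurable_def)
  qed
  show thesis
  proof (rule that[OF Xm XU UX refl])
    show "u ` X \<in> sets lebesgue" using image[OF Xm] by blast
    show "(u has_derivative (*v) (Du x)) (at x)" if "x \<in> X" for x using Xg[OF that] by (simp add: good_def)
    have "(\<lambda>x. indicator U x * det (D x)) \<in> borel_measurable lebesgue" using Um detm by (intro borel_measurable_times) auto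
    moreover have "AE x in lebesgue. indicator U x * det (D x) = indicator U x * det (Du x)"
      using AEg by (rule AE_mp) (auto intro!: AE_I2 simp: good_def indicator_def)
    ultimately show "(\<lambda>x. indicator U x * det (Du x)) \<in> borel_measurable lebesgue"
      by (rule borel_measurable_AE)
    fix B :: "(real^'n) set" assume B: "B \<in> sets borel"
    define S where "S = X \<inter> u -` B"
    have "u \<in> borel_measurable (lebesgue_on U)" using uc Um by (rule continuous_imp_measurable_on_sets_lebesgue)
    then have "U \<inter> u -` B \<in> sets lebesgue"
      using B borel_measurable_lebesgue_on_preimage_borel[OF Um, of u] by (simp add: vimage_def Int_def)
    then have "X \<inter> (U \<inter> u -` B) \<in> sets lebesgue" using Xm by (rule sets.Int[rotated])
    moreover have "X \<inter> (U \<inter> u -` B) = S" using XU by (auto simp: S_def)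
    ultimately have Sm: "S \<in> sets lebesgue" by simp
    have "u ` X \<inter> B = u ` S" by (auto simp: S_def)
    then have "emeasure lebesgue (u ` X \<inter> B) = (\<integral>\<^sup>+x. ennreal (det (Du x)) * indicator S x \<partial>lebesgue)"
      using image[OF Sm] by (simp add: S_def)
    also have "\<dots> = (\<integral>\<^sup>+x. ennreal (det (Du x)) * indicator (U \<inter> u -` B) x \<partial>lebesgue)"
    proof (rule nn_integral_cong_AE)
      have "AE x in lebesgue. x \<notin> U - X" using UX by (intro AE_not_in) (simp add: negligible_iff_null_sets)
      then show "AE x in lebesgue. ennreal (det (Du x)) * indicator S x = ennreal (det (Du x)) * indicator (U \<inter> u -` B) x"
        by (rule AE_mp) (use XU in \<open>auto intro!: AE_I2 simp: S_def indicator_def\<close>)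
    qed
    finally show "emeasure lebesgue (u ` X \<inter> B) = (\<integral>\<^sup>+x. ennreal (det (Du x)) * indicator (U \<inter> u -` B) x \<partial>lebesgue)" .
  qed
qed

section \<open>Transport along lines\<close>

text \<open>Young's inequality for \<open>p\<close> and the conjugate exponent
  \<open>p / (p - 1)\<close>, applied to \<open>a\<close> and \<open>b powr (p - 1)\<close>. In this
  form the conjugate exponent never appears.\<close>

lemma Young_powr:
  fixes a b p :: real
  assumes p: "1 < p" and a: "0 \<le> a" and b: "0 \<le> b"
  shows "a * b powr (p - 1) \<le> a powr p / p + (p - 1) / p * b powr p"
proof -
  define q where "q = p / (p - 1)"
  have q: "1 < q" "1 / p + 1 / q = 1" "(p - 1) * q = p" "1 / q = (p - 1) / p"
    using p by (auto simp: q_def field_simps)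
  have "a * b powr (p - 1) \<le> a powr p / p + (b powr (p - 1)) powr q / q"
    using p a q by (intro Youngs_inequality) auto
  also have "(b powr (p - 1)) powr q / q = (p - 1) / p * b powr p"
    using q(3) by (simp add: powr_powr q(4)[symmetric])
  finally show ?thesis .
qed

lemma nn_lborel_shift:
  fixes f :: "'a::euclidean_space \<Rightarrow> ennreal"
  assumes "f \<in> borel_measurable borel"
  shows "(\<integral>\<^sup>+x. f (v + x) \<partial>lborel) = (\<integral>\<^sup>+x. f x \<partial>lborel)"
proof -
  have "integral\<^sup>N (distr lborel borel ((+) v)) f = (\<integral>\<^sup>+x. f (v + x) \<partial>lborel)"
    by (rule nn_integral_distr) (use assms in auto)
  then show ?thesis unfolding lborel_distr_plus by (rule sym)
qed

text \<open>The slab \<open>0 \<le> z \<bullet> e \<le> 1\<close> meets every line in direction \<open>e\<close> in a set of length one.\<close>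

lemma nn_integral_lines:
  fixes F :: "'a::euclidean_space \<Rightarrow> ennreal"
  assumes F [measurable]: "F \<in> borel_measurable borel" and e: "norm e = 1"
  shows "(\<integral>\<^sup>+y. F y \<partial>lborel) = (\<integral>\<^sup>+z. indicator {0..1} (z \<bullet> e) * (\<integral>\<^sup>+t. F (z + t *\<^sub>R e) \<partial>lborel) \<partial>lborel)"
proof -
  have [measurable]: "(\<lambda>y. indicator {0..1} (y \<bullet> e) :: ennreal) \<in> borel_measurable borel" by measurable
  have "(\<integral>\<^sup>+z. indicator {0..1} (z \<bullet> e) * (\<integral>\<^sup>+t. F (z + t *\<^sub>R e) \<partial>lborel) \<partial>lborel) =
    (\<integral>\<^sup>+z. \<integral>\<^sup>+t. indicator {0..1} (z \<bullet> e) * F (z + t *\<^sub>R e) \<partial>lborel \<partial>lborel)"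
    by (intro nn_integral_cong nn_integral_cmult[symmetric]) measurable
  also have "\<dots> = (\<integral>\<^sup>+t. \<integral>\<^sup>+z. indicator {0..1} (z \<bullet> e) * F (z + t *\<^sub>R e) \<partial>lborel \<partial>lborel)"
    by (rule lborel_pair.Fubini'[symmetric]) measurable
  also have "\<dots> = (\<integral>\<^sup>+t. \<integral>\<^sup>+y. indicator {0..1} (y \<bullet> e - t) * F y \<partial>lborel \<partial>lborel)"
  proof (rule nn_integral_cong)
    fix t :: real
    have "(\<integral>\<^sup>+y. indicator {0..1} (y \<bullet> e - t) * F y \<partial>lborel) = (\<integral>\<^sup>+z. indicator {0..1} ((t *\<^sub>R e + z) \<bullet> e - t) * F (t *\<^sub>R e + z) \<partial>lborel)"
      by (rule nn_lborel_shift[symmetric]) measurable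
    also have "\<dots> = (\<integral>\<^sup>+z. indicator {0..1} (z \<bullet> e) * F (z + t *\<^sub>R e) \<partial>lborel)"
      using e by (simp add: inner_add_left add.commute dot_square_norm)
    finally show "(\<integral>\<^sup>+z. indicator {0..1} (z \<bullet> e) * F (z + t *\<^sub>R e) \<partial>lborel) = (\<integral>\<^sup>+y. indicator {0..1} (y \<bullet> e - t) * F y \<partial>lborel)" ..
  qed
  also have "\<dots> = (\<integral>\<^sup>+y. \<integral>\<^sup>+t. indicator {0..1} (y \<bullet> e - t) * F y \<partial>lborel \<partial>lborel)"
    by (rule lborel_pair.Fubini') measurable
  also have "\<dots> = (\<integral>\<^sup>+y. F y \<partial>lborel)"
  proof (rule nn_integral_cong)
    fix y :: 'a
    have "(\<integral>\<^sup>+t. indicator {0..1} (y \<bullet> e - t) * F y \<partial>lborel) = (\<integral>\<^sup>+t. F y * indicator {y \<bullet> e - 1..y \<bullet> e} t \<partial>lborel)"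
      by (intro nn_integral_cong) (auto simp: indicator_def)
    also have "\<dots> = F y" by (subst nn_integral_cmult_indicator) auto
    finally show "(\<integral>\<^sup>+t. indicator {0..1} (y \<bullet> e - t) * F y \<partial>lborel) = F y" .
  qed
  finally show ?thesis ..
qed

text \<open>The map \<open>\<Phi> t = t + \<integral> w\<close> over the half-line up to
  \<open>t\<close> is nondecreasing with increments equal to the integral of \<open>1 + w\<close>,
  so it pushes the density \<open>1 + w\<close> to Lebesgue measure. It can be constant on intervals
  where \<open>w = - 1\<close>; the proof therefore avoids an inverse and compares measures on
  intervals.\<close>

lemma transport_real_line:
  fixes w :: "real \<Rightarrow> real"
  assumes w [measurable]: "w \<in> borel_measurable borel" and int: "integrable lborel w"
    and K: "\<And>s. \<bar>w s\<bar> \<le> K" and w1: "\<And>s. - 1 \<le> w s" and F [measurable]: "F \<in> borel_measurable borel"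
  shows "(\<integral>\<^sup>+t. F (t + (LINT s|lborel. w s * indicator {..t} s)) * ennreal (1 + w t) \<partial>lborel) = (\<integral>\<^sup>+t. F t \<partial>lborel)"
proof -
  define \<Phi> where "\<Phi> t = t + (LINT s|lborel. w s * indicator {..t} s)" for t
  have iw: "integrable lborel (\<lambda>s. w s * indicator A s)" if "A \<in> sets borel" for A
    using integrable_mult_indicator[OF _ int, of A] that by (simp add: mult.commute)
  have inc: "\<Phi> b - \<Phi> a = (LINT s|lborel. (1 + w s) * indicator {a<..b} s)" if "a \<le> b" for a b
  proof -
    have "(LINT s|lborel. w s * indicator {..b} s) - (LINT s|lborel. w s * indicator {..a} s) =
      (LINT s|lborel. w s * indicator {..b} s - w s * indicator {..a} s)"
      by (rule Bochner_Integration.integral_diff[symmetric]) (auto intro: iw)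
    also have "\<dots> = (LINT s|lborel. w s * indicator {a<..b} s)"
      using that by (intro Bochner_Integration.integral_cong) (auto simp: indicator_def)
    finally have 1: "(LINT s|lborel. w s * indicator {..b} s) - (LINT s|lborel. w s * indicator {..a} s) =
      (LINT s|lborel. w s * indicator {a<..b} s)" .
    have "(LINT s|lborel. (1 + w s) * indicator {a<..b} s) = (LINT s|lborel. indicator {a<..b} s + w s * indicator {a<..b} s)"
      by (simp add: distrib_right)
    also have "\<dots> = (LINT s|lborel. indicator {a<..b} s) + (LINT s|lborel. w s * indicator {a<..b} s)"
      by (rule Bochner_Integration.integral_add) (use that in \<open>auto intro!: iw integrable_real_indicator\<close>)
    also have "(LINT s|lborel. indicator {a<..b} s) = b - a" using that by simp
    finally show ?thesis using 1 by (simp add: \<Phi>_def)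
  qed
  have mono: "\<Phi> a \<le> \<Phi> b" if "a \<le> b" for a b
  proof -
    have "0 \<le> 1 + w s" for s using w1[of s] by linarith
    then have "0 \<le> (LINT s|lborel. (1 + w s) * indicator {a<..b} s)"
      by (intro Bochner_Integration.integral_nonneg mult_nonneg_nonneg) simp_all
    then show ?thesis using inc[OF that] by simp
  qed
  have lip: "\<Phi> b - \<Phi> a \<le> (1 + K) * (b - a)" if "a \<le> b" for a b
  proof -
    have "(LINT s|lborel. (1 + w s) * indicator {a<..b} s) \<le> (LINT s|lborel. (1 + K) * indicator {a<..b} s)"
    proof (rule integral_mono_AE')
      show "integrable lborel (\<lambda>s. (1 + K) * indicator {a<..b} s)"
        using that by (intro integrable_mult_right integrable_real_indicator) auto
      show "AE s in lborel. (1 + w s) * indicator {a<..b} s \<le> (1 + K) * indicator {a<..b} s"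
        using K by (intro AE_I2 mult_right_mono) (auto simp: abs_le_iff)
      show "AE s in lborel. 0 \<le> (1 + K) * indicator {a<..b} s"
        using K[of 0] by (intro AE_I2 mult_nonneg_nonneg) auto
    qed
    also have "\<dots> = (1 + K) * (b - a)" using that by simp
    finally show ?thesis using inc[OF that] by simp
  qed
  have cont: "continuous_on A \<Phi>" for A
  proof -
    have "dist (\<Phi> x) (\<Phi> y) \<le> (1 + K) * dist x y" for x y
      using lip[of x y] lip[of y x] mono[of x y] mono[of y x] by (cases "x \<le> y") (auto simp: dist_real_def)
    moreover have "0 \<le> 1 + K" using K[of 0] by simp
    ultimately have "(1 + K)-lipschitz_on A \<Phi>" by (intro lipschitz_onI) auto
    then show ?thesis by (rule lipschitz_on_continuous_on)
  qed
  \<comment> \<open>The displacement is at most the total mass of the absolute value of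
    \<open>w\<close>. Together with continuity this makes \<Phi> surjective.\<close>
  define C where "C = (LINT s|lborel. \<bar>w s\<bar>)"
  have near: "\<bar>\<Phi> t - t\<bar> \<le> C" for t
  proof -
    have "\<bar>LINT s|lborel. w s * indicator {..t} s\<bar> \<le> (LINT s|lborel. \<bar>w s\<bar>)"
      using int by (intro Bochner_Integration.integral_abs_bound_integral iw) (auto simp: indicator_def)
    then show ?thesis by (simp add: \<Phi>_def C_def)
  qed
  have surj: "\<exists>t. \<Phi> t = c" for c
  proof -
    have "\<exists>t\<ge>c - C. t \<le> c + C \<and> \<Phi> t = c"
      by (rule IVT') (use near[of "c - C"] near[of "c + C"] near[of c] cont in auto)
    then show ?thesis by blast
  qed
  have [measurable]: "\<Phi> \<in> borel_measurable borel" using cont by (rule borel_measurable_continuous_onI)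
  let ?M = "distr (density lborel (\<lambda>t. ennreal (1 + w t))) borel \<Phi>"
  have "lborel = ?M"
  proof (rule lborel_eqI)
    fix l u :: real assume lu: "\<And>b. b \<in> Basis \<Longrightarrow> l \<bullet> b \<le> u \<bullet> b"
    then have lu: "l \<le> u" by simp
    have em: "emeasure ?M (box l u) = (\<integral>\<^sup>+t. ennreal (1 + w t) * indicator {t. l < \<Phi> t \<and> \<Phi> t < u} t \<partial>lborel)"
    proof -
      have m: "\<Phi> -` {l<..<u} \<in> sets borel" using measurable_sets[of \<Phi> borel borel "{l<..<u}"] by simp
      have "emeasure ?M (box l u) = emeasure (density lborel (\<lambda>t. ennreal (1 + w t))) (\<Phi> -` {l<..<u})"
        by (subst emeasure_distr) (simp_all add: box_real)
      also have "\<dots> = (\<integral>\<^sup>+t. ennreal (1 + w t) * indicator (\<Phi> -` {l<..<u}) t \<partial>lborel)"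
        by (rule emeasure_density) (use m in simp_all)
      also have "\<dots> = (\<integral>\<^sup>+t. ennreal (1 + w t) * indicator {t. l < \<Phi> t \<and> \<Phi> t < u} t \<partial>lborel)"
        by (rule nn_integral_cong) (simp add: indicator_def)
      finally show ?thesis .
    qed
    have "emeasure ?M (box l u) = ennreal (u - l)"
    proof (cases "l = u")
      case True then show ?thesis by simp
    next
      case False
      then have lu': "l < u" using lu by simp
      \<comment> \<open>Because of possible flat pieces the preimage of the open interval is
        delimited by the last point at level at most \<open>l\<close> and the first point at level
        at least \<open>u\<close>.\<close>
      define \<alpha> where "\<alpha> = Sup {t. \<Phi> t \<le> l}"
      define \<beta> where "\<beta> = Inf {t. u \<le> \<Phi> t}"
      obtain a0 b0 where ab0: "\<Phi> a0 = l" "\<Phi> b0 = u" using surj by metis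
      have bdd: "bdd_above {t. \<Phi> t \<le> l}" "bdd_below {t. u \<le> \<Phi> t}"
      proof -
        show "bdd_above {t. \<Phi> t \<le> l}" by (rule bdd_aboveI[of _ "l + C"]) (use near in \<open>auto simp: abs_le_iff, smt (verit, best) near\<close>)
        show "bdd_below {t. u \<le> \<Phi> t}" by (rule bdd_belowI[of _ "u - C"]) (use near in \<open>auto simp: abs_le_iff, smt (verit, best) near\<close>)
      qed
      have cl: "closed {t. \<Phi> t \<le> l}" "closed {t. u \<le> \<Phi> t}"
        using cont by (auto intro!: closed_Collect_le continuous_intros)
      have \<alpha>: "\<Phi> \<alpha> = l"
      proof -
        have "\<alpha> \<in> {t. \<Phi> t \<le> l}" unfolding \<alpha>_def by (rule closed_contains_Sup) (use ab0 bdd cl in auto)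
        moreover have "a0 \<le> \<alpha>" unfolding \<alpha>_def by (rule cSup_upper) (use ab0 bdd in auto)
        ultimately show ?thesis using mono[of a0 \<alpha>] ab0 by simp
      qed
      have \<beta>: "\<Phi> \<beta> = u"
      proof -
        have "\<beta> \<in> {t. u \<le> \<Phi> t}" unfolding \<beta>_def by (rule closed_contains_Inf) (use ab0 bdd cl in auto)
        moreover have "\<beta> \<le> b0" unfolding \<beta>_def by (rule cInf_lower) (use ab0 bdd in auto)
        ultimately show ?thesis using mono[of \<beta> b0] ab0 by simp
      qed
      have set: "{t. l < \<Phi> t \<and> \<Phi> t < u} = {\<alpha><..<\<beta>}"
      proof (intro set_eqI iffI)
        fix t assume "t \<in> {t. l < \<Phi> t \<and> \<Phi> t < u}"
        then show "t \<in> {\<alpha><..<\<beta>}" using mono[of t \<alpha>] mono[of \<beta> t] \<alpha> \<beta> by (auto simp: not_le[symmetric])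
      next
        fix t assume t: "t \<in> {\<alpha><..<\<beta>}"
        have "\<not> \<Phi> t \<le> l"
        proof
          assume "\<Phi> t \<le> l"
          then have "t \<le> \<alpha>" unfolding \<alpha>_def by (intro cSup_upper bdd) simp
          with t show False by simp
        qed
        moreover have "\<not> u \<le> \<Phi> t"
        proof
          assume "u \<le> \<Phi> t"
          then have "\<beta> \<le> t" unfolding \<beta>_def by (intro cInf_lower bdd) simp
          with t show False by simp
        qed
        ultimately show "t \<in> {t. l < \<Phi> t \<and> \<Phi> t < u}" by simp
      qed
      have \<alpha>\<beta>: "\<alpha> \<le> \<beta>" using mono[of \<beta> \<alpha>] \<alpha> \<beta> lu' by (meson linear not_le)
      have "emeasure ?M (box l u) = (\<integral>\<^sup>+t. ennreal ((1 + w t) * indicator {\<alpha><..\<beta>} t) \<partial>lborel)"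
        unfolding em set
      proof (rule nn_integral_cong_AE)
        show "AE t in lborel. ennreal (1 + w t) * indicator {\<alpha><..<\<beta>} t = ennreal ((1 + w t) * indicator {\<alpha><..\<beta>} t)"
          using AE_lborel_singleton[of \<beta>] by (rule AE_mp) (auto intro!: AE_I2 simp: indicator_def)
      qed
      also have "\<dots> = ennreal (LINT t|lborel. (1 + w t) * indicator {\<alpha><..\<beta>} t)"
      proof (rule nn_integral_eq_integral)
        have "integrable lborel (\<lambda>t. indicator {\<alpha><..\<beta>} t + w t * indicator {\<alpha><..\<beta>} t)"
          using \<alpha>\<beta> by (intro Bochner_Integration.integrable_add iw integrable_real_indicator) auto
        then show "integrable lborel (\<lambda>t. (1 + w t) * indicator {\<alpha><..\<beta>} t)" by (simp add: algebra_simps)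
        have "0 \<le> 1 + w t" for t using w1[of t] by simp
        then show "AE t in lborel. 0 \<le> (1 + w t) * indicator {\<alpha><..\<beta>} t" by (intro AE_I2 mult_nonneg_nonneg) auto
      qed
      also have "\<dots> = ennreal (u - l)" using inc[OF \<alpha>\<beta>] \<alpha> \<beta> by simp
      finally show ?thesis .
    qed
    then show "emeasure ?M (box l u) = (\<Prod>b\<in>Basis. (u - l) \<bullet> b)" by simp
  qed simp
  then have "(\<integral>\<^sup>+t. F t \<partial>lborel) = (\<integral>\<^sup>+t. F t \<partial>?M)" by simp
  also have "\<dots> = (\<integral>\<^sup>+t. F (\<Phi> t) \<partial>density lborel (\<lambda>t. ennreal (1 + w t)))" by (rule nn_integral_distr) measurable
  also have "\<dots> = (\<integral>\<^sup>+t. ennreal (1 + w t) * F (\<Phi> t) \<partial>lborel)" by (rule nn_integral_density) measurable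
  finally show ?thesis by (simp add: \<Phi>_def mult.commute)
qed

text \<open>Jensen's inequality on an interval of length \<open>L\<close>: Young's inequality
  between \<open>f t\<close> and the mean \<open>c\<close> of \<open>f\<close>, integrated over the
  interval. With this choice of \<open>c\<close> the two sides match and the stated constant
  results.\<close>

lemma powr_integral_interval_le:
  fixes f :: "real \<Rightarrow> real"
  assumes p: "1 < p" and L: "0 < L" and f [measurable]: "f \<in> borel_measurable borel" and f0: "\<And>t. 0 \<le> f t" and K: "\<And>t. f t \<le> K"
    and J: "\<And>t. t \<notin> {a..a + L} \<Longrightarrow> f t = 0"
  shows "integrable lborel f" "integrable lborel (\<lambda>t. f t powr p)"
    "(LINT t|lborel. f t) powr p \<le> L powr (p - 1) * (LINT t|lborel. f t powr p)"
proof -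
  have iJ: "integrable lborel (\<lambda>t. c * indicator {a..a + L} t)" for c :: real
    using L by (intro integrable_mult_right integrable_real_indicator) auto
  have JL: "(LINT t|lborel. c * indicator {a..a + L} t) = c * L" for c :: real
    using L by simp
  show i1: "integrable lborel f"
  proof (rule Bochner_Integration.integrable_bound[OF iJ[of K]])
    show "AE t in lborel. norm (f t) \<le> norm (K * indicator {a..a + L} t)"
    proof (rule AE_I2)
      fix t show "norm (f t) \<le> norm (K * indicator {a..a + L} t)"
        using f0[of t] K[of t] J[of t] by (cases "t \<in> {a..a + L}") auto
    qed
  qed simp
  show i2: "integrable lborel (\<lambda>t. f t powr p)"
  proof (rule Bochner_Integration.integrable_bound[OF iJ[of "K powr p"]])
    show "AE t in lborel. norm (f t powr p) \<le> norm (K powr p * indicator {a..a + L} t)"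
    proof (rule AE_I2)
      fix t show "norm (f t powr p) \<le> norm (K powr p * indicator {a..a + L} t)"
        using f0[of t] K[of t] J[of t] p by (cases "t \<in> {a..a + L}") (auto intro: powr_mono2)
    qed
  qed simp
  define I where "I = (LINT t|lborel. f t)"
  define c where "c = I / L"
  have I0: "0 \<le> I" using f0 by (simp add: I_def)
  have c0: "0 \<le> c" using I0 L by (simp add: c_def)
  have "(LINT t|lborel. p * c powr (p - 1) * f t) \<le> (LINT t|lborel. f t powr p + (p - 1) * c powr p * indicator {a..a + L} t)"
  proof (rule integral_mono)
    show "integrable lborel (\<lambda>t. p * c powr (p - 1) * f t)" using i1 by (rule integrable_mult_right)
    show "integrable lborel (\<lambda>t. f t powr p + (p - 1) * c powr p * indicator {a..a + L} t)"
      using i2 iJ by (rule Bochner_Integration.integrable_add)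
    fix t
    show "p * c powr (p - 1) * f t \<le> f t powr p + (p - 1) * c powr p * indicator {a..a + L} t"
    proof (cases "t \<in> {a..a + L}")
      case True
      have "p * (f t * c powr (p - 1)) \<le> p * (f t powr p / p + (p - 1) / p * c powr p)"
        using Young_powr[OF p f0 c0, of t] p by (intro mult_left_mono) auto
      also have "\<dots> = f t powr p + (p - 1) * c powr p" using p by (simp add: field_simps)
      finally show ?thesis using True by (simp add: mult_ac)
    next
      case False then show ?thesis using J[OF False] p by simp
    qed
  qed
  also have "\<dots> = (LINT t|lborel. f t powr p) + (p - 1) * c powr p * L"
    unfolding Bochner_Integration.integral_add[OF i2 iJ] JL ..
  finally have *: "p * c powr (p - 1) * I \<le> (LINT t|lborel. f t powr p) + (p - 1) * c powr p * L"
    by (simp add: I_def)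
  have I: "I = c * L" using L by (simp add: c_def)
  have cp: "c powr (p - 1) * c = c powr p"
    using c0 p by (cases "c = 0") (simp_all add: powr_mult_base mult.commute)
  have "p * c powr (p - 1) * I = p * (c powr (p - 1) * c) * L" by (simp add: I)
  also have "\<dots> = (p - 1) * c powr p * L + c powr p * L" unfolding cp by (simp add: algebra_simps)
  finally have "c powr p * L \<le> (LINT t|lborel. f t powr p)" using * by linarith
  then have "L powr (p - 1) * (c powr p * L) \<le> L powr (p - 1) * (LINT t|lborel. f t powr p)" by (intro mult_left_mono) auto
  moreover have "L powr (p - 1) * (c powr p * L) = I powr p"
  proof -
    have "L powr (p - 1) * L = L powr p" using L by (simp add: powr_mult_base mult.commute)
    then show ?thesis using c0 L by (simp add: I powr_mult mult_ac)
  qed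
  ultimately show "(LINT t|lborel. f t) powr p \<le> L powr (p - 1) * (LINT t|lborel. f t powr p)" by (simp add: I_def)
qed

section \<open>The shift in space: transport and its cost\<close>

definition line_shift :: "'a::euclidean_space \<Rightarrow> ('a \<Rightarrow> real) \<Rightarrow> 'a \<Rightarrow> real" where
  "line_shift e w y = (LINT s|lborel. w (y + s *\<^sub>R e) * indicator {..0} s)"

lemma line_shift_measurable [measurable]:
  assumes [measurable]: "w \<in> borel_measurable borel"
  shows "line_shift e w \<in> borel_measurable borel"
proof -
  have "(\<lambda>y. LINT s|lborel. w (y + s *\<^sub>R e) * indicator {..0} s) \<in> borel_measurable borel"
    by (rule lborel.borel_measurable_lebesgue_integral) measurable
  then show ?thesis by (simp add: line_shift_def[abs_def])
qed

lemma line_shift_along: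
  assumes [measurable]: "w \<in> borel_measurable borel"
  shows "line_shift e w (z + t *\<^sub>R e) = (LINT s|lborel. w (z + s *\<^sub>R e) * indicator {..t} s)"
proof -
  have "(LINT s|lborel. w (z + s *\<^sub>R e) * indicator {..t} s) = (LINT s|lborel. w (z + (t + s) *\<^sub>R e) * indicator {..t} (t + s))"
    by (rule lborel_integral_shift[symmetric]) measurable
  also have "\<dots> = line_shift e w (z + t *\<^sub>R e)"
    unfolding line_shift_def by (intro Bochner_Integration.integral_cong) (auto simp: scaleR_add_left add.assoc indicator_def)
  finally show ?thesis ..
qed

text \<open>Projecting to \<open>e\<close> shows that a line can meet the ball only for parameters
  in this interval of length \<open>2 * d\<close>. The interval is used for every line, whether or
  not it meets the ball.\<close>

lemma line_support:
  fixes e :: "'a::euclidean_space"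
  assumes e: "norm e = 1" and w: "\<And>y. y \<notin> cball c d \<Longrightarrow> w y = 0" and t: "t \<notin> {(c - z) \<bullet> e - d..(c - z) \<bullet> e - d + 2 * d}"
  shows "w (z + t *\<^sub>R e) = 0"
proof (rule w)
  have "(z + t *\<^sub>R e - c) \<bullet> e = t - (c - z) \<bullet> e" using e by (simp add: inner_simps dot_square_norm)
  then have "d < \<bar>(z + t *\<^sub>R e - c) \<bullet> e\<bar>" using t by auto
  also have "\<dots> \<le> norm (z + t *\<^sub>R e - c)" using Cauchy_Schwarz_ineq2[of "z + t *\<^sub>R e - c" e] e by simp
  finally show "z + t *\<^sub>R e \<notin> cball c d" by (simp add: dist_norm norm_minus_commute)
qed

text \<open>Points move only within their own line, and on each line the map is the one-dimensional
  transport; Fubini over the lines does the rest.\<close>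

lemma transport_shear:
  fixes e :: "'a::euclidean_space"
  assumes e: "norm e = 1" and w [measurable]: "w \<in> borel_measurable borel" and K: "\<And>y. \<bar>w y\<bar> \<le> K"
    and w1: "\<And>y. - 1 \<le> w y" and d: "0 < d" and supp: "\<And>y. y \<notin> cball c d \<Longrightarrow> w y = 0"
    and F [measurable]: "F \<in> borel_measurable borel"
  shows "(\<integral>\<^sup>+y. F (y + line_shift e w y *\<^sub>R e) * ennreal (1 + w y) \<partial>lborel) = (\<integral>\<^sup>+y. F y \<partial>lborel)"
proof -
  have "(\<integral>\<^sup>+y. F (y + line_shift e w y *\<^sub>R e) * ennreal (1 + w y) \<partial>lborel) =
    (\<integral>\<^sup>+z. indicator {0..1} (z \<bullet> e) * (\<integral>\<^sup>+t. F (z + t *\<^sub>R e + line_shift e w (z + t *\<^sub>R e) *\<^sub>R e) * ennreal (1 + w (z + t *\<^sub>R e)) \<partial>lborel) \<partial>lborel)"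
    by (rule nn_integral_lines[OF _ e]) measurable
  also have "\<dots> = (\<integral>\<^sup>+z. indicator {0..1} (z \<bullet> e) * (\<integral>\<^sup>+t. F (z + t *\<^sub>R e) \<partial>lborel) \<partial>lborel)"
  proof (rule nn_integral_cong)
    fix z :: 'a
    have int: "integrable lborel (\<lambda>s. w (z + s *\<^sub>R e))"
    proof (rule Bochner_Integration.integrable_bound)
      have ls: "w (z + s *\<^sub>R e) = 0" if "s \<notin> {(c - z) \<bullet> e - d..(c - z) \<bullet> e - d + 2 * d}" for s
        by (rule line_support[OF e _ that]) (rule supp)
      show "integrable lborel (\<lambda>s. K * indicator {(c - z) \<bullet> e - d..(c - z) \<bullet> e - d + 2 * d} s)"
        using d by (intro integrable_mult_right integrable_real_indicator) auto
      show "AE s in lborel. norm (w (z + s *\<^sub>R e)) \<le> norm (K * indicator {(c - z) \<bullet> e - d..(c - z) \<bullet> e - d + 2 * d} s)"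
      proof (rule AE_I2)
        fix s show "norm (w (z + s *\<^sub>R e)) \<le> norm (K * indicator {(c - z) \<bullet> e - d..(c - z) \<bullet> e - d + 2 * d} s)"
          using ls[of s] K[of "z + s *\<^sub>R e"]
          by (cases "s \<in> {(c - z) \<bullet> e - d..(c - z) \<bullet> e - d + 2 * d}") auto
      qed
    qed measurable
    have "(\<integral>\<^sup>+t. F (z + (t + (LINT s|lborel. w (z + s *\<^sub>R e) * indicator {..t} s)) *\<^sub>R e) * ennreal (1 + w (z + t *\<^sub>R e)) \<partial>lborel) =
      (\<integral>\<^sup>+t. F (z + t *\<^sub>R e) \<partial>lborel)"
      by (rule transport_real_line[where F = "\<lambda>t. F (z + t *\<^sub>R e)", OF _ int K w1]) measurable
    moreover have "z + t *\<^sub>R e + line_shift e w (z + t *\<^sub>R e) *\<^sub>R e =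
      z + (t + (LINT s|lborel. w (z + s *\<^sub>R e) * indicator {..t} s)) *\<^sub>R e" for t
      unfolding line_shift_along[OF w] by (simp add: scaleR_add_left add.assoc)
    ultimately show "indicator {0..1} (z \<bullet> e) * (\<integral>\<^sup>+t. F (z + t *\<^sub>R e + line_shift e w (z + t *\<^sub>R e) *\<^sub>R e) * ennreal (1 + w (z + t *\<^sub>R e)) \<partial>lborel) =
      indicator {0..1} (z \<bullet> e) * (\<integral>\<^sup>+t. F (z + t *\<^sub>R e) \<partial>lborel)" by (simp only:)
  qed
  also have "\<dots> = (\<integral>\<^sup>+y. F y \<partial>lborel)" by (rule nn_integral_lines[OF F e, symmetric])
  finally show ?thesis .
qed

text \<open>On a line, Jensen bounds the shift to the power \<open>p\<close> by
  \<open>(2 * d) powr (p - 1)\<close> times the integral of \<open>\<bar>w\<bar> powr p\<close> over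
  that line. The weight \<open>m\<close> is at most \<open>B\<close> and lives on length
  \<open>2 * d\<close>, which supplies the missing factor.\<close>

lemma transport_cost:
  fixes e :: "'a::euclidean_space"
  assumes p: "1 < p" and e: "norm e = 1" and w [measurable]: "w \<in> borel_measurable borel" and K: "\<And>y. \<bar>w y\<bar> \<le> K"
    and d: "0 < d" and supp: "\<And>y. y \<notin> cball c d \<Longrightarrow> w y = 0"
    and m [measurable]: "m \<in> borel_measurable borel" and B: "\<And>y. m y \<le> B" "0 \<le> B" and msupp: "\<And>y. y \<notin> cball c d \<Longrightarrow> m y = 0"
  shows "(\<integral>\<^sup>+y. ennreal (\<bar>line_shift e w y\<bar> powr p) * ennreal (m y) \<partial>lborel) \<le>
    ennreal (B * (2 * d) powr p) * (\<integral>\<^sup>+y. ennreal (\<bar>w y\<bar> powr p) \<partial>lborel)"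
proof -
  let ?J = "\<lambda>z. {(c - z) \<bullet> e - d..(c - z) \<bullet> e - d + 2 * d}"
  have line: "(\<integral>\<^sup>+t. ennreal (\<bar>line_shift e w (z + t *\<^sub>R e)\<bar> powr p) * ennreal (m (z + t *\<^sub>R e)) \<partial>lborel) \<le>
    ennreal (B * (2 * d) powr p) * (\<integral>\<^sup>+t. ennreal (\<bar>w (z + t *\<^sub>R e)\<bar> powr p) \<partial>lborel)" for z
  proof -
    define f where "f t = \<bar>w (z + t *\<^sub>R e)\<bar>" for t
    have fm [measurable]: "f \<in> borel_measurable borel" unfolding f_def by measurable
    have f0: "f t = 0" if "t \<notin> ?J z" for t using line_support[OF e supp that] by (simp add: f_def)
    have L: "0 < 2 * d" using d by simp
    have fK: "f t \<le> K" and fn: "0 \<le> f t" for t using K by (simp_all add: f_def)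
    have f: "integrable lborel f" "integrable lborel (\<lambda>t. f t powr p)"
      "(LINT t|lborel. f t) powr p \<le> (2 * d) powr (p - 1) * (LINT t|lborel. f t powr p)"
      using powr_integral_interval_le[OF p L fm fn fK, of "(c - z) \<bullet> e - d"] f0 by blast+
    define A where "A = (LINT t|lborel. f t powr p)"
    have A0: "0 \<le> A" by (simp add: A_def)
    have sh: "\<bar>line_shift e w (z + t *\<^sub>R e)\<bar> powr p \<le> (2 * d) powr (p - 1) * A" for t
    proof -
      have "\<bar>line_shift e w (z + t *\<^sub>R e)\<bar> \<le> (LINT t|lborel. f t)"
        unfolding line_shift_along[OF w]
      proof (rule Bochner_Integration.integral_abs_bound_integral[OF _ f(1)])
        show "integrable lborel (\<lambda>s. w (z + s *\<^sub>R e) * indicator {..t} s)"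
          by (rule Bochner_Integration.integrable_bound[OF f(1)]) (auto simp: f_def indicator_def)
      qed (auto simp: f_def indicator_def)
      then have "\<bar>line_shift e w (z + t *\<^sub>R e)\<bar> powr p \<le> (LINT t|lborel. f t) powr p" using p by (intro powr_mono2) auto
      with f(3) show ?thesis by (simp add: A_def)
    qed
    have "(\<integral>\<^sup>+t. ennreal (\<bar>line_shift e w (z + t *\<^sub>R e)\<bar> powr p) * ennreal (m (z + t *\<^sub>R e)) \<partial>lborel) \<le>
      (\<integral>\<^sup>+t. ennreal ((2 * d) powr (p - 1) * A * B) * indicator (?J z) t \<partial>lborel)"
    proof (rule nn_integral_mono)
      fix t
      show "ennreal (\<bar>line_shift e w (z + t *\<^sub>R e)\<bar> powr p) * ennreal (m (z + t *\<^sub>R e)) \<le> ennreal ((2 * d) powr (p - 1) * A * B) * indicator (?J z) t"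
      proof (cases "t \<in> ?J z")
        case True
        have "ennreal (\<bar>line_shift e w (z + t *\<^sub>R e)\<bar> powr p) * ennreal (m (z + t *\<^sub>R e)) \<le> ennreal ((2 * d) powr (p - 1) * A) * ennreal B"
          using sh B by (intro mult_mono ennreal_leI) auto
        also have "\<dots> = ennreal ((2 * d) powr (p - 1) * A * B)" using A0 B(2) by (subst ennreal_mult[symmetric]) auto
        finally show ?thesis using True by simp
      next
        case False
        have "m (z + t *\<^sub>R e) = 0" by (rule line_support[OF e _ False]) (rule msupp)
        then show ?thesis by simp
      qed
    qed
    also have "\<dots> = ennreal ((2 * d) powr (p - 1) * A * B) * ennreal (2 * d)"
      using d by (subst nn_integral_cmult_indicator) auto
    also have "\<dots> = ennreal (B * (2 * d) powr p) * ennreal A"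
    proof -
      have "(2 * d) powr (p - 1) * (2 * d) = (2 * d) powr p" using d by (simp add: powr_mult_base mult.commute)
      then have "(2 * d) powr (p - 1) * A * B * (2 * d) = B * (2 * d) powr p * A" by (simp add: mult_ac)
      then show ?thesis using A0 B(2) d by (simp add: ennreal_mult[symmetric])
    qed
    also have "ennreal A = (\<integral>\<^sup>+t. ennreal (\<bar>w (z + t *\<^sub>R e)\<bar> powr p) \<partial>lborel)"
      unfolding A_def f_def[symmetric] by (rule nn_integral_eq_integral[symmetric]) (use f(2) in auto)
    finally show ?thesis .
  qed
  have "(\<integral>\<^sup>+y. ennreal (\<bar>line_shift e w y\<bar> powr p) * ennreal (m y) \<partial>lborel) =
    (\<integral>\<^sup>+z. indicator {0..1} (z \<bullet> e) * (\<integral>\<^sup>+t. ennreal (\<bar>line_shift e w (z + t *\<^sub>R e)\<bar> powr p) * ennreal (m (z + t *\<^sub>R e)) \<partial>lborel) \<partial>lborel)"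
    by (rule nn_integral_lines[OF _ e]) measurable
  also have "\<dots> \<le> (\<integral>\<^sup>+z. ennreal (B * (2 * d) powr p) * (indicator {0..1} (z \<bullet> e) * (\<integral>\<^sup>+t. ennreal (\<bar>w (z + t *\<^sub>R e)\<bar> powr p) \<partial>lborel)) \<partial>lborel)"
    by (intro nn_integral_mono) (use line in \<open>auto simp: indicator_def\<close>)
  also have "\<dots> = ennreal (B * (2 * d) powr p) * (\<integral>\<^sup>+z. indicator {0..1} (z \<bullet> e) * (\<integral>\<^sup>+t. ennreal (\<bar>w (z + t *\<^sub>R e)\<bar> powr p) \<partial>lborel) \<partial>lborel)"
    by (rule nn_integral_cmult) measurable
  also have "(\<integral>\<^sup>+z. indicator {0..1} (z \<bullet> e) * (\<integral>\<^sup>+t. ennreal (\<bar>w (z + t *\<^sub>R e)\<bar> powr p) \<partial>lborel) \<partial>lborel) = (\<integral>\<^sup>+y. ennreal (\<bar>w y\<bar> powr p) \<partial>lborel)"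
    by (rule nn_integral_lines[OF _ e, symmetric]) measurable
  finally show ?thesis .
qed

section \<open>Volume preserving diffeomorphisms\<close>

text \<open>Preservation of volume is phrased as invariance of the measure rather than through the
  determinant, so it passes to compositions directly. The inverse has to be continuous only, which
  suffices for images of open sets to be open.\<close>

definition volume_diffeo :: "(real^'n \<Rightarrow> real^'n) \<Rightarrow> bool" where
  "volume_diffeo f \<longleftrightarrow>
     (\<exists>g. (\<forall>x. g (f x) = x) \<and> (\<forall>x. f (g x) = x) \<and> continuous_on UNIV g) \<and>
     (\<exists>D. (\<forall>x. (f has_derivative (*v) (D x)) (at x)) \<and> continuous_on UNIV D) \<and>
     distr lborel borel f = lborel"

lemma volume_diffeo_continuous: "volume_diffeo f \<Longrightarrow> continuous_on S f"
  unfolding volume_diffeo_def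
  by (meson continuous_at_imp_continuous_on has_derivative_continuous)

lemma volume_diffeo_id: "volume_diffeo (\<lambda>x. x)"
  unfolding volume_diffeo_def
proof (intro conjI exI allI)
  show "((\<lambda>x. x) has_derivative (*v) (mat 1)) (at x)" for x :: "real^'a"
  proof -
    have "(*v) (mat 1 :: real^'a^'a) = (\<lambda>h. h)" by (rule ext) simp
    then show ?thesis by simp
  qed
  show "distr lborel borel (\<lambda>x::real^'a. x) = lborel"
    using distr_id2[of "borel :: (real^'a) measure" lborel] by simp
qed (auto intro: continuous_intros)

lemma continuous_on_matrix_mult:
  fixes A :: "'a::topological_space \<Rightarrow> real^'n^'m" and B :: "'a \<Rightarrow> real^'k^'n"
  assumes "continuous_on S A" "continuous_on S B"
  shows "continuous_on S (\<lambda>x. A x ** B x)"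
  unfolding matrix_matrix_mult_def by (intro continuous_intros assms)

lemma volume_diffeo_compose:
  assumes f: "volume_diffeo f" and g: "volume_diffeo g"
  shows "volume_diffeo (\<lambda>x. g (f x))"
proof -
  obtain fi gi where fi: "\<And>x. fi (f x) = x" "\<And>x. f (fi x) = x" "continuous_on UNIV fi"
    and gi: "\<And>x. gi (g x) = x" "\<And>x. g (gi x) = x" "continuous_on UNIV gi"
    using f g unfolding volume_diffeo_def by metis
  obtain A B where A: "\<And>x. (f has_derivative (*v) (A x)) (at x)" "continuous_on UNIV A"
    and B: "\<And>x. (g has_derivative (*v) (B x)) (at x)" "continuous_on UNIV B"
    using f g unfolding volume_diffeo_def by metis
  note cf = volume_diffeo_continuous[OF f, of UNIV] and cg = volume_diffeo_continuous[OF g, of UNIV]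
  show ?thesis
    unfolding volume_diffeo_def
  proof (intro conjI exI allI)
    show "fi (gi (g (f x))) = x" "g (f (fi (gi x))) = x" for x by (simp_all add: fi gi)
    show "continuous_on UNIV (\<lambda>x. fi (gi x))" by (rule continuous_on_compose2[OF fi(3) gi(3)]) simp
    show "((\<lambda>x. g (f x)) has_derivative (*v) (B (f x) ** A x)) (at x)" for x
      using has_derivative_compose[OF A(1) B(1), of x] by (simp add: matrix_vector_mul_assoc)
    show "continuous_on UNIV (\<lambda>x. B (f x) ** A x)"
      by (intro continuous_on_matrix_mult A(2) continuous_on_compose2[OF B(2) cf]) simp
    have mf: "f \<in> borel_measurable borel" "g \<in> borel_measurable borel" using cf cg by (auto intro: borel_measurable_continuous_onI)
    have d: "distr lborel borel f = lborel" "distr lborel borel g = lborel" using f g by (auto simp: volume_diffeo_def)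
    have "distr lborel borel (g \<circ> f) = distr (distr lborel borel f) borel g"
      by (rule distr_distr[symmetric]) (use mf in auto)
    then show "distr lborel borel (\<lambda>x. g (f x)) = lborel" using d by (simp add: o_def)
  qed
qed

text \<open>Since \<psi> does not depend on the coordinate \<open>i\<close>, the map is a
  translation on each line in that direction, and the shear by \<open>- \<psi>\<close> inverts
  it.\<close>

lemma volume_diffeo_shear:
  fixes \<psi> :: "real^'n \<Rightarrow> real"
  assumes \<psi>: "\<And>x. (\<psi> has_derivative \<psi>' x) (at x)" "\<And>h. continuous_on UNIV (\<lambda>x. \<psi>' x h)"
    and indep: "\<And>x t. \<psi> (x + t *\<^sub>R axis i 1) = \<psi> x"
  shows "volume_diffeo (\<lambda>x. x + \<psi> x *\<^sub>R axis i 1)"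
proof -
  define e :: "real^'n" where "e = axis i 1"
  have e: "norm e = 1" by (simp add: e_def norm_axis_1)
  define D where "D x = (\<chi> a b. (axis b 1 + \<psi>' x (axis b 1) *\<^sub>R e :: real^'n) $ a)" for x
  have c\<psi>: "continuous_on S \<psi>" for S
    using \<psi>(1) has_derivative_continuous by (intro continuous_at_imp_continuous_on) blast
  have der: "((\<lambda>x. x + \<psi> x *\<^sub>R e) has_derivative (*v) (D x)) (at x)" for x
  proof -
    have *: "((\<lambda>x. x + \<psi> x *\<^sub>R e) has_derivative (\<lambda>h. h + \<psi>' x h *\<^sub>R e)) (at x)"
      by (intro derivative_intros \<psi>(1))
    have "D x = matrix (\<lambda>h. h + \<psi>' x h *\<^sub>R e)" by (simp add: D_def matrix_def)
    then have "(*v) (D x) = (\<lambda>h. h + \<psi>' x h *\<^sub>R e)"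
      using has_derivative_linear[OF *] by (simp add: matrix_works fun_eq_iff)
    with * show ?thesis by simp
  qed
  have cf: "continuous_on UNIV (\<lambda>x. x + \<psi> x *\<^sub>R e)" by (intro continuous_intros c\<psi>)
  then have mf [measurable]: "(\<lambda>x. x + \<psi> x *\<^sub>R e) \<in> borel_measurable borel" by (rule borel_measurable_continuous_onI)
  have ind: "\<psi> (x + t *\<^sub>R e) = \<psi> x" "\<psi> (x - t *\<^sub>R e) = \<psi> x" for x t
    using indep[of x t] indep[of x "- t"] by (simp_all add: e_def)
  have "distr lborel borel (\<lambda>x. x + \<psi> x *\<^sub>R e) = lborel"
  proof (rule measure_eqI)
    fix B assume "B \<in> sets (distr lborel borel (\<lambda>x. x + \<psi> x *\<^sub>R e))"
    then have [measurable]: "B \<in> sets borel" by simp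
    have "emeasure (distr lborel borel (\<lambda>x. x + \<psi> x *\<^sub>R e)) B = (\<integral>\<^sup>+x. indicator B x \<partial>distr lborel borel (\<lambda>x. x + \<psi> x *\<^sub>R e))"
      by simp
    also have "\<dots> = (\<integral>\<^sup>+x. indicator B (x + \<psi> x *\<^sub>R e) \<partial>lborel)" by (rule nn_integral_distr) measurable
    also have "\<dots> = (\<integral>\<^sup>+z. indicator {0..1} (z \<bullet> e) * (\<integral>\<^sup>+t. indicator B (z + t *\<^sub>R e + \<psi> (z + t *\<^sub>R e) *\<^sub>R e) \<partial>lborel) \<partial>lborel)"
      by (rule nn_integral_lines[OF _ e]) measurable
    also have "\<dots> = (\<integral>\<^sup>+z. indicator {0..1} (z \<bullet> e) * (\<integral>\<^sup>+t. indicator B (z + t *\<^sub>R e) \<partial>lborel) \<partial>lborel)"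
    proof (rule nn_integral_cong)
      fix z
      have "(\<integral>\<^sup>+t. indicator B (z + (\<psi> z + t) *\<^sub>R e) \<partial>lborel) = (\<integral>\<^sup>+t. indicator B (z + t *\<^sub>R e) \<partial>lborel)"
        by (rule nn_lborel_shift) measurable
      moreover have "z + t *\<^sub>R e + \<psi> (z + t *\<^sub>R e) *\<^sub>R e = z + (\<psi> z + t) *\<^sub>R e" for t
        by (simp add: ind scaleR_add_left)
      ultimately show "indicator {0..1} (z \<bullet> e) * (\<integral>\<^sup>+t. indicator B (z + t *\<^sub>R e + \<psi> (z + t *\<^sub>R e) *\<^sub>R e) \<partial>lborel) =
        indicator {0..1} (z \<bullet> e) * (\<integral>\<^sup>+t. indicator B (z + t *\<^sub>R e) \<partial>lborel)" by (simp only:)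
    qed
    also have "\<dots> = (\<integral>\<^sup>+x. indicator B x \<partial>lborel)" by (rule nn_integral_lines[OF _ e, symmetric]) measurable
    finally show "emeasure (distr lborel borel (\<lambda>x. x + \<psi> x *\<^sub>R e)) B = emeasure lborel B" by simp
  qed simp
  moreover have "continuous_on UNIV D"
    unfolding D_def by (intro continuous_intros \<psi>(2))
  moreover have "continuous_on UNIV (\<lambda>x. x - \<psi> x *\<^sub>R e)" by (intro continuous_intros c\<psi>)
  moreover have "(x + \<psi> x *\<^sub>R e) - \<psi> (x + \<psi> x *\<^sub>R e) *\<^sub>R e = x" "(x - \<psi> x *\<^sub>R e) + \<psi> (x - \<psi> x *\<^sub>R e) *\<^sub>R e = x" for x
    by (simp_all add: ind)
  ultimately show ?thesis
    unfolding volume_diffeo_def e_def[symmetric]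
    by (intro conjI exI[of _ "\<lambda>x. x - \<psi> x *\<^sub>R e"] exI[of _ D] allI der)
qed

section \<open>Restricting volume preserving diffeomorphisms to the domain\<close>

lemma L_infinity_bounded:
  fixes f :: "'a::euclidean_space \<Rightarrow> 'b::euclidean_space"
  assumes A: "A \<in> sets lebesgue" and f: "f \<in> borel_measurable (lebesgue_on A)" and b: "\<And>x. x \<in> A \<Longrightarrow> norm (f x) \<le> c"
  shows "f \<in> L_infinity A"
proof -
  have m: "(\<lambda>x. ereal (norm (f x))) \<in> borel_measurable (lebesgue_on A)" using f by measurable
  have "esssup (lebesgue_on A) (\<lambda>x. ereal (norm (f x))) \<le> ereal c"
    by (rule esssup_I[OF m]) (use b in \<open>auto intro!: AE_I2 simp: space_restrict_space\<close>)
  also have "\<dots> < \<infinity>" by simp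
  finally show ?thesis using f by (simp add: L_infinity_def)
qed

lemma continuous_L_infinity:
  fixes f :: "'a::euclidean_space \<Rightarrow> 'b::euclidean_space"
  assumes U: "open U" "bounded U" and f: "continuous_on UNIV f"
  shows "f \<in> L_infinity U"
proof -
  have Um: "U \<in> sets lebesgue" using borel_open[OF U(1)] by simp
  have "compact (closure U)" using U(2) by (simp add: compact_closure)
  then have "bounded (f ` closure U)"
    by (intro compact_imp_bounded compact_continuous_image continuous_on_subset[OF f]) auto
  then obtain c where c: "\<And>x. x \<in> closure U \<Longrightarrow> norm (f x) \<le> c" by (auto simp: bounded_iff)
  show ?thesis
  proof (rule L_infinity_bounded[OF Um])
    show "f \<in> borel_measurable (lebesgue_on U)"
      using Um continuous_on_subset[OF f, of U] by (intro continuous_imp_measurable_on_sets_lebesgue) auto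
    show "norm (f x) \<le> c" if "x \<in> U" for x using c[of x] closure_subset[of U] that by blast
  qed
qed

text \<open>The multiplicity function is the indicator of the image. Its essential supremum is 1 and
  not 0 precisely because the image is not null.\<close>

lemma essentially_injective_inj_on:
  fixes S :: "'a::euclidean_space \<Rightarrow> 'a"
  assumes inj: "inj_on S U" and im: "S ` U \<in> sets lebesgue" "\<not> negligible (S ` U)"
  shows "essentially_injective U S"
proof -
  have eq: "multiplicity_function U S = (indicator (S ` U) :: 'a \<Rightarrow> ennreal)"
  proof
    fix y show "multiplicity_function U S y = indicator (S ` U) y"
    proof (cases "y \<in> S ` U")
      case True
      then obtain x where "x \<in> U" "y = S x" by blast
      then have "U \<inter> S -` {y} = {x}" using inj by (auto simp: inj_on_def)
      then show ?thesis using True by (simp add: multiplicity_function_def)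
    next
      case False
      then have "U \<inter> S -` {y} = {}" by auto
      then show ?thesis using False by (simp add: multiplicity_function_def)
    qed
  qed
  let ?f = "indicator (S ` U) :: 'a \<Rightarrow> ennreal"
  have m: "?f \<in> borel_measurable lebesgue" using im(1) by simp
  have le: "esssup lebesgue ?f \<le> 1" by (rule esssup_I[OF m]) (auto simp: indicator_def)
  have "\<not> esssup lebesgue ?f < 1"
  proof
    assume *: "esssup lebesgue ?f < 1"
    have "AE y in lebesgue. y \<in> UNIV \<longrightarrow> y \<notin> S ` U"
      using esssup_AE[of ?f lebesgue]
    proof (rule AE_mp, intro AE_I2 impI)
      fix y assume "?f y \<le> esssup lebesgue ?f"
      then have "?f y < 1" using * by (rule le_less_trans)
      then show "y \<notin> S ` U" by (auto simp: indicator_def)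
    qed
    then have "negligible {y\<in>UNIV. \<not> y \<notin> S ` U}" by (rule AE_imp_negligible)
    with im(2) show False by simp
  qed
  with le show ?thesis by (simp add: essentially_injective_def eq less_le)
qed

text \<open>The image of \<open>U\<close> is the preimage of \<open>U\<close> under the continuous
  inverse, hence open. It is the set \<open>B\<close> demanded by the notion of a measure preserving
  map, and being open and nonempty it is not null.\<close>

theorem volume_diffeo_restrict:
  fixes S :: "real^'n \<Rightarrow> real^'n"
  assumes S: "volume_diffeo S" and U: "open U" "bounded U" "U \<noteq> {}"
  shows "S \<in> W_1_infinity U" "essentially_injective U S" "measure_preserving_map U S"
proof -
  obtain g where g: "\<And>x. g (S x) = x" "\<And>x. S (g x) = x" "continuous_on UNIV g"
    using S unfolding volume_diffeo_def by metis
  obtain D where D: "\<And>x. (S has_derivative (*v) (D x)) (at x)" "continuous_on UNIV D"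
    using S unfolding volume_diffeo_def by metis
  have d: "distr lborel borel S = lborel" using S by (simp add: volume_diffeo_def)
  have cS: "continuous_on UNIV S" by (rule volume_diffeo_continuous[OF S])
  have mS: "S \<in> borel_measurable borel" using cS by (rule borel_measurable_continuous_onI)
  have Um: "U \<in> sets lebesgue" using borel_open[OF U(1)] by simp
  show "S \<in> W_1_infinity U"
    unfolding W_1_infinity_def
    using has_weak_jacobian_C1[OF D] continuous_L_infinity[OF U(1,2) D(2)] continuous_L_infinity[OF U(1,2) cS] continuous_on_subset[OF cS, of U]
    by blast
  have im: "S ` U = g -` U"
  proof (intro set_eqI iffI)
    fix y assume "y \<in> g -` U"
    then have "S (g y) \<in> S ` U" by blast
    then show "y \<in> S ` U" by (simp add: g)
  qed (auto simp: g)
  have open_im: "open (S ` U)" unfolding im using open_vimage[OF U(1) g(3)] .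
  have inj: "inj_on S U" by (metis g(1) inj_onI)
  show "essentially_injective U S"
  proof (rule essentially_injective_inj_on[OF inj])
    show "S ` U \<in> sets lebesgue" using borel_open[OF open_im] by simp
    show "\<not> negligible (S ` U)" using open_not_negligible[OF open_im] U(3) by simp
  qed
  show "measure_preserving_map U S"
    unfolding measure_preserving_map_def
  proof (intro conjI bexI[of _ "S ` U"] Um continuous_L_infinity[OF U(1,2) cS])
    show sim: "S ` U \<in> sets lebesgue" using borel_open[OF open_im] by simp
    show "distr (lebesgue_on U) borel S = distr (lebesgue_on (S ` U)) borel (\<lambda>y. y)"
    proof (rule measure_eqI)
      fix B assume "B \<in> sets (distr (lebesgue_on U) borel S)"
      then have B: "B \<in> sets borel" by simp
      have mSU: "S \<in> borel_measurable (lebesgue_on U)"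
        using Um continuous_on_subset[OF cS, of U] by (intro continuous_imp_measurable_on_sets_lebesgue) auto
      have mid: "(\<lambda>y. y) \<in> borel_measurable (lebesgue_on (S ` U))"
        using sim by (intro continuous_imp_measurable_on_sets_lebesgue continuous_intros)
      have preS: "S -` B \<in> sets borel" using measurable_sets[OF mS B] by simp
      have US: "S -` B \<inter> U = S -` (B \<inter> S ` U)" using g(1) by (auto dest: arg_cong[where f = g])
      have "emeasure (distr (lebesgue_on U) borel S) B = emeasure (lebesgue_on U) (S -` B \<inter> U)"
        using mSU B by (subst emeasure_distr) auto
      also have "\<dots> = emeasure lebesgue (S -` B \<inter> U)"
        using Um preS U(1) by (subst emeasure_restrict_space) auto
      also have "\<dots> = emeasure lborel (S -` (B \<inter> S ` U))"
        using preS borel_open[OF U(1)] unfolding US[symmetric] by (subst emeasure_completion) auto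
      also have "\<dots> = emeasure (distr lborel borel S) (B \<inter> S ` U)"
        using mS B borel_open[OF open_im] by (subst emeasure_distr) auto
      also have "\<dots> = emeasure lebesgue (B \<inter> S ` U)"
        unfolding d using B borel_open[OF open_im] by simp
      also have "\<dots> = emeasure (lebesgue_on (S ` U)) (B \<inter> S ` U)"
        using sim by (subst emeasure_restrict_space) auto
      also have "\<dots> = emeasure (distr (lebesgue_on (S ` U)) borel (\<lambda>y. y)) B"
        using mid B by (subst emeasure_distr) auto
      finally show "emeasure (distr (lebesgue_on U) borel S) B = emeasure (distr (lebesgue_on (S ` U)) borel (\<lambda>y. y)) B" .
    qed simp
  qed
qed

section \<open>A map that does not increase measure\<close>

text \<open>The hypothesis is tested on the set where \<open>g < f\<close>. Finiteness of the
  integral of \<open>g\<close> permits subtraction, so the positive difference integrates to zero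
  there.\<close>

lemma AE_le_of_nn_integral_le:
  assumes [measurable]: "f \<in> borel_measurable M" "g \<in> borel_measurable M"
    and fin: "(\<integral>\<^sup>+x. g x \<partial>M) < \<infinity>"
    and le: "\<And>A. A \<in> sets M \<Longrightarrow> (\<integral>\<^sup>+x. f x * indicator A x \<partial>M) \<le> (\<integral>\<^sup>+x. g x * indicator A x \<partial>M)"
  shows "AE x in M. (f x :: ennreal) \<le> g x"
proof -
  define A where "A = {x\<in>space M. g x < f x}"
  have [measurable]: "A \<in> sets M" unfolding A_def by measurable
  have "(\<integral>\<^sup>+x. g x * indicator A x \<partial>M) \<le> (\<integral>\<^sup>+x. g x \<partial>M)"
    by (rule nn_integral_mono) (simp add: indicator_def)
  then have gfin: "(\<integral>\<^sup>+x. g x * indicator A x \<partial>M) \<noteq> \<infinity>" using fin by auto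
  have "(\<integral>\<^sup>+x. f x * indicator A x - g x * indicator A x \<partial>M) =
    (\<integral>\<^sup>+x. f x * indicator A x \<partial>M) - (\<integral>\<^sup>+x. g x * indicator A x \<partial>M)"
    by (rule nn_integral_diff) (use gfin in \<open>auto simp: A_def indicator_def intro!: AE_I2\<close>)
  also have "\<dots> = 0" using le[of A] gfin by (simp add: diff_eq_0_iff_ennreal less_top)
  finally have "AE x in M. f x * indicator A x - g x * indicator A x = 0"
    by (subst (asm) nn_integral_0_iff_AE) auto
  then show ?thesis
  proof (rule AE_mp, intro AE_I2 impI)
    fix x assume x: "x \<in> space M" and *: "f x * indicator A x - g x * indicator A x = 0"
    show "f x \<le> g x"
    proof (rule ccontr)
      assume "\<not> f x \<le> g x"
      then have "x \<in> A" "g x < f x" using x by (auto simp: A_def)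
      from * have "f x \<le> g x" using \<open>x \<in> A\<close> by (simp add: diff_eq_0_iff_ennreal)
      with \<open>g x < f x\<close> show False by (simp add: leD)
    qed
  qed
qed

lemma essentially_injective_nonempty: "essentially_injective U u \<Longrightarrow> U \<noteq> {}"
proof
  assume "essentially_injective U u" "U = {}"
  then have "esssup lebesgue (\<lambda>y::'a. 0::ennreal) = 1"
    by (simp add: essentially_injective_def multiplicity_function_def[abs_def])
  moreover have "esssup lebesgue (\<lambda>y::'a. 0::ennreal) = 0" by (rule esssup_const) simp
  ultimately show False by simp
qed

lemma nn_lebesgue_on:
  assumes "U \<in> sets lebesgue"
  shows "(\<integral>\<^sup>+x. f x \<partial>lebesgue_on U) = (\<integral>\<^sup>+x. f x * indicator U x \<partial>lebesgue)"
  using assms by (subst nn_integral_restrict_space) auto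

text \<open>As \<open>det Du\<close> is at least \<open>l\<close>, the image of Lebesgue measure is
  dominated by \<open>1 / l\<close> times the measure with density \<open>g\<close>. Hence a
  Radon-Nikodym density exists and inherits the bound. The closing comparison of volumes is needed
  in dimension one.\<close>

lemma image_densities:
  fixes u :: "real^'n \<Rightarrow> real^'n"
  assumes U: "open U" "bounded U" and u: "u \<in> W_1_infinity U" and Du: "has_weak_jacobian U u Du"
    and inj: "essentially_injective U u" and d: "diameter (u ` U) \<le> d" and l: "0 < l"
    and J: "AE x in lebesgue_on U. l \<le> det (Du x) \<and> det (Du x) \<le> \<Lambda>"
  obtains c m g where "m \<in> borel_measurable borel" "g \<in> borel_measurable borel"
    "\<And>y. 0 \<le> m y" "\<And>y. m y \<le> g y / l" "\<And>y. g y = 0 \<or> g y = 1" "\<And>y. y \<notin> cball c d \<Longrightarrow> g y = 0" "0 < d"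
    "distr (lebesgue_on U) borel u = density lborel (\<lambda>y. ennreal (m y))"
    "distr (density (lebesgue_on U) (\<lambda>x. ennreal (indicator U x * det (Du x)))) borel u = density lborel (\<lambda>y. ennreal (g y))"
    "(\<lambda>x. indicator U x * det (Du x)) \<in> borel_measurable lebesgue"
    "u \<in> borel_measurable (lebesgue_on U)"
    "l * measure lebesgue U \<le> (LINT y|lborel. g y)"
proof -
  let ?L = "lebesgue_on U"
  have Um: "U \<in> sets lebesgue" using borel_open[OF U(1)] by simp
  have Ul: "U \<in> lmeasurable" using U(2) Um by (rule bounded_set_imp_lmeasurable)
  have uc: "continuous_on U u" using u by (simp add: W_1_infinity_def)
  have um: "u \<in> borel_measurable ?L" using uc Um by (rule continuous_imp_measurable_on_sets_lebesgue)
  obtain X V where X: "X \<in> sets lebesgue" "X \<subseteq> U" "negligible (U - X)" "V = u ` X" "V \<in> sets lebesgue"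
    and area: "\<And>B. B \<in> sets borel \<Longrightarrow> emeasure lebesgue (V \<inter> B) =
      (\<integral>\<^sup>+x. ennreal (det (Du x)) * indicator (U \<inter> u -` B) x \<partial>lebesgue)"
    and Jm: "(\<lambda>x. indicator U x * det (Du x)) \<in> borel_measurable lebesgue"
    by (rule area_formula[OF U u Du inj l J]) blast
  have AEJ: "AE x in lebesgue. x \<in> U \<longrightarrow> l \<le> det (Du x)"
    using J unfolding AE_lebesgue_on_iff[OF Um] by (rule AE_mp) (auto intro!: AE_I2)
  \<comment> \<open>Densities are taken on the Borel space, so the Lebesgue measurable image is
    replaced by a Borel set that differs from it by a null set.\<close>
  obtain V' N where V': "V' \<in> sets borel" "negligible N" "V' \<union> N = V" by (rule sets_lebesgue_almost_borel[OF X(5)])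
  define g where "g y = (indicator V' y :: real)" for y
  have gm [measurable]: "g \<in> borel_measurable borel" unfolding g_def using V'(1) by measurable
  have area': "(\<integral>\<^sup>+y. ennreal (g y) * indicator B y \<partial>lborel) =
      (\<integral>\<^sup>+x. ennreal (det (Du x)) * indicator (U \<inter> u -` B) x \<partial>lebesgue)" if B: "B \<in> sets borel" for B
  proof -
    have "(\<integral>\<^sup>+y. ennreal (g y) * indicator B y \<partial>lborel) = (\<integral>\<^sup>+y. indicator (V' \<inter> B) y \<partial>lborel)"
      by (rule nn_integral_cong) (simp add: g_def indicator_def)
    also have "\<dots> = emeasure lborel (V' \<inter> B)" using V'(1) B by (intro nn_integral_indicator) auto
    also have "\<dots> = emeasure lebesgue (V' \<inter> B)" using V'(1) B by simp
    also have "\<dots> = emeasure lebesgue (V' \<inter> B \<union> N \<inter> B)"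
      using V'(1,2) B by (intro emeasure_Un_null_set[symmetric]) (auto simp: negligible_iff_null_sets[symmetric] intro: negligible_subset)
    also have "V' \<inter> B \<union> N \<inter> B = V \<inter> B" using V'(3) by blast
    finally show ?thesis using area[OF B] by simp
  qed
  have dist2: "distr (density ?L (\<lambda>x. ennreal (indicator U x * det (Du x)))) borel u = density lborel (\<lambda>y. ennreal (g y))"
  proof (rule measure_eqI)
    fix B assume "B \<in> sets (distr (density ?L (\<lambda>x. ennreal (indicator U x * det (Du x)))) borel u)"
    then have B: "B \<in> sets borel" by simp
    have pre: "u -` B \<inter> U \<in> sets ?L" using measurable_sets[OF um B] by simp
    have Jm': "(\<lambda>x. ennreal (indicator U x * det (Du x))) \<in> borel_measurable ?L"
      by (intro measurable_restrict_space1 measurable_compose[OF Jm measurable_ennreal])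
    have "emeasure (distr (density ?L (\<lambda>x. ennreal (indicator U x * det (Du x)))) borel u) B =
      emeasure (density ?L (\<lambda>x. ennreal (indicator U x * det (Du x)))) (u -` B \<inter> U)"
      using um B by (subst emeasure_distr) auto
    also have "\<dots> = (\<integral>\<^sup>+x. ennreal (indicator U x * det (Du x)) * indicator (u -` B \<inter> U) x \<partial>?L)"
      using Jm' pre by (rule emeasure_density)
    also have "\<dots> = (\<integral>\<^sup>+x. ennreal (det (Du x)) * indicator (U \<inter> u -` B) x \<partial>lebesgue)"
      unfolding nn_lebesgue_on[OF Um] by (rule nn_integral_cong) (auto simp: indicator_def)
    also have "\<dots> = emeasure (density lborel (\<lambda>y. ennreal (g y))) B"
      using area'[OF B] B by (subst emeasure_density) auto
    finally show "emeasure (distr (density ?L (\<lambda>x. ennreal (indicator U x * det (Du x)))) borel u) B = emeasure (density lborel (\<lambda>y. ennreal (g y))) B" .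
  qed simp
  let ?\<mu> = "distr ?L borel u"
  have mu: "emeasure ?\<mu> B \<le> (\<integral>\<^sup>+y. ennreal (g y / l) * indicator B y \<partial>lborel)" if B: "B \<in> sets borel" for B
  proof -
    have pre: "u -` B \<inter> U \<in> sets lebesgue" using measurable_sets[OF um B] Um by (simp add: sets_restrict_space_iff)
    have "emeasure ?\<mu> B = emeasure lebesgue (u -` B \<inter> U)"
      using um B Um pre by (subst emeasure_distr) (auto simp: emeasure_restrict_space)
    also have "\<dots> = (\<integral>\<^sup>+x. indicator (u -` B \<inter> U) x \<partial>lebesgue)" using pre by simp
    also have "\<dots> \<le> (\<integral>\<^sup>+x. ennreal (1 / l) * (ennreal (det (Du x)) * indicator (U \<inter> u -` B) x) \<partial>lebesgue)"
    proof (rule nn_integral_mono_AE, rule AE_mp[OF AEJ], intro AE_I2 impI)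
      fix x assume x: "x \<in> U \<longrightarrow> l \<le> det (Du x)"
      show "indicator (u -` B \<inter> U) x \<le> ennreal (1 / l) * (ennreal (det (Du x)) * indicator (U \<inter> u -` B) x)"
      proof (cases "x \<in> U \<inter> u -` B")
        case True
        then have "1 \<le> 1 / l * det (Du x)" using x l by (simp add: field_simps)
        then have "ennreal 1 \<le> ennreal (1 / l * det (Du x))" by (rule ennreal_leI)
        also have "\<dots> = ennreal (1 / l) * ennreal (det (Du x))" using l by (intro ennreal_mult') simp
        finally show ?thesis using True by simp
      qed (auto simp: indicator_def)
    qed
    also have "\<dots> = ennreal (1 / l) * (\<integral>\<^sup>+x. ennreal (det (Du x)) * indicator (U \<inter> u -` B) x \<partial>lebesgue)"
    proof (rule nn_integral_cmult)
      have "(\<lambda>x. ennreal (indicator U x * det (Du x)) * indicator (u -` B \<inter> U) x) \<in> borel_measurable lebesgue"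
        by (intro borel_measurable_times_ennreal measurable_compose[OF Jm measurable_ennreal] borel_measurable_indicator pre)
      moreover have "(\<lambda>x. ennreal (indicator U x * det (Du x)) * indicator (u -` B \<inter> U) x) = (\<lambda>x. ennreal (det (Du x)) * indicator (U \<inter> u -` B) x)"
        by (auto simp: indicator_def)
      ultimately show "(\<lambda>x. ennreal (det (Du x)) * indicator (U \<inter> u -` B) x) \<in> borel_measurable lebesgue" by simp
    qed
    also have "\<dots> = ennreal (1 / l) * (\<integral>\<^sup>+y. ennreal (g y) * indicator B y \<partial>lborel)" using area'[OF B] by simp
    also have "\<dots> = (\<integral>\<^sup>+y. ennreal (1 / l) * (ennreal (g y) * indicator B y) \<partial>lborel)"
    proof -
      have [measurable]: "B \<in> sets borel" by (rule B)
      show ?thesis by (intro nn_integral_cmult[symmetric]) measurable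
    qed
    also have "\<dots> = (\<integral>\<^sup>+y. ennreal (g y / l) * indicator B y \<partial>lborel)"
      using l by (intro nn_integral_cong) (auto simp: g_def indicator_def)
    finally show ?thesis .
  qed
  define r where "r = RN_deriv lborel ?\<mu>"
  have rm [measurable]: "r \<in> borel_measurable borel" unfolding r_def using borel_measurable_RN_deriv[of lborel ?\<mu>] by simp
  have "absolutely_continuous lborel ?\<mu>"
    unfolding absolutely_continuous_def
  proof
    fix B :: "(real^'n) set" assume B: "B \<in> null_sets lborel"
    then have Bb: "B \<in> sets borel" by auto
    have "(\<integral>\<^sup>+y. ennreal (g y / l) * indicator B y \<partial>lborel) = 0"
      using B by (intro nn_integral_null_set)
    with mu[OF Bb] show "B \<in> null_sets ?\<mu>" using Bb by (auto simp: null_sets_def)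
  qed
  then have dr: "density lborel r = ?\<mu>"
    unfolding r_def by (intro sigma_finite_measure.density_RN_deriv[OF lborel.sigma_finite_measure_axioms]) simp_all
  have Vfin: "(\<integral>\<^sup>+y. ennreal (g y / l) \<partial>lborel) < \<infinity>"
  proof -
    have "bounded V'" using W_1_infinity_bounded[OF U(1) u] by (rule bounded_subset) (use V'(3) X(2,4) in blast)
    then have "emeasure lborel V' < \<infinity>" by (rule emeasure_bounded_finite)
    moreover have "(\<integral>\<^sup>+y. ennreal (g y / l) \<partial>lborel) = (\<integral>\<^sup>+y. ennreal (1 / l) * indicator V' y \<partial>lborel)"
      by (rule nn_integral_cong) (simp add: g_def indicator_def)
    moreover have "\<dots> = ennreal (1 / l) * emeasure lborel V'" using V'(1) by (intro nn_integral_cmult_indicator) simp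
    ultimately show ?thesis by (simp add: ennreal_mult_less_top)
  qed
  have AEr: "AE y in lborel. r y \<le> ennreal (g y / l)"
  proof (rule AE_le_of_nn_integral_le[OF _ _ Vfin])
    fix B :: "(real^'n) set" assume "B \<in> sets lborel"
    then have B: "B \<in> sets borel" by simp
    have "(\<integral>\<^sup>+y. r y * indicator B y \<partial>lborel) = emeasure (density lborel r) B" using B by (subst emeasure_density) auto
    then show "(\<integral>\<^sup>+y. r y * indicator B y \<partial>lborel) \<le> (\<integral>\<^sup>+y. ennreal (g y / l) * indicator B y \<partial>lborel)"
      using mu[OF B] unfolding dr by simp
  qed measurable
  \<comment> \<open>The Radon-Nikodym density obeys its bound only almost everywhere and has
    extended values. The minimum makes it real and makes the bound hold at every point.\<close>
  define m where "m y = min (enn2real (r y)) (g y / l)" for y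
  have mm [measurable]: "m \<in> borel_measurable borel" unfolding m_def by measurable
  have AEm: "AE y in lborel. r y = ennreal (m y)"
    using AEr
  proof (rule AE_mp, intro AE_I2 impI)
    fix y assume le: "r y \<le> ennreal (g y / l)"
    then have fin: "r y < \<infinity>" by (rule le_less_trans) simp
    have "0 \<le> g y / l" using l by (simp add: g_def)
    then have "enn2real (r y) \<le> g y / l" using le by (simp add: enn2real_leI)
    then show "r y = ennreal (m y)" using fin by (simp add: m_def)
  qed
  have dist1: "?\<mu> = density lborel (\<lambda>y. ennreal (m y))"
    unfolding dr[symmetric] by (rule density_cong) (use AEm in auto)
  obtain x0 where x0: "x0 \<in> U" using essentially_injective_nonempty[OF inj] by blast
  define c where "c = u x0"
  have ucb: "u ` U \<subseteq> cball c d"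
  proof
    fix y assume "y \<in> u ` U"
    then have "dist c y \<le> diameter (u ` U)"
      using W_1_infinity_bounded[OF U(1) u] x0 unfolding c_def by (intro diameter_bounded_bound) auto
    then show "y \<in> cball c d" using d by simp
  qed
  have V'sub: "V' \<subseteq> cball c d" using ucb V'(3) X(2,4) by blast
  have g_int: "(\<integral>\<^sup>+y. ennreal (g y) \<partial>lborel) = ennreal (measure lborel V')" "(LINT y|lborel. g y) = measure lborel V'"
  proof -
    have "emeasure lborel V' < \<infinity>" using V'sub bounded_cball bounded_subset by (intro emeasure_bounded_finite) blast
    then have "emeasure lborel V' = ennreal (measure lborel V')" by (simp add: emeasure_eq_ennreal_measure less_top)
    then show "(\<integral>\<^sup>+y. ennreal (g y) \<partial>lborel) = ennreal (measure lborel V')"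
      using V'(1) by (simp add: g_def ennreal_indicator)
    show "(LINT y|lborel. g y) = measure lborel V'" using V'(1) by (simp add: g_def[abs_def])
  qed
  have "ennreal (l * measure lebesgue U) \<le> ennreal (measure lborel V')"
  proof -
    have "ennreal (l * measure lebesgue U) = ennreal l * emeasure lebesgue U"
      using l emeasure_eq_measure2[OF Ul] by (simp add: ennreal_mult)
    also have "\<dots> = (\<integral>\<^sup>+x. ennreal l * indicator U x \<partial>lebesgue)"
      using Um by (rule nn_integral_cmult_indicator[symmetric])
    also have "\<dots> \<le> (\<integral>\<^sup>+x. ennreal (det (Du x)) * indicator (U \<inter> u -` UNIV) x \<partial>lebesgue)"
      by (rule nn_integral_mono_AE, rule AE_mp[OF AEJ], intro AE_I2) (auto simp: indicator_def intro: ennreal_leI)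
    also have "\<dots> = (\<integral>\<^sup>+y. ennreal (g y) \<partial>lborel)" using area'[of UNIV] by simp
    finally show ?thesis using g_int by simp
  qed
  then have lU: "l * measure lebesgue U \<le> measure lborel V'" by simp
  \<comment> \<open>Otherwise the image would lie in a single point and be null, although its volume
    is at least \<open>l\<close> times that of the nonempty open set \<open>U\<close>.\<close>
  have d0: "0 < d"
  proof (rule ccontr)
    assume "\<not> 0 < d"
    have "cball c d \<subseteq> {c}"
    proof
      fix y assume "y \<in> cball c d"
      then have "dist c y \<le> d" by simp
      then have "dist c y \<le> 0" using \<open>\<not> 0 < d\<close> by linarith
      then show "y \<in> {c}" by simp
    qed
    then have "V' \<subseteq> {c}" using V'sub by blast
    then have "emeasure lborel V' \<le> emeasure lborel {c}" by (intro emeasure_mono) auto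
    then have "measure lborel V' = 0" by (simp add: measure_def)
    then have "measure lebesgue U \<le> 0" using lU l by (simp add: mult_le_0_iff)
    moreover have "0 < measure lebesgue U" using open_not_negligible[OF U(1)] x0 Ul
      by (auto simp: negligible_iff_measure0[OF Ul] zero_less_measure_iff)
    ultimately show False by simp
  qed
  show thesis
  proof (rule that[OF mm gm])
    show "0 \<le> m y" for y using l by (simp add: m_def g_def)
    show "m y \<le> g y / l" for y by (simp add: m_def)
    show "g y = 0 \<or> g y = 1" for y by (simp add: g_def indicator_def)
    show "g y = 0" if "y \<notin> cball c d" for y using V'sub that by (auto simp: g_def indicator_def)
    show "l * measure lebesgue U \<le> (LINT y|lborel. g y)" using lU g_int(2) by simp
  qed (use d0 dist1 dist2 Jm um in auto)
qed

text \<open>Testing \<open>w = m - g\<close> against its own dual function and pulling back by \<open>u\<close> turns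
  \<open>w\<close> into \<open>1 - det Du\<close>.\<close>

lemma density_deviation:
  fixes u :: "real^'n \<Rightarrow> real^'n"
  assumes p: "1 < p" and L: "U \<in> lmeasurable" and um [measurable]: "u \<in> borel_measurable (lebesgue_on U)"
    and m [measurable]: "m \<in> borel_measurable borel" and g [measurable]: "g \<in> borel_measurable borel"
    and m0: "\<And>y. 0 \<le> m y" and ml: "\<And>y. m y \<le> g y / l" and g01: "\<And>y. g y = 0 \<or> g y = 1" and gs: "\<And>y. y \<notin> cball c d \<Longrightarrow> g y = 0"
    and l: "0 < l"
    and dm: "distr (lebesgue_on U) borel u = density lborel (\<lambda>y. ennreal (m y))"
    and dg: "distr (density (lebesgue_on U) (\<lambda>x. ennreal (j x))) borel u = density lborel (\<lambda>y. ennreal (g y))"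
    and jm [measurable]: "j \<in> borel_measurable (lebesgue_on U)"
    and j: "AE x in lebesgue_on U. 0 \<le> j x \<and> j x \<le> \<Lambda>"
  shows "integrable lborel (\<lambda>y. \<bar>m y - g y\<bar> powr p)"
    "(LINT y|lborel. \<bar>m y - g y\<bar> powr p) \<le> l powr (1 - p) * (LINT x|lebesgue_on U. \<bar>1 - j x\<bar> powr p)"
proof -
  let ?L = "lebesgue_on U"
  have Um: "U \<in> sets lebesgue" using L by blast
  interpret finite_measure ?L
    by (rule finite_measureI) (use L Um in \<open>auto simp: emeasure_restrict_space fmeasurable_def\<close>)
  define w where "w y = m y - g y" for y
  have wm [measurable]: "w \<in> borel_measurable borel" unfolding w_def by measurable
  define K where "K = 1 / l + 1"
  have K0: "0 < K" using l by (simp add: K_def add_pos_pos)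
  have gb: "0 \<le> g y" "g y \<le> 1" for y using g01[of y] by auto
  have mb: "m y \<le> 1 / l" for y using ml[of y] gb(2)[of y] l by (meson divide_right_mono less_imp_le order_trans)
  have wK: "\<bar>w y\<bar> \<le> K" for y using m0[of y] mb[of y] gb[of y] by (auto simp: w_def K_def abs_le_iff)
  have out: "g y = 0" "m y = 0" "w y = 0" if "y \<notin> cball c d" for y
    using gs[OF that] m0[of y] ml[of y] by (auto simp: w_def)
  have ibs: "integrable lborel h" if [measurable]: "h \<in> borel_measurable borel" and hb: "\<And>y. \<bar>h y\<bar> \<le> B" and h0: "\<And>y. y \<notin> cball c d \<Longrightarrow> h y = 0"
    for h :: "real^'n \<Rightarrow> real" and B
  proof (rule Bochner_Integration.integrable_bound)
    show "integrable lborel (\<lambda>y. B * indicator (cball c d) y)"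
      by (intro integrable_mult_right integrable_real_indicator emeasure_bounded_finite) auto
    show "AE y in lborel. norm (h y) \<le> norm (B * indicator (cball c d) y)"
    proof (rule AE_I2)
      fix y show "norm (h y) \<le> norm (B * indicator (cball c d) y)"
        using hb[of y] h0[of y] by (cases "y \<in> cball c d") auto
    qed
  qed simp
  have powb: "\<bar>w y\<bar> powr q \<le> K powr q" if "0 < q" for y q using wK[of y] that by (intro powr_mono2) auto
  \<comment> \<open>The dual function of \<open>w\<close>: its product with \<open>w\<close> is
    \<open>\<bar>w\<bar> powr p\<close>.\<close>
  define f where "f y = \<bar>w y\<bar> powr (p - 1) * sgn (w y)" for y
  have fm [measurable]: "f \<in> borel_measurable borel" unfolding f_def by measurable
  have fb: "\<bar>f y\<bar> \<le> K powr (p - 1)" for y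
  proof -
    have "\<bar>f y\<bar> \<le> \<bar>w y\<bar> powr (p - 1) * 1" unfolding f_def abs_mult by (intro mult_mono) (auto simp: sgn_if)
    then show ?thesis using powb[of "p - 1" y] p by simp
  qed
  show I: "integrable lborel (\<lambda>y. \<bar>m y - g y\<bar> powr p)"
    unfolding w_def[symmetric]
    by (rule ibs[where B = "K powr p"]) (use powb[of p] p out in \<open>auto\<close>)
  have eqw: "\<bar>w y\<bar> powr p = m y * f y - g y * f y" for y
  proof -
    have "\<bar>w y\<bar> powr p = \<bar>w y\<bar> powr (p - 1) * \<bar>w y\<bar>" using p powr_mult_base[of "\<bar>w y\<bar>" "p - 1"] by (simp add: mult.commute)
    also have "\<dots> = f y * w y" by (simp add: f_def abs_sgn mult_ac)
    finally show ?thesis by (simp add: w_def algebra_simps)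
  qed
  have imf: "integrable lborel (\<lambda>y. m y * f y)"
  proof (rule ibs)
    show "\<bar>m y * f y\<bar> \<le> 1 / l * K powr (p - 1)" for y
      unfolding abs_mult using mb[of y] m0[of y] fb[of y] l by (intro mult_mono) auto
  qed (use out in auto)
  have igf: "integrable lborel (\<lambda>y. g y * f y)"
  proof (rule ibs)
    show "\<bar>g y * f y\<bar> \<le> 1 * K powr (p - 1)" for y
      unfolding abs_mult using gb[of y] fb[of y] by (intro mult_mono) auto
  qed (use out in auto)
  have pull: "(LINT y|lborel. m y * h y) = (LINT x|?L. h (u x))" if [measurable]: "h \<in> borel_measurable borel" for h :: "real^'n \<Rightarrow> real"
  proof -
    have "(LINT y|lborel. m y * h y) = integral\<^sup>L (density lborel (\<lambda>y. ennreal (m y))) h"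
      using m0 by (subst integral_density) auto
    also have "\<dots> = (LINT x|?L. h (u x))" unfolding dm[symmetric] by (rule integral_distr) measurable
    finally show ?thesis .
  qed
  have pullg: "(LINT y|lborel. g y * f y) = (LINT x|?L. j x * f (u x))"
  proof -
    have "(LINT y|lborel. g y * f y) = integral\<^sup>L (density lborel (\<lambda>y. ennreal (g y))) f"
      using gb by (subst integral_density) auto
    also have "\<dots> = integral\<^sup>L (density ?L (\<lambda>x. ennreal (j x))) (\<lambda>x. f (u x))"
      unfolding dg[symmetric] by (rule integral_distr) (use um in auto)
    also have "\<dots> = (LINT x|?L. j x * f (u x))"
    proof (subst integral_density)
      show "AE x in ?L. 0 \<le> j x" using j by (rule AE_mp) auto
    qed auto
    finally show ?thesis .
  qed
  have iu: "integrable ?L (\<lambda>x. f (u x))" by (rule integrable_const_bound[of _ "K powr (p - 1)"]) (use fb in auto)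
  have iju: "integrable ?L (\<lambda>x. j x * f (u x))"
  proof (rule integrable_const_bound)
    show "AE x in ?L. norm (j x * f (u x)) \<le> \<Lambda> * K powr (p - 1)"
      using j
    proof (rule AE_mp, intro AE_I2 impI)
      fix x assume "0 \<le> j x \<and> j x \<le> \<Lambda>"
      then show "norm (j x * f (u x)) \<le> \<Lambda> * K powr (p - 1)"
        unfolding real_norm_def abs_mult using fb[of "u x"] by (intro mult_mono) auto
    qed
  qed measurable
  define I where "I = (LINT y|lborel. \<bar>w y\<bar> powr p)"
  define A where "A = (LINT x|?L. \<bar>1 - j x\<bar> powr p)"
  have iA: "integrable ?L (\<lambda>x. \<bar>1 - j x\<bar> powr p)"
  proof (rule integrable_const_bound)
    show "AE x in ?L. norm (\<bar>1 - j x\<bar> powr p) \<le> (1 + \<Lambda>) powr p"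
      using j by (rule AE_mp) (use p in \<open>auto intro!: AE_I2 powr_mono2\<close>)
  qed measurable
  have iB: "integrable ?L (\<lambda>x. \<bar>w (u x)\<bar> powr p)"
    by (rule integrable_const_bound[of _ "K powr p"]) (use powb[of p] p in auto)
  \<comment> \<open>The weights \<open>l powr ((1 - p) / p)\<close> and
    \<open>l powr (1 / p)\<close> cancel in the product. They leave the factor \<open>l\<close> in
    front of \<open>\<bar>w (u x)\<bar> powr p\<close>; after transport to the target this meets
    \<open>m \<le> 1 / l\<close>, so the term becomes \<open>(p - 1) / p * I\<close> and is absorbed
    on the left.\<close>
  have young: "f (u x) - j x * f (u x) \<le> l powr (1 - p) / p * \<bar>1 - j x\<bar> powr p + (p - 1) / p * l * \<bar>w (u x)\<bar> powr p" for x
  proof -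
    define a where "a = \<bar>1 - j x\<bar>"
    define b where "b = \<bar>w (u x)\<bar>"
    have ab: "0 \<le> a" "0 \<le> b" by (auto simp: a_def b_def)
    have "f (u x) - j x * f (u x) = (1 - j x) * f (u x)" by (simp add: algebra_simps)
    also have "\<dots> \<le> \<bar>(1 - j x) * f (u x)\<bar>" by simp
    also have "\<dots> = a * \<bar>f (u x)\<bar>" by (simp add: abs_mult a_def)
    also have "\<dots> \<le> a * b powr (p - 1)"
      unfolding f_def b_def abs_mult using ab by (intro mult_left_mono) (auto simp: sgn_if)
    also have "\<dots> = (a * l powr ((1 - p) / p)) * (b * l powr (1 / p)) powr (p - 1)"
    proof -
      have "l powr ((1 - p) / p) * l powr (1 / p * (p - 1)) = 1"
        using l p by (simp add: powr_add[symmetric] field_simps)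
      then show ?thesis using ab l by (simp add: powr_mult powr_powr mult_ac)
    qed
    also have "\<dots> \<le> (a * l powr ((1 - p) / p)) powr p / p + (p - 1) / p * (b * l powr (1 / p)) powr p"
      using ab p by (intro Young_powr) auto
    also have "(a * l powr ((1 - p) / p)) powr p = l powr (1 - p) * a powr p"
      using ab l p by (simp add: powr_mult powr_powr)
    also have "(b * l powr (1 / p)) powr p = l * b powr p"
      using ab l p by (simp add: powr_mult powr_powr)
    finally show ?thesis by (simp add: a_def b_def mult_ac)
  qed
  have "I = (LINT y|lborel. m y * f y) - (LINT y|lborel. g y * f y)"
    unfolding I_def eqw by (rule Bochner_Integration.integral_diff[OF imf igf])
  also have "\<dots> = (LINT x|?L. f (u x) - j x * f (u x))"
    unfolding pull[OF fm] pullg by (rule Bochner_Integration.integral_diff[OF iu iju, symmetric])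
  also have "\<dots> \<le> (LINT x|?L. l powr (1 - p) / p * \<bar>1 - j x\<bar> powr p + (p - 1) / p * l * \<bar>w (u x)\<bar> powr p)"
    by (rule integral_mono[OF Bochner_Integration.integrable_diff[OF iu iju]
      Bochner_Integration.integrable_add[OF integrable_mult_right[OF iA] integrable_mult_right[OF iB]]]) (rule young)
  also have "\<dots> = l powr (1 - p) / p * A + (p - 1) / p * l * (LINT x|?L. \<bar>w (u x)\<bar> powr p)"
    unfolding Bochner_Integration.integral_add[OF integrable_mult_right[OF iA] integrable_mult_right[OF iB]] A_def by simp
  also have "(LINT x|?L. \<bar>w (u x)\<bar> powr p) = (LINT y|lborel. m y * \<bar>w y\<bar> powr p)"
    by (rule pull[symmetric]) measurable
  also have "(LINT y|lborel. m y * \<bar>w y\<bar> powr p) \<le> 1 / l * I"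
  proof -
    have "(LINT y|lborel. m y * \<bar>w y\<bar> powr p) \<le> (LINT y|lborel. 1 / l * \<bar>w y\<bar> powr p)"
    proof (rule integral_mono_AE')
      show "integrable lborel (\<lambda>y. 1 / l * \<bar>w y\<bar> powr p)" using I unfolding w_def[symmetric] by (rule integrable_mult_right)
      show "AE y in lborel. m y * \<bar>w y\<bar> powr p \<le> 1 / l * \<bar>w y\<bar> powr p" using mb by (intro AE_I2 mult_right_mono) auto
      show "AE y in lborel. 0 \<le> 1 / l * \<bar>w y\<bar> powr p" using l by (intro AE_I2) simp
    qed
    then show ?thesis by (simp add: I_def)
  qed
  then have "l powr (1 - p) / p * A + (p - 1) / p * l * (LINT y|lborel. m y * \<bar>w y\<bar> powr p) \<le>
    l powr (1 - p) / p * A + (p - 1) / p * l * (1 / l * I)"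
    using p l by (intro add_left_mono mult_left_mono) auto
  finally have "I \<le> l powr (1 - p) / p * A + (p - 1) / p * l * (1 / l * I)" .
  then have "p * I \<le> p * (l powr (1 - p) / p * A + (p - 1) / p * I)" using p l by (intro mult_left_mono) auto
  also have "\<dots> = l powr (1 - p) * A + (p - 1) * I" using p by (simp add: field_simps)
  finally have "I \<le> l powr (1 - p) * A" by (simp add: algebra_simps)
  then show "(LINT y|lborel. \<bar>m y - g y\<bar> powr p) \<le> l powr (1 - p) * (LINT x|?L. \<bar>1 - j x\<bar> powr p)"
    by (simp add: I_def A_def w_def)
qed

text \<open>The map is the composition of \<open>u\<close> with the shift \<open>T\<close>. Its cost
  is the transport cost with weight bound \<open>1 / l\<close> applied to the deviation
  \<open>w\<close>, so the exponents combine as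
  \<open>1 / l * l powr (1 - p) = l powr - p\<close>.\<close>

lemma measure_decreasing_rearrangement:
  fixes u :: "real^'n \<Rightarrow> real^'n"
  assumes p: "1 < p" and U: "open U" "bounded U" and u: "u \<in> W_1_infinity U" and Du: "has_weak_jacobian U u Du"
    and inj: "essentially_injective U u" and d: "diameter (u ` U) \<le> d" and l: "0 < l"
    and J: "AE x in lebesgue_on U. l \<le> det (Du x) \<and> det (Du x) \<le> \<Lambda>"
  obtains s where "s \<in> borel_measurable (lebesgue_on U)" "bounded (s ` U)"
    "\<And>B. B \<in> sets borel \<Longrightarrow> emeasure lebesgue (U \<inter> s -` B) \<le> emeasure lborel B"
    "(\<integral>\<^sup>+x. ennreal (norm (u x - s x) powr p) \<partial>lebesgue_on U) \<le>
      ennreal ((2 * d) powr p * l powr - p * (LINT x:U|lebesgue. \<bar>1 - det (Du x)\<bar> powr p))"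
    "0 < d"
proof -
  let ?L = "lebesgue_on U"
  have Um: "U \<in> sets lebesgue" using borel_open[OF U(1)] by simp
  have Ul: "U \<in> lmeasurable" using U(2) Um by (rule bounded_set_imp_lmeasurable)
  define j where "j x = indicator U x * det (Du x)" for x
  obtain c m g where [measurable]: "m \<in> borel_measurable borel" and [measurable]: "g \<in> borel_measurable borel"
    and mg: "\<And>y. 0 \<le> m y" "\<And>y. m y \<le> g y / l" "\<And>y. g y = 0 \<or> g y = 1" "\<And>y. y \<notin> cball c d \<Longrightarrow> g y = 0" and d0: "0 < d"
    and dm: "distr ?L borel u = density lborel (\<lambda>y. ennreal (m y))"
    and dg: "distr (density ?L (\<lambda>x. ennreal (j x))) borel u = density lborel (\<lambda>y. ennreal (g y))"
    and jm: "j \<in> borel_measurable lebesgue" and um [measurable]: "u \<in> borel_measurable ?L"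
    unfolding j_def by (rule image_densities[OF U u Du inj d l J]) blast
  have jm' [measurable]: "j \<in> borel_measurable ?L" using jm by (rule measurable_restrict_space1)
  have jb: "AE x in ?L. 0 \<le> j x \<and> j x \<le> \<Lambda>"
  proof (rule AE_mp[OF J], intro AE_I2 impI)
    fix x assume "x \<in> space ?L" "l \<le> det (Du x) \<and> det (Du x) \<le> \<Lambda>"
    then show "0 \<le> j x \<and> j x \<le> \<Lambda>" using l by (simp add: j_def space_restrict_space)
  qed
  define w where "w y = m y - g y" for y
  have wm [measurable]: "w \<in> borel_measurable borel" unfolding w_def by measurable
  define A where "A = (LINT x|?L. \<bar>1 - j x\<bar> powr p)"
  have dev: "integrable lborel (\<lambda>y. \<bar>w y\<bar> powr p)" "(LINT y|lborel. \<bar>w y\<bar> powr p) \<le> l powr (1 - p) * A"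
    unfolding w_def A_def
    by (rule density_deviation[OF p Ul um _ _ mg l dm dg jm' jb]; measurable)+
  have A_eq: "A = (LINT x:U|lebesgue. \<bar>1 - det (Du x)\<bar> powr p)"
  proof -
    have "A = (LINT x|?L. \<bar>1 - det (Du x)\<bar> powr p)"
      unfolding A_def by (rule Bochner_Integration.integral_cong) (auto simp: j_def space_restrict_space)
    also have "\<dots> = (LINT x:U|lebesgue. \<bar>1 - det (Du x)\<bar> powr p)"
      unfolding set_lebesgue_integral_def using Um by (subst integral_restrict_space) auto
    finally show ?thesis .
  qed
  have gb: "0 \<le> g y" "g y \<le> 1" for y using mg(3)[of y] by auto
  have mb: "m y \<le> 1 / l" for y using mg(2)[of y] gb(2)[of y] l by (meson divide_right_mono less_imp_le order_trans)
  define K where "K = 1 / l + 1"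
  have wK: "\<bar>w y\<bar> \<le> K" for y using mg(1)[of y] mb[of y] gb[of y] by (auto simp: w_def K_def abs_le_iff)
  have w1: "- 1 \<le> w y" for y using mg(1)[of y] gb[of y] by (simp add: w_def)
  have out: "m y = 0" "w y = 0" if "y \<notin> cball c d" for y
    using mg(4)[OF that] mg(1)[of y] mg(2)[of y] by (auto simp: w_def)
  obtain e :: "real^'n" where e: "norm e = 1" using vector_choose_size[of 1] by auto
  define T where "T y = y + line_shift e w y *\<^sub>R e" for y
  have Tm [measurable]: "T \<in> borel_measurable borel" unfolding T_def by measurable
  have pull: "(\<integral>\<^sup>+x. F (u x) \<partial>?L) = (\<integral>\<^sup>+y. F y * ennreal (m y) \<partial>lborel)" if [measurable]: "F \<in> borel_measurable borel" for F
  proof -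
    have "(\<integral>\<^sup>+x. F (u x) \<partial>?L) = integral\<^sup>N (distr ?L borel u) F" by (rule nn_integral_distr[symmetric]) measurable
    also have "\<dots> = (\<integral>\<^sup>+y. ennreal (m y) * F y \<partial>lborel)" unfolding dm by (rule nn_integral_density) measurable
    finally show ?thesis by (simp add: mult.commute)
  qed
  define s where "s x = T (u x)" for x
  have sm [measurable]: "s \<in> borel_measurable ?L" unfolding s_def by measurable
  show thesis
  proof (rule that[OF sm _ _ _ d0])
    show "emeasure lebesgue (U \<inter> s -` B) \<le> emeasure lborel B" if B [measurable]: "B \<in> sets borel" for B
    proof -
      have pre: "U \<inter> s -` B \<in> sets lebesgue"
        using measurable_sets[OF sm B] Um by (simp add: sets_restrict_space_iff Int_commute)
      have "emeasure lebesgue (U \<inter> s -` B) = (\<integral>\<^sup>+x. indicator (U \<inter> s -` B) x \<partial>lebesgue)" using pre by simp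
      also have "\<dots> = (\<integral>\<^sup>+x. indicator B (T (u x)) \<partial>?L)"
        unfolding nn_lebesgue_on[OF Um] by (rule nn_integral_cong) (auto simp: indicator_def s_def)
      also have "\<dots> = (\<integral>\<^sup>+y. indicator B (T y) * ennreal (m y) \<partial>lborel)" by (rule pull) measurable
      also have "\<dots> \<le> (\<integral>\<^sup>+y. indicator B (T y) * ennreal (1 + w y) \<partial>lborel)"
        using gb by (intro nn_integral_mono mult_left_mono ennreal_leI) (auto simp: w_def)
      also have "\<dots> = (\<integral>\<^sup>+y. indicator B y \<partial>lborel)"
        unfolding T_def by (rule transport_shear[OF e wm wK w1 d0 out(2)]) auto
      also have "\<dots> = emeasure lborel B" by simp
      finally show ?thesis .
    qed
    have "(\<integral>\<^sup>+x. ennreal (norm (u x - s x) powr p) \<partial>?L) = (\<integral>\<^sup>+x. ennreal (\<bar>line_shift e w (u x)\<bar> powr p) \<partial>?L)"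
      using e by (intro nn_integral_cong) (simp add: s_def T_def)
    also have "\<dots> = (\<integral>\<^sup>+y. ennreal (\<bar>line_shift e w y\<bar> powr p) * ennreal (m y) \<partial>lborel)" by (rule pull) measurable
    also have "\<dots> \<le> ennreal (1 / l * (2 * d) powr p) * (\<integral>\<^sup>+y. ennreal (\<bar>w y\<bar> powr p) \<partial>lborel)"
      using l by (intro transport_cost[OF p e wm wK d0 out(2) _ mb _ out(1)]) auto
    also have "(\<integral>\<^sup>+y. ennreal (\<bar>w y\<bar> powr p) \<partial>lborel) = ennreal (LINT y|lborel. \<bar>w y\<bar> powr p)"
      by (rule nn_integral_eq_integral[OF dev(1)]) simp
    also have "ennreal (1 / l * (2 * d) powr p) * ennreal (LINT y|lborel. \<bar>w y\<bar> powr p) \<le> ennreal (1 / l * (2 * d) powr p) * ennreal (l powr (1 - p) * A)"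
      using dev(2) by (intro mult_left_mono ennreal_leI) auto
    also have "\<dots> = ennreal ((2 * d) powr p * l powr - p * A)"
    proof -
      have 1: "1 / l * l powr (1 - p) = l powr - p" using l by (simp add: powr_diff powr_minus_divide)
      have "1 / l * (2 * d) powr p * (l powr (1 - p) * A) = (2 * d) powr p * (1 / l * l powr (1 - p)) * A" by (simp only: mult_ac)
      also have "\<dots> = (2 * d) powr p * l powr - p * A" unfolding 1 ..
      finally have "1 / l * (2 * d) powr p * (l powr (1 - p) * A) = (2 * d) powr p * l powr - p * A" .
      moreover have "0 \<le> A" by (simp add: A_def)
      ultimately show ?thesis using l by (simp add: ennreal_mult[symmetric])
    qed
    finally show "(\<integral>\<^sup>+x. ennreal (norm (u x - s x) powr p) \<partial>?L) \<le>
      ennreal ((2 * d) powr p * l powr - p * (LINT x:U|lebesgue. \<bar>1 - det (Du x)\<bar> powr p))"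
      unfolding A_eq .
    show "bounded (s ` U)"
    proof -
      obtain R where R: "\<And>x. x \<in> U \<Longrightarrow> norm (u x) \<le> R" using W_1_infinity_bounded[OF U(1) u] by (auto simp: bounded_iff)
      \<comment> \<open>On each line \<open>w\<close> is bounded by \<open>K\<close> and lives on
        length \<open>2 * d\<close>, which bounds the shift. Boundedness of \<open>s\<close> is
        required by the later approximation on a finite grid.\<close>
      have sh: "\<bar>line_shift e w y\<bar> \<le> K * (2 * d)" for y
      proof -
        let ?J = "{(c - y) \<bullet> e - d..(c - y) \<bullet> e - d + 2 * d}"
        have "\<bar>line_shift e w y\<bar> \<le> (LINT t|lborel. K * indicator ?J t)"
          unfolding line_shift_def
        proof (rule Bochner_Integration.integral_abs_bound_integral)
          have 0: "\<bar>w (y + t *\<^sub>R e)\<bar> \<le> K * indicator ?J t" for t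
          proof (cases "t \<in> ?J")
            case False
            have "w (y + t *\<^sub>R e) = 0" by (rule line_support[OF e _ False]) (rule out(2))
            with False show ?thesis by simp
          qed (use wK in simp)
          have "\<bar>w (y + t *\<^sub>R e)\<bar> * indicator {..0} t \<le> \<bar>w (y + t *\<^sub>R e)\<bar> * 1" for t :: real
            by (intro mult_left_mono) (auto simp: indicator_def)
          then show *: "\<bar>w (y + t *\<^sub>R e) * indicator {..0} t\<bar> \<le> K * indicator ?J t" for t
            using 0[of t] unfolding abs_mult by (simp, meson order_trans)
          show **: "integrable lborel (\<lambda>t. K * indicator ?J t)"
            using d0 by (intro integrable_mult_right integrable_real_indicator) auto
          show "integrable lborel (\<lambda>t. w (y + t *\<^sub>R e) * indicator {..0} t)"
          proof (rule Bochner_Integration.integrable_bound[OF **])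
            show "AE t in lborel. norm (w (y + t *\<^sub>R e) * indicator {..0} t) \<le> norm (K * indicator ?J t)"
              using * by (intro AE_I2) (simp only: real_norm_def abs_le_iff, meson abs_ge_self order_trans abs_le_D1 abs_le_D2)
          qed measurable
        qed
        also have "\<dots> = K * (2 * d)" using d0 by simp
        finally show ?thesis .
      qed
      have "norm (s x) \<le> R + K * (2 * d)" if "x \<in> U" for x
      proof -
        have "norm (s x) \<le> norm (u x) + norm (line_shift e w (u x) *\<^sub>R e)" unfolding s_def T_def by (rule norm_triangle_ineq)
        then show ?thesis using R[OF that] sh[of "u x"] e by simp
      qed
      then show ?thesis by (auto simp: bounded_iff)
    qed
  qed
qed

section \<open>Row shifts of a grid\<close>

text \<open>Only the line through \<open>c\<close> in direction \<open>i\<close> is moved. Working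
  on the whole infinite lattice makes the shift a bijection without any boundary convention.\<close>

definition row_shift :: "'n \<Rightarrow> ('n \<Rightarrow> int) \<Rightarrow> int \<Rightarrow> ('n \<Rightarrow> int) \<Rightarrow> 'n \<Rightarrow> int" where
  "row_shift i c m z = (if \<forall>j. j \<noteq> i \<longrightarrow> z j = c j then z(i := z i + m) else z)"

inductive row_word :: "(('n \<Rightarrow> int) \<Rightarrow> 'n \<Rightarrow> int) \<Rightarrow> bool" where
  id: "row_word (\<lambda>z. z)"
| shift: "row_word w \<Longrightarrow> row_word (\<lambda>z. row_shift i c m (w z))"

lemma row_word_compose: "row_word v \<Longrightarrow> row_word w \<Longrightarrow> row_word (\<lambda>z. v (w z))"
  by (induction rule: row_word.induct) (auto intro: row_word.shift)

lemma row_word_shift: "row_word (row_shift i c m)"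
  by (rule row_word.shift[OF row_word.id])

lemma row_shift_inverse [simp]: "row_shift i c m (row_shift i c (- m) z) = z"
  by (auto simp: row_shift_def fun_eq_iff)

lemma row_shift_inverse' [simp]: "row_shift i c (- m) (row_shift i c m z) = z"
  using row_shift_inverse[of i c "- m" z] by simp

lemma row_word_inj: "row_word w \<Longrightarrow> inj w"
proof (induction rule: row_word.induct)
  case (shift w i c m)
  show ?case
  proof (rule injI)
    fix x y assume "row_shift i c m (w x) = row_shift i c m (w y)"
    then have "w x = w y" by (metis row_shift_inverse')
    then show "x = y" using shift.IH by (rule injD[rotated])
  qed
qed simp

text \<open>The commutator of two shifts along lines that meet only in \<open>p\<close> is a 3-cycle.\<close>

lemma row_word_three_cycle:
  fixes p :: "'n \<Rightarrow> int"
  assumes ij: "i \<noteq> j" and m: "m \<noteq> 0" and k: "k \<noteq> 0"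
  obtains w where "row_word w" "w p = p(i := p i + m)"
    "\<And>x. x \<noteq> p \<Longrightarrow> x \<noteq> p(i := p i + m) \<Longrightarrow> x \<noteq> p(j := p j + k) \<Longrightarrow> w x = x"
proof -
  define \<alpha> where "\<alpha> = row_shift i p m"
  define \<alpha>' where "\<alpha>' = row_shift i p (- m)"
  define \<beta> where "\<beta> = row_shift j p k"
  define \<beta>' where "\<beta>' = row_shift j p (- k)"
  define R where "R x \<longleftrightarrow> (\<forall>l. l \<noteq> i \<longrightarrow> x l = p l)" for x :: "'n \<Rightarrow> int"
  define C where "C x \<longleftrightarrow> (\<forall>l. l \<noteq> j \<longrightarrow> x l = p l)" for x :: "'n \<Rightarrow> int"
  have inv: "\<alpha> (\<alpha>' x) = x" "\<beta> (\<beta>' x) = x" "\<beta>' (\<beta> x) = x" "\<alpha>' (\<alpha> x) = x" for x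
    by (simp_all add: \<alpha>_def \<alpha>'_def \<beta>_def \<beta>'_def)
  have offR: "\<alpha> x = x" "\<alpha>' x = x" if "\<not> R x" for x using that by (auto simp: \<alpha>_def \<alpha>'_def row_shift_def R_def)
  have offC: "\<beta> x = x" "\<beta>' x = x" if "\<not> C x" for x using that by (auto simp: \<beta>_def \<beta>'_def row_shift_def C_def)
  have onR: "R (\<alpha>' x)" if "R x" for x using that by (auto simp: \<alpha>'_def row_shift_def R_def)
  have onC: "C (\<beta>' x)" if "C x" for x using that by (auto simp: \<beta>'_def row_shift_def C_def)
  have RC: "x = p" if "R x" "C x" for x
  proof
    fix l show "x l = p l" using that ij by (cases "l = i") (auto simp: R_def C_def)
  qed
  have p: "R p" "C p" by (auto simp: R_def C_def)
  have ap: "\<alpha> p = p(i := p i + m)" by (simp add: \<alpha>_def row_shift_def)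
  have bp: "\<beta> p = p(j := p j + k)" by (simp add: \<beta>_def row_shift_def)
  have b'p: "\<beta>' p \<noteq> p" using k by (auto simp: \<beta>'_def row_shift_def fun_eq_iff)
  show thesis
  \<comment> \<open>The inner shift takes \<open>p\<close> off the row, so the inverse row shift
    leaves it alone, \<beta> brings it back to \<open>p\<close>, and \<alpha> moves it along the
    row. Any other point is moved by at most one pair of inverse shifts unless it passes through
    \<open>p\<close>, which happens only for the two excluded points.\<close>
  proof (rule that[of "\<lambda>x. \<alpha> (\<beta> (\<alpha>' (\<beta>' x)))"])
    show "row_word (\<lambda>x. \<alpha> (\<beta> (\<alpha>' (\<beta>' x))))"
      unfolding \<alpha>_def \<beta>_def \<alpha>'_def \<beta>'_def by (intro row_word.intros row_word_shift)
    have "\<not> R (\<beta>' p)" using RC onC[OF p(2)] b'p by blast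
    then have "\<alpha>' (\<beta>' p) = \<beta>' p" by (rule offR)
    then show "\<alpha> (\<beta> (\<alpha>' (\<beta>' p))) = p(i := p i + m)" by (simp add: inv ap)
    fix x assume x: "x \<noteq> p" "x \<noteq> p(i := p i + m)" "x \<noteq> p(j := p j + k)"
    show "\<alpha> (\<beta> (\<alpha>' (\<beta>' x))) = x"
    proof (cases "C x")
      case True
      have "\<beta>' x \<noteq> p" using x(3) bp inv(2)[of x] by auto
      then have "\<not> R (\<beta>' x)" using RC onC[OF True] by blast
      moreover have "\<not> R x" using RC True x(1) by blast
      ultimately show ?thesis using offR by (simp add: inv)
    next
      case False
      then have b: "\<beta>' x = x" by (rule offC)
      show ?thesis
      proof (cases "R x")
        case True
        have "\<alpha>' x \<noteq> p" using x(2) ap inv(1)[of x] by auto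
        then have "\<not> C (\<alpha>' x)" using RC onR[OF True] by blast
        then show ?thesis using offC b by (simp add: inv)
      next
        case False
        then show ?thesis using offR offC[OF \<open>\<not> C x\<close>] b by simp
      qed
    qed
  qed
qed

text \<open>Reachability under the pointwise stabiliser of \<open>A\<close>, the set of cells that
  are already in place.\<close>

definition moves_fixing :: "('n \<Rightarrow> int) set \<Rightarrow> ('n \<Rightarrow> int) \<Rightarrow> ('n \<Rightarrow> int) \<Rightarrow> bool" where
  "moves_fixing A p q \<longleftrightarrow> (\<exists>w. row_word w \<and> (\<forall>a\<in>A. w a = a) \<and> w p = q)"

lemma moves_fixing_refl: "moves_fixing A p p"
  unfolding moves_fixing_def using row_word.id by blast

lemma moves_fixing_trans: "moves_fixing A p q \<Longrightarrow> moves_fixing A q r \<Longrightarrow> moves_fixing A p r"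
  unfolding moves_fixing_def
proof (elim exE conjE)
  fix v w assume "row_word v" "row_word w" "\<forall>a\<in>A. v a = a" "\<forall>a\<in>A. w a = a" "v p = q" "w q = r"
  then show "\<exists>w. row_word w \<and> (\<forall>a\<in>A. w a = a) \<and> w p = r"
    by (intro exI[of _ "\<lambda>z. w (v z)"]) (simp add: row_word_compose)
qed

text \<open>A 3-cycle through \<open>p\<close>, the target and a third point in another direction
  \<open>j\<close>. The third point can be put beyond the finite set \<open>A\<close>; a second
  direction exists because the dimension is at least two.\<close>

lemma moves_fixing_step:
  fixes p :: "'n::finite \<Rightarrow> int"
  assumes n: "2 \<le> CARD('n)" and A: "finite A" "p \<notin> A" "p(i := b) \<notin> A"
  shows "moves_fixing A p (p(i := b))"
proof (cases "b = p i")
  case True then show ?thesis by (simp add: moves_fixing_refl)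
next
  case False
  obtain j where j: "i \<noteq> j"
  proof -
    have "UNIV \<noteq> {i}" using n by (metis card_1_singleton_iff One_nat_def card.empty numeral_le_one_iff semiring_norm(69) is_singletonI is_singleton_altdef)
    then obtain j where "j \<noteq> i" by blast
    then show thesis using that[of j] by simp
  qed
  \<comment> \<open>The coordinate \<open>N\<close> occurs in no point of \<open>A\<close>, so the
    third point of the cycle is not in \<open>A\<close>; it differs from \<open>p j\<close>, so the
    shift is not trivial.\<close>
  have "infinite (UNIV - ({p j} \<union> (\<lambda>a. a j) ` A))" using A(1) by (intro Diff_infinite_finite infinite_UNIV_int) auto
  then obtain N where N: "N \<notin> {p j} \<union> (\<lambda>a. a j) ` A" by (metis DiffD2 ex_in_conv finite.emptyI)
  have "b - p i \<noteq> 0" "N - p j \<noteq> 0" using False N by auto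
  then obtain w where w: "row_word w" "w p = p(i := p i + (b - p i))"
    "\<And>x. x \<noteq> p \<Longrightarrow> x \<noteq> p(i := p i + (b - p i)) \<Longrightarrow> x \<noteq> p(j := p j + (N - p j)) \<Longrightarrow> w x = x"
    by (rule row_word_three_cycle[OF j, where p = p]) blast
  have "w a = a" if a: "a \<in> A" for a
  proof (rule w(3))
    show "a \<noteq> p" "a \<noteq> p(i := p i + (b - p i))" using a A by auto
    show "a \<noteq> p(j := p j + (N - p j))"
    proof
      assume "a = p(j := p j + (N - p j))"
      then have "a j = N" by simp
      with N a show False by blast
    qed
  qed
  with w(1,2) show ?thesis unfolding moves_fixing_def by auto
qed

text \<open>Changing coordinates one after another might run into \<open>A\<close>. The path
  therefore first enters a hyperplane \<open>x i = M\<close> that misses \<open>A\<close>, adjusts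
  the remaining coordinates there, and finally restores coordinate \<open>i\<close>.\<close>

lemma moves_fixing_all:
  fixes p q :: "'n::finite \<Rightarrow> int"
  assumes n: "2 \<le> CARD('n)" and A: "finite A" "p \<notin> A" "q \<notin> A"
  shows "moves_fixing A p q"
proof -
  obtain i :: 'n where True by simp
  have "infinite (UNIV - (\<lambda>a. a i) ` A)" using A(1) by (intro Diff_infinite_finite infinite_UNIV_int) auto
  then obtain M where M: "M \<notin> (\<lambda>a. a i) ` A" by (metis DiffD2 ex_in_conv finite.emptyI)
  have offA: "x \<notin> A" if "x i = M" for x using M that by blast
  have mid: "moves_fixing A (p(i := M)) (\<lambda>l. if l = i then M else if l \<in> J then q l else p l)" if "finite J" for J
    using that
  proof (induction J)
    case empty
    have "p(i := M) = (\<lambda>l. if l = i then M else if l \<in> {} then q l else p l)" by (auto simp: fun_eq_iff)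
    then show ?case using moves_fixing_refl by metis
  next
    case (insert j J)
    let ?x = "\<lambda>J l. if l = i then M else if l \<in> J then q l else p l"
    show ?case
    proof (cases "j = i")
      case True
      then have "?x (insert j J) = ?x J" by (auto simp: fun_eq_iff)
      then show ?thesis using insert.IH by simp
    next
      case False
      then have eq: "?x (insert j J) = (?x J)(j := q j)" by (auto simp: fun_eq_iff)
      have "moves_fixing A (?x J) ((?x J)(j := q j))"
        by (rule moves_fixing_step[OF n A(1)]) (use False in \<open>auto intro!: offA\<close>)
      then show ?thesis unfolding eq by (rule moves_fixing_trans[OF insert.IH])
    qed
  qed
  have "moves_fixing A p (p(i := M))" by (rule moves_fixing_step[OF n A(1,2)]) (simp add: offA)
  moreover have "moves_fixing A (p(i := M)) (q(i := M))"
  proof -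
    have "(\<lambda>l. if l = i then M else if l \<in> UNIV then q l else p l) = q(i := M)" by (auto simp: fun_eq_iff)
    then show ?thesis using mid[of UNIV] by simp
  qed
  moreover have "moves_fixing A (q(i := M)) q"
  proof -
    have "moves_fixing A (q(i := M)) ((q(i := M))(i := q i))"
      by (rule moves_fixing_step[OF n A(1)]) (use A(3) in \<open>simp_all add: offA\<close>)
    then show ?thesis by simp
  qed
  ultimately show ?thesis by (blast intro: moves_fixing_trans)
qed

text \<open>Induction on \<open>A\<close>: once its points are in place, the image of the new point
  is carried to its goal by a word that fixes all goals reached so far. Injectivity of
  \<open>w\<close> and of \<open>f\<close> keeps start and goal away from those.\<close>

theorem row_word_highly_transitive:
  fixes f :: "('n::finite \<Rightarrow> int) \<Rightarrow> 'n \<Rightarrow> int"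
  assumes n: "2 \<le> CARD('n)" and A: "finite A" "inj_on f A"
  obtains w where "row_word w" "\<And>a. a \<in> A \<Longrightarrow> w a = f a"
proof -
  have "\<exists>w. row_word w \<and> (\<forall>a\<in>A. w a = f a)"
    using A
  proof (induction A)
    case empty
    show ?case using row_word.id by blast
  next
    case (insert p A)
    then obtain w where w: "row_word w" "\<And>a. a \<in> A \<Longrightarrow> w a = f a" by (auto simp: inj_on_insert)
    have "w p \<notin> w ` A" using row_word_inj[OF w(1)] insert.hyps(2) by (simp add: inj_image_mem_iff)
    then have 1: "w p \<notin> f ` A" using w(2) by auto
    have 2: "f p \<notin> f ` A" using insert.prems insert.hyps(2) by (auto simp: inj_on_insert)
    obtain h where h: "row_word h" "\<forall>a\<in>f ` A. h a = a" "h (w p) = f p"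
      using moves_fixing_all[OF n _ 1 2] insert.hyps(1) unfolding moves_fixing_def by blast
    show ?case
      by (rule exI[of _ "\<lambda>z. h (w z)"]) (use h w row_word_compose in auto)
  qed
  then show thesis using that by blast
qed

section \<open>From permutations of cells to smooth volume preserving maps\<close>

definition grid_cell :: "real \<Rightarrow> ('n::finite \<Rightarrow> int) \<Rightarrow> (real^'n) set" where
  "grid_cell h z = {x. \<forall>i. h * of_int (z i) < x $ i \<and> x $ i < h * (of_int (z i) + 1)}"

lemma open_grid_cell: "open (grid_cell h z)"
proof -
  have "grid_cell h z = box (\<chi> i. h * of_int (z i)) (\<chi> i. h * (of_int (z i) + 1))"
    by (auto simp: grid_cell_def mem_box_cart)
  then show ?thesis by (simp only: open_box)
qed

text \<open>Permutations of cells that are pointwise limits, uniformly on convergent sequences, of smooth volume preserving maps.\<close>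

definition smoothly_realizable :: "real \<Rightarrow> (('n::finite \<Rightarrow> int) \<Rightarrow> 'n \<Rightarrow> int) \<Rightarrow> bool" where
  "smoothly_realizable h w \<longleftrightarrow> (\<exists>S M. (\<forall>k. volume_diffeo (S k)) \<and> (\<forall>k x. norm (S k x - x) \<le> M) \<and>
     (\<forall>z x X. x \<in> grid_cell h z \<longrightarrow> X \<longlonglongrightarrow> x \<longrightarrow>
       (\<lambda>k. S k (X k)) \<longlonglongrightarrow> x + h *\<^sub>R (\<chi> i. of_int (w z i) - of_int (z i))))"

lemma smoothly_realizable_id: "smoothly_realizable h (\<lambda>z. z)"
  unfolding smoothly_realizable_def
proof (intro exI conjI allI impI)
  show "volume_diffeo (\<lambda>x. x)" by (rule volume_diffeo_id)
  show "norm (x - x) \<le> 0" for x :: "real^'a" by simp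
  fix z :: "'a \<Rightarrow> int" and x :: "real^'a" and X assume "X \<longlonglongrightarrow> x"
  moreover have "(\<chi> i. of_int (z i) - of_int (z i)) = (0 :: real^'a)" by (simp add: vec_eq_iff)
  ultimately show "X \<longlonglongrightarrow> x + h *\<^sub>R (\<chi> i. of_int (z i) - of_int (z i))" by simp
qed

text \<open>The outer maps are evaluated at the moving points \<open>T k (X k)\<close>, not at a
  fixed point. They converge to a point of the open cell \<open>w z\<close>, which is why the notion
  asks for limits along all convergent sequences.\<close>

lemma smoothly_realizable_compose:
  fixes v w :: "('n::finite \<Rightarrow> int) \<Rightarrow> 'n \<Rightarrow> int"
  assumes v: "smoothly_realizable h v" and w: "smoothly_realizable h w"
  shows "smoothly_realizable h (\<lambda>z. v (w z))"
proof -
  obtain S M where S: "\<And>k. volume_diffeo (S k)" "\<And>k x. norm (S k x - x) \<le> M"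
    "\<And>z x X. x \<in> grid_cell h z \<Longrightarrow> X \<longlonglongrightarrow> x \<Longrightarrow> (\<lambda>k. S k (X k)) \<longlonglongrightarrow> x + h *\<^sub>R (\<chi> i. of_int (v z i) - of_int (z i))"
    using v unfolding smoothly_realizable_def by blast
  obtain T N where T: "\<And>k. volume_diffeo (T k)" "\<And>k x. norm (T k x - x) \<le> N"
    "\<And>z x X. x \<in> grid_cell h z \<Longrightarrow> X \<longlonglongrightarrow> x \<Longrightarrow> (\<lambda>k. T k (X k)) \<longlonglongrightarrow> x + h *\<^sub>R (\<chi> i. of_int (w z i) - of_int (z i))"
    using w unfolding smoothly_realizable_def by blast
  show ?thesis
    unfolding smoothly_realizable_def
  proof (intro exI conjI allI impI)
    show "volume_diffeo (\<lambda>x. S k (T k x))" for k by (rule volume_diffeo_compose[OF T(1) S(1)])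
    show "norm (S k (T k x) - x) \<le> M + N" for k x
      using norm_triangle_ineq[of "S k (T k x) - T k x" "T k x - x"] S(2)[of k "T k x"] T(2)[of k x] by simp
    fix z :: "'n \<Rightarrow> int" and x X assume x: "x \<in> grid_cell h z" "X \<longlonglongrightarrow> x"
    let ?y = "x + h *\<^sub>R (\<chi> i. of_int (w z i) - of_int (z i))"
    have y: "?y \<in> grid_cell h (w z)" using x(1) by (auto simp: grid_cell_def algebra_simps)
    have "(\<lambda>k. S k (T k (X k))) \<longlonglongrightarrow> ?y + h *\<^sub>R (\<chi> i. of_int (v (w z) i) - of_int (w z i))"
      by (rule S(3)[OF y T(3)[OF x]])
    moreover have "?y + h *\<^sub>R (\<chi> i. of_int (v (w z) i) - of_int (w z i)) = x + h *\<^sub>R (\<chi> i. of_int (v (w z) i) - of_int (z i))"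
      by (simp add: vec_eq_iff algebra_simps)
    ultimately show "(\<lambda>k. S k (T k (X k))) \<longlonglongrightarrow> x + h *\<^sub>R (\<chi> i. of_int (v (w z) i) - of_int (z i))" by simp
  qed
qed

text \<open>The function \<beta> depends only on the coordinates other than \<open>i\<close> and is
  positive exactly over the cross-section of the row. Shears with the profile
  \<open>1 - (1 - \<beta> x) ^ Suc k\<close> therefore tend to a translation inside the row and do
  nothing outside it.\<close>

lemma smoothly_realizable_row_shift:
  assumes h: "0 < h"
  shows "smoothly_realizable h (row_shift i c m)"
proof -
  let ?J = "UNIV - {i}"
  define \<beta> where "\<beta> x = (\<Prod>j\<in>?J. bump 0 (x $ j - h * of_int (c j)) * bump 0 (h * (of_int (c j) + 1) - x $ j))" for x :: "real^'a"
  have alg\<beta>: "bump_algebra \<beta>"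
  proof -
    have "bump_algebra (\<lambda>x::real^'a. \<Prod>j\<in>J. bump 0 (x $ j - h * of_int (c j)) * bump 0 (h * (of_int (c j) + 1) - x $ j))"
      if "finite J" for J
      using that
    proof (induction J)
      case empty show ?case using bump_algebra.const[of 1] by simp
    next
      case (insert j J)
      have "bump_algebra (\<lambda>x::real^'a. bump 0 (- (h * of_int (c j)) + 1 * (x \<bullet> axis j 1)))"
        "bump_algebra (\<lambda>x::real^'a. bump 0 (h * (of_int (c j) + 1) + (-1) * (x \<bullet> axis j 1)))"
        by (rule bump_algebra.bump)+
      then have "bump_algebra (\<lambda>x::real^'a. bump 0 (x $ j - h * of_int (c j)))"
        "bump_algebra (\<lambda>x::real^'a. bump 0 (h * (of_int (c j) + 1) - x $ j))"
        by (simp_all add: inner_axis)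
      with insert show ?case by (simp add: bump_algebra.mult)
    qed
    then show ?thesis unfolding \<beta>_def by simp
  qed
  have \<beta>01: "0 \<le> \<beta> x" "\<beta> x \<le> 1" for x
    unfolding \<beta>_def
    by (auto intro!: prod_nonneg prod_le_1 mult_nonneg_nonneg mult_le_one bump_nonneg bump_0_le_1)
  have cont\<beta>: "continuous_on UNIV \<beta>" using bump_algebra_continuously_differentiable[OF alg\<beta>, of 0] by simp
  define \<theta> where "\<theta> k x = 1 - (1 - \<beta> x) ^ Suc k" for k x
  have \<theta>01: "0 \<le> \<theta> k x" "\<theta> k x \<le> 1" for k x
    using \<beta>01[of x] power_le_one[of "1 - \<beta> x" "Suc k"] zero_le_power[of "1 - \<beta> x" "Suc k"] unfolding \<theta>_def by linarith+
  define \<psi> where "\<psi> k x = h * of_int m * \<theta> k x" for k x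
  define S where "S k x = x + \<psi> k x *\<^sub>R axis i 1" for k x
  have alg\<psi>: "bump_algebra (\<psi> k)" for k
  proof -
    have "bump_algebra (\<lambda>x. (h * of_int m) * (1 + (-1) * (1 + (-1) * \<beta> x) ^ Suc k))"
      by (intro bump_algebra.intros bump_algebra_power alg\<beta>)
    then show ?thesis by (simp add: \<psi>_def[abs_def] \<theta>_def)
  qed
  have vd: "volume_diffeo (S k)" for k
  proof -
    obtain \<psi>' where \<psi>': "\<And>x. (\<psi> k has_derivative \<psi>' x) (at x)" "\<And>b. bump_algebra (\<lambda>x. \<psi>' x b)"
      using bump_algebra_derivative[OF alg\<psi>] by blast
    have "continuous_on UNIV (\<lambda>x. \<psi>' x b)" for b
      using bump_algebra_continuously_differentiable[OF \<psi>'(2), of 0] by simp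
    moreover have "\<psi> k (x + t *\<^sub>R axis i 1) = \<psi> k x" for x t
    proof -
      have "\<beta> (x + t *\<^sub>R axis i 1) = \<beta> x"
        unfolding \<beta>_def by (rule prod.cong) (auto simp: axis_def)
      then show ?thesis by (simp add: \<psi>_def \<theta>_def)
    qed
    ultimately show ?thesis unfolding S_def by (rule volume_diffeo_shear[OF \<psi>'(1)])
  qed
  have bound: "norm (S k x - x) \<le> \<bar>h * of_int m\<bar>" for k x
    using \<theta>01[of k x] mult_left_mono[of "\<bar>\<theta> k x\<bar>" 1 "\<bar>h * of_int m\<bar>"] by (simp add: S_def \<psi>_def abs_mult norm_axis_1)
  have lim: "(\<lambda>k. S k (X k)) \<longlonglongrightarrow> x + h *\<^sub>R (\<chi> l. of_int (row_shift i c m z l) - of_int (z l))"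
    if x: "x \<in> grid_cell h z" "X \<longlonglongrightarrow> x" for z x X
  proof (cases "\<forall>j. j \<noteq> i \<longrightarrow> z j = c j")
    case True
    have "0 < \<beta> x"
      unfolding \<beta>_def
    proof (rule prod_pos)
      fix j assume "j \<in> ?J"
      then have "z j = c j" using True by auto
      moreover have "h * of_int (z j) < x $ j" "x $ j < h * (of_int (z j) + 1)" using x(1) by (auto simp: grid_cell_def)
      ultimately have "0 < x $ j - h * of_int (c j)" "0 < h * (of_int (c j) + 1) - x $ j" by simp_all
      then show "0 < bump 0 (x $ j - h * of_int (c j)) * bump 0 (h * (of_int (c j) + 1) - x $ j)"
        by (intro mult_pos_pos) (simp_all add: bump_pos_iff)
    qed
    moreover have "(\<lambda>k. \<beta> (X k)) \<longlonglongrightarrow> \<beta> x"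
      using continuous_on_tendsto_compose[OF cont\<beta> x(2)] by simp
    ultimately have ev: "\<forall>\<^sub>F k in sequentially. \<beta> x / 2 < \<beta> (X k)" by (intro order_tendstoD(1)) auto
    \<comment> \<open>Along the moving points \<beta> eventually exceeds half of its limit, so the
      powers are dominated by a geometric sequence.\<close>
    define \<rho> where "\<rho> = 1 - \<beta> x / 2"
    have \<rho>: "0 \<le> \<rho>" "\<rho> < 1" using \<open>0 < \<beta> x\<close> \<beta>01[of x] by (auto simp: \<rho>_def)
    have "(\<lambda>k. (1 - \<beta> (X k)) ^ Suc k) \<longlonglongrightarrow> 0"
    proof (rule tendsto_sandwich[OF _ _ tendsto_const])
      show "\<forall>\<^sub>F k in sequentially. 0 \<le> (1 - \<beta> (X k)) ^ Suc k" using \<beta>01 by (intro always_eventually allI zero_le_power) simp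
      show "\<forall>\<^sub>F k in sequentially. (1 - \<beta> (X k)) ^ Suc k \<le> \<rho> ^ Suc k"
        using ev
      proof eventually_elim
        case (elim k)
        then show ?case using \<beta>01[of "X k"] by (intro power_mono) (auto simp: \<rho>_def)
      qed
      show "(\<lambda>k. \<rho> ^ Suc k) \<longlonglongrightarrow> 0" using \<rho> by (intro LIMSEQ_Suc LIMSEQ_power_zero) simp
    qed
    then have "(\<lambda>k. S k (X k)) \<longlonglongrightarrow> x + (h * of_int m * (1 - 0)) *\<^sub>R axis i 1"
      unfolding S_def \<psi>_def \<theta>_def by (intro tendsto_intros x(2))
    moreover have "(h * of_int m * (1 - 0)) *\<^sub>R axis i 1 = h *\<^sub>R (\<chi> l. (of_int (row_shift i c m z l) - of_int (z l) :: real))"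
      using True by (simp add: vec_eq_iff row_shift_def axis_def)
    ultimately show ?thesis by simp
  next
    case False
    then obtain j where j: "j \<noteq> i" "z j \<noteq> c j" by blast
    \<comment> \<open>On a cell off the row some factor of \<beta> vanishes, so each shear is the
      identity on this open cell, which contains \<open>X k\<close> for all large
      \<open>k\<close>.\<close>
    have zero: "\<beta> y = 0" if "y \<in> grid_cell h z" for y
    proof -
      have y: "h * of_int (z j) < y $ j" "y $ j < h * (of_int (z j) + 1)" using that by (auto simp: grid_cell_def)
      have "bump 0 (y $ j - h * of_int (c j)) * bump 0 (h * (of_int (c j) + 1) - y $ j) = 0"
      proof (cases "z j < c j")
        case True
        then have "of_int (z j) + 1 \<le> (of_int (c j) :: real)" by linarith
        then have "h * (of_int (z j) + 1) \<le> h * of_int (c j)" using h by (intro mult_left_mono) auto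
        then have "y $ j - h * of_int (c j) \<le> 0" using y by linarith
        then show ?thesis by (simp add: bump_def)
      next
        case False
        then have "of_int (c j) + 1 \<le> (of_int (z j) :: real)" using j(2) by linarith
        then have "h * (of_int (c j) + 1) \<le> h * of_int (z j)" using h by (intro mult_left_mono) auto
        then have "h * (of_int (c j) + 1) - y $ j \<le> 0" using y by linarith
        then show ?thesis by (simp add: bump_def)
      qed
      then show ?thesis unfolding \<beta>_def using j(1) by (intro prod_zero) auto
    qed
    have "\<forall>\<^sub>F k in sequentially. X k \<in> grid_cell h z" using topological_tendstoD[OF x(2) open_grid_cell x(1)] .
    then have "\<forall>\<^sub>F k in sequentially. X k = S k (X k)"
      by eventually_elim (simp add: S_def \<psi>_def \<theta>_def zero)
    then have "(\<lambda>k. S k (X k)) \<longlonglongrightarrow> x" using x(2) by (rule Lim_transform_eventually[rotated])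
    moreover have "row_shift i c m z = z" using False by (auto simp: row_shift_def)
    moreover have "(\<chi> l. of_int (z l) - of_int (z l)) = (0 :: real^'a)" by (simp add: vec_eq_iff)
    ultimately show ?thesis by simp
  qed
  show ?thesis
    unfolding smoothly_realizable_def using vd bound lim by blast
qed

lemma row_word_smoothly_realizable:
  assumes "0 < h" "row_word w"
  shows "smoothly_realizable h w"
  using assms(2)
proof (induction rule: row_word.induct)
  case id
  show ?case by (rule smoothly_realizable_id)
next
  case (shift w i c m)
  show ?case by (rule smoothly_realizable_compose[OF smoothly_realizable_row_shift[OF assms(1)] shift.IH])
qed

section \<open>Approximation by volume preserving diffeomorphisms\<close>

text \<open>Inner regularity gives a compact \<open>T\<close>. Should it have the full measure
  \<open>c\<close>, a small ball that meets it in positive measure is removed. The strict inequality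
  leaves room for an open neighbourhood of smaller volume than a coarse cell.\<close>

lemma compact_inner_strict:
  fixes A :: "'a::euclidean_space set"
  assumes A: "A \<in> sets lebesgue" "bounded A" "measure lebesgue A \<le> c" and c: "0 < c" and \<delta>: "0 < \<delta>"
  obtains K where "compact K" "K \<subseteq> A" "measure lebesgue K < c" "measure lebesgue (A - K) \<le> \<delta>"
proof -
  have Al: "A \<in> lmeasurable" using A(1,2) bounded_set_imp_lmeasurable by blast
  obtain T where T: "closed T" "T \<subseteq> A" "A - T \<in> lmeasurable" "emeasure lebesgue (A - T) < ennreal (\<delta> / 2)"
    using sets_lebesgue_inner_closed[OF A(1), of "\<delta> / 2"] \<delta> by auto
  have Tc: "compact T" using T(1,2) A(2) bounded_subset by (auto simp: compact_eq_bounded_closed)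
  have AT: "measure lebesgue (A - T) < \<delta> / 2"
    using T(4) \<delta> unfolding emeasure_eq_measure2[OF T(3)] by (simp add: ennreal_less_iff)
  show thesis
  proof (cases "measure lebesgue T < c")
    case True
    then show thesis using that[OF Tc T(2)] AT \<delta> by simp
  next
    case False
    define V where "V = unit_ball_vol (real DIM('a))"
    have V: "0 < V" by (simp add: V_def)
    \<comment> \<open>With \<open>\<rho> \<le> 1\<close> the volume of the ball is at most
      \<open>V * \<rho>\<close>, hence at most \<open>\<delta> / 2\<close>, in every
      dimension.\<close>
    define \<rho> where "\<rho> = min 1 (\<delta> / (2 * V))"
    have \<rho>: "0 < \<rho>" "\<rho> \<le> 1" using \<delta> V by (auto simp: \<rho>_def)
    have vol: "measure lebesgue (ball x \<rho>) \<le> \<delta> / 2" for x :: 'a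
    proof -
      have "measure lebesgue (ball x \<rho>) = V * \<rho> ^ DIM('a)" using content_ball[of \<rho> x] \<rho> by (simp add: V_def)
      also have "\<dots> \<le> V * \<rho> ^ 1" using V \<rho> by (intro mult_left_mono power_decreasing) (auto simp: Suc_leI)
      also have "\<dots> \<le> V * (\<delta> / (2 * V))" using V by (intro mult_left_mono) (auto simp: \<rho>_def)
      also have "\<dots> = \<delta> / 2" using V by simp
      finally show ?thesis .
    qed
    obtain D where D: "finite D" "T \<subseteq> (\<Union>x\<in>D. ball x \<rho>)"
    proof -
      have "\<exists>D\<subseteq>T. finite D \<and> T \<subseteq> (\<Union>x\<in>D. ball x \<rho>)"
        by (rule compactE_image[OF Tc, of T "\<lambda>x. ball x \<rho>"]) (use \<rho> in auto)
      then show thesis using that by blast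
    qed
    have "\<not> negligible T" using False c Tc by (auto dest: negligible_imp_measure0)
    moreover have "T = (\<Union>x\<in>D. T \<inter> ball x \<rho>)" using D(2) by blast
    moreover have "negligible (\<Union>x\<in>D. T \<inter> ball x \<rho>)" if "\<And>x. x \<in> D \<Longrightarrow> negligible (T \<inter> ball x \<rho>)"
      using D(1) that by (intro negligible_Union) auto
    ultimately obtain x where x: "\<not> negligible (T \<inter> ball x \<rho>)" by metis
    define K where "K = T - ball x \<rho>"
    have Kc: "compact K" unfolding K_def using Tc by (intro compact_diff) auto
    have Tl: "T \<in> lmeasurable" "T \<inter> ball x \<rho> \<in> lmeasurable" using Tc by (auto intro: lmeasurable_compact fmeasurable.Int lmeasurable_ball)
    have "0 < measure lebesgue (T \<inter> ball x \<rho>)" using x Tl(2) by (simp add: negligible_iff_measure0 zero_less_measure_iff)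
    moreover have "measure lebesgue K = measure lebesgue T - measure lebesgue (T \<inter> ball x \<rho>)"
    proof -
      have "K = T - (T \<inter> ball x \<rho>)" by (auto simp: K_def)
      then show ?thesis using Tl by (simp add: measurable_measure_Diff fmeasurableD)
    qed
    moreover have "measure lebesgue T \<le> c"
    proof -
      have "measure lebesgue T \<le> measure lebesgue A" using T(2) Al Tl(1) by (intro measure_mono_fmeasurable) (auto simp: fmeasurableD)
      then show ?thesis using A(3) by simp
    qed
    ultimately have "measure lebesgue K < c" by simp
    moreover have "measure lebesgue (A - K) \<le> \<delta>"
    proof -
      have "measure lebesgue (A - K) \<le> measure lebesgue ((A - T) \<union> ball x \<rho>)"
      proof (rule measure_mono_fmeasurable)
        show "A - K \<subseteq> (A - T) \<union> ball x \<rho>" by (auto simp: K_def)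
        show "A - K \<in> sets lebesgue" using A(1) Kc by (simp add: borel_compact sets.Diff)
        show "(A - T) \<union> ball x \<rho> \<in> lmeasurable" using T(3) lmeasurable_ball by (rule fmeasurable.Un)
      qed
      also have "\<dots> \<le> measure lebesgue (A - T) + measure lebesgue (ball x \<rho>)"
        using T(3) lmeasurable_ball by (intro measure_Un_le) (auto simp: fmeasurableD)
      finally show ?thesis using AT vol[of x] by simp
    qed
    moreover have "K \<subseteq> A" using T(2) by (auto simp: K_def)
    ultimately show thesis using that Kc by blast
  qed
qed

section \<open>Coarse and fine grids\<close>

lemma component_norm_bound:
  fixes x :: "real^'n"
  assumes "\<And>i. \<bar>x $ i\<bar> \<le> b"
  shows "norm x \<le> real CARD('n) * b"
proof -
  have "norm x \<le> (\<Sum>i\<in>UNIV. \<bar>x $ i\<bar>)" by (rule norm_le_l1_cart)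
  also have "\<dots> \<le> (\<Sum>i\<in>(UNIV::'n set). b)" using assms by (intro sum_mono) auto
  finally show ?thesis by simp
qed

text \<open>The half-open convention gives each point exactly one index. It agrees with the open
  cells off the walls, which form a null set.\<close>

definition grid_index :: "real \<Rightarrow> real^'n \<Rightarrow> 'n \<Rightarrow> int" where
  "grid_index h x i = \<lfloor>x $ i / h\<rfloor>"

lemma grid_index_bounds:
  assumes "0 < h"
  shows "h * of_int (grid_index h x i) \<le> x $ i" "x $ i < h * (of_int (grid_index h x i) + 1)"
proof -
  have "of_int \<lfloor>x $ i / h\<rfloor> \<le> x $ i / h" "x $ i / h < of_int \<lfloor>x $ i / h\<rfloor> + 1" by linarith+
  then have "h * of_int \<lfloor>x $ i / h\<rfloor> \<le> h * (x $ i / h)" "h * (x $ i / h) < h * (of_int \<lfloor>x $ i / h\<rfloor> + 1)"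
    using assms by (simp_all only: mult_le_cancel_left_pos mult_less_cancel_left_pos)
  then show "h * of_int (grid_index h x i) \<le> x $ i" "x $ i < h * (of_int (grid_index h x i) + 1)"
    using assms by (simp_all add: grid_index_def)
qed

lemma grid_index_cell:
  assumes "0 < h" "x \<in> grid_cell h z"
  shows "grid_index h x = z"
proof
  fix i
  have "of_int (z i) \<le> x $ i / h" "x $ i / h < of_int (z i) + 1" using assms by (auto simp: grid_cell_def field_simps less_imp_le)
  then show "grid_index h x i = z i" unfolding grid_index_def by linarith
qed

lemma AE_grid_cell:
  fixes h :: real
  assumes h: "0 < h"
  shows "AE x in lebesgue. x \<in> grid_cell h (grid_index h (x :: real^'n))"
proof -
  have "negligible {x :: real^'n. x \<bullet> axis i 1 = h * of_int m}" for i m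
    by (rule negligible_standard_hyperplane) simp
  then have "AE x in lebesgue. (x :: real^'n) \<bullet> axis i 1 \<noteq> h * of_int m" for i m
    unfolding negligible_iff_null_sets by (rule AE_I') auto
  then have "AE x in lebesgue. \<forall>i m. (x :: real^'n) \<bullet> axis i 1 \<noteq> h * of_int (m :: int)"
    unfolding AE_all_countable by blast
  then show ?thesis
  proof (rule AE_mp, intro AE_I2 impI)
    fix x :: "real^'n" assume *: "\<forall>i m. x \<bullet> axis i 1 \<noteq> h * of_int (m :: int)"
    have "h * of_int (grid_index h x i) < x $ i" for i
    proof -
      have "x $ i \<noteq> h * of_int (grid_index h x i)" using * by (simp add: inner_axis)
      then show ?thesis using grid_index_bounds(1)[OF h, of x i] by linarith
    qed
    then show "x \<in> grid_cell h (grid_index h x)" using grid_index_bounds(2)[OF h] by (auto simp: grid_cell_def)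
  qed
qed

lemma finite_grid_index:
  assumes h: "0 < h"
  shows "finite (grid_index h ` {x :: real^'n. norm x \<le> R})"
proof (rule finite_subset)
  show "grid_index h ` {x :: real^'n. norm x \<le> R} \<subseteq> PiE UNIV (\<lambda>_. {\<lfloor>- R / h\<rfloor>..\<lfloor>R / h\<rfloor>})"
  proof
    fix z assume "z \<in> grid_index h ` {x :: real^'n. norm x \<le> R}"
    then obtain x :: "real^'n" where x: "norm x \<le> R" "z = grid_index h x" by blast
    have "z i \<in> {\<lfloor>- R / h\<rfloor>..\<lfloor>R / h\<rfloor>}" for i
    proof -
      have "\<bar>x $ i\<bar> \<le> R" using component_le_norm_cart[of x i] x(1) by linarith
      then have "- R / h \<le> x $ i / h" "x $ i / h \<le> R / h"
        using divide_right_mono[of "- R" "x $ i" h] divide_right_mono[of "x $ i" R h] h by (auto simp: abs_le_iff)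
      then show ?thesis unfolding x(2) grid_index_def by (auto intro: floor_mono)
    qed
    then show "z \<in> PiE UNIV (\<lambda>_. {\<lfloor>- R / h\<rfloor>..\<lfloor>R / h\<rfloor>})" by auto
  qed
qed (simp add: finite_PiE)

lemma measure_grid_cell:
  assumes h: "0 < h"
  shows "measure lebesgue (grid_cell h z :: (real^'n) set) = h ^ CARD('n)" "grid_cell h z \<in> lmeasurable"
proof -
  have eq: "grid_cell h z = box (\<chi> i. h * of_int (z i)) (\<chi> i. h * (of_int (z i) + 1) :: real^'n)"
    by (auto simp: grid_cell_def mem_box_cart)
  have ne: "cbox (\<chi> i. h * of_int (z i)) (\<chi> i. h * (of_int (z i) + 1) :: real^'n) \<noteq> {}"
    using h by (simp add: interval_ne_empty_cart mult_left_mono)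
  have "measure lebesgue (grid_cell h z :: (real^'n) set) = measure lborel (cbox (\<chi> i. h * of_int (z i)) (\<chi> i. h * (of_int (z i) + 1) :: real^'n))"
    unfolding eq by (simp add: measure_lborel_box_eq measure_lborel_cbox_eq)
  also have "\<dots> = h ^ CARD('n)" by (subst content_cbox_cart[OF ne]) (simp add: algebra_simps)
  finally show "measure lebesgue (grid_cell h z :: (real^'n) set) = h ^ CARD('n)" .
  show "grid_cell h z \<in> lmeasurable" unfolding eq by (rule lmeasurable_box)
qed

lemma measure_grid_index_fibre:
  assumes h: "0 < h"
  shows "{x :: real^'n. grid_index h x = z} \<in> sets borel"
    "emeasure lborel {x :: real^'n. grid_index h x = z} \<le> ennreal (h ^ CARD('n))"
proof -
  have eq: "{x :: real^'n. grid_index h x = z} = {x. \<forall>i. h * of_int (z i) \<le> x $ i \<and> x $ i < h * (of_int (z i) + 1)}"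
  proof (intro set_eqI iffI)
    fix x :: "real^'n" assume "x \<in> {x. \<forall>i. h * of_int (z i) \<le> x $ i \<and> x $ i < h * (of_int (z i) + 1)}"
    then have "of_int (z i) \<le> x $ i / h" "x $ i / h < of_int (z i) + 1" for i using h by (auto simp: field_simps)
    then have "grid_index h x i = z i" for i unfolding grid_index_def by (simp add: floor_eq_iff)
    then show "x \<in> {x. grid_index h x = z}" by auto
  qed (use grid_index_bounds[OF h] in auto)
  show m: "{x :: real^'n. grid_index h x = z} \<in> sets borel" unfolding eq by measurable
  let ?c = "cbox (\<chi> i. h * of_int (z i)) (\<chi> i. h * (of_int (z i) + 1) :: real^'n)"
  have ne: "?c \<noteq> {}" using h by (simp add: interval_ne_empty_cart mult_left_mono)
  have "emeasure lborel {x :: real^'n. grid_index h x = z} \<le> emeasure lborel ?c"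
    unfolding eq by (rule emeasure_mono) (auto simp: mem_box_cart less_imp_le)
  also have "\<dots> = ennreal (measure lborel ?c)"
    using emeasure_lborel_cbox_finite by (intro emeasure_eq_ennreal_measure) (auto simp: less_top)
  also have "measure lborel ?c = h ^ CARD('n)" by (subst content_cbox_cart[OF ne]) (simp add: algebra_simps)
  finally show "emeasure lborel {x :: real^'n. grid_index h x = z} \<le> ennreal (h ^ CARD('n))" .
qed

text \<open>The fine cells meeting the compact \<open>K z\<close> are sent into the coarse cell \<open>z\<close>; all other cells meeting
  \<open>U\<close> are pushed away by a shift whose length does not depend on the fine scale, so that the resulting cell
  map stays within a distance from \<open>s\<close> that is bounded independently of how small the uncovered set is.\<close>

lemma injective_cell_map:
  fixes K :: "('n::finite \<Rightarrow> int) \<Rightarrow> (real^'n) set"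
  assumes h0: "0 < h0" and R: "0 < R" and U: "\<And>x. x \<in> U \<Longrightarrow> norm x \<le> R"
    and Z: "Z = grid_index h0 ` {x. norm x \<le> R}"
    and K: "\<And>z. z \<in> Z \<Longrightarrow> compact (K z)" "\<And>z. z \<in> Z \<Longrightarrow> K z \<subseteq> U" "\<And>z. z \<in> Z \<Longrightarrow> measure lebesgue (K z) < h0 ^ CARD('n)"
      "\<And>z z'. z \<in> Z \<Longrightarrow> z' \<in> Z \<Longrightarrow> z \<noteq> z' \<Longrightarrow> K z \<inter> K z' = {}"
  obtains h f where "0 < h" "inj_on f {y. grid_cell h y \<inter> U \<noteq> {}}" "finite {y. grid_cell h y \<inter> U \<noteq> {}}"
    "\<And>z y x i. z \<in> Z \<Longrightarrow> x \<in> K z \<Longrightarrow> x \<in> grid_cell h y \<Longrightarrow>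
       h0 * of_int (z i) \<le> x $ i + h * (of_int (f y i) - of_int (y i)) \<and> x $ i + h * (of_int (f y i) - of_int (y i)) \<le> h0 * (of_int (z i) + 1)"
    "\<And>y x i. x \<in> U \<Longrightarrow> x \<in> grid_cell h y \<Longrightarrow> \<bar>x $ i + h * (of_int (f y i) - of_int (y i))\<bar> \<le> 3 * R + 4 * h0"
proof -
  define n where "n = CARD('n)"
  have n0: "0 < n" by (simp add: n_def)
  have Zf: "finite Z" unfolding Z by (rule finite_grid_index[OF h0])
  \<comment> \<open>Each compact set gets an open neighbourhood that is still smaller in volume than
    a coarse cell and avoids the other compact sets.\<close>
  have "\<exists>W. open W \<and> K z \<subseteq> W \<and> W \<in> lmeasurable \<and> measure lebesgue W < h0 ^ n \<and> (\<forall>z'\<in>Z. z' \<noteq> z \<longrightarrow> W \<inter> K z' = {})" if z: "z \<in> Z" for z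
  proof -
    have Kl: "K z \<in> lmeasurable" using K(1)[OF z] by (rule lmeasurable_compact)
    define e where "e = h0 ^ n - measure lebesgue (K z)"
    have e: "0 < e" using K(3)[OF z] by (simp add: e_def n_def)
    obtain T where T: "open T" "K z \<subseteq> T" "T - K z \<in> lmeasurable" "emeasure lebesgue (T - K z) < ennreal e"
      using sets_lebesgue_outer_open[OF fmeasurableD[OF Kl] e] by metis
    define W' where "W' = T - (\<Union>z'\<in>Z - {z}. K z')"
    have cl: "closed (\<Union>z'\<in>Z - {z}. K z')" using Zf K(1) by (intro closed_UN) (auto intro: compact_imp_closed)
    have "T = (T - K z) \<union> K z" using T(2) by blast
    then have Tl: "T \<in> lmeasurable" using T(3) Kl fmeasurable.Un by metis
    have "measure lebesgue T = measure lebesgue (K z) + measure lebesgue (T - K z)"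
      using T(2) Tl Kl measurable_measure_Diff[of T lebesgue "K z"] by (simp add: fmeasurableD)
    also have "measure lebesgue (T - K z) < e"
      using T(4) e unfolding emeasure_eq_measure2[OF T(3)] by (simp add: ennreal_less_iff)
    finally have "measure lebesgue T < h0 ^ n" by (simp add: e_def)
    moreover have W'm: "open W'" unfolding W'_def using T(1) cl by (rule open_Diff)
    moreover have "W' \<in> lmeasurable"
      by (rule fmeasurableI2[OF Tl]) (use borel_open[OF W'm] in \<open>auto simp: W'_def\<close>)
    moreover have "measure lebesgue W' \<le> measure lebesgue T"
      by (rule measure_mono_fmeasurable[OF _ _ Tl]) (use borel_open[OF W'm] in \<open>auto simp: W'_def\<close>)
    moreover have "K z \<subseteq> W'" using T(2) K(4)[OF z] unfolding W'_def by blast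
    moreover have "\<forall>z'\<in>Z. z' \<noteq> z \<longrightarrow> W' \<inter> K z' = {}" unfolding W'_def by blast
    ultimately show ?thesis by (intro exI[of _ W']) auto
  qed
  then have "\<forall>z\<in>Z. \<exists>W. open W \<and> K z \<subseteq> W \<and> W \<in> lmeasurable \<and> measure lebesgue W < h0 ^ n \<and> (\<forall>z'\<in>Z. z' \<noteq> z \<longrightarrow> W \<inter> K z' = {})"
    by blast
  from bchoice[OF this] obtain W' where "\<forall>z\<in>Z. open (W' z) \<and> K z \<subseteq> W' z \<and> W' z \<in> lmeasurable \<and> measure lebesgue (W' z) < h0 ^ n \<and> (\<forall>z'\<in>Z. z' \<noteq> z \<longrightarrow> W' z \<inter> K z' = {})"
    by blast
  then have W': "\<And>z. z \<in> Z \<Longrightarrow> open (W' z)" "\<And>z. z \<in> Z \<Longrightarrow> K z \<subseteq> W' z" "\<And>z. z \<in> Z \<Longrightarrow> W' z \<in> lmeasurable"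
    "\<And>z. z \<in> Z \<Longrightarrow> measure lebesgue (W' z) < h0 ^ n" "\<And>z z'. z \<in> Z \<Longrightarrow> z' \<in> Z \<Longrightarrow> z' \<noteq> z \<Longrightarrow> W' z \<inter> K z' = {}"
    by blast+
  have "\<exists>r>0. \<forall>x\<in>K z. ball x r \<subseteq> W' z" if z: "z \<in> Z" for z
    using compact_subset_open_imp_ball_epsilon_subset[OF K(1)[OF z] W'(1)[OF z] W'(2)[OF z]] by (metis UN_subset_iff)
  then obtain \<rho> where \<rho>: "\<And>z. z \<in> Z \<Longrightarrow> 0 < \<rho> z" "\<And>z x. z \<in> Z \<Longrightarrow> x \<in> K z \<Longrightarrow> ball x (\<rho> z) \<subseteq> W' z" by metis
  define r where "r = Min (insert 1 (\<rho> ` Z))"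
  have r: "0 < r" "\<And>z. z \<in> Z \<Longrightarrow> r \<le> \<rho> z" unfolding r_def using Zf \<rho>(1) by auto
  \<comment> \<open>The refinement is so fine that a fine cell has diameter below \<open>r\<close>;
    a fine cell that meets \<open>K z\<close> then lies in \<open>W' z\<close>.\<close>
  obtain N0 where N0: "h0 * real n / r < real N0" using reals_Archimedean2 by blast
  define N where "N = Suc N0"
  have N: "0 < N" by (simp add: N_def)
  define h where "h = h0 / real N"
  have h: "0 < h" "h0 = h * real N" "h * real n < r"
  proof -
    show "0 < h" "h0 = h * real N" using h0 N by (simp_all add: h_def)
    have "h0 * real n / r < real N" using N0 by (simp add: N_def)
    then show "h * real n < r" using r(1) N by (simp add: h_def field_simps)
  qed
  have hh0: "h \<le> h0" using h0 N by (simp add: h_def field_simps)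
  have diam: "norm (x - x') \<le> h * real n" if "x \<in> grid_cell h y" "x' \<in> grid_cell h y" for x x' :: "real^'n" and y
  proof -
    have "\<bar>(x - x') $ i\<bar> \<le> h" for i
    proof -
      have "h * of_int (y i) < x $ i" "x $ i < h * (of_int (y i) + 1)" "h * of_int (y i) < x' $ i" "x' $ i < h * (of_int (y i) + 1)"
        using that by (auto simp: grid_cell_def)
      then show ?thesis by (simp add: algebra_simps abs_le_iff)
    qed
    then have "norm (x - x') \<le> real CARD('n) * h" by (rule component_norm_bound)
    then show ?thesis by (simp add: n_def mult.commute)
  qed
  define G where "G = {y :: 'n \<Rightarrow> int. grid_cell h y \<inter> U \<noteq> {}}"
  have Gf: "finite G"
  proof (rule finite_subset[OF _ finite_grid_index[OF h(1), of R]])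
    show "G \<subseteq> grid_index h ` {x. norm x \<le> R}"
    proof
      fix y assume "y \<in> G"
      then obtain x where "x \<in> grid_cell h y" "x \<in> U" unfolding G_def by blast
      then show "y \<in> grid_index h ` {x. norm x \<le> R}" using U grid_index_cell[OF h(1)] by blast
    qed
  qed
  define F where "F z = {y. grid_cell h y \<inter> K z \<noteq> {}}" for z
  have FG: "F z \<subseteq> G" if "z \<in> Z" for z using K(2)[OF that] unfolding F_def G_def by blast
  have Ff: "finite (F z)" if "z \<in> Z" for z using FG[OF that] Gf finite_subset by blast
  have cellO: "grid_cell h y \<subseteq> W' z" if z: "z \<in> Z" and y: "y \<in> F z" for y z
  proof
    fix x' assume x': "x' \<in> grid_cell h y"
    obtain x where x: "x \<in> grid_cell h y" "x \<in> K z" using y unfolding F_def by blast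
    have "norm (x - x') < \<rho> z" using diam[OF x(1) x'] h(3) r(2)[OF z] by linarith
    then have "x' \<in> ball x (\<rho> z)" by (simp add: dist_norm)
    then show "x' \<in> W' z" using \<rho>(2)[OF z x(2)] by blast
  qed
  have Fdisj: "z = z'" if a: "z \<in> Z" "z' \<in> Z" "y \<in> F z" "y \<in> F z'" for y z z'
  proof (rule ccontr)
    assume ne: "z \<noteq> z'"
    obtain x' where "x' \<in> grid_cell h y" "x' \<in> K z'" using a(4) unfolding F_def by blast
    then show False using cellO[OF a(1,3)] W'(5)[OF a(1,2)] ne by blast
  qed
  \<comment> \<open>The indices of the \<open>N ^ n\<close> fine cells into which the coarse cell
    \<open>z\<close> is divided.\<close>
  define T where "T z = PiE UNIV (\<lambda>i. {z i * int N..<z i * int N + int N})" for z :: "'n \<Rightarrow> int"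
  have Tf: "finite (T z)" and Tcard: "card (T z) = N ^ n" for z
    unfolding T_def by (simp_all add: finite_PiE card_PiE n_def)
  \<comment> \<open>Counting by volume: the disjoint fine cells meeting \<open>K z\<close> fit into
    \<open>W' z\<close>, whose volume is less than that of the \<open>N ^ n\<close> fine cells of
    the coarse cell. Hence an injection exists.\<close>
  have Fcard: "card (F z) \<le> card (T z)" if z: "z \<in> Z" for z
  proof -
    have disj: "disjoint_family_on (grid_cell h) (F z)"
      unfolding disjoint_family_on_def
    proof (intro ballI impI)
      fix y y' :: "'n \<Rightarrow> int" assume "y \<noteq> y'"
      then show "grid_cell h y \<inter> grid_cell h y' = {}" using grid_index_cell[OF h(1)] by blast
    qed
    have "real (card (F z)) * h ^ n = (\<Sum>y\<in>F z. measure lebesgue (grid_cell h y))"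
      using measure_grid_cell(1)[OF h(1), where 'n = 'n] by (simp add: n_def)
    also have "\<dots> = measure lebesgue (\<Union>y\<in>F z. grid_cell h y)"
    proof (rule measure_finite_Union[symmetric, OF Ff[OF z] _ disj])
      show "grid_cell h ` F z \<subseteq> sets lebesgue" using measure_grid_cell(2)[OF h(1), where 'n = 'n] by (auto simp: fmeasurableD)
      show "emeasure lebesgue (grid_cell h y) \<noteq> \<infinity>" for y :: "'n \<Rightarrow> int"
        using emeasure_eq_measure2[OF measure_grid_cell(2)[OF h(1), of y]] by (simp only: ennreal_neq_top infinity_ennreal_def not_False_eq_True)
    qed
    also have "\<dots> \<le> measure lebesgue (W' z)"
    proof (rule measure_mono_fmeasurable[OF _ _ W'(3)[OF z]])
      show "(\<Union>y\<in>F z. grid_cell h y) \<subseteq> W' z" using cellO[OF z] by blast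
      show "(\<Union>y\<in>F z. grid_cell h y) \<in> sets lebesgue"
        using Ff[OF z] measure_grid_cell(2)[OF h(1), where 'n = 'n] by (intro sets.finite_UN) (auto simp: fmeasurableD)
    qed
    also have "\<dots> < h0 ^ n" by (rule W'(4)[OF z])
    also have "\<dots> = real (N ^ n) * h ^ n" unfolding h(2) by (simp add: power_mult_distrib)
    finally have "real (card (F z)) < real (N ^ n)" using h(1) by (simp add: mult_less_cancel_right)
    then show ?thesis using Tcard by simp
  qed
  have "\<exists>g. inj_on g (F z) \<and> g ` F z \<subseteq> T z" if "z \<in> Z" for z
    using card_le_inj[OF Ff[OF that] Tf Fcard[OF that]] by blast
  then obtain g where g: "\<And>z. z \<in> Z \<Longrightarrow> inj_on (g z) (F z)" "\<And>z. z \<in> Z \<Longrightarrow> g z ` F z \<subseteq> T z" by metis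
  obtain i0 :: 'n where True by simp
  \<comment> \<open>Cells that meet \<open>U\<close> start no lower than \<open>- R - h\<close>, and
    coarse cells in \<open>Z\<close> end by \<open>R + h0\<close>. A displacement
    \<open>h * L\<close> of at least \<open>2 * R + h0 + 2 * h\<close> separates shifted cells from
    all coarse ones, and it never exceeds \<open>2 * R + h0 + 3 * h\<close>.\<close>
  define L where "L = \<lceil>2 * R / h\<rceil> + int N + 2"
  have L: "2 * R / h + real N + 2 \<le> of_int L" "of_int L \<le> 2 * R / h + real N + 3" unfolding L_def by linarith+
  define f where "f y = (if \<exists>z\<in>Z. y \<in> F z then g (THE z. z \<in> Z \<and> y \<in> F z) y else y(i0 := y i0 + L))" for y
  have fF: "f y = g z y" if "z \<in> Z" "y \<in> F z" for z y
  proof -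
    have "(THE z. z \<in> Z \<and> y \<in> F z) = z" using that Fdisj by (intro the_equality) blast+
    then show ?thesis using that by (auto simp: f_def)
  qed
  have f0: "f y = y(i0 := y i0 + L)" if "\<not> (\<exists>z\<in>Z. y \<in> F z)" for y using that by (simp add: f_def)
  have fT: "f y \<in> T z" if "z \<in> Z" "y \<in> F z" for z y using fF[OF that] g(2)[OF that(1)] that(2) by auto
  have Tb: "z i * int N \<le> y i \<and> y i + 1 \<le> z i * int N + int N" if "y \<in> T z" for y z i
  proof -
    have "y i \<in> {z i * int N..<z i * int N + int N}" using that unfolding T_def by (rule PiE_mem) simp
    then show ?thesis by simp
  qed
  have Th: "h0 * of_int (z i) \<le> h * of_int (y i)" "h * (of_int (y i) + 1) \<le> h0 * (of_int (z i) + 1)" if "y \<in> T z" for y z i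
  proof -
    have "of_int (z i * int N) \<le> (of_int (y i) :: real)" "of_int (y i + 1) \<le> (of_int (z i * int N + int N) :: real)"
      using Tb[OF that, of i] by (simp_all only: of_int_le_iff)
    then have "h * (of_int (z i) * real N) \<le> h * of_int (y i)" "h * (of_int (y i) + 1) \<le> h * (of_int (z i) * real N + real N)"
      using h(1) by (auto intro!: mult_left_mono)
    then show "h0 * of_int (z i) \<le> h * of_int (y i)" "h * (of_int (y i) + 1) \<le> h0 * (of_int (z i) + 1)"
      unfolding h(2) by (simp_all add: algebra_simps)
  qed
  have Zb: "\<bar>h0 * of_int (z i)\<bar> \<le> R + h0 \<and> \<bar>h0 * (of_int (z i) + 1)\<bar> \<le> R + h0" if z: "z \<in> Z" for z i
  proof -
    obtain x :: "real^'n" where x: "norm x \<le> R" "z = grid_index h0 x" using z unfolding Z by blast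
    have "\<bar>x $ i\<bar> \<le> R" using component_le_norm_cart[of x i] x(1) by linarith
    then show ?thesis using grid_index_bounds[OF h0, of x i] unfolding x(2) by (auto simp: abs_le_iff algebra_simps)
  qed
  have Gb: "- R - h \<le> h * of_int (y i)" "h * of_int (y i) \<le> R" if y: "y \<in> G" for y i
  proof -
    obtain x where x: "x \<in> grid_cell h y" "x \<in> U" using y unfolding G_def by blast
    have "\<bar>x $ i\<bar> \<le> R" using component_le_norm_cart[of x i] U[OF x(2)] by linarith
    moreover have "h * of_int (y i) < x $ i" "x $ i < h * (of_int (y i) + 1)" using x(1) by (auto simp: grid_cell_def)
    ultimately show "- R - h \<le> h * of_int (y i)" "h * of_int (y i) \<le> R" by (auto simp: algebra_simps abs_le_iff)
  qed
  have far: "y(i0 := y i0 + L) \<notin> T z" if y: "y \<in> G" and z: "z \<in> Z" for y z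
  proof
    assume t: "y(i0 := y i0 + L) \<in> T z"
    have "h * (of_int (y i0 + L) + 1) \<le> R + h0" using Th(2)[OF t, of i0] Zb[OF z, of i0] by (auto simp: abs_le_iff)
    moreover have "h * of_int L \<ge> 2 * R + h0 + 2 * h"
    proof -
      have "h * (2 * R / h + real N + 2) \<le> h * of_int L" using L(1) h(1) by (intro mult_left_mono) auto
      then show ?thesis using h(1) by (simp add: h(2) algebra_simps)
    qed
    ultimately show False using Gb(1)[OF y, of i0] h(1) by (simp add: algebra_simps)
  qed
  have inj: "inj_on f G"
  proof (rule inj_onI)
    fix y y' assume y: "y \<in> G" "y' \<in> G" "f y = f y'"
    show "y = y'"
    proof (cases "\<exists>z\<in>Z. y \<in> F z")
      case True
      then obtain z where z: "z \<in> Z" "y \<in> F z" by blast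
      show ?thesis
      proof (cases "\<exists>z\<in>Z. y' \<in> F z")
        case True
        then obtain z' where z': "z' \<in> Z" "y' \<in> F z'" by blast
        have "z = z'"
        proof
          fix i
          have *: "f y \<in> T z" "f y \<in> T z'" using fT[OF z] fT[OF z'] y(3) by auto
          have "z i * int N < z' i * int N + int N" "z' i * int N < z i * int N + int N"
            using Tb[OF *(1), of i] Tb[OF *(2), of i] by linarith+
          then have "z i * int N < (z' i + 1) * int N" "z' i * int N < (z i + 1) * int N" by (simp_all add: algebra_simps)
          then have "z i < z' i + 1" "z' i < z i + 1" using N by (auto simp: mult_less_cancel_right)
          then show "z i = z' i" by simp
        qed
        then show ?thesis using y(3) fF[OF z] fF[OF z'] z z' g(1)[OF z(1)] by (auto dest: inj_onD)
      next
        case False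
        then show ?thesis using fT[OF z] far[OF y(2) z(1)] f0[OF False] y(3) by simp
      qed
    next
      case F1: False
      show ?thesis
      proof (cases "\<exists>z\<in>Z. y' \<in> F z")
        case True
        then obtain z' where z': "z' \<in> Z" "y' \<in> F z'" by blast
        then show ?thesis using fT[OF z'] far[OF y(1) z'(1)] f0[OF F1] y(3) by simp
      next
        case False
        have "y(i0 := y i0 + L) = y'(i0 := y' i0 + L)" using y(3) f0[OF F1] f0[OF False] by simp
        then have "\<And>i. (y(i0 := y i0 + L)) i = (y'(i0 := y' i0 + L)) i" by simp
        then show ?thesis by (metis add_right_cancel ext fun_upd_apply)
      qed
    qed
  qed
  show thesis
  proof (rule that[OF h(1), of f])
    show "inj_on f {y. grid_cell h y \<inter> U \<noteq> {}}" "finite {y. grid_cell h y \<inter> U \<noteq> {}}" using inj Gf by (simp_all add: G_def)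
    have inT: "h0 * of_int (z i) \<le> x $ i + h * (of_int (f y i) - of_int (y i)) \<and> x $ i + h * (of_int (f y i) - of_int (y i)) \<le> h0 * (of_int (z i) + 1)"
      if z: "z \<in> Z" and y: "y \<in> F z" and x: "x \<in> grid_cell h y" for x y z i
    proof -
      have "h * of_int (y i) < x $ i" "x $ i < h * (of_int (y i) + 1)" using x by (auto simp: grid_cell_def)
      then show ?thesis using Th[OF fT[OF z y], of i] by (simp add: algebra_simps)
    qed
    show "h0 * of_int (z i) \<le> x $ i + h * (of_int (f y i) - of_int (y i)) \<and> x $ i + h * (of_int (f y i) - of_int (y i)) \<le> h0 * (of_int (z i) + 1)"
      if "z \<in> Z" "x \<in> K z" "x \<in> grid_cell h y" for z y x i
      by (rule inT[OF that(1) _ that(3)]) (use that in \<open>auto simp: F_def\<close>)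
    show "\<bar>x $ i + h * (of_int (f y i) - of_int (y i))\<bar> \<le> 3 * R + 4 * h0" if x: "x \<in> U" "x \<in> grid_cell h y" for y x i
    proof (cases "\<exists>z\<in>Z. y \<in> F z")
      case True
      then obtain z where z: "z \<in> Z" "y \<in> F z" by blast
      show ?thesis using inT[OF z x(2), of i] Zb[OF z(1), of i] R h0 by (auto simp: abs_le_iff)
    next
      case False
      have "\<bar>x $ i\<bar> \<le> R" using component_le_norm_cart[of x i] U[OF x(1)] by linarith
      moreover have "\<bar>h * (of_int (f y i) - of_int (y i))\<bar> \<le> h * of_int L"
      proof -
        have "0 \<le> 2 * R / h" using R h(1) by simp
        then have "0 \<le> (of_int L :: real)" using L(1) of_nat_0_le_iff[of N, where 'a = real] by linarith
        then show ?thesis unfolding f0[OF False] using h(1) by (auto simp: abs_mult)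
      qed
      moreover have "h * of_int L \<le> 2 * R + h0 + 3 * h"
      proof -
        have "h * of_int L \<le> h * (2 * R / h + real N + 3)" using L(2) h(1) by (intro mult_left_mono) auto
        then show ?thesis using h(1) by (simp add: h(2) algebra_simps)
      qed
      ultimately show ?thesis using hh0 by (simp add: abs_le_iff)
    qed
  qed
qed

text \<open>The part \<open>A z\<close> of \<open>U\<close> that \<open>s\<close> sends into the
  coarse cell \<open>z\<close> has at most the volume of that cell; this is where
  \<open>push\<close> enters. On a compact part of each \<open>A z\<close> the cell map hits the
  correct coarse cell. Its error is at most the cell diameter there and bounded by \<open>C0\<close>
  on the small remainder, and smooth realizations converge to it dominatedly.\<close>

theorem volume_diffeo_approximation:
  fixes s :: "real^'n \<Rightarrow> real^'n"
  assumes n: "2 \<le> CARD('n)" and p: "1 < p" and U: "open U" "bounded U"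
    and sm [measurable]: "s \<in> borel_measurable (lebesgue_on U)" and sb: "bounded (s ` U)"
    and push: "\<And>B. B \<in> sets borel \<Longrightarrow> emeasure lebesgue (U \<inter> s -` B) \<le> emeasure lborel B" and \<epsilon>: "0 < \<epsilon>"
  obtains S where "volume_diffeo S" "integrable (lebesgue_on U) (\<lambda>x. norm (s x - S x) powr p)"
    "(LINT x|lebesgue_on U. norm (s x - S x) powr p) < \<epsilon>"
proof -
  let ?L = "lebesgue_on U"
  have Um: "U \<in> sets lebesgue" using borel_open[OF U(1)] by simp
  have Ul: "U \<in> lmeasurable" using U(2) Um by (rule bounded_set_imp_lmeasurable)
  interpret finite_measure ?L
    by (rule finite_measureI) (use Ul Um in \<open>auto simp: emeasure_restrict_space fmeasurable_def\<close>)
  define \<mu> where "\<mu> = measure lebesgue U"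
  have \<mu>0: "0 \<le> \<mu>" by (simp add: \<mu>_def)
  obtain R1 R2 where "\<And>x. x \<in> U \<Longrightarrow> norm x \<le> R1" "\<And>x. x \<in> U \<Longrightarrow> norm (s x) \<le> R2"
    using U(2) sb by (auto simp: bounded_iff)
  define R where "R = max 1 (max R1 R2)"
  have R: "0 < R" "\<And>x. x \<in> U \<Longrightarrow> norm x \<le> R" "\<And>x. x \<in> U \<Longrightarrow> norm (s x) \<le> R"
    using \<open>\<And>x. x \<in> U \<Longrightarrow> norm x \<le> R1\<close> \<open>\<And>x. x \<in> U \<Longrightarrow> norm (s x) \<le> R2\<close> unfolding R_def by (fastforce simp: le_max_iff_disj)+
  define N where "N = real CARD('n)"
  have N: "1 \<le> N" using n by (simp add: N_def)
  \<comment> \<open>The crude bound for the distance between \<open>s\<close> and the cell map on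
    the remainder. It is fixed before the grid and the remainder are chosen.\<close>
  define C0 where "C0 = N * (3 * R + 4) + R"
  have C0: "0 \<le> C0" using N R(1) by (simp add: C0_def)
  \<comment> \<open>The admissible diameter of a coarse cell: its power \<open>p\<close>, integrated
    over \<open>U\<close>, stays below \<open>\<epsilon> / 4\<close>.\<close>
  define \<eta> where "\<eta> = min 1 ((\<epsilon> / (4 * (\<mu> + 1))) powr (1 / p))"
  have \<eta>: "0 < \<eta>" "\<eta> \<le> 1" using \<epsilon> \<mu>0 by (auto simp: \<eta>_def)
  have \<eta>p: "\<eta> powr p \<le> \<epsilon> / (4 * (\<mu> + 1))"
  proof -
    have "\<eta> powr p \<le> ((\<epsilon> / (4 * (\<mu> + 1))) powr (1 / p)) powr p" using \<eta>(1) p by (intro powr_mono2) (auto simp: \<eta>_def)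
    also have "\<dots> = \<epsilon> / (4 * (\<mu> + 1))" using \<epsilon> \<mu>0 p by (simp add: powr_powr)
    finally show ?thesis .
  qed
  define h0 where "h0 = \<eta> / N"
  have h0: "0 < h0" "h0 \<le> 1" "N * h0 = \<eta>" using \<eta> N by (auto simp: h0_def field_simps)
  define Z where "Z = grid_index h0 ` {x :: real^'n. norm x \<le> R}"
  have Zf: "finite Z" unfolding Z_def by (rule finite_grid_index[OF h0(1)])
  define c where "c = real (card Z) + 1"
  have c: "0 < c" by (simp add: c_def)
  \<comment> \<open>At most \<open>c\<close> cells lose volume \<delta> each, so the remainder costs
    at most \<open>C0 powr p * c * \<delta>\<close>, again below \<open>\<epsilon> / 4\<close>. The
    added ones keep the denominator positive.\<close>
  define \<delta> where "\<delta> = \<epsilon> / (4 * (C0 powr p + 1) * c)"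
  have C0p: "0 \<le> C0 powr p" by simp
  have \<delta>: "0 < \<delta>" using \<epsilon> c C0p by (simp add: \<delta>_def add_nonneg_pos)
  define A where "A z = U \<inter> s -` {y. grid_index h0 y = z}" for z
  have Am: "A z \<in> sets lebesgue" for z
    using measurable_sets[OF sm measure_grid_index_fibre(1)[OF h0(1), of z]] Um by (simp add: sets_restrict_space_iff A_def Int_commute)
  have Ab: "bounded (A z)" for z using U(2) by (rule bounded_subset) (auto simp: A_def)
  have Ale: "measure lebesgue (A z) \<le> h0 ^ CARD('n)" for z
  proof -
    have "emeasure lebesgue (A z) \<le> ennreal (h0 ^ CARD('n))"
      unfolding A_def using push[OF measure_grid_index_fibre(1)[OF h0(1)]] measure_grid_index_fibre(2)[OF h0(1)] by (rule order_trans)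
    moreover have "A z \<in> lmeasurable" using Ab Am by (rule bounded_set_imp_lmeasurable)
    ultimately show ?thesis using h0(1) by (simp add: emeasure_eq_measure2)
  qed
  have "\<exists>K. compact K \<and> K \<subseteq> A z \<and> measure lebesgue K < h0 ^ CARD('n) \<and> measure lebesgue (A z - K) \<le> \<delta>" for z
    using compact_inner_strict[OF Am Ab Ale zero_less_power[OF h0(1)] \<delta>, of z] by metis
  then obtain K where K: "\<And>z. compact (K z)" "\<And>z. K z \<subseteq> A z" "\<And>z. measure lebesgue (K z) < h0 ^ CARD('n)" "\<And>z. measure lebesgue (A z - K z) \<le> \<delta>"
    by metis
  have KU: "K z \<subseteq> U" for z using K(2)[of z] by (auto simp: A_def)
  have Kd: "K z \<inter> K z' = {}" if "z \<noteq> z'" for z z' using K(2)[of z] K(2)[of z'] that by (auto simp: A_def)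
  obtain h f where h: "0 < h" and f: "inj_on f {y. grid_cell h y \<inter> U \<noteq> {}}" "finite {y. grid_cell h y \<inter> U \<noteq> {}}"
    and near: "\<And>z y x i. z \<in> Z \<Longrightarrow> x \<in> K z \<Longrightarrow> x \<in> grid_cell h y \<Longrightarrow>
       h0 * of_int (z i) \<le> x $ i + h * (of_int (f y i) - of_int (y i)) \<and> x $ i + h * (of_int (f y i) - of_int (y i)) \<le> h0 * (of_int (z i) + 1)"
    and far: "\<And>y x i. x \<in> U \<Longrightarrow> x \<in> grid_cell h y \<Longrightarrow> \<bar>x $ i + h * (of_int (f y i) - of_int (y i))\<bar> \<le> 3 * R + 4 * h0"
  proof (rule injective_cell_map[OF h0(1) R(1) _ Z_def, where U = U and K = K])
    show "norm x \<le> R" if "x \<in> U" for x using that by (rule R(2))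
    show "compact (K z)" for z by (rule K(1))
    show "K z \<subseteq> U" for z by (rule KU)
    show "measure lebesgue (K z) < h0 ^ CARD('n)" for z by (rule K(3))
    show "K z \<inter> K z' = {}" if "z \<noteq> z'" for z z' using that by (rule Kd)
  qed (rule that, assumption+)
  have "\<exists>w. row_word w \<and> (\<forall>y\<in>{y. grid_cell h y \<inter> U \<noteq> {}}. w y = f y)"
    by (rule row_word_highly_transitive[OF n f(2,1)]) blast
  then obtain w where w: "row_word w" "\<And>y. grid_cell h y \<inter> U \<noteq> {} \<Longrightarrow> w y = f y" by blast
  obtain S M where S: "\<And>k. volume_diffeo (S k)" "\<And>k x. norm (S k x - x) \<le> M"
    and Slim: "\<And>z x X. x \<in> grid_cell h z \<Longrightarrow> X \<longlonglongrightarrow> x \<Longrightarrow> (\<lambda>k. S k (X k)) \<longlonglongrightarrow> x + h *\<^sub>R (\<chi> i. of_int (w z i) - of_int (z i))"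
    using row_word_smoothly_realizable[OF h w(1)] unfolding smoothly_realizable_def by blast
  have Sm [measurable]: "S k \<in> borel_measurable ?L" for k
    using Um volume_diffeo_continuous[OF S(1), of U] by (intro continuous_imp_measurable_on_sets_lebesgue)
  define H where "H k x = norm (s x - S k x) powr p" for k x
  have Hm [measurable]: "H k \<in> borel_measurable ?L" for k unfolding H_def by measurable
  define W where "W x = x + h *\<^sub>R (\<chi> i. of_int (f (grid_index h x) i) - of_int (grid_index h x i))" for x
  have AEU: "AE x in ?L. x \<in> U \<and> x \<in> grid_cell h (grid_index h x)"
    using AE_grid_cell[OF h] unfolding AE_lebesgue_on_iff[OF Um] by (rule AE_mp) simp
  have Hlim: "AE x in ?L. (\<lambda>k. H k x) \<longlonglongrightarrow> norm (s x - W x) powr p"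
  proof (rule AE_mp[OF AEU], intro AE_I2 impI)
    fix x assume x: "x \<in> U \<and> x \<in> grid_cell h (grid_index h x)"
    then have "w (grid_index h x) = f (grid_index h x)" by (intro w(2)) blast
    then have "(\<lambda>k. S k x) \<longlonglongrightarrow> W x" using Slim[of x "grid_index h x" "\<lambda>_. x"] x by (simp add: W_def)
    then show "(\<lambda>k. H k x) \<longlonglongrightarrow> norm (s x - W x) powr p"
      unfolding H_def using p by (intro tendsto_powr' tendsto_norm tendsto_diff tendsto_const) auto
  qed
  \<comment> \<open>Taking the limit of the measurable functions \<open>H k\<close> spares a
    separate proof that the cell map \<open>W\<close> is measurable.\<close>
  define g where "g x = lim (\<lambda>k. H k x)" for x
  have gm: "g \<in> borel_measurable ?L" unfolding g_def by (rule borel_measurable_lim_metric) measurable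
  have gW: "AE x in ?L. g x = norm (s x - W x) powr p"
    using Hlim
  proof eventually_elim
    case (elim x)
    then show ?case unfolding g_def by (rule limI)
  qed
  have Hg: "AE x in ?L. (\<lambda>k. H k x) \<longlonglongrightarrow> g x"
    using Hlim gW
  proof eventually_elim
    case (elim x)
    then show ?case by simp
  qed
  have Hb: "norm (H k x) \<le> (2 * R + \<bar>M\<bar>) powr p" if "x \<in> U" for k x
  proof -
    have "norm (s x - S k x) \<le> norm (s x) + norm x + norm (S k x - x)"
      using norm_triangle_ineq4[of "s x - x" "S k x - x"] norm_triangle_ineq4[of "s x" x] by simp
    also have "\<dots> \<le> 2 * R + \<bar>M\<bar>" using R(2,3)[OF that] S(2)[of k x] by linarith
    finally show ?thesis using p by (simp add: H_def powr_mono2)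
  qed
  have Hb': "AE x in ?L. norm (H k x) \<le> (2 * R + \<bar>M\<bar>) powr p" for k
    using AEU by (rule AE_mp) (use Hb in \<open>auto intro!: AE_I2\<close>)
  have Hint: "integrable ?L (H k)" for k by (rule integrable_const_bound[OF Hb' Hm])
  have conv: "(\<lambda>k. integral\<^sup>L ?L (H k)) \<longlonglongrightarrow> integral\<^sup>L ?L g"
    by (rule integral_dominated_convergence[OF gm Hm _ Hg Hb']) simp
  define E where "E = U - (\<Union>z\<in>Z. K z)"
  have Em: "E \<in> sets lebesgue" unfolding E_def using Um Zf K(1) by (intro sets.Diff sets.finite_UN) (auto simp: borel_compact)
  have El: "E \<in> lmeasurable" by (rule fmeasurableI2[OF Ul _ Em]) (auto simp: E_def)
  have Emeas: "measure lebesgue E \<le> c * \<delta>"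
  proof -
    have AKl: "A z - K z \<in> lmeasurable" for z
      using bounded_set_imp_lmeasurable[OF Ab Am] K(1) by (intro fmeasurable_Diff) (auto simp: borel_compact)
    have sub: "E \<subseteq> (\<Union>z\<in>Z. A z - K z)"
    proof
      fix x assume x: "x \<in> E"
      then have "x \<in> U" by (simp add: E_def)
      then have "grid_index h0 (s x) \<in> Z" "x \<in> A (grid_index h0 (s x))" using R(3) by (auto simp: Z_def A_def)
      with x show "x \<in> (\<Union>z\<in>Z. A z - K z)" unfolding E_def by blast
    qed
    have "measure lebesgue E \<le> measure lebesgue (\<Union>z\<in>Z. A z - K z)"
      using sub Em Zf AKl by (intro measure_mono_fmeasurable fmeasurable.finite_UN)
    also have "\<dots> \<le> (\<Sum>z\<in>Z. measure lebesgue (A z - K z))"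
      using Zf AKl by (intro measure_UNION_le) (auto simp: fmeasurableD)
    also have "\<dots> \<le> (\<Sum>z\<in>Z. \<delta>)" using K(4) by (rule sum_mono)
    also have "\<dots> \<le> c * \<delta>" using \<delta> by (simp add: c_def)
    finally show ?thesis .
  qed
  have bound: "AE x in ?L. g x \<le> \<eta> powr p + C0 powr p * indicator E x"
    using AEU gW
  proof eventually_elim
    case (elim x)
    then have x: "x \<in> U" "x \<in> grid_cell h (grid_index h x)" and gx: "g x = norm (s x - W x) powr p" by auto
    have Wi: "W x $ i = x $ i + h * (of_int (f (grid_index h x) i) - of_int (grid_index h x i))" for i by (simp add: W_def)
    show "g x \<le> \<eta> powr p + C0 powr p * indicator E x"
    proof (cases "x \<in> E")
      case True
      have "\<bar>W x $ i\<bar> \<le> 3 * R + 4" for i using far[OF x, of i] h0(2) unfolding Wi by linarith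
      then have "norm (W x) \<le> N * (3 * R + 4)" unfolding N_def by (rule component_norm_bound)
      then have "norm (s x - W x) \<le> C0" using norm_triangle_ineq4[of "s x" "W x"] R(3)[OF x(1)] by (simp add: C0_def)
      then have "g x \<le> C0 powr p" unfolding gx using p by (intro powr_mono2) auto
      moreover have "0 \<le> \<eta> powr p" by simp
      ultimately have "g x \<le> \<eta> powr p + C0 powr p" by linarith
      then show ?thesis using True by simp
    next
      case False
      then obtain z where z: "z \<in> Z" "x \<in> K z" using x(1) unfolding E_def by blast
      then have sz: "grid_index h0 (s x) = z" using K(2)[of z] by (auto simp: A_def)
      have "\<bar>(s x - W x) $ i\<bar> \<le> h0" for i
        using near[OF z x(2), of i] grid_index_bounds[OF h0(1), of "s x" i] unfolding sz vector_minus_component Wi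
        by (auto simp: abs_le_iff algebra_simps)
      then have "norm (s x - W x) \<le> N * h0" unfolding N_def by (rule component_norm_bound)
      then have "norm (s x - W x) \<le> \<eta>" using h0(3) by simp
      then have "g x \<le> \<eta> powr p" unfolding gx using p by (intro powr_mono2) auto
      then show ?thesis using False by simp
    qed
  qed
  have iE: "integrable ?L (indicator E :: real^'n \<Rightarrow> real)" and LE: "integral\<^sup>L ?L (indicator E :: real^'n \<Rightarrow> real) = measure lebesgue E"
  proof -
    have Es: "E \<in> sets ?L" using Em Um by (auto simp: sets_restrict_space_iff E_def)
    then show "integrable ?L (indicator E :: real^'n \<Rightarrow> real)" by (intro integrable_real_indicator) (simp_all add: less_top[symmetric])
    have "integral\<^sup>L ?L (indicator E :: real^'n \<Rightarrow> real) = measure ?L E" using Es by (simp add: E_def Int_absorb2 space_restrict_space)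
    also have "\<dots> = measure lebesgue E" using Um by (intro measure_restrict_space) (auto simp: E_def)
    finally show "integral\<^sup>L ?L (indicator E :: real^'n \<Rightarrow> real) = measure lebesgue E" .
  qed
  have "integral\<^sup>L ?L g \<le> (LINT x|?L. \<eta> powr p + C0 powr p * indicator E x)"
  proof (rule integral_mono_AE'[OF _ bound])
    show "integrable ?L (\<lambda>x. \<eta> powr p + C0 powr p * indicator E x)"
      using iE by (intro Bochner_Integration.integrable_add integrable_mult_right) auto
    show "AE x in ?L. 0 \<le> \<eta> powr p + C0 powr p * indicator E x" by (intro AE_I2) (simp add: indicator_def)
  qed
  also have "\<dots> = (LINT x|?L. \<eta> powr p) + (LINT x|?L. C0 powr p * indicator E x)"
    using iE by (intro Bochner_Integration.integral_add integrable_mult_right) auto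
  also have "(LINT x|?L. \<eta> powr p) = \<mu> * \<eta> powr p"
    using Um by (simp add: \<mu>_def measure_restrict_space space_restrict_space)
  also have "(LINT x|?L. C0 powr p * indicator E x) = C0 powr p * measure lebesgue E" using LE by simp
  also have "\<mu> * \<eta> powr p + C0 powr p * measure lebesgue E \<le> \<epsilon> / 4 + \<epsilon> / 4"
  proof (rule add_mono)
    have "\<mu> * \<eta> powr p \<le> \<mu> * (\<epsilon> / (4 * (\<mu> + 1)))" using \<eta>p \<mu>0 by (rule mult_left_mono)
    also have "\<dots> = \<epsilon> / 4 * (\<mu> / (\<mu> + 1))" by simp
    also have "\<dots> \<le> \<epsilon> / 4 * 1" using \<epsilon> \<mu>0 by (intro mult_left_mono) auto
    finally show "\<mu> * \<eta> powr p \<le> \<epsilon> / 4" by simp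
    have "C0 powr p * measure lebesgue E \<le> (C0 powr p + 1) * (c * \<delta>)" using Emeas C0p c \<delta> by (intro mult_mono) auto
    also have "\<dots> = \<epsilon> / 4"
    proof -
      define a where "a = C0 powr p + 1"
      have "0 < a" using C0p by (simp add: a_def add_nonneg_pos)
      then show ?thesis using c unfolding \<delta>_def a_def[symmetric] by simp
    qed
    finally show "C0 powr p * measure lebesgue E \<le> \<epsilon> / 4" .
  qed
  finally have "integral\<^sup>L ?L g < \<epsilon>" using \<epsilon> by simp
  with conv have "\<forall>\<^sub>F k in sequentially. integral\<^sup>L ?L (H k) < \<epsilon>" by (rule order_tendstoD(2))
  then obtain k where "integral\<^sup>L ?L (H k) < \<epsilon>" by (auto simp: eventually_sequentially)
  then show thesis using that[OF S(1)[of k]] Hint[of k] by (simp add: H_def[abs_def])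
qed

section \<open>The corollary\<close>

text \<open>Jensen's inequality again, now on a finite measure space: Young's inequality between
  \<open>f x\<close> and the mean of \<open>f\<close>.\<close>

lemma (in finite_measure) powr_integral_le:
  fixes f :: "'a \<Rightarrow> real"
  assumes p: "1 < p" and f: "integrable M f" "integrable M (\<lambda>x. f x powr p)" and f0: "AE x in M. 0 \<le> f x"
    and \<mu>: "0 < measure M (space M)"
  shows "(LINT x|M. f x) powr p \<le> measure M (space M) powr (p - 1) * (LINT x|M. f x powr p)"
proof -
  define L where "L = measure M (space M)"
  have L: "0 < L" using \<mu> by (simp add: L_def)
  define I where "I = (LINT x|M. f x)"
  define c where "c = I / L"
  have I0: "0 \<le> I" unfolding I_def using f0 by (rule integral_nonneg_AE)
  have c0: "0 \<le> c" using I0 L by (simp add: c_def)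
  have "(LINT x|M. p * c powr (p - 1) * f x) \<le> (LINT x|M. f x powr p + (p - 1) * c powr p)"
  proof (rule integral_mono_AE)
    show "AE x in M. p * c powr (p - 1) * f x \<le> f x powr p + (p - 1) * c powr p"
      using f0
    proof eventually_elim
      case (elim x)
      have "p * (f x * c powr (p - 1)) \<le> p * (f x powr p / p + (p - 1) / p * c powr p)"
        using Young_powr[OF p elim c0] p by (intro mult_left_mono) auto
      also have "\<dots> = f x powr p + (p - 1) * c powr p" using p by (simp add: field_simps)
      finally show ?case by (simp add: mult_ac)
    qed
  qed (use f in auto)
  also have "\<dots> = (LINT x|M. f x powr p) + (p - 1) * c powr p * L"
    using f(2) by (subst Bochner_Integration.integral_add) (auto simp: L_def)
  finally have *: "p * c powr (p - 1) * I \<le> (LINT x|M. f x powr p) + (p - 1) * c powr p * L"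
    by (simp add: I_def)
  have I: "I = c * L" using L by (simp add: c_def)
  have cp: "c powr (p - 1) * c = c powr p"
    using c0 p by (cases "c = 0") (simp_all add: powr_mult_base mult.commute)
  have "p * c powr (p - 1) * I = p * (c powr (p - 1) * c) * L" by (simp add: I)
  also have "\<dots> = (p - 1) * c powr p * L + c powr p * L" unfolding cp by (simp add: algebra_simps)
  finally have "c powr p * L \<le> (LINT x|M. f x powr p)" using * by linarith
  then have "L powr (p - 1) * (c powr p * L) \<le> L powr (p - 1) * (LINT x|M. f x powr p)" by (intro mult_left_mono) auto
  moreover have "L powr (p - 1) * (c powr p * L) = I powr p"
  proof -
    have "L powr (p - 1) * L = L powr p" using L by (simp add: powr_mult_base mult.commute)
    then show ?thesis using c0 L by (simp add: I powr_mult mult_ac)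
  qed
  ultimately show ?thesis by (simp add: I_def L_def)
qed

text \<open>In one dimension \<open>u - id\<close> maps \<open>U\<close> onto a connected set of length at most \<open>\<integral>\<bar>det Du - 1\<bar>\<close>.\<close>

lemma one_dimensional_translation:
  fixes u :: "real^'n \<Rightarrow> real^'n"
  assumes n: "CARD('n) = 1" and p: "1 < p" and U: "open U" "bounded U" "connected U" and u: "u \<in> W_1_infinity U" and Du: "has_weak_jacobian U u Du"
    and inj: "essentially_injective U u" and d: "diameter (u ` U) \<le> d" and l: "0 < l"
    and J: "AE x in lebesgue_on U. l \<le> det (Du x) \<and> det (Du x) \<le> \<Lambda>"
  obtains S where "volume_diffeo S"
    "(LINT x|lebesgue_on U. norm (u x - S x) powr p) \<le> (2 * d) powr p * l powr - p * (LINT x|lebesgue_on U. \<bar>1 - det (Du x)\<bar> powr p)"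
proof -
  let ?L = "lebesgue_on U"
  obtain i :: 'n where i: "UNIV = {i}" using n by (auto simp: card_1_singleton_iff)
  have all_i: "(k::'n) = i" for k using i by blast
  have Um: "U \<in> sets lebesgue" using borel_open[OF U(1)] by simp
  have Ul: "U \<in> lmeasurable" using U(2) Um by (rule bounded_set_imp_lmeasurable)
  interpret finite_measure ?L
    by (rule finite_measureI) (use Ul Um in \<open>auto simp: emeasure_restrict_space fmeasurable_def\<close>)
  obtain x0 where x0: "x0 \<in> U" using essentially_injective_nonempty[OF inj] by blast
  have uc: "continuous_on U u" using u by (simp add: W_1_infinity_def)
  define \<mu> where "\<mu> = measure lebesgue U"
  have \<mu>: "0 < \<mu>" unfolding \<mu>_def using open_not_negligible[OF U(1)] x0 Ul
    by (auto simp: negligible_iff_measure0[OF Ul] zero_less_measure_iff)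
  have \<mu>L: "measure ?L (space ?L) = \<mu>" using Um by (simp add: \<mu>_def measure_restrict_space space_restrict_space)
  obtain X V where X: "X \<in> sets lebesgue" "X \<subseteq> U" "negligible (U - X)"
    and Jm: "(\<lambda>x. indicator U x * det (Du x)) \<in> borel_measurable lebesgue"
    and der: "\<And>x. x \<in> X \<Longrightarrow> (u has_derivative (*v) (Du x)) (at x)"
    by (rule area_formula[OF U(1,2) u Du inj l J]) blast
  obtain c m g where "m \<in> borel_measurable borel" and gm: "g \<in> borel_measurable borel"
    and "\<And>y. 0 \<le> m y" "\<And>y. m y \<le> g y / l" and g01: "\<And>y. g y = 0 \<or> g y = 1" and gs: "\<And>y. y \<notin> cball c d \<Longrightarrow> g y = 0" and d0: "0 < d"
    and "distr ?L borel u = density lborel (\<lambda>y. ennreal (m y))"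
    and "distr (density ?L (\<lambda>x. ennreal (indicator U x * det (Du x)))) borel u = density lborel (\<lambda>y. ennreal (g y))"
    and "(\<lambda>x. indicator U x * det (Du x)) \<in> borel_measurable lebesgue"
    and "u \<in> borel_measurable ?L" and lg: "l * measure lebesgue U \<le> (LINT y|lborel. g y)"
    by (rule image_densities[OF U(1,2) u Du inj d l J]) (rule that, assumption+)
  \<comment> \<open>The image has volume at least \<open>l * \<mu>\<close> and lies in a ball, which
    in dimension one has length \<open>2 * d\<close>. This converts the volume of \<open>U\<close>
    into the constant of the estimate.\<close>
  have \<mu>d: "\<mu> \<le> 2 * d / l"
  proof -
    have "(LINT y|lborel. g y) \<le> (LINT y|lborel. indicator (cball c d) y)"
    proof (rule integral_mono_AE')
      show "integrable lborel (indicator (cball c d) :: real^'n \<Rightarrow> real)" by (intro integrable_real_indicator emeasure_bounded_finite) auto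
      show "AE y in lborel. g y \<le> indicator (cball c d) y"
      proof (rule AE_I2)
        fix y show "g y \<le> indicator (cball c d) y" using g01[of y] gs[of y] by (cases "y \<in> cball c d") auto
      qed
    qed simp
    also have "\<dots> = measure lborel (cball c d)" by simp
    also have "\<dots> = 2 * d" using d0 n by (simp add: content_cball unit_ball_vol_1)
    finally have "l * \<mu> \<le> 2 * d" using lg by (simp add: \<mu>_def)
    then show ?thesis using l by (simp add: field_simps)
  qed
  define j where "j x = \<bar>1 - det (Du x)\<bar>" for x
  have jm: "j \<in> borel_measurable ?L"
  proof -
    have 1: "(\<lambda>x. \<bar>1 - indicator U x * det (Du x)\<bar>) \<in> borel_measurable ?L"
      using measurable_restrict_space1[OF Jm, of U] by (intro borel_measurable_abs borel_measurable_diff borel_measurable_const)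
    have "(\<lambda>x. \<bar>1 - indicator U x * det (Du x)\<bar>) \<in> borel_measurable ?L \<longleftrightarrow> j \<in> borel_measurable ?L"
      by (rule measurable_cong) (simp add: j_def space_restrict_space)
    with 1 show ?thesis by simp
  qed
  have jb: "AE x in ?L. j x \<le> 1 + \<bar>\<Lambda>\<bar>"
    using J by (rule AE_mp) (use l in \<open>auto intro!: AE_I2 simp: j_def\<close>)
  have j0: "0 \<le> j x" for x by (simp add: j_def)
  have ij: "integrable ?L j" by (rule integrable_const_bound[OF _ jm, of "1 + \<bar>\<Lambda>\<bar>"]) (use jb j0 in auto)
  have ijp: "integrable ?L (\<lambda>x. j x powr p)"
  proof (rule integrable_const_bound)
    show "AE x in ?L. norm (j x powr p) \<le> (1 + \<bar>\<Lambda>\<bar>) powr p" using jb by (rule AE_mp) (use j0 p in \<open>auto intro!: AE_I2 powr_mono2\<close>)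
    show "(\<lambda>x. j x powr p) \<in> borel_measurable ?L" using jm by measurable
  qed
  define I where "I = (LINT x|?L. j x)"
  have Xint: "(j has_integral I) X"
  proof -
    have "set_integrable lebesgue U j" using ij Um by (simp add: set_integrable_def integrable_restrict_space)
    then have "(j has_integral (LINT x:U|lebesgue. j x)) U"
      using set_lebesgue_integral_eq_integral by (metis has_integral_iff)
    moreover have "(LINT x:U|lebesgue. j x) = I" using Um by (simp add: I_def set_lebesgue_integral_def integral_restrict_space)
    ultimately have "(j has_integral I) U" by simp
    moreover have "negligible {x \<in> U - X. j x \<noteq> 0}" "negligible {x \<in> X - U. j x \<noteq> 0}"
      using X(2,3) by (auto intro: negligible_subset)
    ultimately show ?thesis using has_integral_spike_set_eq[of U X j I] by blast
  qed
  \<comment> \<open>The derivative of the displacement is \<open>Du x - mat 1\<close>. For a one by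
    one matrix the determinant is the entry itself, so its absolute value is
    \<open>j x\<close>.\<close>
  define w where "w x = u x - x" for x
  have wc: "continuous_on U w" unfolding w_def by (intro continuous_intros uc)
  have detd: "\<bar>det (Du x - mat 1)\<bar> = j x" for x
  proof -
    have det1: "det A = A $ i $ i" for A :: "real^'n^'n"
    proof -
      have "{\<pi>. \<pi> permutes (UNIV :: 'n set)} = {id}" unfolding i by (simp add: permutes_sing)
      then show ?thesis by (simp add: det_def sign_id i)
    qed
    show ?thesis by (simp add: j_def det1 mat_def abs_minus_commute)
  qed
  have wX: "w ` X \<in> lmeasurable" "measure lebesgue (w ` X) \<le> I"
  proof -
    have Xb: "bounded X" using U(2) X(2) by (rule bounded_subset)
    have wb: "bounded (w ` X)"
    proof -
      have "bounded ((\<lambda>x. u x - x) ` X)"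
        using bounded_subset[OF W_1_infinity_bounded[OF U(1) u], of "u ` X"] X(2) Xb
        by (intro bounded_minus_comp) auto
      then show ?thesis by (simp add: w_def[abs_def])
    qed
    have dw: "(w has_derivative (*v) (Du x - mat 1)) (at x within X)" if "x \<in> X" for x
    proof -
      have "(w has_derivative (\<lambda>h. Du x *v h - h)) (at x)" unfolding w_def by (intro derivative_intros der that)
      moreover have "(\<lambda>h. Du x *v h - h) = (*v) (Du x - mat 1)" by (auto simp: matrix_vector_mult_diff_rdistrib)
      ultimately show ?thesis by (simp add: has_derivative_at_withinI)
    qed
    have hi: "((\<lambda>x. \<bar>det (Du x - mat 1)\<bar>) has_integral I) X" unfolding detd by (rule Xint)
    show "w ` X \<in> lmeasurable" "measure lebesgue (w ` X) \<le> I"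
      using measure_differentiable_image_finite(1,2)[OF X(1) Xb dw wb hi] by blast+
  qed
  \<comment> \<open>The discarded null set also has a null image, since the displacement is locally
    Lipschitz. So the length bound holds for the image of all of \<open>U\<close>, which is the
    connected one.\<close>
  have "negligible (w ` (U - X))"
  proof (rule negligible_locally_Lipschitz_image[OF _ X(3)])
    fix x assume "x \<in> U - X"
    then have "x \<in> U" by simp
    then obtain T B where T: "open T" "x \<in> T" "\<And>y. y \<in> T \<Longrightarrow> norm (u y - u x) \<le> B * norm (y - x)"
      using W_1_infinity_locally_Lipschitz[OF U(1) u] by metis
    have "norm (w y - w x) \<le> (B + 1) * norm (y - x)" if "y \<in> T" for y
      using T(3)[OF that] norm_triangle_ineq4[of "u y - u x" "y - x"] by (simp add: w_def algebra_simps)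
    then show "\<exists>T B. open T \<and> x \<in> T \<and> (\<forall>y\<in>(U - X) \<inter> T. norm (w y - w x) \<le> B * norm (y - x))" using T(1,2) by blast
  qed simp
  then have N: "w ` (U - X) \<in> null_sets lebesgue" "w ` (U - X) \<in> lmeasurable"
    by (simp_all add: negligible_iff_null_sets negligible_imp_measurable)
  have eq: "w ` U = w ` X \<union> w ` (U - X)" using X(2) by blast
  have wU: "w ` U \<in> lmeasurable" "measure lebesgue (w ` U) \<le> I"
    unfolding eq using fmeasurable.Un[OF wX(1) N(2)] measure_Un_null_set[OF fmeasurableD[OF wX(1)] N(1)] wX(2) by simp_all
  \<comment> \<open>By connectedness the image of the displacement contains the whole segment
    between two of its values, so their distance is at most the length of the image.\<close>
  have osc: "norm (w x - w x0) \<le> I" if x: "x \<in> U" for x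
  proof -
    define a where "a = (\<chi> k::'n. min (w x $ i) (w x0 $ i))"
    define b where "b = (\<chi> k::'n. max (w x $ i) (w x0 $ i))"
    have con: "connected ((\<lambda>y. y $ i) ` w ` U)"
      by (intro connected_continuous_image continuous_intros wc U(3))
    have "cbox a b \<subseteq> w ` U"
    proof
      fix y assume "y \<in> cbox a b"
      then have "min (w x $ i) (w x0 $ i) \<le> y $ i" "y $ i \<le> max (w x $ i) (w x0 $ i)"
        by (auto simp: mem_box_cart a_def b_def)
      moreover have "w x $ i \<in> (\<lambda>y. y $ i) ` w ` U" "w x0 $ i \<in> (\<lambda>y. y $ i) ` w ` U" using x x0 by auto
      ultimately have "y $ i \<in> (\<lambda>y. y $ i) ` w ` U"
        using connectedD_interval[OF con, of "w x $ i" "w x0 $ i" "y $ i"] connectedD_interval[OF con, of "w x0 $ i" "w x $ i" "y $ i"]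
        by (cases "w x $ i \<le> w x0 $ i") (auto simp: min_def max_def)
      then obtain z where "z \<in> U" "y $ i = w z $ i" by auto
      then have "y = w z" unfolding vec_eq_iff using all_i by metis
      then show "y \<in> w ` U" using \<open>z \<in> U\<close> by blast
    qed
    then have "measure lebesgue (cbox a b) \<le> measure lebesgue (w ` U)" using wU(1) by (intro measure_mono_fmeasurable) auto
    moreover have "measure lebesgue (cbox a b) = \<bar>w x $ i - w x0 $ i\<bar>"
    proof -
      have ne: "cbox a b \<noteq> {}" by (simp add: interval_ne_empty_cart a_def b_def)
      have "measure lebesgue (cbox a b) = measure lborel (cbox a b)" by simp
      also have "\<dots> = \<bar>w x $ i - w x0 $ i\<bar>" unfolding content_cbox_cart[OF ne] i by (auto simp: a_def b_def)
      finally show ?thesis .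
    qed
    moreover have "norm (w x - w x0) = \<bar>w x $ i - w x0 $ i\<bar>" by (simp add: norm_vec_def L2_set_def i)
    ultimately show ?thesis using wU(2) by simp
  qed
  \<comment> \<open>The translation by the displacement at the base point. What is left of
    \<open>u - S\<close> is the oscillation of the displacement.\<close>
  define S where "S x = x + (w x0 $ i) *\<^sub>R axis i 1" for x :: "real^'n"
  have vS: "volume_diffeo S"
    unfolding S_def by (rule volume_diffeo_shear[where \<psi>' = "\<lambda>_ _. 0"]) auto
  have uS: "u x - S x = w x - w x0" for x
  proof -
    have "(w x0 $ i) *\<^sub>R axis i 1 = w x0" unfolding vec_eq_iff using all_i by (metis axis_nth mult.right_neutral real_scaleR_def vector_scaleR_component)
    then show ?thesis by (simp add: S_def w_def)
  qed
  have I0: "0 \<le> I" unfolding I_def using j0 by simp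
  have "(LINT x|?L. norm (u x - S x) powr p) \<le> (LINT x|?L. I powr p)"
  proof (rule integral_mono_AE')
    show "AE x in ?L. norm (u x - S x) powr p \<le> I powr p"
      using osc p I0 unfolding uS by (intro AE_I2 powr_mono2) (auto simp: space_restrict_space)
  qed auto
  also have "\<dots> = \<mu> * I powr p" using \<mu>L by simp
  \<comment> \<open>Jensen passes from the integral of \<open>j\<close> to that of its power
    \<open>p\<close>; together with the volume of \<open>U\<close> from the integration of a
    constant, the factor becomes \<open>\<mu> powr p\<close>.\<close>
  also have "\<dots> \<le> \<mu> * (\<mu> powr (p - 1) * (LINT x|?L. j x powr p))"
    using powr_integral_le[OF p ij ijp] j0 \<mu> unfolding \<mu>L I_def by (intro mult_left_mono) auto
  also have "\<dots> = \<mu> powr p * (LINT x|?L. j x powr p)" using \<mu> powr_mult_base[of \<mu> "p - 1"] by (simp add: mult.assoc[symmetric])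
  also have "\<dots> \<le> (2 * d) powr p * l powr - p * (LINT x|?L. j x powr p)"
  proof (rule mult_right_mono)
    have "\<mu> powr p \<le> (2 * d / l) powr p" using \<mu> \<mu>d p by (intro powr_mono2) auto
    also have "\<dots> = (2 * d) powr p * l powr - p" using d0 l by (simp add: powr_divide powr_minus_divide)
    finally show "\<mu> powr p \<le> (2 * d) powr p * l powr - p" .
  qed simp
  finally show thesis using that[OF vS] by (simp add: j_def)
qed

text \<open>When the determinant is 1, weighting by it changes nothing, so the image of Lebesgue
  measure has the density \<open>g\<close>, which takes only the values 0 and 1. The set where
  \<open>g\<close> is 1 serves as \<open>B\<close>.\<close>

lemma measure_preserving_map_det_1:
  fixes u :: "real^'n \<Rightarrow> real^'n"
  assumes U: "open U" "bounded U" and u: "u \<in> W_1_infinity U" and Du: "has_weak_jacobian U u Du"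
    and inj: "essentially_injective U u" and J: "AE x in lebesgue_on U. det (Du x) = 1"
  shows "measure_preserving_map U u"
proof -
  let ?L = "lebesgue_on U"
  have Um: "U \<in> sets lebesgue" using borel_open[OF U(1)] by simp
  have J': "AE x in ?L. 1 \<le> det (Du x) \<and> det (Du x) \<le> 1" using J by (rule AE_mp) auto
  obtain c m g where m: "m \<in> borel_measurable borel" and gm [measurable]: "g \<in> borel_measurable borel" and m0: "\<And>y. 0 \<le> m y" "\<And>y. m y \<le> g y / 1"
    and g01: "\<And>y. g y = 0 \<or> g y = 1" and gs: "\<And>y. y \<notin> cball c (diameter (u ` U)) \<Longrightarrow> g y = 0" and d0: "0 < diameter (u ` U)"
    and dm: "distr ?L borel u = density lborel (\<lambda>y. ennreal (m y))"
    and dg: "distr (density ?L (\<lambda>x. ennreal (indicator U x * det (Du x)))) borel u = density lborel (\<lambda>y. ennreal (g y))"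
    and jm: "(\<lambda>x. indicator U x * det (Du x)) \<in> borel_measurable lebesgue"
    and um: "u \<in> borel_measurable ?L"
    by (rule image_densities[OF U u Du inj order_refl zero_less_one J']) (rule that, assumption+)
  have "density ?L (\<lambda>x. ennreal (indicator U x * det (Du x))) = density ?L (\<lambda>x. 1)"
  proof (rule density_cong)
    show "(\<lambda>x. ennreal (indicator U x * det (Du x))) \<in> borel_measurable ?L"
      by (intro measurable_restrict_space1 measurable_compose[OF jm measurable_ennreal])
    show "AE x in ?L. ennreal (indicator U x * det (Du x)) = 1"
      by (rule AE_mp[OF J]) (auto intro!: AE_I2 simp: space_restrict_space)
  qed simp
  then have dg': "distr ?L borel u = density lborel (\<lambda>y. ennreal (g y))" using dg by (simp add: density_1)
  define B where "B = {y. g y = 1}"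
  have B [measurable]: "B \<in> sets borel" unfolding B_def by measurable
  have gB: "g y = indicator B y" for y using g01[of y] by (auto simp: B_def)
  have Bl: "B \<in> sets lebesgue" using B by simp
  obtain R where "\<And>x. x \<in> U \<Longrightarrow> norm (u x) \<le> R" using W_1_infinity_bounded[OF U(1) u] by (auto simp: bounded_iff)
  then have uL: "u \<in> L_infinity U" by (rule L_infinity_bounded[OF Um um])
  have "distr ?L borel u = distr (lebesgue_on B) borel (\<lambda>y. y)"
    unfolding dg'
  proof (rule measure_eqI)
    fix E assume "E \<in> sets (density lborel (\<lambda>y. ennreal (g y)))"
    then have E [measurable]: "E \<in> sets borel" by simp
    have mid: "(\<lambda>y. y) \<in> borel_measurable (lebesgue_on B)"
      using Bl by (intro continuous_imp_measurable_on_sets_lebesgue continuous_intros)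
    have "emeasure (density lborel (\<lambda>y. ennreal (g y))) E = (\<integral>\<^sup>+y. ennreal (g y) * indicator E y \<partial>lborel)"
      by (rule emeasure_density) measurable
    also have "\<dots> = (\<integral>\<^sup>+y. indicator (B \<inter> E) y \<partial>lborel)" by (rule nn_integral_cong) (simp add: gB indicator_def)
    also have "\<dots> = emeasure lborel (B \<inter> E)" by simp
    also have "\<dots> = emeasure lebesgue (B \<inter> E)" by simp
    also have "\<dots> = emeasure (lebesgue_on B) (E \<inter> B)" using Bl by (simp add: emeasure_restrict_space Int_commute)
    also have "\<dots> = emeasure (distr (lebesgue_on B) borel (\<lambda>y. y)) E"
      using mid by (subst emeasure_distr) (auto simp: space_restrict_space)
    finally show "emeasure (density lborel (\<lambda>y. ennreal (g y))) E = emeasure (distr (lebesgue_on B) borel (\<lambda>y. y)) E" .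
  qed simp
  then show ?thesis unfolding measure_preserving_map_def using Um Bl uL by blast
qed

section \<open>Assembling the estimate\<close>

lemma powr_add_le:
  fixes a b p :: real
  assumes "0 \<le> a" "0 \<le> b" "0 < p"
  shows "(a + b) powr p \<le> 2 powr p * (a powr p + b powr p)"
proof -
  have "(a + b) powr p \<le> (2 * max a b) powr p" using assms by (intro powr_mono2) auto
  also have "\<dots> = 2 powr p * max a b powr p" using assms by (simp add: powr_mult)
  also have "max a b powr p \<le> a powr p + b powr p" by (simp add: max_def)
  finally show ?thesis by simp
qed

text \<open>For \<open>l \<ge> 1\<close> the power \<open>l powr - p\<close> is at most
  \<open>l powr (- p / N)\<close>, and the bracket is at least 1. For \<open>l < 1\<close> the
  prefactor \<open>l powr (- p / N)\<close> is at least 1, and the second term of the bracket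
  dominates \<open>l powr - p\<close> because \<open>\<Lambda> / l\<close> is at least 1.\<close>

lemma constant_comparison:
  fixes N p l d \<Lambda> :: real
  assumes p: "1 < p" and N: "1 \<le> N" and l: "0 < l" and \<Lambda>: "l \<le> \<Lambda>" and d: "0 < d"
  shows "d powr p * l powr - p \<le> (d / l powr (1 / N)) powr p * (1 + 1 / l powr p * (\<Lambda> / l) powr (2 * p - 2))"
proof -
  have r: "1 \<le> (\<Lambda> / l) powr (2 * p - 2)" using p l \<Lambda> by (intro ge_one_powr_ge_zero) auto
  have eq: "(d / l powr (1 / N)) powr p = d powr p * l powr (- p / N)"
    using d l by (simp add: powr_divide powr_powr powr_minus_divide)
  have "l powr - p \<le> l powr (- p / N) * (1 + 1 / l powr p * (\<Lambda> / l) powr (2 * p - 2))"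
  proof (cases "1 \<le> l")
    case True
    have "l powr - p \<le> l powr (- p / N) * 1" using True p N by (simp add: powr_mono divide_le_eq mult_le_cancel_left1)
    also have "\<dots> \<le> l powr (- p / N) * (1 + 1 / l powr p * (\<Lambda> / l) powr (2 * p - 2))"
      by (intro mult_left_mono) auto
    finally show ?thesis .
  next
    case False
    have "l powr - p = 1 * (1 / l powr p * 1)" by (simp add: powr_minus_divide)
    also have "\<dots> \<le> l powr (- p / N) * (1 + 1 / l powr p * (\<Lambda> / l) powr (2 * p - 2))"
    proof (rule mult_mono)
      have "l powr 0 \<le> l powr (- p / N)" using False l p N by (intro powr_mono') auto
      then show "1 \<le> l powr (- p / N)" using l by simp
      have "1 / l powr p * 1 \<le> 1 / l powr p * (\<Lambda> / l) powr (2 * p - 2)" using r by (intro mult_left_mono) auto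
      then show "1 / l powr p * 1 \<le> 1 + 1 / l powr p * (\<Lambda> / l) powr (2 * p - 2)" by simp
    qed auto
    finally show ?thesis .
  qed
  then have "d powr p * l powr - p \<le> d powr p * (l powr (- p / N) * (1 + 1 / l powr p * (\<Lambda> / l) powr (2 * p - 2)))"
    by (rule mult_left_mono) simp
  then show ?thesis by (simp only: eq mult.assoc)
qed

text \<open>With \<open>D = (2 * d) powr p * l powr - p\<close>, the map \<open>s\<close> costs at
  most \<open>D * A\<close>, and the same amount is granted to its smooth approximation when it is
  positive. The inequality for the power of a sum contributes \<open>2 powr p\<close>, which merges
  with that in \<open>D\<close> to \<open>4 powr p\<close>; the two equal errors give the factor
  2.\<close>

lemma measure_preserving_approximation:
  fixes u :: "real^'n \<Rightarrow> real^'n"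
  assumes p: "1 < p" and U: "open U" "bounded U" "connected U" and u: "u \<in> W_1_infinity U" and Du: "has_weak_jacobian U u Du"
    and inj: "essentially_injective U u" and d: "diameter (u ` U) \<le> d" and l: "0 < l"
    and J: "AE x in lebesgue_on U. l \<le> det (Du x) \<and> det (Du x) \<le> \<Lambda>"
  obtains S where "S \<in> W_1_infinity U" "essentially_injective U S" "measure_preserving_map U S"
    "(LINT x:U|lebesgue. norm (u x - S x) powr p) \<le>
      2 * 4 powr p * (d powr p * l powr - p) * (LINT x:U|lebesgue. \<bar>1 - det (Du x)\<bar> powr p)"
    "0 < d" "l \<le> \<Lambda>"
proof -
  let ?L = "lebesgue_on U"
  have Um: "U \<in> sets lebesgue" using borel_open[OF U(1)] by simp
  have Ul: "U \<in> lmeasurable" using U(2) Um by (rule bounded_set_imp_lmeasurable)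
  interpret finite_measure ?L
    by (rule finite_measureI) (use Ul Um in \<open>auto simp: emeasure_restrict_space fmeasurable_def\<close>)
  have Une: "U \<noteq> {}" by (rule essentially_injective_nonempty[OF inj])
  have set_eq: "(LINT x:U|lebesgue. h x) = (LINT x|?L. h x)" for h :: "real^'n \<Rightarrow> real"
    using Um by (simp add: set_lebesgue_integral_def integral_restrict_space)
  define A where "A = (LINT x|?L. \<bar>1 - det (Du x)\<bar> powr p)"
  have A0: "0 \<le> A" by (simp add: A_def)
  \<comment> \<open>The set \<open>U\<close> is open and nonempty, hence not null, so the almost
    everywhere bounds hold at some point.\<close>
  have l\<Lambda>: "l \<le> \<Lambda>"
  proof (rule ccontr)
    assume "\<not> l \<le> \<Lambda>"
    have "AE x in ?L. False" using J by (rule AE_mp) (use \<open>\<not> l \<le> \<Lambda>\<close> in auto)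
    then have "AE x in lebesgue. x \<in> U \<longrightarrow> False" by (simp add: AE_lebesgue_on_iff[OF Um])
    then have "negligible {x\<in>U. \<not> False}" by (rule AE_imp_negligible)
    then show False using open_not_negligible[OF U(1)] Une by simp
  qed
  obtain s where sm [measurable]: "s \<in> borel_measurable ?L" and sb: "bounded (s ` U)"
    and push: "\<And>B. B \<in> sets borel \<Longrightarrow> emeasure lebesgue (U \<inter> s -` B) \<le> emeasure lborel B"
    and cost: "(\<integral>\<^sup>+x. ennreal (norm (u x - s x) powr p) \<partial>?L) \<le>
      ennreal ((2 * d) powr p * l powr - p * (LINT x:U|lebesgue. \<bar>1 - det (Du x)\<bar> powr p))"
    and d0: "0 < d"
    by (rule measure_decreasing_rearrangement[OF p U(1,2) u Du inj d l J]) (rule that, assumption+)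
  define D where "D = (2 * d) powr p * l powr - p"
  have D: "0 < D" using d0 l by (simp add: D_def)
  have pow: "2 * 2 powr p * D = 2 * 4 powr p * (d powr p * l powr - p)"
  proof -
    have "(4::real) powr p = 2 powr p * 2 powr p" by (simp add: powr_mult[symmetric])
    then show ?thesis using d0 by (simp add: D_def powr_mult)
  qed
  have um [measurable]: "u \<in> borel_measurable ?L"
    using Um u by (intro continuous_imp_measurable_on_sets_lebesgue) (simp_all add: W_1_infinity_def)
  have "\<exists>S \<in> W_1_infinity U. essentially_injective U S \<and> measure_preserving_map U S \<and>
    (LINT x|?L. norm (u x - S x) powr p) \<le> 2 * 2 powr p * D * A"
  proof (cases "CARD('n) = 1")
    case True
    obtain S where S: "volume_diffeo S" "(LINT x|?L. norm (u x - S x) powr p) \<le> D * A"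
      by (rule one_dimensional_translation[OF True p U u Du inj d l J]) (rule that, auto simp: D_def A_def)
    have "1 \<le> 2 * 2 powr p" using p ge_one_powr_ge_zero[of 2 p] by simp
    then have "1 * (D * A) \<le> (2 * 2 powr p) * (D * A)" using D A0 by (intro mult_right_mono) auto
    then have "(LINT x|?L. norm (u x - S x) powr p) \<le> 2 * 2 powr p * D * A" using S(2) by (simp add: mult.assoc)
    then show ?thesis using volume_diffeo_restrict[OF S(1) U(1,2) Une] by blast
  next
    case False
    then have n2: "2 \<le> CARD('n)" using zero_less_card_finite[where 'a='n] by linarith
    show ?thesis
    proof (cases "A = 0")
      case True
      have jm: "(\<lambda>x. indicator U x * det (Du x)) \<in> borel_measurable lebesgue"
        by (rule area_formula[OF U(1,2) u Du inj l J])
      have jm': "(\<lambda>x. \<bar>1 - indicator U x * det (Du x)\<bar> powr p) \<in> borel_measurable ?L"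
        using measurable_restrict_space1[OF jm, of U] by measurable
      have eqj: "(LINT x|?L. \<bar>1 - indicator U x * det (Du x)\<bar> powr p) = A"
        unfolding A_def by (rule Bochner_Integration.integral_cong) (auto simp: space_restrict_space)
      have "integrable ?L (\<lambda>x. \<bar>1 - indicator U x * det (Du x)\<bar> powr p)"
      proof (rule integrable_const_bound[OF _ jm'])
        show "AE x in ?L. norm (\<bar>1 - indicator U x * det (Du x)\<bar> powr p) \<le> (1 + \<bar>\<Lambda>\<bar>) powr p"
          using J by (rule AE_mp) (use l p in \<open>auto intro!: AE_I2 powr_mono2 simp: space_restrict_space\<close>)
      qed
      then have "AE x in ?L. \<bar>1 - indicator U x * det (Du x)\<bar> powr p = 0"
        using True eqj integral_nonneg_eq_0_iff_AE[of ?L "\<lambda>x. \<bar>1 - indicator U x * det (Du x)\<bar> powr p"] by simp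
      then have "AE x in ?L. det (Du x) = 1"
        by (rule AE_mp) (auto intro!: AE_I2 simp: space_restrict_space)
      then have "measure_preserving_map U u" by (rule measure_preserving_map_det_1[OF U(1,2) u Du inj])
      moreover have "(LINT x|?L. norm (u x - u x) powr p) \<le> 2 * 2 powr p * D * A" using True by simp
      ultimately show ?thesis using u inj by blast
    next
      case False
      then have DA: "0 < D * A" using A0 D by simp
      obtain S where S: "volume_diffeo S" "integrable ?L (\<lambda>x. norm (s x - S x) powr p)"
        "(LINT x|?L. norm (s x - S x) powr p) < D * A"
      proof (rule volume_diffeo_approximation[OF n2 p U(1,2) sm sb _ DA])
        show "emeasure lebesgue (U \<inter> s -` B) \<le> emeasure lborel B" if "B \<in> sets borel" for B
          using that by (rule push)
      qed (rule that, assumption+)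
      have us: "integrable ?L (\<lambda>x. norm (u x - s x) powr p)" "(LINT x|?L. norm (u x - s x) powr p) \<le> D * A"
      proof -
        have cost': "(\<integral>\<^sup>+x. ennreal (norm (u x - s x) powr p) \<partial>?L) \<le> ennreal (D * A)"
          using cost unfolding set_eq D_def A_def .
        show i: "integrable ?L (\<lambda>x. norm (u x - s x) powr p)"
        proof (rule integrableI_nonneg)
          show "(\<integral>\<^sup>+x. ennreal (norm (u x - s x) powr p) \<partial>?L) < \<infinity>" using cost' by (rule le_less_trans) simp
        qed auto
        have "ennreal (LINT x|?L. norm (u x - s x) powr p) \<le> ennreal (D * A)"
          using cost' by (subst nn_integral_eq_integral[OF i, symmetric]) auto
        then show "(LINT x|?L. norm (u x - s x) powr p) \<le> D * A" using DA by (simp add: ennreal_le_iff)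
      qed
      have "(LINT x|?L. norm (u x - S x) powr p) \<le> (LINT x|?L. 2 powr p * (norm (u x - s x) powr p + norm (s x - S x) powr p))"
      proof (rule integral_mono_AE')
        show "integrable ?L (\<lambda>x. 2 powr p * (norm (u x - s x) powr p + norm (s x - S x) powr p))"
          using us(1) S(2) by (intro integrable_mult_right Bochner_Integration.integrable_add)
        show "AE x in ?L. norm (u x - S x) powr p \<le> 2 powr p * (norm (u x - s x) powr p + norm (s x - S x) powr p)"
        proof (rule AE_I2)
          fix x
          have "norm (u x - S x) \<le> norm (u x - s x) + norm (s x - S x)"
            using norm_triangle_ineq[of "u x - s x" "s x - S x"] by simp
          then have "norm (u x - S x) powr p \<le> (norm (u x - s x) + norm (s x - S x)) powr p" using p by (intro powr_mono2) auto
          also have "\<dots> \<le> 2 powr p * (norm (u x - s x) powr p + norm (s x - S x) powr p)" using p by (intro powr_add_le) auto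
          finally show "norm (u x - S x) powr p \<le> 2 powr p * (norm (u x - s x) powr p + norm (s x - S x) powr p)" .
        qed
      qed simp
      also have "\<dots> = 2 powr p * ((LINT x|?L. norm (u x - s x) powr p) + (LINT x|?L. norm (s x - S x) powr p))"
        using us(1) S(2) by simp
      also have "\<dots> \<le> 2 powr p * (D * A + D * A)" using us(2) S(3) by (intro mult_left_mono add_mono) auto
      also have "\<dots> = 2 * 2 powr p * D * A" by simp
      finally show ?thesis using volume_diffeo_restrict[OF S(1) U(1,2) Une] by blast
    qed
  qed
  then obtain S where "S \<in> W_1_infinity U" "essentially_injective U S" "measure_preserving_map U S"
    "(LINT x|?L. norm (u x - S x) powr p) \<le> 2 * 2 powr p * D * A" by blast
  then show thesis using that[of S] d0 l\<Lambda> unfolding set_eq pow A_def by blast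
qed

theorem corollary2p6:
  fixes p :: real
  assumes "1 < p"
  shows "\<exists>C\<^sub>3::real. \<forall>(U :: (real^'n) set) (u :: real^'n \<Rightarrow> real^'n) (Du :: real^'n \<Rightarrow> real^'n^'n)
            (d::real) (l::real) (\<Lambda>::real).
     open U \<and> bounded U \<and> connected U \<and> lipschitz_boundary U \<and>
     u \<in> W_1_infinity U \<and> has_weak_jacobian U u Du \<and>
     essentially_injective U u \<and>
     diameter (u ` U) \<le> d \<and>
     0 < l \<and> (AE x in lebesgue_on U. l \<le> det (Du x) \<and> det (Du x) \<le> \<Lambda>) \<longrightarrow>
     (\<exists>S \<in> W_1_infinity U.
        essentially_injective U S \<and> measure_preserving_map U S \<and>
        (LINT x:U|lebesgue. norm (u x - S x) powr p) \<le>
          C\<^sub>3 * (d / l powr (1 / real CARD('n))) powr p *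
            (1 + 1 / l powr p * (\<Lambda> / l) powr (2 * p - 2)) *
          (LINT x:U|lebesgue. \<bar>1 - det (Du x)\<bar> powr p))"
\<comment> \<open>This constant depends on \<open>p\<close> alone; the dimension enters only through
  the exponent of \<open>l\<close>.\<close>
proof (intro exI[of _ "2 * 4 powr p"] allI impI, elim conjE)
  fix U :: "(real^'n) set" and u :: "real^'n \<Rightarrow> real^'n" and Du :: "real^'n \<Rightarrow> real^'n^'n" and d l \<Lambda> :: real
  assume U: "open U" "bounded U" "connected U" and u: "u \<in> W_1_infinity U" "has_weak_jacobian U u Du" "essentially_injective U u"
    and d: "diameter (u ` U) \<le> d" and l: "0 < l" and J: "AE x in lebesgue_on U. l \<le> det (Du x) \<and> det (Du x) \<le> \<Lambda>"
  let ?A = "LINT x:U|lebesgue. \<bar>1 - det (Du x)\<bar> powr p"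
  let ?C = "(d / l powr (1 / real CARD('n))) powr p * (1 + 1 / l powr p * (\<Lambda> / l) powr (2 * p - 2))"
  obtain S where S: "S \<in> W_1_infinity U" "essentially_injective U S" "measure_preserving_map U S"
    and le: "(LINT x:U|lebesgue. norm (u x - S x) powr p) \<le> 2 * 4 powr p * (d powr p * l powr - p) * ?A"
    and d0: "0 < d" and l\<Lambda>: "l \<le> \<Lambda>"
    by (rule measure_preserving_approximation[OF assms U u d l J]) (rule that, assumption+)
  have A0: "0 \<le> ?A" unfolding set_lebesgue_integral_def by (simp add: indicator_def)
  have "d powr p * l powr - p \<le> ?C"
    by (rule constant_comparison[OF assms _ l l\<Lambda> d0]) (simp add: Suc_leI)
  then have "2 * 4 powr p * (d powr p * l powr - p) * ?A \<le> 2 * 4 powr p * ?C * ?A"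
    using A0 by (intro mult_right_mono mult_left_mono) auto
  with le have "(LINT x:U|lebesgue. norm (u x - S x) powr p) \<le> 2 * 4 powr p * ?C * ?A" by (rule order_trans)
  then have "(LINT x:U|lebesgue. norm (u x - S x) powr p) \<le> 2 * 4 powr p * (d / l powr (1 / real CARD('n))) powr p *
      (1 + 1 / l powr p * (\<Lambda> / l) powr (2 * p - 2)) * ?A" by (simp only: mult.assoc)
  with S show "\<exists>S \<in> W_1_infinity U.
        essentially_injective U S \<and> measure_preserving_map U S \<and>
        (LINT x:U|lebesgue. norm (u x - S x) powr p) \<le>
          2 * 4 powr p * (d / l powr (1 / real CARD('n))) powr p *
            (1 + 1 / l powr p * (\<Lambda> / l) powr (2 * p - 2)) * ?A" by blast
qed

end
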